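(* Let $d\ge1$ and let $Y_{n,k}$ be the number of nodes at level $k$ in the random $d$-dimensional quad tree built from $n$ points independently and uniformly chosen from $[0,1]^d$. Let $W_n=\max_kY_{n,k}$ and let $k^*$ be one of the levels with $Y_{n,k^*}=W_n$. Then, as $n\to\infty$, with $\sigma^2=2/d^2$, $$\mathbb{E}\{W_n\}=\frac{n}{\sqrt{2\pi\sigma^2L_n}}\bigl(1+O(L_n^{-1})\bigr),$$ $$\mathbb{E}\{|W_n-\mathbb{E}\{W_n\}|^s\}=O\bigl(n^sL_n^{-3s/2}\bigr)\qquad(s\ge0),$$ and, for every $B>0$, there is $T_0>1$ such that for $T>T_0$ $$\mathbb{P}\Bigl(\Bigl|k^*-\frac2d L_n\Bigr|\ge T\Bigr)=O(T^{-B}),$$ with implied constant independent of $n$ and $T$. Moreover, $W_n/\mathbb{E}\{W_n\}\to1$ almost surely.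
   Context: $L_n:=\max\{\log n,1\}$ (natural logarithm). Given a sequence of points in $[0,1]^d$, the (point) quad tree is constructed by placing the first point at the root; this point splits the space into $2^d$ hyperrectangles (by the $d$ axis-parallel hyperplanes through it), each corresponding to one of the $2^d$ subtrees of the root. The remaining points falling in each hyperrectangle are directed, in order, to the corresponding subtree, which is constructed recursively in the same way. Each node contains one point, so the tree has $n$ nodes; the root is at level $0$. For the almost sure statement, the trees are grown sequentially by inserting the points of an infinite i.i.d. uniform sequence one at a time. *)

theory Defs
  imports "HOL-Probability.Probability" "HOL-Library.Landau_Symbols"
begin

text \<open>The \<open>2^d\<close> subtrees of a node are indexed by the subsets of the set \<open>'d\<close> of coordinates.\<close>

datatype ('p, 'o) quad_tree = Empty | Node 'p "'o \<Rightarrow> ('p, 'o) quad_tree"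

text \<open>The index of the hyperrectangle, cut out by the axis-parallel hyperplanes through \<open>x\<close>, that
  contains \<open>y\<close>. Points on one of these hyperplanes, which occur with probability 0 only, are put on
  the upper side.\<close>

definition orthant :: "real ^ 'd \<Rightarrow> real ^ 'd \<Rightarrow> 'd set" where
  "orthant x y = {i. x $ i \<le> y $ i}"

text \<open>The cell of a node need not be recorded: all points of the list lie in it, so their position
  relative to the hyperplanes through the node's point determines the subcell.\<close>

function quad_tree_of :: "(real ^ 'd) list \<Rightarrow> (real ^ 'd, 'd set) quad_tree" where
  "quad_tree_of [] = Empty"
| "quad_tree_of (x # xs) = Node x (\<lambda>S. quad_tree_of (filter (\<lambda>y. orthant x y = S) xs))"
  by pat_completeness auto
termination
  by (relation "Wellfounded.measure length") (auto simp: less_Suc_eq_le)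

fun nodes_at_level :: "nat \<Rightarrow> ('p, 'o :: finite) quad_tree \<Rightarrow> nat" where
  "nodes_at_level k Empty = 0"
| "nodes_at_level 0 (Node x t) = 1"
| "nodes_at_level (Suc k) (Node x t) = (\<Sum>S\<in>UNIV. nodes_at_level k (t S))"

text \<open>\<open>profile x n k\<close> is \<open>Y\<^bsub>n,k\<^esub>\<close> and \<open>tree_width x n\<close> is \<open>W\<^sub>n\<close>, for the tree built from
  the first \<open>n\<close> points of the sequence \<open>x\<close>.\<close>

definition profile :: "(nat \<Rightarrow> real ^ 'd) \<Rightarrow> nat \<Rightarrow> nat \<Rightarrow> nat" where
  "profile x n k = nodes_at_level k (quad_tree_of (map x [0..<n]))"

definition tree_width :: "(nat \<Rightarrow> real ^ 'd) \<Rightarrow> nat \<Rightarrow> nat" where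
  "tree_width x n = Max (range (profile x n))"

lemma nodes_at_level_eq_0: "length xs \<le> k \<Longrightarrow> nodes_at_level k (quad_tree_of xs) = 0"
proof (induction k arbitrary: xs)
  case (Suc k)
  show ?case
  proof (cases xs)
    case (Cons x ys)
    have "length (filter P ys) \<le> k" for P
      using Suc.prems Cons by (intro order_trans[OF length_filter_le]) simp
    then show ?thesis by (simp add: Cons Suc.IH)
  qed simp
qed simp

lemma finite_range_profile: "finite (range (profile x n))"
proof (rule finite_subset)
  show "range (profile x n) \<subseteq> insert 0 (profile x n ` {..<n})"
  proof
    fix y assume "y \<in> range (profile x n)"
    then obtain k where "y = profile x n k" by auto
    then show "y \<in> insert 0 (profile x n ` {..<n})"
      by (cases "k < n") (auto simp: profile_def nodes_at_level_eq_0)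
  qed
qed simp

definition L :: "nat \<Rightarrow> real" where
  "L n = max (ln (real n)) 1"

end

theory Submission
  imports Defs "HOL-Complex_Analysis.Complex_Analysis" "HOL-Real_Asymp.Real_Asymp"
begin

text \<open>Let \<open>P(z) = \<Sum>k. Y\<^bsub>n,k\<^esub> z^k\<close>. The size of a subtree of the root arises from \<open>n\<close> by \<open>d\<close>
  uniform splittings, so the mean of \<open>P(z)\<close> satisfies \<open>f(n+1) = 1 + (2 \<zeta>)^d (C^d f)(n)\<close>, where \<open>C\<close> is
  the Cesaro operator and \<open>\<zeta>^d = z\<close>; it grows at most like \<open>n^\<alpha>\<close> with \<open>\<alpha> = max Re (2 \<zeta>) - 1\<close> over the
  roots \<open>\<zeta>\<close>. Since \<open>2^d C^d\<close> contracts on powers \<open>n^\<beta>\<close> with \<open>\<beta> > 1\<close>, the recursion for the moments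
  gives \<open>E|P(z)|^s = O(n^(s \<alpha>))\<close> for \<open>z\<close> close to 1 or on the unit circle. Hence
  \<open>n^(-1) P(e^(i \<tau>)) exp (-2 log n (e^(i \<tau>/d) - 1))\<close> has bounded moments on a complex
  neighbourhood of \<open>\<tau> = 0\<close>, which by Cauchy's formula controls its Taylor coefficients, and
  \<open>P(e^(i \<tau>))\<close> is negligible for the other real \<open>\<tau>\<close>. Fourier inversion shows that \<open>Y\<^bsub>n,k\<^esub>\<close> differs
  from a Gaussian profile, centred at the random mean level, by at most \<open>n L\<^sub>n^(-3/2)\<close> times a
  variable with bounded moments. The maximum of the Gaussian does not depend on its centre, so \<open>W\<^sub>n\<close>
  has fluctuations of that order only. Almost sure convergence follows from fourth moments and the
  Borel--Cantelli lemma along \<open>n = exp (sqrt j)\<close>, and from the monotonicity of \<open>W\<^sub>n\<close> in between.\<close>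

\<comment> \<open>\<open>Formal_Laurent_Series\<close> exports the notation \<open>$\<close> for power series, which clashes with that for vectors.\<close>
unbundle no Formal_Power_Series.fps_syntax

text \<open>All probabilistic input consists of upper bounds: the constant of the main term comes
  from \<open>P(1) = n\<close>, which makes the normalised transform equal to 1 at \<tau> = 0. Its
  derivative there is \<open>i X\<close>, where \<open>X\<close>, the distance of the mean level
  from \<open>2/d log n\<close>, is random and of order 1. Centring at a fixed level would leave a
  relative error of order L_n^(-1/2); centring at the mean level removes the linear term, and the
  quadratic one costs 1/L_n. The cubic term in the expansion of \<open>2 log n (e^(i u) - 1)\<close>
  again has relative order L_n^(-1/2), but it is odd: it vanishes at the centre, and near the centre
  the quadratic decay of the Gaussian outweighs it. Hence the error bounds with a factor 1 + |y|.
  The lower limit 3/4 for \<alpha> has to lie strictly between 1/2 and 1: twice it exceeds 1, so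
  second moments are contracted, and P(e^(i \<tau>)) stays a power of n below n. Cancellation enters
  the moments only for s = 2, through products of means of different subtrees; absolute values would
  lose it.\<close>

abbreviation cube :: "(real ^ 'd) measure" where
  "cube \<equiv> uniform_measure lborel (cbox 0 1)"

abbreviation point_seq :: "(nat \<Rightarrow> real ^ 'd) measure" where
  "point_seq \<equiv> PiM UNIV (\<lambda>_. cube)"

section \<open>Functionals of random point lists: measurability and means\<close>

definition list_mean :: "nat \<Rightarrow> ((real ^ 'd) list \<Rightarrow> real) \<Rightarrow> real" where
  "list_mean n G = (\<integral>f. G (map f [0..<n]) \<partial>point_seq)"

text \<open>Boundedness is asked for all lists of bounded length, not only for lists in the cube.
  The class is therefore closed under filtering, under prepending a point and under mapping the
  points, and all its means exist.\<close>

definition list_measurable :: "((real ^ 'd) list \<Rightarrow> real) \<Rightarrow> bool" where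
  "list_measurable G \<longleftrightarrow> (\<forall>n. (\<lambda>f. G (map f [0..<n])) \<in> borel_measurable (PiM UNIV (\<lambda>_::nat. borel)))
     \<and> (\<forall>n. \<exists>B. \<forall>xs. length xs \<le> n \<longrightarrow> \<bar>G xs\<bar> \<le> B)"

lemma emeasure_unit_cbox: "emeasure lborel (cbox 0 1 :: (real ^ 'd) set) = 1"
proof -
  have "b \<in> Basis \<Longrightarrow> (1 :: real ^ 'd) \<bullet> b = 1" for b :: "real ^ 'd"
    by (auto simp: Basis_vec_def inner_axis)
  moreover have "b \<in> Basis \<Longrightarrow> 0 \<le> (1 :: real ^ 'd) \<bullet> b" for b :: "real ^ 'd"
    by (auto simp: Basis_vec_def inner_axis)
  ultimately show ?thesis
    by (subst emeasure_lborel_cbox) (auto)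
qed

lemma prob_space_cube: "prob_space cube"
  by (rule prob_space_uniform_measure) (auto simp: emeasure_unit_cbox)

lemma sets_point_seq: "sets (point_seq :: (nat \<Rightarrow> real ^ 'd) measure) = sets (PiM UNIV (\<lambda>_. borel))"
  by (intro sets_PiM_cong) auto

lemma product_prob_space_cube: "product_prob_space (\<lambda>_::nat. cube)"
  unfolding product_prob_space_def product_prob_space_axioms_def product_sigma_finite_def
  using prob_space_cube prob_space_imp_sigma_finite by blast

lemma prob_space_point_seq: "prob_space point_seq"
  by (intro prob_space_PiM prob_space_cube)

lemma measurable_seq_to_borel:
  "(F :: (nat \<Rightarrow> real ^ 'd) \<Rightarrow> real) \<in> borel_measurable (PiM UNIV (\<lambda>_. borel)) \<longleftrightarrow> F \<in> borel_measurable point_seq"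
  by (intro iffI) (simp_all add: measurable_def sets_point_seq space_PiM)

lemma list_measurableD:
  fixes G :: "(real ^ 'd) list \<Rightarrow> real"
  assumes "list_measurable G"
  shows "(\<lambda>f. G (map f [0..<n])) \<in> borel_measurable (PiM UNIV (\<lambda>_::nat. borel))"
  using assms by (simp add: list_measurable_def)

lemma list_measurable_bounded:
  fixes G :: "(real ^ 'd) list \<Rightarrow> real"
  assumes "list_measurable G"
  obtains B where "B \<ge> 0" "\<And>xs. length xs \<le> n \<Longrightarrow> \<bar>G xs\<bar> \<le> B"
proof -
  obtain B where "\<forall>xs. length xs \<le> n \<longrightarrow> \<bar>G xs\<bar> \<le> B"
    using assms[unfolded list_measurable_def, THEN conjunct2, THEN spec, of n] ..
  then have "\<bar>G xs\<bar> \<le> max B 0" if "length xs \<le> n" for xs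
    using that by (simp add: le_max_iff_disj)
  then show ?thesis by (rule that[OF max.cobounded2])
qed

lemma list_measurable_index:
  fixes G :: "(real ^ 'd) list \<Rightarrow> real"
  assumes "list_measurable G"
  shows "(\<lambda>f. G (map f is)) \<in> borel_measurable (PiM UNIV (\<lambda>_::nat. borel))"
proof -
  have "map f is = map (\<lambda>k. f (is ! k)) [0..<length is]" for f :: "nat \<Rightarrow> real ^ 'd"
    by (intro nth_equalityI) auto
  moreover have "(\<lambda>f k. f (is ! k)) \<in> PiM UNIV (\<lambda>_::nat. borel) \<rightarrow>\<^sub>M PiM UNIV (\<lambda>_::nat. borel :: (real ^ 'd) measure)"
    by (rule measurable_PiM_single') (auto)
  from measurable_compose[OF this list_measurableD[OF assms, of "length is"]]
  have "(\<lambda>f. G (map (\<lambda>k. f (is ! k)) [0..<length is])) \<in> borel_measurable (PiM UNIV (\<lambda>_::nat. borel))" .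
  ultimately show ?thesis by simp
qed

lemma list_measurable_integrable:
  fixes G :: "(real ^ 'd) list \<Rightarrow> real"
  assumes "list_measurable G"
  shows "integrable point_seq (\<lambda>f. G (map f [0..<n]))"
proof -
  interpret prob_space point_seq by (rule prob_space_point_seq)
  obtain B where "\<And>xs. length xs \<le> n \<Longrightarrow> \<bar>G xs\<bar> \<le> B"
    using list_measurable_bounded[OF assms] by metis
  then show ?thesis
    using list_measurableD[OF assms, of n] unfolding measurable_seq_to_borel
    by (intro integrable_const_bound[of _ B]) auto
qed

text \<open>The filtered index list itself depends on \<open>f\<close>, so the claim is not a mere
  composition of measurable maps. The induction decides one index at a time: \<open>pre\<close>
  collects the indices accepted so far, and each decision is a measurable case distinction.\<close>

lemma list_measurable_filter_index:
  fixes G :: "(real ^ 'd) list \<Rightarrow> real"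
  assumes "list_measurable G" and "\<And>i. Measurable.pred (PiM UNIV (\<lambda>_::nat. borel)) (\<lambda>f. Q f i)"
  shows "(\<lambda>f. G (map f (pre @ filter (Q f) is))) \<in> borel_measurable (PiM UNIV (\<lambda>_::nat. borel))"
proof (induction "is" arbitrary: pre)
  case Nil
  then show ?case using list_measurable_index[OF assms(1)] by simp
next
  case (Cons i "is")
  have "(\<lambda>f. if Q f i then G (map f ((pre @ [i]) @ filter (Q f) is)) else G (map f (pre @ filter (Q f) is)))
     \<in> borel_measurable (PiM UNIV (\<lambda>_::nat. borel))"
    using assms(2)[of i] by (intro measurable_If Cons) (simp_all add: pred_def)
  then show ?case
    by (rule measurable_cong[THEN iffD1, rotated]) auto
qed

lemma list_measurableI:
  fixes G :: "(real ^ 'd) list \<Rightarrow> real"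
  assumes "\<And>n. (\<lambda>f. G (map f [0..<n])) \<in> borel_measurable (PiM UNIV (\<lambda>_::nat. borel))"
    and "\<And>n. \<exists>B. \<forall>xs. length xs \<le> n \<longrightarrow> \<bar>G xs\<bar> \<le> B"
  shows "list_measurable G"
  using assms by (auto simp: list_measurable_def)

lemma list_measurable_filter:
  fixes G :: "(real ^ 'd) list \<Rightarrow> real"
  assumes "list_measurable G" and "A \<in> sets borel"
  shows "list_measurable (\<lambda>xs. G (filter (\<lambda>y. y \<in> A) xs))"
proof (rule list_measurableI)
  fix n
  have "Measurable.pred (PiM UNIV (\<lambda>_::nat. borel)) (\<lambda>f. f i \<in> A)" for i
    using assms(2) by measurable
  from list_measurable_filter_index[OF assms(1), of "\<lambda>f i. f i \<in> A" "[]", OF this]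
  show "(\<lambda>f. G (filter (\<lambda>y. y \<in> A) (map f [0..<n]))) \<in> borel_measurable (PiM UNIV (\<lambda>_::nat. borel))"
    by (simp add: filter_map comp_def)
  show "\<exists>B. \<forall>xs. length xs \<le> n \<longrightarrow> \<bar>G (filter (\<lambda>y. y \<in> A) xs)\<bar> \<le> B"
    using list_measurable_bounded[OF assms(1), of n] length_filter_le order_trans by metis
qed

lemma list_measurable_map:
  fixes T :: "real ^ 'd \<Rightarrow> real ^ 'd"
  assumes "list_measurable G" and [measurable]: "T \<in> borel_measurable borel"
  shows "list_measurable (\<lambda>xs. G (map T xs))"
proof (rule list_measurableI)
  fix n
  have "(\<lambda>f k. T (f k)) \<in> PiM UNIV (\<lambda>_::nat. borel) \<rightarrow>\<^sub>M PiM UNIV (\<lambda>_::nat. borel :: (real ^ 'd) measure)"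
    by (rule measurable_PiM_single') auto
  from measurable_compose[OF this list_measurableD[OF assms(1)]]
  show "(\<lambda>f. G (map T (map f [0..<n]))) \<in> borel_measurable (PiM UNIV (\<lambda>_::nat. borel))"
    by (simp add: comp_def)
  show "\<exists>B. \<forall>xs. length xs \<le> n \<longrightarrow> \<bar>G (map T xs)\<bar> \<le> B"
    using list_measurable_bounded[OF assms(1), of n] by (metis length_map)
qed

lemma map_case_nat: "map (case_nat x f) [0..<Suc n] = x # map f [0..<n]"
  by (simp add: upt_conv_Cons map_Suc_upt[symmetric] comp_def del: upt_Suc)

lemma measurable_case_nat_seq:
  "(\<lambda>(x, f). case_nat x f) \<in> borel \<Otimes>\<^sub>M PiM UNIV (\<lambda>_::nat. borel) \<rightarrow>\<^sub>M PiM UNIV (\<lambda>_::nat. borel :: (real ^ 'd) measure)"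
proof (rule measurable_PiM_single')
  show "(\<lambda>\<omega>. (case \<omega> of (x, f) \<Rightarrow> case_nat x f) i) \<in> borel \<Otimes>\<^sub>M PiM UNIV (\<lambda>_::nat. borel) \<rightarrow>\<^sub>M (borel :: (real ^ 'd) measure)" for i
    by (cases i) (simp_all add: case_prod_unfold)
qed auto

lemma list_measurable_Cons:
  fixes G :: "(real ^ 'd) list \<Rightarrow> real"
  assumes "list_measurable G"
  shows "list_measurable (\<lambda>xs. G (x # xs))"
proof (rule list_measurableI)
  fix n
  show "(\<lambda>f. G (x # map f [0..<n])) \<in> borel_measurable (PiM UNIV (\<lambda>_::nat. borel))"
    using measurable_compose[OF measurable_compose[OF measurable_Pair1' measurable_case_nat_seq]
        list_measurableD[OF assms, of "Suc n"], of x]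
    by (simp add: map_case_nat del: upt_Suc)
  show "\<exists>B. \<forall>xs. length xs \<le> n \<longrightarrow> \<bar>G (x # xs)\<bar> \<le> B"
    using list_measurable_bounded[OF assms, of "Suc n"] by (metis length_Cons Suc_le_mono)
qed

lemma list_measurable_const: "list_measurable (\<lambda>_. c)"
  by (rule list_measurableI) auto

lemma list_measurable_mult:
  fixes G H :: "(real ^ 'd) list \<Rightarrow> real"
  assumes "list_measurable G" "list_measurable H"
  shows "list_measurable (\<lambda>xs. G xs * H xs)"
proof (rule list_measurableI)
  fix n
  show "(\<lambda>f. G (map f [0..<n]) * H (map f [0..<n])) \<in> borel_measurable (PiM UNIV (\<lambda>_::nat. borel))"
    by (intro borel_measurable_times list_measurableD assms)
  obtain B where B: "B \<ge> 0" "\<And>xs. length xs \<le> n \<Longrightarrow> \<bar>G xs\<bar> \<le> B"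
    using list_measurable_bounded[OF assms(1)] by metis
  obtain C where C: "C \<ge> 0" "\<And>xs. length xs \<le> n \<Longrightarrow> \<bar>H xs\<bar> \<le> C"
    using list_measurable_bounded[OF assms(2)] by metis
  show "\<exists>B. \<forall>xs. length xs \<le> n \<longrightarrow> \<bar>G xs * H xs\<bar> \<le> B"
    using B C by (intro exI[of _ "B * C"]) (auto simp: abs_mult intro: mult_mono)
qed

lemma list_measurable_add:
  fixes G H :: "(real ^ 'd) list \<Rightarrow> real"
  assumes "list_measurable G" "list_measurable H"
  shows "list_measurable (\<lambda>xs. G xs + H xs)"
proof (rule list_measurableI)
  fix n
  show "(\<lambda>f. G (map f [0..<n]) + H (map f [0..<n])) \<in> borel_measurable (PiM UNIV (\<lambda>_::nat. borel))"
    by (intro borel_measurable_add list_measurableD assms)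
  obtain B where B: "\<And>xs. length xs \<le> n \<Longrightarrow> \<bar>G xs\<bar> \<le> B"
    using list_measurable_bounded[OF assms(1)] by metis
  obtain C where C: "\<And>xs. length xs \<le> n \<Longrightarrow> \<bar>H xs\<bar> \<le> C"
    using list_measurable_bounded[OF assms(2)] by metis
  show "\<exists>B. \<forall>xs. length xs \<le> n \<longrightarrow> \<bar>G xs + H xs\<bar> \<le> B"
  proof (intro exI[of _ "B + C"] allI impI)
    fix xs :: "(real ^ 'd) list" assume "length xs \<le> n"
    then show "\<bar>G xs + H xs\<bar> \<le> B + C" using B[of xs] C[of xs] by linarith
  qed
qed

lemma list_measurable_sum:
  fixes G :: "'i \<Rightarrow> (real ^ 'd) list \<Rightarrow> real"
  assumes "finite I" "\<And>i. i \<in> I \<Longrightarrow> list_measurable (G i)"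
  shows "list_measurable (\<lambda>xs. \<Sum>i\<in>I. G i xs)"
  using assms by (induction I) (auto intro: list_measurable_const list_measurable_add)

lemma list_measurable_continuous:
  fixes G :: "(real ^ 'd) list \<Rightarrow> real"
  assumes "list_measurable G" "continuous_on UNIV h"
  shows "list_measurable (\<lambda>xs. h (G xs) :: real)"
proof (rule list_measurableI)
  fix n
  show "(\<lambda>f. h (G (map f [0..<n]))) \<in> borel_measurable (PiM UNIV (\<lambda>_::nat. borel))"
    using measurable_compose[OF list_measurableD[OF assms(1)] borel_measurable_continuous_onI[OF assms(2)]] .
  obtain B where B: "\<And>xs. length xs \<le> n \<Longrightarrow> \<bar>G xs\<bar> \<le> B"
    using list_measurable_bounded[OF assms(1)] by metis
  have "compact (h ` {-B..B})"
    by (rule compact_continuous_image) (auto intro: continuous_on_subset[OF assms(2)])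
  then obtain C where "\<forall>y\<in>h ` {-B..B}. \<bar>y\<bar> \<le> C"
    using compact_imp_bounded bounded_real by blast
  then show "\<exists>B. \<forall>xs. length xs \<le> n \<longrightarrow> \<bar>h (G xs)\<bar> \<le> B"
    using B by (intro exI[of _ C]) (auto simp: abs_le_iff minus_le_iff)
qed

lemma list_mean_0 [simp]: "list_mean 0 (G :: (real ^ 'd) list \<Rightarrow> real) = G []"
proof -
  interpret prob_space "point_seq :: (nat \<Rightarrow> real ^ 'd) measure" by (rule prob_space_point_seq)
  show ?thesis by (simp add: list_mean_def prob_space)
qed

text \<open>The law of an i.i.d. sequence equals that of \<open>case_nat x f\<close> with
  independent \<open>x\<close> and \<open>f\<close> (\<open>PiM_iter\<close>). Fubini's theorem then
  splits off the first point, which is the root of the tree.\<close>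

lemma list_mean_Suc:
  fixes G :: "(real ^ 'd) list \<Rightarrow> real"
  assumes "list_measurable G"
  shows "list_mean (Suc n) G = (\<integral>x. list_mean n (\<lambda>xs. G (x # xs)) \<partial>cube)"
proof -
  interpret sequence_space "cube :: (real ^ 'd) measure"
    unfolding sequence_space_def by (rule product_prob_space_cube)
  interpret C: prob_space "cube :: (real ^ 'd) measure" by (rule prob_space_cube)
  interpret S: prob_space "point_seq :: (nat \<Rightarrow> real ^ 'd) measure" by (rule prob_space_point_seq)
  interpret P: pair_prob_space "cube :: (real ^ 'd) measure" "point_seq :: (nat \<Rightarrow> real ^ 'd) measure" ..
  let ?h = "\<lambda>f. G (map f [0..<Suc n])"
  have [measurable]: "?h \<in> borel_measurable point_seq"
    using list_measurableD[OF assms, of "Suc n"] unfolding measurable_seq_to_borel .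
  have cm: "(\<lambda>(x, f). case_nat x f) \<in> cube \<Otimes>\<^sub>M point_seq \<rightarrow>\<^sub>M (point_seq :: (nat \<Rightarrow> real ^ 'd) measure)"
  proof (rule measurable_PiM_single')
    show "(\<lambda>\<omega>. (case \<omega> of (x, f) \<Rightarrow> case_nat x f) i) \<in> cube \<Otimes>\<^sub>M point_seq \<rightarrow>\<^sub>M (cube :: (real ^ 'd) measure)" for i
      by (cases i) (simp_all add: case_prod_unfold)
  qed auto
  obtain B where B: "\<And>xs. length xs \<le> Suc n \<Longrightarrow> \<bar>G xs\<bar> \<le> B"
    using list_measurable_bounded[OF assms] by metis
  have int: "integrable (cube \<Otimes>\<^sub>M point_seq) (\<lambda>z. ?h (case z of (x, f) \<Rightarrow> case_nat x f))"
    by (rule P.P.integrable_const_bound[of _ B])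
      (use B in \<open>auto intro: measurable_compose[OF cm] simp del: upt_Suc\<close>)
  have "list_mean (Suc n) G = (\<integral>f. ?h f \<partial>distr (cube \<Otimes>\<^sub>M point_seq) point_seq (\<lambda>(x, f). case_nat x f))"
    unfolding list_mean_def PiM_iter ..
  also have "\<dots> = (\<integral>z. ?h (case z of (x, f) \<Rightarrow> case_nat x f) \<partial>(cube \<Otimes>\<^sub>M point_seq))"
    by (rule integral_distr[OF cm]) fact
  also have "\<dots> = (\<integral>x. (\<integral>f. ?h (case_nat x f) \<partial>point_seq) \<partial>cube)"
    using P.integral_fst'[OF int] by simp
  finally show ?thesis by (simp add: list_mean_def map_case_nat del: upt_Suc)
qed

lemma measurable_section_mean:
  fixes F :: "(nat \<Rightarrow> real ^ 'd) \<Rightarrow> real"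
  assumes "F \<in> borel_measurable (PiM UNIV (\<lambda>_. borel))"
  shows "(\<lambda>x. \<integral>f. F (case_nat x f) \<partial>point_seq) \<in> borel_measurable borel"
proof -
  interpret prob_space "point_seq :: (nat \<Rightarrow> real ^ 'd) measure" by (rule prob_space_point_seq)
  have "sets (borel \<Otimes>\<^sub>M point_seq) = sets (borel \<Otimes>\<^sub>M PiM UNIV (\<lambda>_::nat. borel :: (real ^ 'd) measure))"
    by (intro sets_pair_measure_cong sets_point_seq refl)
  then have "(\<lambda>(x, f). F (case_nat x f)) \<in> borel_measurable (borel \<Otimes>\<^sub>M point_seq)"
    using measurable_compose[OF measurable_case_nat_seq assms] by (simp add: case_prod_unfold cong: measurable_cong_sets)
  then show ?thesis by (rule borel_measurable_lebesgue_integral)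
qed

lemma list_mean_Cons_measurable:
  fixes G :: "(real ^ 'd) list \<Rightarrow> real"
  assumes "list_measurable G"
  shows "(\<lambda>x. list_mean n (\<lambda>xs. G (x # xs))) \<in> borel_measurable borel"
  using measurable_section_mean[OF list_measurableD[OF assms, of "Suc n"]]
  by (simp add: list_mean_def map_case_nat del: upt_Suc)

lemma list_mean_bound:
  fixes G :: "(real ^ 'd) list \<Rightarrow> real"
  assumes "\<And>xs. length xs = n \<Longrightarrow> \<bar>G xs\<bar> \<le> B"
  shows "\<bar>list_mean n G\<bar> \<le> B"
proof -
  interpret prob_space "point_seq :: (nat \<Rightarrow> real ^ 'd) measure" by (rule prob_space_point_seq)
  have "B \<ge> 0" using assms[of "replicate n 0"] by simp
  show ?thesis
  proof (cases "integrable point_seq (\<lambda>f. G (map f [0..<n]))")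
    case True
    have "\<bar>list_mean n G\<bar> \<le> (\<integral>f. \<bar>G (map f [0..<n])\<bar> \<partial>point_seq)"
      unfolding list_mean_def by (rule integral_abs_bound)
    also have "\<dots> \<le> (\<integral>f. B \<partial>(point_seq :: (nat \<Rightarrow> real ^ 'd) measure))"
      using True assms by (intro Bochner_Integration.integral_mono integrable_abs) auto
    finally show ?thesis using prob_space by simp
  next
    case False
    then show ?thesis using \<open>B \<ge> 0\<close> by (simp add: list_mean_def not_integrable_integral_eq)
  qed
qed

lemma list_mean_mono:
  fixes G H :: "(real ^ 'd) list \<Rightarrow> real"
  assumes "list_measurable G" "list_measurable H" "\<And>xs. length xs = n \<Longrightarrow> G xs \<le> H xs"
  shows "list_mean n G \<le> list_mean n H"
  unfolding list_mean_def using assms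
  by (intro Bochner_Integration.integral_mono list_measurable_integrable) auto

lemma list_mean_add:
  fixes G H :: "(real ^ 'd) list \<Rightarrow> real"
  assumes "list_measurable G" "list_measurable H"
  shows "list_mean n (\<lambda>xs. G xs + H xs) = list_mean n G + list_mean n H"
  unfolding list_mean_def using assms by (intro Bochner_Integration.integral_add list_measurable_integrable)

lemma list_mean_sum:
  fixes G :: "'i \<Rightarrow> (real ^ 'd) list \<Rightarrow> real"
  assumes "\<And>i. i \<in> I \<Longrightarrow> list_measurable (G i)"
  shows "list_mean n (\<lambda>xs. \<Sum>i\<in>I. G i xs) = (\<Sum>i\<in>I. list_mean n (G i))"
  unfolding list_mean_def using assms by (intro Bochner_Integration.integral_sum list_measurable_integrable)

lemma list_mean_cmult: "list_mean n (\<lambda>xs. c * G xs) = c * list_mean n G"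
  by (simp add: list_mean_def)

lemma list_mean_const [simp]: "list_mean n (\<lambda>_ :: (real ^ 'd) list. c) = c"
proof -
  interpret prob_space "point_seq :: (nat \<Rightarrow> real ^ 'd) measure" by (rule prob_space_point_seq)
  show ?thesis by (simp add: list_mean_def prob_space)
qed

lemma list_mean_cong: "(\<And>xs. length xs = n \<Longrightarrow> G xs = H xs) \<Longrightarrow> list_mean n G = list_mean n H"
  unfolding list_mean_def by (intro Bochner_Integration.integral_cong) auto

lemma list_mean_nonneg: "(\<And>xs. length xs = n \<Longrightarrow> 0 \<le> G xs) \<Longrightarrow> 0 \<le> list_mean n G"
  unfolding list_mean_def by (intro Bochner_Integration.integral_nonneg) auto

section \<open>Numbers of points in two disjoint cells\<close>

primrec two_cell_mix :: "real \<Rightarrow> real \<Rightarrow> nat \<Rightarrow> (nat \<Rightarrow> nat \<Rightarrow> real) \<Rightarrow> real" where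
  "two_cell_mix a b 0 F = F 0 0"
| "two_cell_mix a b (Suc m) F = a * two_cell_mix a b m (\<lambda>j. F (Suc j))
     + b * two_cell_mix a b m (\<lambda>j k. F j (Suc k)) + (1 - a - b) * two_cell_mix a b m F"

text \<open>Both mixes are expectations over random counts, written by recursion on the points
  instead of with binomial coefficients: \<open>binomial_mix a m g\<close> is the mean of
  \<open>g\<close> at a binomial variable with \<open>m\<close> trials of success probability
  \<open>a\<close>, and \<open>two_cell_mix a b m F\<close> is the mean of \<open>F\<close> at the
  numbers of points, among \<open>m\<close>, that fall in two disjoint cells of masses
  \<open>a\<close> and \<open>b\<close>.\<close>

primrec binomial_mix :: "real \<Rightarrow> nat \<Rightarrow> (nat \<Rightarrow> real) \<Rightarrow> real" where
  "binomial_mix a 0 g = g 0"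
| "binomial_mix a (Suc m) g = a * binomial_mix a m (\<lambda>j. g (Suc j)) + (1 - a) * binomial_mix a m g"

lemma two_cell_mix_one: "two_cell_mix a 0 m (\<lambda>j k. g j) = binomial_mix a m g"
  by (induction m arbitrary: g) auto

lemma two_cell_mix_integral:
  assumes "\<And>j k. integrable N (\<lambda>y. F y j k)"
  shows "integrable N (\<lambda>y. two_cell_mix a b m (F y))" (is ?A)
    and "(\<integral>y. two_cell_mix a b m (F y) \<partial>N) = two_cell_mix a b m (\<lambda>j k. \<integral>y. F y j k \<partial>N)" (is ?B)
proof -
  have "?A \<and> ?B"
    using assms
  proof (induction m arbitrary: F)
    case (Suc m)
    have *: "integrable N (\<lambda>y. two_cell_mix a b m (\<lambda>j. F y (Suc j)))"
      "(\<integral>y. two_cell_mix a b m (\<lambda>j. F y (Suc j)) \<partial>N) = two_cell_mix a b m (\<lambda>j k. \<integral>y. F y (Suc j) k \<partial>N)"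
      "integrable N (\<lambda>y. two_cell_mix a b m (\<lambda>j k. F y j (Suc k)))"
      "(\<integral>y. two_cell_mix a b m (\<lambda>j k. F y j (Suc k)) \<partial>N) = two_cell_mix a b m (\<lambda>j k. \<integral>y. F y j (Suc k) \<partial>N)"
      "integrable N (\<lambda>y. two_cell_mix a b m (F y))"
      "(\<integral>y. two_cell_mix a b m (F y) \<partial>N) = two_cell_mix a b m (\<lambda>j k. \<integral>y. F y j k \<partial>N)"
      using Suc.IH[of "\<lambda>y j. F y (Suc j)"] Suc.IH[of "\<lambda>y j k. F y j (Suc k)"] Suc.IH[of F] Suc.prems by auto
    then show ?case by simp
  qed simp
  then show ?A ?B by auto
qed

lemma two_cell_mix_bound:
  assumes "0 \<le> a" "0 \<le> b" "a + b \<le> 1" "\<And>j k. j \<le> m \<Longrightarrow> k \<le> m \<Longrightarrow> F j k \<le> B"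
  shows "two_cell_mix a b m F \<le> B"
  using assms(4)
proof (induction m arbitrary: F)
  case (Suc m)
  have "two_cell_mix a b (Suc m) F \<le> a * B + b * B + (1 - a - b) * B"
    unfolding two_cell_mix.simps using assms(1-3) Suc.prems
    by (intro add_mono mult_left_mono Suc.IH) auto
  then show ?case by (simp add: algebra_simps)
qed simp

text \<open>\<open>A\<close> has mass \<open>a\<close>, and the uniform law conditioned on \<open>A\<close> is the image of the uniform law under \<open>T\<close>.\<close>

definition cell_map :: "(real ^ 'd) set \<Rightarrow> (real ^ 'd \<Rightarrow> real ^ 'd) \<Rightarrow> real \<Rightarrow> bool" where
  "cell_map A T a \<longleftrightarrow> A \<in> sets borel \<and> T \<in> borel_measurable borel \<and> 0 \<le> a \<and>
     (\<forall>\<phi>\<in>borel_measurable borel. bounded (range \<phi>) \<longrightarrow>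
       (\<integral>y. indicator A y * \<phi> y \<partial>cube) = a * (\<integral>y. \<phi> (T y) \<partial>cube :: real))"

lemma integrable_cube_bounded:
  fixes \<phi> :: "real ^ 'd \<Rightarrow> real"
  assumes "\<phi> \<in> borel_measurable borel" "\<And>y. \<bar>\<phi> y\<bar> \<le> B"
  shows "integrable cube \<phi>"
proof -
  interpret prob_space "cube :: (real ^ 'd) measure" by (rule prob_space_cube)
  show ?thesis using assms by (intro integrable_const_bound[of _ B]) auto
qed

lemma cell_mapD:
  assumes "cell_map A T a" "\<phi> \<in> borel_measurable borel" "\<And>y. \<bar>\<phi> y\<bar> \<le> B"
  shows "(\<integral>y. indicator A y * \<phi> y \<partial>cube) = a * (\<integral>y. \<phi> (T y) \<partial>cube)"
proof -
  have "bounded (range \<phi>)" using assms(3) by (auto simp: bounded_iff)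
  then show ?thesis using assms(1,2) by (auto simp: cell_map_def)
qed

lemma cell_map_measure:
  fixes A :: "(real ^ 'd) set"
  assumes "cell_map A T a"
  shows "(\<integral>y. indicator A y \<partial>cube) = a"
proof -
  interpret prob_space "cube :: (real ^ 'd) measure" by (rule prob_space_cube)
  have "prob UNIV = 1" using prob_space by simp
  then show ?thesis using cell_mapD[OF assms, of "\<lambda>_. 1" 1] by simp
qed

lemma cell_map_add_le_one:
  fixes A B :: "(real ^ 'd) set"
  assumes "cell_map A T a" "cell_map B T' b" "A \<inter> B = {}"
  shows "a + b \<le> 1"
proof -
  interpret prob_space "cube :: (real ^ 'd) measure" by (rule prob_space_cube)
  have "A \<in> sets borel" "B \<in> sets borel" using assms by (auto simp: cell_map_def)
  then have "(\<integral>y. indicator A y + indicator B y \<partial>cube) = a + b"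
    unfolding cell_map_measure[OF assms(1), symmetric] cell_map_measure[OF assms(2), symmetric]
    by (intro Bochner_Integration.integral_add) (auto intro!: integrable_cube_bounded[of _ 1] simp: indicator_def)
  moreover have "(\<integral>y. indicator A y + indicator B y \<partial>cube) \<le> (\<integral>y. (1 :: real) \<partial>(cube :: (real ^ 'd) measure))"
    using \<open>A \<in> sets borel\<close> \<open>B \<in> sets borel\<close> assms(3)
    by (intro Bochner_Integration.integral_mono integrable_cube_bounded[of _ 2]) (auto simp: indicator_def)
  moreover have "prob UNIV = 1" using prob_space by simp
  ultimately show ?thesis by simp
qed

text \<open>The point \<open>y\<close> is treated as coordinate 0 of a sequence and the filtered
  points as coordinates 1 to \<open>m\<close>. This reduces measurability in \<open>y\<close> to
  \<open>list_measurable_filter_index\<close>.\<close>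

lemma list_mean_cons_filter_measurable:
  fixes G H :: "(real ^ 'd) list \<Rightarrow> real"
  assumes "list_measurable G" "list_measurable H" "A \<in> sets borel" "B \<in> sets borel"
  shows "(\<lambda>y. list_mean m (\<lambda>xs. G (y # filter (\<lambda>y. y \<in> A) xs) * H (filter (\<lambda>y. y \<in> B) xs)))
    \<in> borel_measurable borel"
proof -
  have *: "Measurable.pred (PiM UNIV (\<lambda>_::nat. borel)) (\<lambda>f. f i \<in> S)" if "S \<in> sets borel"
    for i and S :: "(real ^ 'd) set"
    using that by measurable
  let ?F = "\<lambda>f. G (map f ([0] @ filter (\<lambda>i. f i \<in> A) [1..<Suc m])) * H (map f ([] @ filter (\<lambda>i. f i \<in> B) [1..<Suc m]))"
  have "?F \<in> borel_measurable (PiM UNIV (\<lambda>_. borel))"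
    by (intro borel_measurable_times list_measurable_filter_index assms *)
  moreover have "map (case_nat y f) (filter (\<lambda>i. case_nat y f i \<in> S) [1..<Suc m]) = filter (\<lambda>y. y \<in> S) (map f [0..<m])"
    for y f and S :: "(real ^ 'd) set"
    by (simp add: map_Suc_upt[symmetric] filter_map comp_def del: upt_Suc)
  ultimately show ?thesis
    using measurable_section_mean[of ?F] by (simp add: list_mean_def del: upt_Suc)
qed

text \<open>Given their numbers, the points in disjoint cells are independent uniform samples of
  these cells. By induction on \<open>m\<close>, the first point falls in \<open>A\<close>, in
  \<open>B\<close> or in neither, which gives the three terms of \<open>two_cell_mix\<close>; a
  point in \<open>A\<close> has the law of \<open>T y\<close> for uniform \<open>y\<close>, and it
  prolongs the list seen by \<open>G\<close>. Therefore \<open>G\<close> and \<open>H\<close> vary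
  in the induction.\<close>

lemma list_mean_two_cells:
  fixes G H :: "(real ^ 'd) list \<Rightarrow> real"
  assumes A: "cell_map A T a" and B: "cell_map B T' b" and AB: "A \<inter> B = {}"
    and G: "list_measurable G" and H: "list_measurable H"
  shows "list_mean m (\<lambda>xs. G (filter (\<lambda>y. y \<in> A) xs) * H (filter (\<lambda>y. y \<in> B) xs))
    = two_cell_mix a b m (\<lambda>j k. list_mean j (\<lambda>xs. G (map T xs)) * list_mean k (\<lambda>xs. H (map T' xs)))"
  using G H
proof (induction m arbitrary: G H)
  case (Suc m)
  note G = Suc.prems(1) and H = Suc.prems(2)
  interpret C: prob_space "cube :: (real ^ 'd) measure" by (rule prob_space_cube)
  have sA: "A \<in> sets borel" and sB: "B \<in> sets borel"
    and mT: "T \<in> borel_measurable borel" and mT': "T' \<in> borel_measurable borel"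
    using A B by (auto simp: cell_map_def)
  define K where "K = (\<lambda>xs. G (filter (\<lambda>y. y \<in> A) xs) * H (filter (\<lambda>y. y \<in> B) xs))"
  define KA where "KA = (\<lambda>y xs. G (y # filter (\<lambda>y. y \<in> A) xs) * H (filter (\<lambda>y. y \<in> B) xs))"
  define KB where "KB = (\<lambda>y xs. G (filter (\<lambda>y. y \<in> A) xs) * H (y # filter (\<lambda>y. y \<in> B) xs))"
  define g where "g j = list_mean j (\<lambda>xs. G (map T xs))" for j
  define h where "h j = list_mean j (\<lambda>xs. H (map T' xs))" for j
  have GT: "list_measurable (\<lambda>xs. G (map T xs))" by (intro list_measurable_map G mT)
  have HT: "list_measurable (\<lambda>xs. H (map T' xs))" by (intro list_measurable_map H mT')
  have K: "list_measurable K" unfolding K_def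
    by (intro list_measurable_mult list_measurable_filter G H sA sB)
  have KAB: "list_measurable (KA y)" "list_measurable (KB y)" for y
    unfolding KA_def KB_def
    by (intro list_measurable_mult list_measurable_filter[OF list_measurable_Cons] list_measurable_filter G H sA sB)+
  obtain bG where bG: "bG \<ge> 0" "\<And>xs. length xs \<le> Suc m \<Longrightarrow> \<bar>G xs\<bar> \<le> bG"
    using list_measurable_bounded[OF G] by metis
  obtain bH where bH: "bH \<ge> 0" "\<And>xs. length xs \<le> Suc m \<Longrightarrow> \<bar>H xs\<bar> \<le> bH"
    using list_measurable_bounded[OF H] by metis
  have KAb: "\<bar>list_mean m (KA y)\<bar> \<le> bG * bH" "\<bar>list_mean m (KB y)\<bar> \<le> bG * bH" for y
  proof -
    have *: "length (filter P xs) \<le> m" if "length xs = m" for P and xs :: "(real ^ 'd) list"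
      using that length_filter_le by metis
    show "\<bar>list_mean m (KA y)\<bar> \<le> bG * bH" "\<bar>list_mean m (KB y)\<bar> \<le> bG * bH"
      unfolding KA_def KB_def using bG bH
      by (intro list_mean_bound; auto simp: abs_mult * le_SucI intro!: mult_mono)+
  qed
  have mK: "(\<lambda>y. list_mean m (KA y)) \<in> borel_measurable borel" "(\<lambda>y. list_mean m (KB y)) \<in> borel_measurable borel"
    using list_mean_cons_filter_measurable[OF G H sA sB] list_mean_cons_filter_measurable[OF H G sB sA]
    unfolding KA_def KB_def by (simp_all add: mult.commute)
  have split: "list_mean m (\<lambda>xs. K (y # xs)) = indicator A y * list_mean m (KA y)
      + indicator B y * list_mean m (KB y) + (1 - indicator A y - indicator B y) * list_mean m K" for y
    using AB by (auto simp: K_def KA_def KB_def indicator_def)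
  have iA: "(\<integral>y. indicator A y * list_mean m (KA y) \<partial>cube)
      = a * two_cell_mix a b m (\<lambda>j k. g (Suc j) * h k)"
  proof -
    have "(\<integral>y. indicator A y * list_mean m (KA y) \<partial>cube) = a * (\<integral>y. list_mean m (KA (T y)) \<partial>cube)"
      by (rule cell_mapD[OF A mK(1) KAb(1)])
    also have "(\<integral>y. list_mean m (KA (T y)) \<partial>cube)
       = (\<integral>y. two_cell_mix a b m (\<lambda>j k. list_mean j (\<lambda>xs. G (map T (y # xs))) * h k) \<partial>cube)"
      unfolding KA_def h_def
      using Suc.IH[OF list_measurable_Cons[OF G] H] by simp
    also have "\<dots> = two_cell_mix a b m (\<lambda>j k. g (Suc j) * h k)"
    proof (subst two_cell_mix_integral(2))
      show "integrable cube (\<lambda>y. list_mean j (\<lambda>xs. G (map T (y # xs))) * h k)" for j k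
      proof (intro integrable_mult_left)
        obtain B where "\<And>xs. length xs \<le> Suc j \<Longrightarrow> \<bar>G (map T xs)\<bar> \<le> B"
          using list_measurable_bounded[OF GT] by metis
        then show "integrable cube (\<lambda>y. list_mean j (\<lambda>xs. G (map T (y # xs))))"
          by (intro integrable_cube_bounded[of _ B] list_mean_Cons_measurable[OF GT] list_mean_bound)
              (auto simp del: list.map)
      qed
      show "two_cell_mix a b m (\<lambda>j k. \<integral>y. list_mean j (\<lambda>xs. G (map T (y # xs))) * h k \<partial>cube)
        = two_cell_mix a b m (\<lambda>j k. g (Suc j) * h k)"
        unfolding g_def by (simp add: list_mean_Suc[OF GT])
    qed
    finally show ?thesis .
  qed
  have iB: "(\<integral>y. indicator B y * list_mean m (KB y) \<partial>cube)
      = b * two_cell_mix a b m (\<lambda>j k. g j * h (Suc k))"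
  proof -
    have "(\<integral>y. indicator B y * list_mean m (KB y) \<partial>cube) = b * (\<integral>y. list_mean m (KB (T' y)) \<partial>cube)"
      by (rule cell_mapD[OF B mK(2) KAb(2)])
    also have "(\<integral>y. list_mean m (KB (T' y)) \<partial>cube)
       = (\<integral>y. two_cell_mix a b m (\<lambda>j k. g j * list_mean k (\<lambda>xs. H (map T' (y # xs)))) \<partial>cube)"
      unfolding KB_def g_def
      using Suc.IH[OF G list_measurable_Cons[OF H]] by simp
    also have "\<dots> = two_cell_mix a b m (\<lambda>j k. g j * h (Suc k))"
    proof (subst two_cell_mix_integral(2))
      show "integrable cube (\<lambda>y. g j * list_mean k (\<lambda>xs. H (map T' (y # xs))))" for j k
      proof (intro integrable_mult_right)
        obtain B where "\<And>xs. length xs \<le> Suc k \<Longrightarrow> \<bar>H (map T' xs)\<bar> \<le> B"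
          using list_measurable_bounded[OF HT] by metis
        then show "integrable cube (\<lambda>y. list_mean k (\<lambda>xs. H (map T' (y # xs))))"
          by (intro integrable_cube_bounded[of _ B] list_mean_Cons_measurable[OF HT] list_mean_bound)
              (auto simp del: list.map)
      qed
      show "two_cell_mix a b m (\<lambda>j k. \<integral>y. g j * list_mean k (\<lambda>xs. H (map T' (y # xs))) \<partial>cube)
        = two_cell_mix a b m (\<lambda>j k. g j * h (Suc k))"
        unfolding h_def by (simp add: list_mean_Suc[OF HT])
    qed
    finally show ?thesis .
  qed
  have int: "integrable cube (\<lambda>y. indicator A y * list_mean m (KA y))"
    "integrable cube (\<lambda>y. indicator B y * list_mean m (KB y))"
    using sA sB mK KAb
    by (auto intro!: integrable_cube_bounded[of _ "bG * bH"] simp: indicator_def abs_mult bG bH)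
  have int': "integrable cube (\<lambda>y. indicator A y :: real)" "integrable cube (\<lambda>y. indicator B y :: real)"
    using sA sB by (auto intro!: integrable_cube_bounded[of _ 1] simp: indicator_def)
  have ints: "integrable cube (\<lambda>y. (1 - indicator A y - indicator B y) * list_mean m K)"
    using int' by (intro integrable_mult_left) auto
  have "list_mean (Suc m) K = (\<integral>y. list_mean m (\<lambda>xs. K (y # xs)) \<partial>cube)"
    by (rule list_mean_Suc[OF K])
  also have "\<dots> = (\<integral>y. indicator A y * list_mean m (KA y) \<partial>cube) + (\<integral>y. indicator B y * list_mean m (KB y) \<partial>cube)
      + (\<integral>y. (1 - indicator A y - indicator B y) * list_mean m K \<partial>cube)"
    unfolding split using int ints by simp
  also have "(\<integral>y. (1 - indicator A y - indicator B y) * list_mean m K \<partial>cube) = (1 - a - b) * list_mean m K"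
    using int' cell_map_measure[OF A] cell_map_measure[OF B] C.prob_space by simp
  also have "list_mean m K = two_cell_mix a b m (\<lambda>j k. g j * h k)"
    unfolding K_def g_def h_def by (rule Suc.IH[OF G H])
  finally show ?case unfolding iA iB K_def g_def h_def by simp
qed simp

section \<open>Orthants as affine images of the cube\<close>

lemma integral_cube:
  fixes \<phi> :: "real ^ 'd \<Rightarrow> real"
  assumes "\<phi> \<in> borel_measurable borel"
  shows "(\<integral>y. \<phi> y \<partial>cube) = (\<integral>y. indicator (cbox 0 1) y * \<phi> y \<partial>lborel)"
proof -
  have "cube = density lborel (\<lambda>x :: real ^ 'd. ennreal (indicator (cbox 0 1) x))"
    unfolding uniform_measure_def by (intro density_cong) (auto simp: emeasure_unit_cbox indicator_def)
  then show ?thesis using assms by (simp add: integral_real_density)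
qed

lemma AE_lborel_nth_neq:
  "AE y in lborel :: (real ^ 'd) measure. \<forall>i. y $ i \<noteq> c"
proof -
  have "AE y in lborel. (y :: real ^ 'd) $ i \<noteq> c" for i
  proof -
    have "negligible {y :: real ^ 'd. y \<bullet> axis i 1 = c}"
      by (intro negligible_standard_hyperplane) (auto simp: Basis_vec_def)
    moreover have "{y :: real ^ 'd. y \<bullet> axis i 1 = c} \<in> sets lborel"
      by simp
    ultimately have "{y :: real ^ 'd. y \<bullet> axis i 1 = c} \<in> null_sets lborel"
      by (simp add: negligible_iff_null_sets null_sets_completion_iff)
    then show ?thesis
      by (rule AE_I') (auto simp: inner_axis)
  qed
  then show ?thesis by (simp add: AE_all_countable)
qed

definition cell_embedding :: "'d set \<Rightarrow> real ^ 'd \<Rightarrow> real ^ 'd \<Rightarrow> real ^ 'd" where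
  "cell_embedding S x y = (\<chi> i. if i \<in> S then x $ i + (1 - x $ i) * y $ i else x $ i * y $ i)"

definition cell_volume :: "'d set \<Rightarrow> real ^ 'd \<Rightarrow> real" where
  "cell_volume S x = (\<Prod>i\<in>UNIV. if i \<in> S then 1 - x $ i else x $ i)"

lemma integral_lborel_diagonal_affine:
  fixes h :: "real ^ 'd \<Rightarrow> real"
  assumes h: "h \<in> borel_measurable borel" and c: "\<And>i. c i > 0"
  shows "(\<integral>y. h y \<partial>lborel) = (\<Prod>i\<in>UNIV. c i) * (\<integral>y. h (\<chi> i. t i + c i * y $ i) \<partial>lborel)"
proof -
  define c' where "c' b = (\<chi> i. c i) \<bullet> b" for b :: "real ^ 'd"
  define T where "T = (\<lambda>y :: real ^ 'd. \<chi> i. t i + c i * y $ i)"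
  have T: "T y = (\<chi> i. t i) + (\<Sum>b\<in>Basis. (c' b * (y \<bullet> b)) *\<^sub>R b)" for y
  proof (subst euclidean_eq_iff, intro ballI)
    fix b :: "real ^ 'd" assume "b \<in> Basis"
    then obtain i where "b = axis i 1" by (auto simp: Basis_vec_def)
    have "((\<chi> i. t i) + (\<Sum>b\<in>Basis. (c' b * (y \<bullet> b)) *\<^sub>R b)) \<bullet> b = (\<chi> i. t i) \<bullet> b + c' b * (y \<bullet> b)"
      using \<open>b \<in> Basis\<close> by (simp add: inner_add_left inner_sum_left_Basis)
    also have "\<dots> = T y \<bullet> b"
      using \<open>b = axis i 1\<close> by (simp add: T_def c'_def inner_axis)
    finally show "T y \<bullet> b = ((\<chi> i. t i) + (\<Sum>b\<in>Basis. (c' b * (y \<bullet> b)) *\<^sub>R b)) \<bullet> b" ..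
  qed
  have c'0: "c' b \<noteq> 0" if "b \<in> Basis" for b
    using that c by (auto simp: Basis_vec_def c'_def inner_axis less_imp_neq[symmetric])
  have "(\<Prod>b\<in>Basis. \<bar>c' b\<bar>) = (\<Prod>i\<in>UNIV. c i)"
  proof -
    have "Basis = (\<lambda>i. axis i (1 :: real)) ` (UNIV :: 'd set)" by (auto simp: Basis_vec_def)
    moreover have "inj (\<lambda>i :: 'd. axis i (1 :: real))" by (auto simp: inj_on_def axis_eq_axis)
    ultimately show ?thesis
      unfolding \<open>Basis = _\<close> using c by (simp add: prod.reindex c'_def inner_axis less_imp_le)
  qed
  then have lb: "(lborel :: (real ^ 'd) measure) = density (distr lborel borel T) (\<lambda>_. ennreal (\<Prod>i\<in>UNIV. c i))"
    using lborel_affine_euclidean[of c' "\<chi> i. t i"] c'0 unfolding T[abs_def] by simp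
  have [measurable]: "T \<in> borel_measurable borel"
    unfolding T by measurable
  have "(\<integral>y. h y \<partial>lborel) = (\<integral>y. h y \<partial>density (distr lborel borel T) (\<lambda>_. ennreal (\<Prod>i\<in>UNIV. c i)))"
    using lb by simp
  also have "\<dots> = (\<integral>y. (\<Prod>i\<in>UNIV. c i) * h y \<partial>distr lborel borel T)"
    using h prod_nonneg[of UNIV c] c by (subst integral_real_density) (auto simp: less_imp_le)
  also have "\<dots> = (\<integral>y. (\<Prod>i\<in>UNIV. c i) * h (T y) \<partial>lborel)"
    using h by (subst integral_distr) auto
  finally show ?thesis by (simp add: T_def)
qed

lemma orthant_vimage_borel: "{y. orthant (x :: real ^ 'd) y = S} \<in> sets borel"
proof -
  have "{y. orthant x y = S} = (\<Inter>i\<in>UNIV. {y. x $ i \<le> y $ i \<longleftrightarrow> i \<in> S})"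
    unfolding orthant_def set_eq_iff by simp
  moreover have "{y. x $ i \<le> y $ i \<longleftrightarrow> i \<in> S} \<in> sets borel" for i
    by (cases "i \<in> S") (auto simp: not_le intro!: borel_closed closed_Collect_le borel_open open_Collect_less continuous_intros)
  ultimately show ?thesis by (simp add: sets.finite_INT)
qed

lemma cell_volume_pos:
  assumes "\<And>i. 0 < x $ i" "\<And>i. x $ i < 1"
  shows "0 < cell_volume S x"
  unfolding cell_volume_def using assms by (intro prod_pos) auto

lemma cell_map_orthant:
  fixes x :: "real ^ 'd"
  assumes x: "\<And>i. 0 < x $ i" "\<And>i. x $ i < 1"
  shows "cell_map {y. orthant x y = S} (cell_embedding S x) (cell_volume S x)"
  unfolding cell_map_def
proof (intro conjI ballI impI)
  let ?A = "{y. orthant x y = S}"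
  let ?t = "\<lambda>i. if i \<in> S then x $ i else 0"
  let ?c = "\<lambda>i. if i \<in> S then 1 - x $ i else x $ i"
  show A: "?A \<in> sets borel" by (rule orthant_vimage_borel)
  have T: "cell_embedding S x = (\<lambda>y. \<chi> i. ?t i + ?c i * y $ i)"
    by (auto simp: cell_embedding_def fun_eq_iff vec_eq_iff)
  show mT: "cell_embedding S x \<in> borel_measurable borel"
    unfolding T by (intro borel_measurable_continuous_onI continuous_on_vec_lambda continuous_intros)
  show "0 \<le> cell_volume S x" using cell_volume_pos[of x] x less_imp_le by blast
  fix \<phi> :: "real ^ 'd \<Rightarrow> real" assume \<phi>: "\<phi> \<in> borel_measurable borel"
  have "(\<integral>y. indicator ?A y * \<phi> y \<partial>cube) = (\<integral>y. indicator (cbox 0 1) y * (indicator ?A y * \<phi> y) \<partial>lborel)"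
    using A \<phi> by (intro integral_cube) auto
  also have "\<dots> = cell_volume S x * (\<integral>y. indicator (cbox 0 1) (cell_embedding S x y) *
      (indicator ?A (cell_embedding S x y) * \<phi> (cell_embedding S x y)) \<partial>lborel)"
    unfolding T cell_volume_def using A \<phi> x by (intro integral_lborel_diagonal_affine) auto
  also have "(\<integral>y. indicator (cbox 0 1) (cell_embedding S x y) *
      (indicator ?A (cell_embedding S x y) * \<phi> (cell_embedding S x y)) \<partial>lborel)
     = (\<integral>y. indicator (cbox 0 1) y * \<phi> (cell_embedding S x y) \<partial>lborel)"
  proof (rule integral_cong_AE)
    show "AE y in lborel. indicator (cbox 0 1) (cell_embedding S x y) *
      (indicator ?A (cell_embedding S x y) * \<phi> (cell_embedding S x y))
      = indicator (cbox 0 1) y * \<phi> (cell_embedding S x y)"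
      \<comment> \<open>A coordinate \<open>y $ i = 1\<close> with \<open>i \<notin> S\<close> is
        sent to \<open>x $ i\<close>, which \<open>orthant\<close> counts as the upper side, so this
        null set has to be left out.\<close>
      using AE_lborel_nth_neq[of 1]
    proof eventually_elim
      case (elim y)
      let ?Ty = "cell_embedding S x y"
      have "?Ty \<in> cbox 0 1 \<and> orthant x ?Ty = S \<longleftrightarrow> y \<in> cbox 0 1"
      proof -
        have "?Ty \<in> cbox 0 1 \<and> orthant x ?Ty = S \<longleftrightarrow>
          (\<forall>i. 0 \<le> ?Ty $ i \<and> ?Ty $ i \<le> 1 \<and> (x $ i \<le> ?Ty $ i \<longleftrightarrow> i \<in> S))"
          by (auto simp: orthant_def mem_box_cart set_eq_iff)
        also have "\<dots> \<longleftrightarrow> (\<forall>i. 0 \<le> y $ i \<and> y $ i \<le> 1)"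
        proof (rule all_cong1)
          fix i
          have "x $ i > 0" "x $ i < 1" "y $ i \<noteq> 1" using x elim by auto
          show "0 \<le> ?Ty $ i \<and> ?Ty $ i \<le> 1 \<and> (x $ i \<le> ?Ty $ i \<longleftrightarrow> i \<in> S) \<longleftrightarrow> 0 \<le> y $ i \<and> y $ i \<le> 1"
          proof (cases "i \<in> S")
            case True
            have "x $ i + (1 - x $ i) * y $ i \<le> 1 \<longleftrightarrow> (1 - x $ i) * y $ i \<le> (1 - x $ i) * 1"
              by (auto simp: algebra_simps)
            also have "\<dots> \<longleftrightarrow> y $ i \<le> 1" using \<open>x $ i < 1\<close> by (subst mult_le_cancel_left_pos) auto
            finally have 1: "x $ i + (1 - x $ i) * y $ i \<le> 1 \<longleftrightarrow> y $ i \<le> 1" .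
            have 2: "0 \<le> (1 - x $ i) * y $ i \<longleftrightarrow> 0 \<le> y $ i"
              using \<open>x $ i < 1\<close> by (simp add: zero_le_mult_iff)
            from True 1 2 \<open>x $ i > 0\<close> show ?thesis
              by (auto simp: cell_embedding_def)
          next
            case False
            have 1: "0 \<le> x $ i * y $ i \<longleftrightarrow> 0 \<le> y $ i"
              using \<open>x $ i > 0\<close> by (simp add: zero_le_mult_iff)
            have "x $ i \<le> x $ i * y $ i \<longleftrightarrow> x $ i * 1 \<le> x $ i * y $ i" by simp
            also have "\<dots> \<longleftrightarrow> 1 \<le> y $ i" using \<open>x $ i > 0\<close> by (subst mult_le_cancel_left_pos) auto
            finally have 2: "x $ i \<le> x $ i * y $ i \<longleftrightarrow> 1 \<le> y $ i" .
            from False 1 2 \<open>y $ i \<noteq> 1\<close> \<open>x $ i < 1\<close> show ?thesis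
              by (auto simp: cell_embedding_def)
          qed
        qed
        also have "\<dots> \<longleftrightarrow> y \<in> cbox 0 1" by (auto simp: mem_box_cart)
        finally show ?thesis .
      qed
      then show ?case by (auto simp: indicator_def)
    qed
  qed (use \<phi> A mT in measurable)
  also have "\<dots> = (\<integral>y. \<phi> (cell_embedding S x y) \<partial>cube)"
    using \<phi> mT by (intro integral_cube[symmetric]) auto
  finally show "(\<integral>y. indicator ?A y * \<phi> y \<partial>cube) = cell_volume S x * (\<integral>y. \<phi> (cell_embedding S x y) \<partial>cube)" .
qed

lemma quad_tree_levels_map:
  assumes "\<And>x y. orthant (T x) (T y) = orthant x y"
  shows "nodes_at_level k (quad_tree_of (map T xs)) = nodes_at_level k (quad_tree_of xs)"
proof (induction k arbitrary: xs)
  case 0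
  then show ?case by (cases xs) auto
next
  case (Suc k)
  then show ?case
    by (cases xs) (auto simp: filter_map comp_def assms)
qed

lemma orthant_cell_embedding:
  assumes "\<And>i. 0 < x $ i" "\<And>i. x $ i < 1"
  shows "orthant (cell_embedding S x y) (cell_embedding S x y') = orthant y y'"
proof -
  have "cell_embedding S x y $ i \<le> cell_embedding S x y' $ i \<longleftrightarrow> y $ i \<le> y' $ i" for i
    using assms[of i] by (auto simp: cell_embedding_def mult_le_cancel_left_pos)
  then show ?thesis by (simp add: orthant_def)
qed

lemma AE_cube_interior: "AE x in cube :: (real ^ 'd) measure. \<forall>i. 0 < x $ i \<and> x $ i < 1"
proof (rule AE_uniform_measureI)
  show "AE x\<in>cbox 0 1 in lborel. \<forall>i. 0 < x $ i \<and> x $ i < (1 :: real)"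
    using AE_lborel_nth_neq[of 0] AE_lborel_nth_neq[of 1]
    by eventually_elim (auto simp: mem_box_cart less_le)
qed auto

section \<open>The Cesaro operator and the law of the size of a subtree\<close>

definition cesaro :: "(nat \<Rightarrow> 'a :: real_normed_field) \<Rightarrow> nat \<Rightarrow> 'a" where
  "cesaro g m = (\<Sum>j\<le>m. g j) / (of_nat m + 1)"

lemma cesaro_cong: "(\<And>j. j \<le> m \<Longrightarrow> g j = h j) \<Longrightarrow> cesaro g m = cesaro h m"
  by (auto simp: cesaro_def intro!: sum.cong)

lemma funpow_cesaro_cong: "(\<And>j. j \<le> m \<Longrightarrow> g j = h j) \<Longrightarrow> (cesaro ^^ p) g m = (cesaro ^^ p) h m"
  by (induction p arbitrary: m) (auto intro!: cesaro_cong)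

lemma cesaro_linear: "cesaro (\<lambda>m. \<Sum>k\<in>K. c k * h k m) m = (\<Sum>k\<in>K. c k * cesaro (h k) m)"
proof -
  have "(\<Sum>j\<le>m. \<Sum>k\<in>K. c k * h k j) = (\<Sum>k\<in>K. c k * (\<Sum>j\<le>m. h k j))"
    by (subst sum.swap) (simp add: sum_distrib_left)
  then show ?thesis by (simp add: cesaro_def sum_divide_distrib[symmetric])
qed

lemma funpow_cesaro_linear:
  "(cesaro ^^ p) (\<lambda>j. \<Sum>k\<in>K. c k * g k j) m = (\<Sum>k\<in>K. c k * (cesaro ^^ p) (g k) m)"
proof (induction p arbitrary: m)
  case (Suc p)
  have "(cesaro ^^ p) (\<lambda>j. \<Sum>k\<in>K. c k * g k j) = (\<lambda>m. \<Sum>k\<in>K. c k * (cesaro ^^ p) (g k) m)"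
    using Suc by blast
  then show ?case by (simp add: cesaro_linear)
qed simp

text \<open>By the hockey-stick identity, \<open>j choose k\<close> is an eigenvector of the Cesaro
  operator with eigenvalue \<open>1 / (k + 1)\<close>.\<close>

lemma cesaro_choose: "cesaro (\<lambda>j. c * real (j choose k)) m = c / (real k + 1) * real (m choose k)"
proof -
  have "(\<Sum>j\<le>m. j choose k) = Suc m choose Suc k"
    by (rule sum_choose_upper)
  then have "(\<Sum>j\<le>m. real (j choose k)) = real (Suc m choose Suc k)"
    by (metis of_nat_sum)
  moreover have "(real k + 1) * real (Suc m choose Suc k) = (real m + 1) * real (m choose k)"
    using arg_cong[OF Suc_times_binomial_eq[of m k], of real]
    by (simp add: algebra_simps del: binomial_Suc_Suc)
  ultimately have *: "(real k + 1) * (\<Sum>j\<le>m. real (j choose k)) = (real m + 1) * real (m choose k)"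
    by simp
  have "(\<Sum>j\<le>m. real (j choose k)) = (real m + 1) * real (m choose k) / (real k + 1)"
    unfolding *[symmetric] by simp
  then show ?thesis
    by (simp add: cesaro_def sum_distrib_left[symmetric])
qed

lemma funpow_cesaro_choose:
  "(cesaro ^^ p) (\<lambda>j. real (j choose k)) m = real (m choose k) / (real k + 1) ^ p"
proof (induction p arbitrary: m)
  case (Suc p)
  have "(cesaro ^^ p) (\<lambda>j. real (j choose k)) = (\<lambda>m. (1 / (real k + 1) ^ p) * real (m choose k))"
    using Suc by auto
  then show ?case using cesaro_choose[of "1 / (real k + 1) ^ p" k m] by simp
qed simp

lemma binomial_mix_cong: "(\<And>j. j \<le> m \<Longrightarrow> g j = h j) \<Longrightarrow> binomial_mix a m g = binomial_mix a m h"
proof (induction m arbitrary: g h)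
  case (Suc m)
  have "binomial_mix a m (\<lambda>j. g (Suc j)) = binomial_mix a m (\<lambda>j. h (Suc j))" "binomial_mix a m g = binomial_mix a m h"
    using Suc.prems by (intro Suc.IH; simp)+
  then show ?case by simp
qed simp

lemma binomial_mix_linear:
  "binomial_mix a m (\<lambda>j. \<Sum>k\<in>K. c k * g k j) = (\<Sum>k\<in>K. c k * binomial_mix a m (g k))"
proof (induction m arbitrary: g)
  case (Suc m)
  show ?case
    using Suc[of "\<lambda>k j. g k (Suc j)"] Suc[of g]
    by (simp add: sum_distrib_left sum.distrib distrib_left mult.left_commute)
qed simp

lemma binomial_mix_add:
  "binomial_mix a m (\<lambda>j. g j + h j) = binomial_mix a m g + binomial_mix a m h"
  by (induction m arbitrary: g h) (auto simp: algebra_simps)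

text \<open>These are the factorial moments of the binomial distribution, divided by the factorial
  of \<open>k\<close>; Pascal's rule carries the induction.\<close>

lemma binomial_mix_choose: "binomial_mix a m (\<lambda>j. real (j choose k)) = a ^ k * real (m choose k)"
proof (induction m arbitrary: k)
  case 0
  then show ?case by (cases k) auto
next
  case (Suc m)
  show ?case
  proof (cases k)
    case 0
    have "binomial_mix a m (\<lambda>j. 1) = 1" for m by (induction m) auto
    with 0 show ?thesis by simp
  next
    case (Suc k')
    with \<open>\<And>k. binomial_mix a m (\<lambda>j. real (j choose k)) = a ^ k * real (m choose k)\<close>
    show ?thesis by (simp add: binomial_mix_add algebra_simps)
  qed
qed

text \<open>Newton interpolation: \<open>j choose Suc m\<close> vanishes for
  \<open>j \<le> m\<close> and equals 1 at \<open>Suc m\<close>, so one new coefficient corrects the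
  value there without disturbing the others.\<close>

lemma newton_expansion:
  fixes g :: "nat \<Rightarrow> real"
  shows "\<exists>c. \<forall>j\<le>m. g j = (\<Sum>k\<le>m. c k * real (j choose k))"
proof (induction m)
  case 0
  show ?case by (rule exI[of _ "\<lambda>_. g 0"]) simp
next
  case (Suc m)
  then obtain c where c: "\<forall>j\<le>m. g j = (\<Sum>k\<le>m. c k * real (j choose k))" by auto
  define c' where "c' = c(Suc m := g (Suc m) - (\<Sum>k\<le>m. c k * real (Suc m choose k)))"
  have eq: "(\<Sum>k\<le>m. c' k * real (j choose k)) = (\<Sum>k\<le>m. c k * real (j choose k))" for j
    by (intro sum.cong) (auto simp: c'_def)
  have "g j = (\<Sum>k\<le>Suc m. c' k * real (j choose k))" if "j \<le> Suc m" for j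
  proof (cases "j = Suc m")
    case True
    then show ?thesis by (simp add: eq del: binomial_Suc_Suc) (simp add: c'_def)
  next
    case False
    then show ?thesis using c that by (simp add: eq)
  qed
  then show ?case by blast
qed

text \<open>The integrand factors over the coordinates, and both \<open>t ^ k\<close> and
  \<open>(1 - t) ^ k\<close> integrate to \<open>1 / (k + 1)\<close> over the unit interval. The
  result is thus the same for all cells \<open>S\<close>, although for a given \<open>x\<close>
  their volumes differ.\<close>

lemma integral_cell_volume_power:
  "(\<integral>x. cell_volume S x ^ k \<partial>(cube :: (real ^ 'd) measure)) = 1 / (real k + 1) ^ CARD('d)"
  and integrable_cell_volume_power: "integrable (cube :: (real ^ 'd) measure) (\<lambda>x. cell_volume S x ^ k)"
proof -
  define f :: "real ^ 'd \<Rightarrow> real \<Rightarrow> real" where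
    "f b t = indicator {0..1} t * (if b \<in> (\<lambda>i. axis i 1) ` S then 1 - t else t) ^ k" for b t
  have f0: "f b t \<ge> 0" for b t by (auto simp: f_def indicator_def)
  have fm [measurable]: "f b \<in> borel_measurable borel" for b unfolding f_def by measurable
  have B: "Basis = (\<lambda>i. axis i (1 :: real)) ` (UNIV :: 'd set)" by (auto simp: Basis_vec_def)
  have inj: "inj (\<lambda>i :: 'd. axis i (1 :: real))" by (auto simp: inj_on_def axis_eq_axis)
  have vm: "(\<lambda>x :: real ^ 'd. cell_volume S x) \<in> borel_measurable borel"
  proof -
    have "(\<lambda>x :: real ^ 'd. if i \<in> S then 1 - x $ i else x $ i) \<in> borel_measurable borel" for i
      by (cases "i \<in> S") simp_all
    then show ?thesis unfolding cell_volume_def by (rule borel_measurable_prod)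
  qed
  have prod: "indicator (cbox 0 1) x * cell_volume S x ^ k = (\<Prod>b\<in>Basis. f b (x \<bullet> b))" for x :: "real ^ 'd"
  proof -
    have "axis i (1::real) \<in> (\<lambda>i. axis i 1) ` S \<longleftrightarrow> i \<in> S" for i using inj by (auto simp: inj_on_def)
    then have "(\<Prod>b\<in>Basis. f b (x \<bullet> b)) = (\<Prod>i\<in>UNIV. indicator {0..1} (x $ i) * (if i \<in> S then 1 - x $ i else x $ i) ^ k)"
      unfolding B by (subst prod.reindex[OF inj]) (simp add: f_def inner_axis cong: if_cong)
    also have "\<dots> = (\<Prod>i\<in>UNIV. indicator {0..1} (x $ i)) * cell_volume S x ^ k"
      by (simp add: prod.distrib cell_volume_def prod_power_distrib)
    also have "(\<Prod>i\<in>UNIV. indicator {0..1} (x $ i)) = (indicator (cbox 0 1) x :: real)"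
      by (auto simp: indicator_def mem_box_cart prod_zero_iff)
    finally show ?thesis ..
  qed
  have one: "(\<integral>\<^sup>+t. f b t \<partial>lborel) = ennreal (1 / (real k + 1))" for b
  proof (cases "b \<in> (\<lambda>i. axis i 1) ` S")
    case True
    have "((\<lambda>t. - ((1 - t) ^ Suc k / (real k + 1))) has_real_derivative (1 - t) ^ k) (at t)" for t :: real
    proof -
      have "((\<lambda>t. - ((1 - t) ^ Suc k / (real k + 1))) has_real_derivative
          - ((1 + real k) * (1 - t) ^ k * - 1 / (real k + 1))) (at t)"
        by (auto intro!: derivative_eq_intros simp del: power_Suc)
      then show ?thesis by (simp add: add.commute)
    qed
    then have "(\<integral>\<^sup>+t. ennreal ((1 - t) ^ k) * indicator {0..1} t \<partial>lborel)
       = ennreal (- ((1 - 1) ^ Suc k / (real k + 1)) - (- ((1 - 0) ^ Suc k / (real k + 1))))"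
      by (intro nn_integral_FTC_Icc) auto
    then show ?thesis
      by (subst nn_integral_cong[of _ _ "\<lambda>t. ennreal ((1 - t) ^ k) * indicator {0..1} t"])
        (use True in \<open>auto simp: f_def indicator_def\<close>)
  next
    case False
    have "((\<lambda>t. (t ^ Suc k / (real k + 1))) has_real_derivative t ^ k) (at t)" for t :: real
    proof -
      have "((\<lambda>t. t ^ Suc k / (real k + 1)) has_real_derivative (1 + real k) * t ^ k / (real k + 1)) (at t)"
        by (auto intro!: derivative_eq_intros simp del: power_Suc)
      then show ?thesis by (simp add: add.commute)
    qed
    then have "(\<integral>\<^sup>+t. ennreal (t ^ k) * indicator {0..1} t \<partial>lborel)
       = ennreal ((1 ^ Suc k / (real k + 1)) - ((0 ^ Suc k / (real k + 1))))"
      by (intro nn_integral_FTC_Icc) auto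
    then show ?thesis
      by (subst nn_integral_cong[of _ _ "\<lambda>t. ennreal (t ^ k) * indicator {0..1} t"])
        (use False in \<open>auto simp: f_def indicator_def\<close>)
  qed
  have "(\<integral>\<^sup>+x. ennreal (indicator (cbox 0 1) x * cell_volume S x ^ k) \<partial>(lborel :: (real ^ 'd) measure))
     = (\<integral>\<^sup>+x. (\<Prod>b\<in>Basis. ennreal (f b (x \<bullet> b))) \<partial>lborel)"
    unfolding prod using f0 by (simp add: prod_ennreal)
  also have "\<dots> = (\<Prod>b\<in>(Basis :: (real ^ 'd) set). (\<integral>\<^sup>+t. ennreal (f b t) \<partial>lborel))"
    by (rule nn_integral_lborel_prod) auto
  also have "\<dots> = ennreal (1 / (real k + 1) ^ CARD('d))"
    unfolding one by (simp add: ennreal_power power_divide)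
  finally have nn: "(\<integral>\<^sup>+x. ennreal (indicator (cbox 0 1) x * cell_volume S x ^ k) \<partial>(lborel :: (real ^ 'd) measure))
    = ennreal (1 / (real k + 1) ^ CARD('d))" .
  have nneg: "0 \<le> indicator (cbox 0 1) x * cell_volume S x ^ k" for x :: "real ^ 'd"
    unfolding prod by (intro prod_nonneg f0)
  show "(\<integral>x. cell_volume S x ^ k \<partial>(cube :: (real ^ 'd) measure)) = 1 / (real k + 1) ^ CARD('d)"
    using vm nn nneg by (subst integral_cube) (auto intro!: integral_eq_nn_integral[THEN trans])
  have "bounded ((\<lambda>x :: real ^ 'd. cell_volume S x ^ k) ` cbox 0 1)"
  proof (intro compact_imp_bounded compact_continuous_image compact_cbox)
    have "continuous_on (cbox 0 1) (\<lambda>x :: real ^ 'd. if i \<in> S then 1 - x $ i else x $ i)" for i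
      by (cases "i \<in> S") (auto intro!: continuous_intros)
    then show "continuous_on (cbox 0 1) (\<lambda>x :: real ^ 'd. cell_volume S x ^ k)"
      unfolding cell_volume_def by (intro continuous_intros)
  qed
  then obtain C where C: "\<And>x :: real ^ 'd. x \<in> cbox 0 1 \<Longrightarrow> \<bar>cell_volume S x ^ k\<bar> \<le> C"
    by (auto simp: bounded_iff)
  interpret prob_space "cube :: (real ^ 'd) measure" by (rule prob_space_cube)
  have "AE x in (cube :: (real ^ 'd) measure). x \<in> cbox 0 1"
    by (rule AE_uniform_measureI) auto
  then show "integrable (cube :: (real ^ 'd) measure) (\<lambda>x. cell_volume S x ^ k)"
    using vm C by (intro integrable_const_bound[of _ C]) auto
qed

text \<open>Both sides are linear in \<open>g\<close>, so they are compared on the Newton basis.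
  There the binomial mean is the \<open>k\<close>-th power of \<open>cell_volume\<close> times
  \<open>m choose k\<close>, and the average of that power over \<open>x\<close> is precisely the
  eigenvalue of the iterated Cesaro operator. Averaged over the root, the size of a subtree thus
  arises by one uniform splitting per coordinate.\<close>

lemma integral_binomial_mix:
  "(\<integral>x. binomial_mix (cell_volume S x) m g \<partial>(cube :: (real ^ 'd) measure)) = (cesaro ^^ CARD('d)) g m" (is ?A)
  and integrable_binomial_mix: "integrable (cube :: (real ^ 'd) measure) (\<lambda>x. binomial_mix (cell_volume S x) m g)" (is ?B)
proof -
  obtain c where c: "\<forall>j\<le>m. g j = (\<Sum>k\<le>m. c k * real (j choose k))"
    using newton_expansion by blast
  have eq: "binomial_mix a m g = (\<Sum>k\<le>m. c k * (a ^ k * real (m choose k)))" for a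
    using c binomial_mix_cong[of m g "\<lambda>j. \<Sum>k\<le>m. c k * real (j choose k)"]
    by (simp add: binomial_mix_linear binomial_mix_choose)
  have "(cesaro ^^ CARD('d)) g m = (\<Sum>k\<le>m. c k * (real (m choose k) / (real k + 1) ^ CARD('d)))"
    using c funpow_cesaro_cong[of m g "\<lambda>j. \<Sum>k\<le>m. c k * real (j choose k)"]
    by (simp add: funpow_cesaro_linear funpow_cesaro_choose)
  then show ?A
    unfolding eq using integrable_cell_volume_power
    by (subst Bochner_Integration.integral_sum) (auto simp: integral_cell_volume_power)
  show ?B
    unfolding eq
    by (intro Bochner_Integration.integrable_sum integrable_mult_right integrable_mult_left integrable_cell_volume_power)
qed

lemma sum_length_filter:
  fixes h :: "'b \<Rightarrow> 'c :: finite"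
  shows "(\<Sum>S\<in>UNIV. length (filter (\<lambda>y. h y = S) xs)) = length xs"
proof (induction xs)
  case (Cons x xs)
  have "(\<Sum>S\<in>UNIV. length (filter (\<lambda>y. h y = S) (x # xs)))
     = (\<Sum>S\<in>UNIV. (if S = h x then 1 else 0) + length (filter (\<lambda>y. h y = S) xs))"
    by (intro sum.cong) auto
  then show ?case using Cons by (simp add: sum.distrib)
qed simp

section \<open>The level polynomial and the recursion at the root\<close>

definition level_poly :: "complex \<Rightarrow> (real ^ 'd) list \<Rightarrow> complex" where
  "level_poly z xs = (\<Sum>k<length xs. of_nat (nodes_at_level k (quad_tree_of xs)) * z ^ k)"

lemma level_poly_eq:
  assumes "length xs \<le> N"
  shows "level_poly z xs = (\<Sum>k<N. of_nat (nodes_at_level k (quad_tree_of xs)) * z ^ k)"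
  unfolding level_poly_def
  using assms by (intro sum.mono_neutral_left) (auto simp: nodes_at_level_eq_0)

lemma level_poly_Nil [simp]: "level_poly z [] = 0"
  by (simp add: level_poly_def)

lemma level_poly_Cons:
  "level_poly z (x # xs) = 1 + z * (\<Sum>S\<in>UNIV. level_poly z (filter (\<lambda>y. orthant x y = S) xs))"
proof -
  let ?n = "length xs"
  have "level_poly z (x # xs) = (\<Sum>k<Suc ?n. of_nat (nodes_at_level k (quad_tree_of (x # xs))) * z ^ k)"
    by (simp add: level_poly_def)
  also have "\<dots> = 1 + (\<Sum>k<?n. \<Sum>S\<in>UNIV. of_nat (nodes_at_level k (quad_tree_of (filter (\<lambda>y. orthant x y = S) xs))) * z ^ Suc k)"
    by (subst sum.lessThan_Suc_shift) (simp add: sum_distrib_right)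
  also have "(\<Sum>k<?n. \<Sum>S\<in>UNIV. of_nat (nodes_at_level k (quad_tree_of (filter (\<lambda>y. orthant x y = S) xs))) * z ^ Suc k)
     = z * (\<Sum>S\<in>UNIV. level_poly z (filter (\<lambda>y. orthant x y = S) xs))"
    by (subst sum.swap) (simp add: sum_distrib_left level_poly_eq[of _ ?n] mult_ac)
  finally show ?thesis .
qed

text \<open>At \<open>z = 1\<close> the recursion \<open>level_poly_Cons\<close> counts the root and
  then the points passed on to the subtrees.\<close>

lemma sum_nodes_at_level: "(\<Sum>k<length xs. nodes_at_level k (quad_tree_of xs)) = length xs"
proof -
  have "level_poly 1 xs = of_nat (length xs)"
  proof (induction xs rule: measure_induct_rule[of length])
    case (less xs)
    show ?case
    proof (cases xs)
      case (Cons x ys)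
      have "length (filter P ys) < length xs" for P
        using Cons by (simp add: le_imp_less_Suc)
      then have "level_poly 1 xs = 1 + (\<Sum>S\<in>UNIV. of_nat (length (filter (\<lambda>y. orthant x y = S) ys)))"
        using less unfolding Cons level_poly_Cons by simp
      also have "\<dots> = of_nat (length xs)"
        unfolding of_nat_sum[symmetric] sum_length_filter Cons by simp
      finally show ?thesis .
    qed simp
  qed
  then have "(of_nat (\<Sum>k<length xs. nodes_at_level k (quad_tree_of xs)) :: complex) = of_nat (length xs)"
    by (simp add: level_poly_def)
  then show ?thesis using of_nat_eq_iff by blast
qed

lemma nodes_at_level_le: "nodes_at_level k (quad_tree_of xs) \<le> length xs"
proof (cases "k < length xs")
  case True
  then have "nodes_at_level k (quad_tree_of xs) \<le> (\<Sum>k<length xs. nodes_at_level k (quad_tree_of xs))"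
    by (intro member_le_sum) auto
  then show ?thesis by (simp add: sum_nodes_at_level)
qed (simp add: nodes_at_level_eq_0)

text \<open>The value 0 at the empty list is chosen so that \<open>nodes_at_level_Suc_eq\<close>
  also holds for the empty tree.\<close>

definition subtree_functional :: "'d set \<Rightarrow> ((real ^ 'd) list \<Rightarrow> real) \<Rightarrow> (real ^ 'd) list \<Rightarrow> real" where
  "subtree_functional S F xs = (case xs of [] \<Rightarrow> 0 | x # ys \<Rightarrow> F (filter (\<lambda>y. orthant x y = S) ys))"

lemma list_measurable_subtree:
  fixes F :: "(real ^ 'd) list \<Rightarrow> real"
  assumes "list_measurable F"
  shows "list_measurable (subtree_functional S F)"
proof (rule list_measurableI)
  fix n
  have p: "Measurable.pred (PiM UNIV (\<lambda>_::nat. borel :: (real ^ 'd) measure)) (\<lambda>f. orthant (f 0) (f i) = S)" for i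
  proof -
    have "Measurable.pred (PiM UNIV (\<lambda>_::nat. borel :: (real ^ 'd) measure)) (\<lambda>f. \<forall>j\<in>UNIV. (f 0 $ j \<le> f i $ j) = (j \<in> S))"
    proof (intro pred_intros_finite pred_intros_logic)
      have m: "(\<lambda>f. f k $ j) \<in> borel_measurable (PiM UNIV (\<lambda>_::nat. borel :: (real ^ 'd) measure))" for k j
        by (rule measurable_compose[OF measurable_component_singleton, where g = "\<lambda>v. v $ j"]) auto
      show "Measurable.pred (PiM UNIV (\<lambda>_::nat. borel :: (real ^ 'd) measure)) (\<lambda>f. f 0 $ j \<le> f i $ j)" for j
        unfolding pred_def by (rule borel_measurable_le[OF m m])
    qed auto
    then show ?thesis by (simp add: orthant_def set_eq_iff)
  qed
  show "(\<lambda>f. subtree_functional S F (map f [0..<n])) \<in> borel_measurable (PiM UNIV (\<lambda>_::nat. borel))"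
  proof (cases n)
    case (Suc m)
    have "subtree_functional S F (map f [0..<n]) = F (map f ([] @ filter (\<lambda>i. orthant (f 0) (f i) = S) [1..<Suc m]))" for f
      unfolding Suc by (simp add: subtree_functional_def upt_conv_Cons filter_map comp_def del: upt_Suc)
    then show ?thesis using list_measurable_filter_index[OF assms, OF p, of "[]"] by simp
  qed (simp add: subtree_functional_def)
  obtain B where B: "B \<ge> 0" "\<And>xs. length xs \<le> n \<Longrightarrow> \<bar>F xs\<bar> \<le> B"
    using list_measurable_bounded[OF assms] by metis
  show "\<exists>B. \<forall>xs. length xs \<le> n \<longrightarrow> \<bar>subtree_functional S F xs\<bar> \<le> B"
  proof (intro exI[of _ B] allI impI)
    fix xs :: "(real ^ 'd) list" assume "length xs \<le> n"
    then show "\<bar>subtree_functional S F xs\<bar> \<le> B"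
      using B length_filter_le[of _ "tl xs"]
      by (cases xs) (auto simp: subtree_functional_def intro!: B(2) order_trans[OF length_filter_le])
  qed
qed

lemma nodes_at_level_Suc_eq:
  "real (nodes_at_level (Suc k) (quad_tree_of xs))
     = (\<Sum>S\<in>UNIV. subtree_functional S (\<lambda>xs. real (nodes_at_level k (quad_tree_of xs))) xs)"
  by (cases xs) (auto simp: subtree_functional_def)

lemma list_measurable_nodes_at_level:
  "list_measurable (\<lambda>xs :: (real ^ 'd) list. real (nodes_at_level k (quad_tree_of xs)))"
proof (induction k)
  case 0
  have "nodes_at_level 0 (quad_tree_of xs) = (if length xs = 0 then 0 else 1)" for xs :: "(real ^ 'd) list"
    by (cases xs) auto
  then show ?case by (intro list_measurableI) (auto intro!: exI[of _ 1])
next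
  case (Suc k)
  show ?case
    unfolding nodes_at_level_Suc_eq using list_measurable_sum[of UNIV "\<lambda>S. subtree_functional S (\<lambda>xs. real (nodes_at_level k (quad_tree_of xs)))",
        OF finite list_measurable_subtree[OF Suc]] by simp
qed

lemma list_measurable_sum_length:
  fixes G :: "nat \<Rightarrow> (real ^ 'd) list \<Rightarrow> real"
  assumes "\<And>k. list_measurable (G k)"
  shows "list_measurable (\<lambda>xs. \<Sum>k<length xs. G k xs)"
proof (rule list_measurableI)
  fix n
  show "(\<lambda>f. \<Sum>k<length (map f [0..<n]). G k (map f [0..<n])) \<in> borel_measurable (PiM UNIV (\<lambda>_::nat. borel))"
    using list_measurableD[OF assms] by simp
  have "\<exists>B. \<forall>xs. length xs \<le> n \<longrightarrow> \<bar>G k xs\<bar> \<le> B" for k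
    using assms[of k] by (simp add: list_measurable_def)
  then obtain B where B: "\<And>k xs. length xs \<le> n \<Longrightarrow> \<bar>G k xs\<bar> \<le> B k" by metis
  have "\<bar>\<Sum>k<length xs. G k xs\<bar> \<le> (\<Sum>k<n. B k)" if "length xs \<le> n" for xs
  proof -
    have B0: "0 \<le> B k" for k using B[OF that, of k] by linarith
    have "\<bar>\<Sum>k<length xs. G k xs\<bar> \<le> (\<Sum>k<length xs. B k)"
      using B[OF that] by (intro order_trans[OF sum_abs] sum_mono)
    also have "\<dots> \<le> (\<Sum>k<n. B k)"
      using that B0 by (intro sum_mono2) auto
    finally show ?thesis .
  qed
  then show "\<exists>B. \<forall>xs. length xs \<le> n \<longrightarrow> \<bar>\<Sum>k<length xs. G k xs\<bar> \<le> B" by blast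
qed

text \<open>The maps \<open>T\<close> preserve the coordinatewise order of all pairs of points, as
  the affine maps onto the cells do. Invariance lets a functional of the points in a cell be
  evaluated as if these points were uniform in the cube.\<close>

definition tree_invariant :: "((real ^ 'd) list \<Rightarrow> real) \<Rightarrow> bool" where
  "tree_invariant F \<longleftrightarrow> (\<forall>T xs. (\<forall>x y. orthant (T x) (T y) = orthant x y) \<longrightarrow> F (map T xs) = F xs)"

lemma tree_invariant_cell_embedding:
  assumes "tree_invariant F" "\<And>i. 0 < x $ i" "\<And>i. x $ i < 1"
  shows "F (map (cell_embedding S x) xs) = F xs"
  using assms orthant_cell_embedding unfolding tree_invariant_def by blast

lemma level_poly_map:
  assumes "\<And>x y. orthant (T x) (T y) = orthant x y"
  shows "level_poly z (map T xs) = level_poly z xs"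
  unfolding level_poly_def using quad_tree_levels_map[of T, OF assms] by simp

lemma tree_invariant_level_poly: "tree_invariant (\<lambda>xs. h (level_poly z xs))"
  unfolding tree_invariant_def using level_poly_map by metis

lemma list_measurable_linear_levels:
  "list_measurable (\<lambda>xs :: (real ^ 'd) list. \<Sum>k<length xs. c k * real (nodes_at_level k (quad_tree_of xs)))"
  by (intro list_measurable_sum_length list_measurable_mult list_measurable_const list_measurable_nodes_at_level)

lemma Re_level_poly: "Re (level_poly z xs) = (\<Sum>k<length xs. Re (z ^ k) * real (nodes_at_level k (quad_tree_of xs)))"
  by (simp add: level_poly_def mult.commute)

lemma Im_level_poly: "Im (level_poly z xs) = (\<Sum>k<length xs. Im (z ^ k) * real (nodes_at_level k (quad_tree_of xs)))"
  by (simp add: level_poly_def mult.commute)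

lemma list_measurable_Re_level_poly: "list_measurable (\<lambda>xs. Re (level_poly z xs))"
  unfolding Re_level_poly by (rule list_measurable_linear_levels)

lemma list_measurable_Im_level_poly: "list_measurable (\<lambda>xs. Im (level_poly z xs))"
  unfolding Im_level_poly by (rule list_measurable_linear_levels)

lemma list_measurable_norm_level_poly: "list_measurable (\<lambda>xs. cmod (level_poly z xs) ^ s)"
proof -
  have "list_measurable (\<lambda>xs. sqrt (Re (level_poly z xs) * Re (level_poly z xs) + Im (level_poly z xs) * Im (level_poly z xs)) ^ s)"
    by (rule list_measurable_continuous[of _ "\<lambda>x. sqrt x ^ s"])
      (intro list_measurable_add list_measurable_mult list_measurable_Re_level_poly list_measurable_Im_level_poly continuous_intros)+
  then show ?thesis by (simp add: cmod_def power2_eq_square)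
qed

lemma integrable_list_mean_Cons:
  fixes G :: "(real ^ 'd) list \<Rightarrow> real"
  assumes "list_measurable G"
  shows "integrable cube (\<lambda>x. list_mean m (\<lambda>xs. G (x # xs)))"
proof -
  obtain B where "\<And>xs. length xs \<le> Suc m \<Longrightarrow> \<bar>G xs\<bar> \<le> B"
    using list_measurable_bounded[OF assms] by metis
  then show ?thesis
    by (intro integrable_cube_bounded[of _ B] list_mean_Cons_measurable assms list_mean_bound) auto
qed

text \<open>Conditioned on the root \<open>x\<close>, the number of points in the cell
  \<open>S\<close> is binomial with parameter \<open>cell_volume S x\<close>, and given this number
  the points are an affine image of a uniform sample. The average over \<open>x\<close> is
  \<open>integral_binomial_mix\<close>.\<close>

lemma list_mean_subtree:
  fixes F :: "(real ^ 'd) list \<Rightarrow> real"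
  assumes F: "list_measurable F" "tree_invariant F"
  shows "list_mean (Suc m) (subtree_functional S F) = (cesaro ^^ CARD('d)) (\<lambda>j. list_mean j F) m"
proof -
  have "list_mean (Suc m) (subtree_functional S F)
      = (\<integral>x. list_mean m (\<lambda>xs. subtree_functional S F (x # xs)) \<partial>cube)"
    by (intro list_mean_Suc list_measurable_subtree F)
  also have "\<dots> = (\<integral>x. binomial_mix (cell_volume S x) m (\<lambda>j. list_mean j F) \<partial>cube)"
  proof (rule integral_cong_AE)
    show "(\<lambda>x. list_mean m (\<lambda>xs. subtree_functional S F (x # xs))) \<in> borel_measurable cube"
      using integrable_list_mean_Cons[OF list_measurable_subtree[OF F(1)]] by (rule borel_measurable_integrable)
    show "(\<lambda>x. binomial_mix (cell_volume S x) m (\<lambda>j. list_mean j F)) \<in> borel_measurable cube"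
      using integrable_binomial_mix by (rule borel_measurable_integrable)
    show "AE x in cube. list_mean m (\<lambda>xs. subtree_functional S F (x # xs))
        = binomial_mix (cell_volume S x) m (\<lambda>j. list_mean j F)"
      using AE_cube_interior
    proof eventually_elim
      case (elim x)
      have A: "cell_map {y. orthant x y = S} (cell_embedding S x) (cell_volume S x)"
        using elim by (intro cell_map_orthant) auto
      \<comment> \<open>The lemma on two cells is applied with an empty second cell of mass
        0.\<close>
      have B: "cell_map {} (\<lambda>y :: real ^ 'd. y) 0" by (auto simp: cell_map_def)
      have "list_mean m (\<lambda>xs. F (filter (\<lambda>y. y \<in> {y. orthant x y = S}) xs) * 1)
        = two_cell_mix (cell_volume S x) 0 m (\<lambda>j k. list_mean j (\<lambda>xs. F (map (cell_embedding S x) xs)) * list_mean k (\<lambda>_ :: (real ^ 'd) list. 1))"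
        by (rule list_mean_two_cells[OF A B _ F(1), of "\<lambda>_. 1"]) (auto intro: list_measurable_const)
      then show ?case
        using elim by (simp add: subtree_functional_def tree_invariant_cell_embedding[OF F(2)] two_cell_mix_one)
    qed
  qed
  also have "\<dots> = (cesaro ^^ CARD('d)) (\<lambda>j. list_mean j F) m"
    by (rule integral_binomial_mix)
  finally show ?thesis .
qed

text \<open>Given the root and the sizes, two different subtrees are independent. The mean of the
  product is therefore an average, over the pair of sizes, of products of two means, and a bound
  that is uniform in the sizes survives the averaging. The joint law of the sizes does not have to
  be computed.\<close>

lemma list_mean_subtree_mult_le:
  fixes F H :: "(real ^ 'd) list \<Rightarrow> real"
  assumes F: "list_measurable F" "tree_invariant F" and H: "list_measurable H" "tree_invariant H"
    and "S \<noteq> S'" and le: "\<And>j k. j \<le> m \<Longrightarrow> k \<le> m \<Longrightarrow> list_mean j F * list_mean k H \<le> B"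
  shows "list_mean (Suc m) (\<lambda>xs. subtree_functional S F xs * subtree_functional S' H xs) \<le> B"
proof -
  interpret prob_space "cube :: (real ^ 'd) measure" by (rule prob_space_cube)
  let ?K = "\<lambda>xs. subtree_functional S F xs * subtree_functional S' H xs"
  have K: "list_measurable ?K" by (intro list_measurable_mult list_measurable_subtree F H)
  have "list_mean (Suc m) ?K = (\<integral>x. list_mean m (\<lambda>xs. ?K (x # xs)) \<partial>cube)"
    by (rule list_mean_Suc[OF K])
  also have "\<dots> \<le> (\<integral>x. B \<partial>(cube :: (real ^ 'd) measure))"
  proof (rule integral_mono_AE)
    show "AE x in cube. list_mean m (\<lambda>xs. ?K (x # xs)) \<le> B"
      using AE_cube_interior
    proof eventually_elim
      case (elim x)
      have A: "cell_map {y. orthant x y = S} (cell_embedding S x) (cell_volume S x)" for S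
        using elim by (intro cell_map_orthant) auto
      have AB: "{y. orthant x y = S} \<inter> {y. orthant x y = S'} = {}" using \<open>S \<noteq> S'\<close> by auto
      have "list_mean m (\<lambda>xs. ?K (x # xs)) = two_cell_mix (cell_volume S x) (cell_volume S' x) m
          (\<lambda>j k. list_mean j F * list_mean k H)"
        using list_mean_two_cells[OF A A AB F(1) H(1), of m] elim
        by (simp add: subtree_functional_def tree_invariant_cell_embedding[OF F(2)] tree_invariant_cell_embedding[OF H(2)])
      also have "\<dots> \<le> B"
        using cell_map_add_le_one[OF A A AB] cell_volume_pos[of x] elim le
        by (intro two_cell_mix_bound) (auto intro: less_imp_le)
      finally show ?case .
    qed
  qed (use integrable_list_mean_Cons[OF K] in auto)
  finally show ?thesis using prob_space by simp
qed

text \<open>The \<open>itself\<close> argument carries the dimension, which occurs in the type of no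
  other argument.\<close>

definition mean_level_poly :: "'d :: finite itself \<Rightarrow> complex \<Rightarrow> nat \<Rightarrow> complex" where
  "mean_level_poly _ z n = (\<Sum>k<n. of_real (list_mean n (\<lambda>xs :: (real ^ 'd) list. real (nodes_at_level k (quad_tree_of xs)))) * z ^ k)"

text \<open>By \<open>list_mean_subtree\<close> every cell contributes the same mean, whatever its
  position relative to the root; this produces the factor 2 for each coordinate.\<close>

lemma mean_level_poly_Suc:
  "mean_level_poly TYPE('d :: finite) z (Suc n)
    = 1 + 2 ^ CARD('d) * z * (cesaro ^^ CARD('d)) (mean_level_poly TYPE('d) z) n"
proof -
  define \<mu> where "\<mu> n k = list_mean n (\<lambda>xs :: (real ^ 'd) list. real (nodes_at_level k (quad_tree_of xs)))" for n k
  have f: "mean_level_poly TYPE('d) z n = (\<Sum>k<n. of_real (\<mu> n k) * z ^ k)" for n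
    by (simp add: mean_level_poly_def \<mu>_def)
  have \<mu>0: "\<mu> (Suc n) 0 = 1" for n
  proof -
    have "\<mu> (Suc n) 0 = list_mean (Suc n) (\<lambda>_ :: (real ^ 'd) list. 1)"
      unfolding \<mu>_def by (rule list_mean_cong) (auto simp: length_Suc_conv)
    then show ?thesis by simp
  qed
  have \<mu>_ge: "\<mu> n k = 0" if "n \<le> k" for n k
  proof -
    have "\<mu> n k = list_mean n (\<lambda>_ :: (real ^ 'd) list. 0)"
      unfolding \<mu>_def using that by (intro list_mean_cong) (auto simp: nodes_at_level_eq_0)
    then show ?thesis by simp
  qed
  have \<mu>_Suc: "\<mu> (Suc n) (Suc k) = 2 ^ CARD('d) * (cesaro ^^ CARD('d)) (\<lambda>j. \<mu> j k) n" for n k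
  proof -
    have inv: "tree_invariant (\<lambda>xs :: (real ^ 'd) list. real (nodes_at_level k (quad_tree_of xs)))"
      unfolding tree_invariant_def using quad_tree_levels_map by metis
    have "\<mu> (Suc n) (Suc k) = (\<Sum>S\<in>(UNIV :: 'd set set). (cesaro ^^ CARD('d)) (\<lambda>j. \<mu> j k) n)"
      unfolding \<mu>_def nodes_at_level_Suc_eq
      by (subst list_mean_sum)
        (auto intro!: list_measurable_subtree list_measurable_nodes_at_level
          simp: list_mean_subtree[OF list_measurable_nodes_at_level inv])
    then show ?thesis by (simp add: card_Pow flip: Pow_UNIV)
  qed
  have of_real_cesaro: "of_real ((cesaro ^^ p) g n) = (cesaro ^^ p) (\<lambda>j. of_real (g j) :: complex) n" for p g n
  proof (induction p arbitrary: n)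
    case (Suc p)
    have "(cesaro ^^ p) (\<lambda>j. of_real (g j) :: complex) = (\<lambda>n. of_real ((cesaro ^^ p) g n))"
      using Suc by auto
    moreover have "of_real (cesaro h n) = cesaro (\<lambda>j. of_real (h j) :: complex) n" for h
      by (simp add: cesaro_def)
    ultimately show ?case by simp
  qed simp
  have "mean_level_poly TYPE('d) z (Suc n) = 1 + (\<Sum>k<n. of_real (\<mu> (Suc n) (Suc k)) * z ^ Suc k)"
    unfolding f by (subst sum.lessThan_Suc_shift) (simp add: \<mu>0)
  also have "(\<Sum>k<n. of_real (\<mu> (Suc n) (Suc k)) * z ^ Suc k)
     = 2 ^ CARD('d) * z * (\<Sum>k<n. z ^ k * (cesaro ^^ CARD('d)) (\<lambda>j. of_real (\<mu> j k)) n)"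
    by (simp add: \<mu>_Suc of_real_cesaro sum_distrib_left mult_ac)
  also have "(\<Sum>k<n. z ^ k * (cesaro ^^ CARD('d)) (\<lambda>j. of_real (\<mu> j k)) n)
     = (cesaro ^^ CARD('d)) (\<lambda>j. \<Sum>k<n. z ^ k * of_real (\<mu> j k)) n"
    by (rule funpow_cesaro_linear[symmetric])
  also have "\<dots> = (cesaro ^^ CARD('d)) (mean_level_poly TYPE('d) z) n"
  proof (rule funpow_cesaro_cong)
    fix j assume "j \<le> n"
    then show "(\<Sum>k<n. z ^ k * of_real (\<mu> j k)) = mean_level_poly TYPE('d) z j"
      unfolding f by (intro sum.mono_neutral_cong_right) (auto simp: \<mu>_ge)
  qed
  finally show ?thesis .
qed

lemma mean_level_poly_0 [simp]: "mean_level_poly TYPE('d::finite) z 0 = 0"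
  by (simp add: mean_level_poly_def)

lemma list_mean_linear_levels:
  "list_mean n (\<lambda>xs :: (real ^ 'd) list. \<Sum>k<length xs. c k * real (nodes_at_level k (quad_tree_of xs)))
    = (\<Sum>k<n. c k * list_mean n (\<lambda>xs :: (real ^ 'd) list. real (nodes_at_level k (quad_tree_of xs))))"
proof -
  have "list_mean n (\<lambda>xs :: (real ^ 'd) list. \<Sum>k<length xs. c k * real (nodes_at_level k (quad_tree_of xs)))
     = list_mean n (\<lambda>xs :: (real ^ 'd) list. \<Sum>k<n. c k * real (nodes_at_level k (quad_tree_of xs)))"
    by (rule list_mean_cong) simp
  also have "\<dots> = (\<Sum>k<n. list_mean n (\<lambda>xs :: (real ^ 'd) list. c k * real (nodes_at_level k (quad_tree_of xs))))"
    by (intro list_mean_sum list_measurable_mult list_measurable_const list_measurable_nodes_at_level)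
  finally show ?thesis by (simp add: list_mean_cmult)
qed

lemma list_mean_Re_level_poly:
  "list_mean n (\<lambda>xs :: (real ^ 'd) list. Re (level_poly z xs)) = Re (mean_level_poly TYPE('d) z n)"
  unfolding Re_level_poly list_mean_linear_levels mean_level_poly_def by (simp add: mult.commute)

lemma list_mean_Im_level_poly:
  "list_mean n (\<lambda>xs :: (real ^ 'd) list. Im (level_poly z xs)) = Im (mean_level_poly TYPE('d) z n)"
  unfolding Im_level_poly list_mean_linear_levels mean_level_poly_def by (simp add: mult.commute)

section \<open>Growth of the mean level polynomial\<close>

text \<open>A discrete Gronwall argument: up to summable relative errors the recursion multiplies by
  \<open>m / (m - \<alpha>)\<close>, and the product of these factors grows like
  \<open>m powr \<alpha>\<close>. The constant has to be uniform in \<open>N\<close> and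
  \<open>\<alpha>\<close>, so the values up to \<open>m0\<close> are controlled by the common
  majorant \<open>B\<close>. Since \<open>\<alpha> \<ge> 3/4\<close>, the inhomogeneity, which
  contributes order \<open>1 / m\<close> to \<open>N m\<close>, is of order
  \<open>m powr (-7/4)\<close> relative to \<open>m powr \<alpha>\<close>, which is
  summable.\<close>

lemma growth_from_recursion:
  fixes K :: real and B :: "nat \<Rightarrow> real"
  assumes "K \<ge> 0"
  shows "\<exists>C\<ge>0. \<forall>N \<alpha>. (\<forall>m. 0 \<le> N m \<and> N m \<le> B m) \<longrightarrow> N 0 = 0 \<longrightarrow> 3/4 \<le> \<alpha> \<longrightarrow> \<alpha> \<le> 3 \<longrightarrow>
     (\<forall>m\<ge>1. (real m - \<alpha>) * N m \<le> real m * N (m - 1) + K * (1 + (N m + N (m - 1)) / real m)) \<longrightarrow>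
     (\<forall>m. N m \<le> C * real m powr \<alpha>)"
proof -
  \<comment> \<open>\<open>K1\<close> makes \<open>x / 2\<close> times \<open>K1 / x^2\<close> equal
    to \<open>(5 K + 9) / x\<close>. This covers the loss \<open>(9 + 4 K) / x\<close> of
    \<open>q (1 + \<alpha> / x)\<close> against \<open>x\<close> and the extra \<open>K / x\<close>
    on the left of \<open>ratio\<close> below. \<open>K2\<close> adds the share of the
    inhomogeneity, and \<open>m0\<close> ensures that the corrections of order \<open>1 / x\<close>
    take away at most half of \<open>x\<close>.\<close>
  define K1 where "K1 = 2 * (5 * K + 9)"
  define K2 where "K2 = K1 + 2 * K"
  define m0 where "m0 = nat \<lceil>8 + 4 * K\<rceil> + 1"
  have m0: "real m0 \<ge> 8 + 4 * K" "m0 \<ge> 1" unfolding m0_def by linarith+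
  have K12: "K1 \<ge> 0" "K2 \<ge> 0" using assms by (auto simp: K1_def K2_def)
  have summ: "summable (\<lambda>m. 1 / real m powr (7/4))"
    using summable_real_powr_iff[of "-7/4"] by (simp add: powr_minus_divide)
  define S where "S = suminf (\<lambda>m. 1 / real m powr (7/4))"
  define B' where "B' = (\<Sum>m\<le>m0. \<bar>B m\<bar>) + 1"
  define C where "C = B' * exp (K2 * S)"
  have "B' \<ge> 1" by (auto simp: B'_def intro!: sum_nonneg)
  have S0: "S \<ge> 0" unfolding S_def by (rule suminf_nonneg[OF summ]) auto
  have "C \<ge> B'" unfolding C_def using mult_left_mono[of 1 "exp (K2 * S)" B'] \<open>B' \<ge> 1\<close> K12 S0 by simp
  have "C \<ge> 0" using \<open>C \<ge> B'\<close> \<open>B' \<ge> 1\<close> by linarith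
  show ?thesis
  proof (intro exI[of _ C] conjI allI impI \<open>C \<ge> 0\<close>)
    fix N :: "nat \<Rightarrow> real" and \<alpha> :: real and m
    assume N: "\<forall>m. 0 \<le> N m \<and> N m \<le> B m" and N0: "N 0 = 0" and \<alpha>: "3/4 \<le> \<alpha>" "\<alpha> \<le> 3"
      and rec: "\<forall>m\<ge>1. (real m - \<alpha>) * N m \<le> real m * N (m - 1) + K * (1 + (N m + N (m - 1)) / real m)"
    \<comment> \<open>Adding 1 to the normalised value turns the additive error into a part of the
      relative error, so that the bounds simply multiply.\<close>
    define D where "D m = N m / real m powr \<alpha> + 1" for m
    have D1: "D m \<ge> 1" for m using N by (simp add: D_def)
    have step: "D m \<le> D (m - 1) * (1 + K2 / real m powr (7/4))" if "m > m0" for m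
    proof -
      define x where "x = real m"
      have x: "x \<ge> 9 + 4 * K" "x > 1" using that m0 assms unfolding x_def by auto
      have x0: "x > 0" using x by simp
      define q where "q = x - \<alpha> - K / x"
      have Kx: "0 \<le> K / x" "K / x \<le> 1/4" using x assms by (auto simp: divide_simps)
      have q: "q \<ge> x / 2" "q > 0" using Kx x \<alpha> assms unfolding q_def by linarith+
      have m1: "m \<ge> 1" "m - 1 \<ge> 1" "real (m - 1) = x - 1" using that m0 unfolding x_def by auto
      have "(x - \<alpha>) * N m \<le> x * N (m - 1) + K * (1 + (N m + N (m - 1)) / x)"
        using rec m1 unfolding x_def by blast
      moreover have "K * (1 + (N m + N (m - 1)) / x) = K + K / x * N m + K / x * N (m - 1)"
        by (simp add: add_divide_distrib distrib_left)
      ultimately have r1: "q * N m \<le> (x + K / x) * N (m - 1) + K"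
        by (simp add: q_def algebra_simps)
      have ratio: "x + K / x \<le> q * ((1 + \<alpha> / x) * (1 + K1 / x\<^sup>2))"
      proof -
        have a2: "\<alpha>\<^sup>2 \<le> 9" using \<alpha> power_mono[of \<alpha> 3 2] by simp
        have e: "q * (1 + \<alpha> / x) = x - (\<alpha>\<^sup>2 + K + K * \<alpha> / x) / x"
          using x0 by (simp add: q_def field_simps power2_eq_square)
        have "K * \<alpha> / x \<le> K * 3 / 1"
          using x assms \<alpha> by (intro frac_le mult_left_mono mult_nonneg_nonneg) auto
        then have b: "(\<alpha>\<^sup>2 + K + K * \<alpha> / x) / x \<le> (9 + 4 * K) / x"
          using a2 x0 by (intro divide_right_mono) auto
        have "(9 + 4 * K) / x \<le> x / 2"
        proof -
          have "(9 + 4 * K) * 2 \<le> x * x" using x assms by (intro mult_mono) auto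
          then show ?thesis using x0 by (simp add: field_simps)
        qed
        moreover have "A \<le> x / 2 \<Longrightarrow> B \<le> A \<Longrightarrow> x / 2 \<le> x - B" for A B by linarith
        ultimately have half: "q * (1 + \<alpha> / x) \<ge> x / 2" unfolding e using b by blast
        have "q * ((1 + \<alpha> / x) * (1 + K1 / x\<^sup>2)) = q * (1 + \<alpha> / x) + q * (1 + \<alpha> / x) * (K1 / x\<^sup>2)"
          by (simp add: algebra_simps)
        also have "\<dots> \<ge> (x - (9 + 4 * K) / x) + x / 2 * (K1 / x\<^sup>2)"
          using e b half K12 by (intro add_mono mult_right_mono) auto
        also have "x / 2 * (K1 / x\<^sup>2) = (5 * K + 9) / x"
          using x0 by (simp add: K1_def power2_eq_square field_simps)
        also have "x - (9 + 4 * K) / x + (5 * K + 9) / x = x + K / x"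
          by (simp add: add_divide_distrib algebra_simps)
        finally show ?thesis by simp
      qed
      have pw: "(1 + \<alpha> / x) * (x - 1) powr \<alpha> \<le> x powr \<alpha>"
      proof -
        have "ln ((x - 1) / x) \<le> (x - 1) / x - 1" using x by (intro ln_le_minus_one) auto
        then have "ln (x - 1) - ln x \<le> - (1 / x)" using x by (simp add: ln_div field_simps)
        then have "\<alpha> * (ln (x - 1) - ln x) \<le> \<alpha> * (- (1 / x))" using \<alpha> by (intro mult_left_mono) auto
        then have l: "\<alpha> / x + \<alpha> * ln (x - 1) \<le> \<alpha> * ln x" by (simp add: algebra_simps)
        have "(1 + \<alpha> / x) * (x - 1) powr \<alpha> \<le> exp (\<alpha> / x) * exp (\<alpha> * ln (x - 1))"
          using x exp_ge_add_one_self[of "\<alpha> / x"] by (intro mult_mono) (auto simp: powr_def)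
        also have "\<dots> \<le> exp (\<alpha> * ln x)" unfolding exp_add[symmetric] using l by simp
        finally show ?thesis using x by (simp add: powr_def)
      qed
      have p2: "1 / x\<^sup>2 \<le> 1 / x powr (7/4)"
      proof -
        have "x powr (7/4) \<le> x powr 2" using x by (intro powr_mono) auto
        also have "x powr 2 = x\<^sup>2" using x0 by simp
        finally show ?thesis using x0 by (intro divide_left_mono) auto
      qed
      have N1: "N (m - 1) = (D (m - 1) - 1) * (x - 1) powr \<alpha>"
        unfolding D_def m1(3) using x by simp
      have "q * N m \<le> q * ((1 + \<alpha> / x) * (1 + K1 / x\<^sup>2)) * N (m - 1) + K"
        using r1 mult_right_mono[OF ratio, of "N (m - 1)"] N by (smt (verit))
      then have "q * N m \<le> q * ((1 + \<alpha> / x) * (1 + K1 / x\<^sup>2) * N (m - 1) + K / q)"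
        using q by (simp add: algebra_simps)
      then have "N m \<le> (1 + \<alpha> / x) * (1 + K1 / x\<^sup>2) * N (m - 1) + K / q"
        using q by simp
      also have "(1 + \<alpha> / x) * (1 + K1 / x\<^sup>2) * N (m - 1)
         = ((1 + \<alpha> / x) * (x - 1) powr \<alpha>) * ((1 + K1 / x\<^sup>2) * (D (m - 1) - 1))"
        unfolding N1 by (simp only: mult_ac)
      also have "\<dots> \<le> x powr \<alpha> * ((1 + K1 / x\<^sup>2) * (D (m - 1) - 1))"
        using pw D1[of "m - 1"] K12 by (intro mult_right_mono mult_nonneg_nonneg) auto
      also have "K / q \<le> 2 * K / x"
        using frac_le[of K K "x / 2" q] q x0 assms by (simp add: mult.commute)
      finally have "N m / x powr \<alpha> \<le> (1 + K1 / x\<^sup>2) * (D (m - 1) - 1) + 2 * K / x / x powr \<alpha>"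
        using x0 by (simp add: field_simps)
      moreover have "2 * K / x / x powr \<alpha> \<le> 2 * K * (1 / x powr (7/4))"
      proof -
        have "x powr (7/4) \<le> x powr (1 + \<alpha>)" using x \<alpha> by (intro powr_mono) auto
        also have "\<dots> = x * x powr \<alpha>" using x by (simp add: powr_add)
        finally have "1 / (x * x powr \<alpha>) \<le> 1 / x powr (7/4)" using x by (intro divide_left_mono) auto
        then have "2 * K * (1 / (x * x powr \<alpha>)) \<le> 2 * K * (1 / x powr (7/4))"
          using assms by (intro mult_left_mono) auto
        then show ?thesis by simp
      qed
      moreover have "(1 + K1 / x\<^sup>2) * (D (m - 1) - 1) \<le> (1 + K1 * (1 / x powr (7/4))) * (D (m - 1) - 1)"
        using p2 K12 D1[of "m - 1"] mult_left_mono[OF p2, of K1] by (intro mult_right_mono) auto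
      ultimately have "D m \<le> (1 + K1 * (1 / x powr (7/4))) * (D (m - 1) - 1) + 2 * K * (1 / x powr (7/4)) + 1"
        by (simp add: D_def x_def)
      also have "\<dots> \<le> D (m - 1) * (1 + K2 * (1 / x powr (7/4)))"
      proof -
        define y where "y = 1 / x powr (7/4)"
        have "y \<ge> 0" by (simp add: y_def)
        have "0 \<le> K1 * y" "0 \<le> (2 * K * y) * (D (m - 1) - 1)"
          using \<open>y \<ge> 0\<close> K12 assms D1[of "m - 1"] by auto
        then show ?thesis unfolding y_def[symmetric] K2_def by (simp add: algebra_simps)
      qed
      finally show ?thesis by (simp add: x_def)
    qed
    have small: "N m \<le> (B' - 1) * real m powr \<alpha>" if "m \<le> m0" for m
    proof (cases "m = 0")
      case False
      have "N m \<le> \<bar>B m\<bar>" using N by (metis abs_ge_self order_trans)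
      also have "\<dots> \<le> (\<Sum>m\<le>m0. \<bar>B m\<bar>)" using that by (intro member_le_sum) auto
      also have "\<dots> = B' - 1" by (simp add: B'_def)
      finally have "N m \<le> B' - 1" .
      moreover have "1 \<le> real m powr \<alpha>" using False \<alpha> by (intro ge_one_powr_ge_zero) auto
      ultimately show ?thesis using \<open>B' \<ge> 1\<close> mult_mono[of "N m" "B' - 1" 1 "real m powr \<alpha>"] by simp
    qed (simp add: N0)
    have main: "D m \<le> B' * exp (K2 * (\<Sum>j\<le>m. 1 / real j powr (7/4)))" if "m \<ge> m0" for m
      using that
    proof (induction m rule: dec_induct)
      case base
      have "real m0 powr \<alpha> > 0" using m0 by simp
      then have "D m0 \<le> B'" using small[of m0] by (simp add: D_def field_simps)
      also have "B' \<le> B' * exp (K2 * (\<Sum>j\<le>m0. 1 / real j powr (7/4)))"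
        using \<open>B' \<ge> 1\<close> K12 by (simp add: sum_nonneg)
      finally show ?case .
    next
      case (step n)
      have "D (Suc n) \<le> D n * (1 + K2 / real (Suc n) powr (7/4))"
        using \<open>\<And>m. m > m0 \<Longrightarrow> _\<close>[of "Suc n"] step.hyps by simp
      also have "\<dots> \<le> (B' * exp (K2 * (\<Sum>j\<le>n. 1 / real j powr (7/4)))) * exp (K2 / real (Suc n) powr (7/4))"
      proof (rule mult_mono[OF step.IH exp_ge_add_one_self])
        show "0 \<le> 1 + K2 / real (Suc n) powr (7/4)" using K12 by (simp add: add_nonneg_nonneg)
        show "0 \<le> B' * exp (K2 * (\<Sum>j\<le>n. 1 / real j powr (7/4)))" using \<open>B' \<ge> 1\<close> by simp
      qed
      also have "\<dots> = B' * exp (K2 * (\<Sum>j\<le>Suc n. 1 / real j powr (7/4)))"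
        by (simp add: distrib_left exp_add)
      finally show ?case .
    qed
    show "N m \<le> C * real m powr \<alpha>"
    proof (cases "m \<ge> m0")
      case True
      have "(\<Sum>j\<le>m. 1 / real j powr (7/4)) \<le> S"
        unfolding S_def by (intro sum_le_suminf summ) auto
      then have "exp (K2 * (\<Sum>j\<le>m. 1 / real j powr (7/4))) \<le> exp (K2 * S)"
        using K12 by (simp add: mult_left_mono)
      then have "D m \<le> C" unfolding C_def
        using main[OF True] \<open>B' \<ge> 1\<close> by (smt (verit) mult_left_mono)
      then have "N m / real m powr \<alpha> \<le> C" by (simp add: D_def)
      then show ?thesis using True m0 by (simp add: field_simps)
    next
      case False
      then have "N m \<le> (B' - 1) * real m powr \<alpha>" by (intro small) simp
      also have "\<dots> \<le> C * real m powr \<alpha>" using \<open>C \<ge> B'\<close> by (intro mult_right_mono) auto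
      finally show ?thesis .
    qed
  qed
qed

lemma norm_funpow_cesaro_le:
  fixes g :: "nat \<Rightarrow> 'a :: real_normed_field"
  assumes "\<And>j. j \<le> m \<Longrightarrow> norm (g j) \<le> B"
  shows "norm ((cesaro ^^ i) g m) \<le> B"
  using assms
proof (induction i arbitrary: m)
  case (Suc i)
  have "norm ((cesaro ^^ Suc i) g m) = norm (\<Sum>j\<le>m. (cesaro ^^ i) g j) / (real m + 1)"
    by (simp add: cesaro_def norm_divide flip: of_nat_Suc)
      (metis norm_of_nat of_nat_Suc add.commute)
  also have "\<dots> \<le> (\<Sum>j\<le>m. B) / (real m + 1)"
    using Suc by (intro divide_right_mono sum_norm_le) auto
  also have "\<dots> = B" by (simp add: field_simps)
  finally show ?case .
qed simp

text \<open>Multiplied by the number of terms the average becomes a sum, so the nonlocal operator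
  turns into a first-order recursion in \<open>m\<close>.\<close>

lemma cesaro_step:
  assumes "m \<ge> 1"
  shows "(of_nat m + 1) * cesaro g m = of_nat m * cesaro g (m - 1) + g m"
proof -
  obtain k where k: "m = Suc k" using assms by (cases m) auto
  have nz: "(of_nat (Suc j) :: 'a) \<noteq> 0" for j by (simp only: of_nat_eq_0_iff)
  have "(of_nat m + 1) * cesaro g m = (\<Sum>j\<le>m. g j)"
    using nz[of m] by (simp add: cesaro_def add.commute)
  moreover have "of_nat m * cesaro g (m - 1) = (\<Sum>j\<le>k. g j)"
    using nz[of k] by (simp add: cesaro_def k add.commute)
  ultimately show ?thesis by (simp add: k)
qed

text \<open>Orthogonality of the characters of the cyclic group of order \<open>p\<close>. The
  exponents are shifted by one because the iterates to be transformed are numbered from 1 to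
  \<open>p\<close>.\<close>

lemma sum_root_unity_powers:
  assumes "p \<ge> 1" "l < p" "i < p"
  defines "r \<equiv> exp (2 * of_real pi * \<i> / of_nat p)"
  shows "(\<Sum>j<p. (r ^ j) ^ Suc l / (r ^ j) ^ Suc i) = (if l = i then of_nat p else 0)"
proof -
  have rp: "r ^ k = exp (2 * of_real pi * \<i> * of_nat k / of_nat p)" for k
    unfolding r_def exp_of_nat_mult[symmetric] by (simp add: mult_ac)
  have [simp]: "r \<noteq> 0" by (simp add: r_def)
  have r1: "r ^ p = 1" using assms(1) by (simp add: rp exp_eq_1 mult_ac)
  define x where "x = r ^ l / r ^ i"
  have "(r ^ j) ^ Suc l / (r ^ j) ^ Suc i = x ^ j" for j
    by (simp add: x_def power_divide power_mult[symmetric] mult.commute)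
  then have eq: "(\<Sum>j<p. (r ^ j) ^ Suc l / (r ^ j) ^ Suc i) = (\<Sum>j<p. x ^ j)" by simp
  show ?thesis
  proof (cases "l = i")
    case False
    have "x \<noteq> 1"
    proof
      assume "x = 1"
      then have "r ^ l = r ^ i" by (simp add: x_def)
      then have "l mod p = i mod p"
        using complex_root_unity_eq[OF assms(1), of l i] by (simp add: rp)
      then show False using False assms(2,3) by simp
    qed
    moreover have "x ^ p = 1"
      by (simp add: x_def power_divide power_mult[symmetric] mult.commute[of _ p] power_mult r1)
    ultimately show ?thesis using False eq by (simp add: geometric_sum)
  qed (simp add: eq x_def)
qed

text \<open>The eigenvalues of the recursion become visible after a discrete Fourier transform of the
  iterates of \<open>2 \<zeta>\<close> times the Cesaro operator, taken with respect to the number of iterations.\<close>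

lemma mean_recursion_bound:
  assumes p: "p \<ge> 1"
  shows "\<exists>C\<ge>0. \<forall>(f :: nat \<Rightarrow> complex) \<zeta> \<alpha>. f 0 = 0 \<longrightarrow> (\<forall>n. f (Suc n) = 1 + (2 * \<zeta>) ^ p * (cesaro ^^ p) f n) \<longrightarrow>
    cmod \<zeta> \<le> 2 \<longrightarrow> 3/4 \<le> \<alpha> \<longrightarrow> \<alpha> \<le> 3 \<longrightarrow> (\<forall>\<eta>. \<eta> ^ p = 1 \<longrightarrow> 2 * Re (\<zeta> * \<eta>) \<le> \<alpha> + 1) \<longrightarrow>
    (\<forall>n. cmod (f n) \<le> C * real n powr \<alpha>)"
proof -
  define r where "r = exp (2 * of_real pi * \<i> / of_nat p)"
  have [simp]: "r \<noteq> 0" by (simp add: r_def)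
  have rnorm: "cmod r = 1" by (simp add: r_def norm_exp_eq_Re)
  have rp: "r ^ p = 1"
    using p unfolding r_def exp_of_nat_mult[symmetric] by (simp add: exp_eq_1 mult_ac)
  define B where "B = (\<lambda>m. real p * (real p * (4 ^ p * (1 + 4 ^ p) ^ m)))"
  have "\<exists>C\<ge>0. \<forall>N \<alpha>. (\<forall>m. 0 \<le> N m \<and> N m \<le> B m) \<longrightarrow> N 0 = 0 \<longrightarrow> 3/4 \<le> \<alpha> \<longrightarrow> \<alpha> \<le> 3 \<longrightarrow>
     (\<forall>m\<ge>1. (real m - \<alpha>) * N m \<le> real m * N (m - 1) + real (24 * p) * (1 + (N m + N (m - 1)) / real m)) \<longrightarrow>
     (\<forall>m. N m \<le> C * real m powr \<alpha>)"
    by (rule growth_from_recursion) simp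
  then obtain C where C: "C \<ge> 0" "\<forall>N \<alpha>. (\<forall>m. 0 \<le> N m \<and> N m \<le> B m) \<longrightarrow> N 0 = 0 \<longrightarrow> 3/4 \<le> \<alpha> \<longrightarrow> \<alpha> \<le> 3 \<longrightarrow>
     (\<forall>m\<ge>1. (real m - \<alpha>) * N m \<le> real m * N (m - 1) + real (24 * p) * (1 + (N m + N (m - 1)) / real m)) \<longrightarrow>
     (\<forall>m. N m \<le> C * real m powr \<alpha>)"
    by (elim exE conjE)
  show ?thesis
  proof (intro exI[of _ "1 + C"] conjI allI impI)
    show "0 \<le> 1 + C" using C(1) by simp
    fix f :: "nat \<Rightarrow> complex" and \<zeta> :: complex and \<alpha> :: real and n :: nat
    assume f0: "f 0 = 0" and rec: "\<forall>n. f (Suc n) = 1 + (2 * \<zeta>) ^ p * (cesaro ^^ p) f n"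
      and \<zeta>: "cmod \<zeta> \<le> 2" and \<alpha>: "3/4 \<le> \<alpha>" "\<alpha> \<le> 3" and rot: "\<forall>\<eta>. \<eta> ^ p = 1 \<longrightarrow> 2 * Re (\<zeta> * \<eta>) \<le> \<alpha> + 1"
    define a where "a = 2 * \<zeta>"
    have a4: "cmod a \<le> 4" using \<zeta> by (simp add: a_def norm_mult)
    \<comment> \<open>\<open>u i\<close> is the \<open>i\<close>-th iterate of
      \<open>2 \<zeta>\<close> times the Cesaro operator on \<open>f\<close>. The recursion closes
      this chain up to a delay: \<open>u 0 m = 1 + u p (m - 1)\<close>. The transform
      \<open>w j\<close> over the iterates 1 to \<open>p\<close> diagonalises the cyclic shift, with
      eigenvalues \<open>r ^ j\<close> running through all \<open>p\<close>-th roots of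
      unity.\<close>
    define u where "u = (\<lambda>i m. a ^ i * (cesaro ^^ i) f m)"
    define w where "w = (\<lambda>j m. \<Sum>i<p. (r ^ j) ^ Suc i * u (Suc i) m)"
    define N where "N = (\<lambda>m. \<Sum>j<p. cmod (w j m))"
    have N_nonneg: "N m \<ge> 0" for m by (simp add: N_def sum_nonneg)
    have rj: "cmod (r ^ j) = 1" "(r ^ j) ^ p = 1" for j
      by (simp add: norm_power rnorm) (simp add: power_mult[symmetric] mult.commute[of j] power_mult rp)
    \<comment> \<open>A crude exponential bound; it only has to be uniform in \<open>f\<close>,
      \<open>\<zeta>\<close> and \<open>\<alpha>\<close>, as it yields the common majorant
      \<open>B\<close> for \<open>growth_from_recursion\<close>.\<close>
    have f_bound: "cmod (f m) \<le> (1 + 4 ^ p) ^ m" for m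
    proof (induction m rule: less_induct)
      case (less m)
      show ?case
      proof (cases m)
        case (Suc k)
        have "cmod ((cesaro ^^ p) f k) \<le> (1 + 4 ^ p) ^ k"
          using less Suc by (intro norm_funpow_cesaro_le order_trans[OF less power_increasing]) auto
        then have "cmod (a ^ p * (cesaro ^^ p) f k) \<le> 4 ^ p * (1 + 4 ^ p) ^ k"
          unfolding norm_mult norm_power using a4 by (intro mult_mono power_mono) auto
        then have "cmod (f m) \<le> 1 + 4 ^ p * (1 + 4 ^ p) ^ k"
          using norm_triangle_ineq[of 1 "a ^ p * (cesaro ^^ p) f k"] rec by (simp add: Suc a_def)
        also have "\<dots> \<le> (1 + 4 ^ p) ^ k + 4 ^ p * (1 + 4 ^ p) ^ k" by simp
        finally show ?thesis by (simp add: Suc algebra_simps)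
      qed (simp add: f0)
    qed
    have u_bound: "cmod (u i m) \<le> 4 ^ p * (1 + 4 ^ p) ^ m" if "i \<le> p" for i m
    proof -
      have "cmod ((cesaro ^^ i) f m) \<le> (1 + 4 ^ p) ^ m"
        by (intro norm_funpow_cesaro_le order_trans[OF f_bound power_increasing]) auto
      moreover have "cmod a ^ i \<le> 4 ^ p"
        using a4 that by (intro order_trans[OF power_mono power_increasing]) auto
      ultimately show ?thesis unfolding u_def norm_mult norm_power by (intro mult_mono) auto
    qed
    have N_le: "N m \<le> B m" for m
    proof -
      have "cmod (w j m) \<le> real p * (4 ^ p * (1 + 4 ^ p) ^ m)" for j
      proof -
        have "cmod (w j m) \<le> (\<Sum>i<p. 4 ^ p * (1 + 4 ^ p) ^ m)"
          unfolding w_def using rj u_bound by (intro sum_norm_le) (auto simp: norm_mult norm_power rj simp del: power_Suc)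
        then show ?thesis by simp
      qed
      then have "N m \<le> (\<Sum>j<p. real p * (4 ^ p * (1 + 4 ^ p) ^ m))"
        unfolding N_def by (intro sum_mono)
      then show ?thesis by (simp add: B_def)
    qed
    have u0: "u i 0 = 0" for i
      using norm_funpow_cesaro_le[of 0 f 0 i] by (simp add: u_def f0)
    have N0: "N 0 = 0" by (simp add: N_def w_def u0)
    have ustep: "(of_nat m + 1) * u (Suc i) m = of_nat m * u (Suc i) (m - 1) + a * u i m" if "m \<ge> 1" for i m
    proof -
      have "(of_nat m + 1) * u (Suc i) m = a ^ Suc i * ((of_nat m + 1) * cesaro ((cesaro ^^ i) f) m)"
        by (simp add: u_def mult_ac)
      then show ?thesis unfolding cesaro_step[OF that] by (simp add: u_def algebra_simps)
    qed
    have fu: "f m = 1 + u p (m - 1)" if "m \<ge> 1" for m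
      using rec that by (cases m) (auto simp: u_def a_def)
    have wstep: "(of_nat m + 1) * w j m = of_nat m * w j (m - 1) + a * r ^ j * (w j m + u 0 m - u p m)"
      if "m \<ge> 1" for j m
    proof -
      have "(of_nat m + 1) * w j m = (\<Sum>i<p. (r ^ j) ^ Suc i * ((of_nat m + 1) * u (Suc i) m))"
        unfolding w_def by (simp add: sum_distrib_left mult_ac)
      also have "\<dots> = of_nat m * w j (m - 1) + a * r ^ j * (\<Sum>i<p. (r ^ j) ^ i * u i m)"
        unfolding ustep[OF that] w_def by (simp add: sum_distrib_left sum.distrib algebra_simps)
      also have "(\<Sum>i<p. (r ^ j) ^ i * u i m) = w j m + u 0 m - u p m"
      proof -
        have "(\<Sum>i<Suc p. (r ^ j) ^ i * u i m) = u 0 m + w j m"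
          unfolding w_def by (subst sum.lessThan_Suc_shift) simp
        then show ?thesis by (simp add: rj algebra_simps)
      qed
      finally show ?thesis .
    qed
    have dft: "cmod (u (Suc i) m) \<le> N m" if "i < p" for i m
    proof -
      have "(\<Sum>j<p. w j m / (r ^ j) ^ Suc i) = (\<Sum>j<p. \<Sum>l<p. ((r ^ j) ^ Suc l / (r ^ j) ^ Suc i) * u (Suc l) m)"
        unfolding w_def by (simp add: sum_divide_distrib)
      also have "\<dots> = (\<Sum>l<p. (\<Sum>j<p. (r ^ j) ^ Suc l / (r ^ j) ^ Suc i) * u (Suc l) m)"
        by (subst sum.swap) (simp add: sum_distrib_right)
      also have "\<dots> = (\<Sum>l<p. (if l = i then of_nat p else 0) * u (Suc l) m)"
        using sum_root_unity_powers[OF p _ that] unfolding r_def by (intro sum.cong) auto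
      also have "\<dots> = of_nat p * u (Suc i) m"
        using that by (simp add: if_distrib[of "\<lambda>x. x * _"] cong: if_cong)
      finally have "real p * cmod (u (Suc i) m) = cmod (\<Sum>j<p. w j m / (r ^ j) ^ Suc i)"
        by (simp add: norm_mult)
      also have "\<dots> \<le> N m"
        unfolding N_def by (intro sum_norm_le) (simp add: norm_divide norm_mult norm_power rnorm)
      finally have "real p * cmod (u (Suc i) m) \<le> N m" .
      moreover have "1 * cmod (u (Suc i) m) \<le> real p * cmod (u (Suc i) m)"
        using p by (intro mult_right_mono) auto
      ultimately show ?thesis by simp
    qed
    have recN: "(real m - \<alpha>) * N m \<le> real m * N (m - 1) + (24 * p) * (1 + (N m + N (m - 1)) / real m)"
      if m: "m \<ge> 1" for m
    proof -
      \<comment> \<open>\<open>\<delta>\<close> is the defect of cyclicity. As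
        \<open>u 0 m = 1 + u p (m - 1)\<close>, it equals 1 minus the increment of
        \<open>u p\<close> at \<open>m\<close>, and an increment of averages is smaller than the
        averages by a factor of order \<open>1 / m\<close>.\<close>
      define \<delta> where "\<delta> = u 0 m - u p m"
      obtain p' where p': "p = Suc p'" using p by (cases p) auto
      have up: "cmod (u p k) \<le> N k" for k using dft[of p' k] by (simp add: p')
      have up': "cmod (u p' m) \<le> 1 + N m + N (m - 1)"
      proof (cases p')
        case 0
        have "cmod (f m) \<le> 1 + cmod (u p (m - 1))"
          using fu[OF m] norm_triangle_ineq[of 1 "u p (m - 1)"] by simp
        then show ?thesis using up[of "m - 1"] N_nonneg[of m] by (simp add: 0 u_def)
      next
        case (Suc k)
        then show ?thesis using dft[of k m] N_nonneg[of "m - 1"] p' by simp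
      qed
      have "(of_nat m + 1) * (u p m - u p (m - 1)) = a * u p' m - u p (m - 1)"
        using ustep[OF m, of p'] by (simp add: p' algebra_simps)
      then have "cmod (of_nat m + 1) * cmod (u p m - u p (m - 1)) \<le> cmod a * cmod (u p' m) + cmod (u p (m - 1))"
        by (metis norm_mult norm_triangle_ineq4)
      also have "\<dots> \<le> 4 * (1 + N m + N (m - 1)) + N (m - 1)"
        using a4 up' up by (intro add_mono mult_mono) auto
      also have "\<dots> \<le> 5 * (1 + N m + N (m - 1))" using N_nonneg by simp
      also have "cmod (of_nat m + 1) = real m + 1" by (metis norm_of_nat of_nat_Suc add.commute)
      finally have "cmod (u p m - u p (m - 1)) \<le> 5 * (1 + N m + N (m - 1)) / (real m + 1)"
        by (simp add: field_simps)
      also have "\<dots> \<le> 5 * (1 + N m + N (m - 1)) / real m"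
        using m N_nonneg by (intro divide_left_mono) auto
      finally have du: "cmod (u p m - u p (m - 1)) \<le> 5 * (1 + N m + N (m - 1)) / real m" .
      have "\<delta> = 1 - (u p m - u p (m - 1))" using fu[OF m] by (simp add: \<delta>_def u_def)
      then have "cmod \<delta> \<le> 1 + 5 * (1 + N m + N (m - 1)) / real m"
        using du norm_triangle_ineq4[of 1 "u p m - u p (m - 1)"] by simp
      also have "\<dots> = 1 + 5 / real m + 5 * ((N m + N (m - 1)) / real m)"
        by (simp add: add_divide_distrib algebra_simps)
      also have "\<dots> \<le> 6 + 6 * ((N m + N (m - 1)) / real m)"
        using m N_nonneg by (intro add_mono mult_right_mono divide_nonneg_nonneg) (auto simp: divide_simps)
      finally have \<delta>: "cmod \<delta> \<le> 6 * (1 + (N m + N (m - 1)) / real m)" by simp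
      have "(real m - \<alpha>) * cmod (w j m) \<le> real m * cmod (w j (m - 1)) + 4 * cmod \<delta>" for j
      proof -
        \<comment> \<open>Here the real parts of the roots enter: the modulus of
          \<open>m + 1 - a r^j\<close> is at least its real part, which is at least
          \<open>m - \<alpha>\<close>.\<close>
        have "2 * Re (\<zeta> * r ^ j) \<le> \<alpha> + 1" using rot rj(2)[of j] by blast
        moreover have "Re (a * r ^ j) = 2 * Re (\<zeta> * r ^ j)" by (simp add: a_def algebra_simps)
        moreover have "Re (of_nat m + 1 - a * r ^ j) = real m + 1 - Re (a * r ^ j)"
          by (simp only: minus_complex.sel plus_complex.sel complex_Re_of_nat one_complex.sel)
        ultimately have "real m - \<alpha> \<le> Re (of_nat m + 1 - a * r ^ j)" by linarith
        also have "\<dots> \<le> cmod (of_nat m + 1 - a * r ^ j)" by (rule complex_Re_le_cmod)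
        finally have "(real m - \<alpha>) * cmod (w j m) \<le> cmod ((of_nat m + 1 - a * r ^ j) * w j m)"
          unfolding norm_mult by (intro mult_right_mono) auto
        also have "(of_nat m + 1 - a * r ^ j) * w j m = of_nat m * w j (m - 1) + a * r ^ j * \<delta>"
          using wstep[OF m, of j] by (simp add: \<delta>_def algebra_simps)
        also have "cmod \<dots> \<le> real m * cmod (w j (m - 1)) + cmod a * cmod \<delta>"
          using norm_triangle_ineq[of "of_nat m * w j (m - 1)" "a * r ^ j * \<delta>"] rj(1)[of j]
          by (simp add: norm_mult norm_power rnorm)
        also have "\<dots> \<le> real m * cmod (w j (m - 1)) + 4 * cmod \<delta>"
          using a4 by (intro add_mono mult_right_mono) auto
        finally show ?thesis .
      qed
      then have "(\<Sum>j<p. (real m - \<alpha>) * cmod (w j m)) \<le> (\<Sum>j<p. real m * cmod (w j (m - 1)) + 4 * cmod \<delta>)"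
        by (intro sum_mono)
      then have N1: "(real m - \<alpha>) * N m \<le> real m * N (m - 1) + 4 * p * cmod \<delta>"
        by (simp add: N_def sum_distrib_left sum.distrib mult_ac)
      have "4 * p * cmod \<delta> \<le> 4 * p * (6 * (1 + (N m + N (m - 1)) / real m))"
        using \<delta> by (intro mult_left_mono) auto
      also have "\<dots> = (24 * p) * (1 + (N m + N (m - 1)) / real m)"
      proof -
        have "4 * y * (6 * x) = 24 * y * x" for x y :: real by simp
        then show ?thesis by simp
      qed
      finally show ?thesis using N1 by linarith
    qed
    have N_growth: "N m \<le> C * real m powr \<alpha>" for m
      using C(2)[rule_format, of N \<alpha> m] N0 \<alpha> recN N_nonneg N_le by blast
    show "cmod (f n) \<le> (1 + C) * real n powr \<alpha>"
    proof (cases "n = 0")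
      case False
      obtain p' where p': "p = Suc p'" using p by (cases p) auto
      have "cmod (f n) \<le> 1 + cmod (u p (n - 1))"
        using fu[of n] False norm_triangle_ineq[of 1 "u p (n - 1)"] by simp
      also have "cmod (u p (n - 1)) \<le> C * real (n - 1) powr \<alpha>"
        using dft[of p' "n - 1"] N_growth[of "n - 1"] by (simp add: p')
      also have "C * real (n - 1) powr \<alpha> \<le> C * real n powr \<alpha>"
        using C(1) \<alpha> by (intro mult_left_mono powr_mono2) auto
      also have "1 \<le> real n powr \<alpha>" using False \<alpha> by (intro ge_one_powr_ge_zero) auto
      finally show ?thesis by (simp add: algebra_simps)
    qed (simp add: f0)
  qed
qed

section \<open>Contraction on powers of \<open>n\<close>, and inequalities for powers of
  sums\<close>

lemma powr_le_difference_quotient: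
  assumes "\<beta> > 0"
  shows "real j powr \<beta> \<le> (real (Suc j) powr (\<beta> + 1) - real j powr (\<beta> + 1)) / (\<beta> + 1)"
proof (cases "j = 0")
  case False
  have "\<exists>\<xi>. real j < \<xi> \<and> \<xi> < real (Suc j) \<and>
     real (Suc j) powr (\<beta> + 1) - real j powr (\<beta> + 1) = (real (Suc j) - real j) * ((\<beta> + 1) * \<xi> powr \<beta>)"
  proof (rule MVT2)
    fix x assume "real j \<le> x" "x \<le> real (Suc j)"
    then show "((\<lambda>x. x powr (\<beta> + 1)) has_real_derivative (\<beta> + 1) * x powr \<beta>) (at x)"
      using False by (auto intro!: derivative_eq_intros)
  qed simp
  then obtain \<xi> where \<xi>: "real j < \<xi>"
    "real (Suc j) powr (\<beta> + 1) - real j powr (\<beta> + 1) = (\<beta> + 1) * \<xi> powr \<beta>" by auto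
  have "real j powr \<beta> \<le> \<xi> powr \<beta>" using \<xi>(1) assms by (intro powr_mono2) auto
  then show ?thesis unfolding \<xi>(2) using assms by simp
qed (use assms in simp)

lemma cesaro_powr_le:
  assumes "\<beta> > 0"
  shows "cesaro (\<lambda>j. real j powr \<beta>) m \<le> (real m + 1) powr \<beta> / (\<beta> + 1)"
proof -
  have "(\<Sum>j\<le>m. real j powr \<beta>) \<le> (\<Sum>j\<le>m. (real (Suc j) powr (\<beta> + 1) - real j powr (\<beta> + 1)) / (\<beta> + 1))"
    using powr_le_difference_quotient[OF assms] by (intro sum_mono)
  also have "\<dots> = real (Suc m) powr (\<beta> + 1) / (\<beta> + 1)"
    unfolding sum_divide_distrib[symmetric] lessThan_Suc_atMost[symmetric]
      sum_lessThan_telescope[of "\<lambda>j. real j powr (\<beta> + 1)"] by simp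
  finally have "cesaro (\<lambda>j. real j powr \<beta>) m \<le> real (Suc m) powr (\<beta> + 1) / (\<beta> + 1) / (real m + 1)"
    unfolding cesaro_def by (intro divide_right_mono) auto
  also have "\<dots> = (real m + 1) powr \<beta> / (\<beta> + 1)"
    by (simp add: powr_add add.commute)
  finally show ?thesis .
qed

lemma cesaro_mono:
  fixes g h :: "nat \<Rightarrow> real"
  assumes "\<And>j. j \<le> m \<Longrightarrow> g j \<le> h j"
  shows "cesaro g m \<le> cesaro h m"
  unfolding cesaro_def using assms by (intro divide_right_mono sum_mono) auto

lemma cesaro_affine: "cesaro (\<lambda>j. a * g j + b) m = a * cesaro g m + (b :: real)"
  by (simp add: cesaro_def sum.distrib sum_distrib_left[symmetric] add_divide_distrib) (simp add: field_simps)

text \<open>On \<open>j powr \<beta>\<close> with \<open>\<beta> \<ge> 3/2\<close> the Cesaro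
  operator acts asymptotically as division by \<open>\<beta> + 1 \<ge> 5/2\<close>. Allowing 42/100
  in place of 2/5 absorbs the shift from \<open>m + 1\<close> to \<open>m\<close>, and
  \<open>11/10 * 2 ^ p * (42/100) ^ p \<le> 94/100\<close>. The induction adds 4/100 for the
  additive errors, by the choice of \<open>n0\<close>, and 1/100 for the inhomogeneity, by the
  choice of \<open>C\<close>; the total 99/100 stays below 1.\<close>

lemma contraction_growth:
  fixes K b :: real
  assumes K: "K \<ge> 0" and p: "p \<ge> 1"
  shows "\<exists>C\<ge>0. \<forall>e \<beta>. (\<forall>n. 0 \<le> e n) \<longrightarrow> e 0 = 0 \<longrightarrow> 3/2 \<le> \<beta> \<longrightarrow> \<beta> \<le> b \<longrightarrow>
     (\<forall>n. e (Suc n) \<le> 11/10 * 2 ^ p * (cesaro ^^ p) e n + K * real (Suc n) powr \<beta>) \<longrightarrow>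
     (\<forall>n. e n \<le> C * real n powr \<beta>)"
proof (cases "b \<ge> 3/2")
  case b: True
  define P where "P e \<beta> \<longleftrightarrow> (\<forall>n. 0 \<le> e n) \<and> e 0 = 0 \<and> 3/2 \<le> \<beta> \<and> \<beta> \<le> b \<and>
     (\<forall>n. e (Suc n) \<le> 11/10 * 2 ^ p * (cesaro ^^ p) e n + K * real (Suc n) powr \<beta>)"
    for e :: "nat \<Rightarrow> real" and \<beta> :: real
  \<comment> \<open>The constant must serve all \<open>e\<close> and \<open>\<beta>\<close> at once,
    so the first values are bounded by running the recursion itself.\<close>
  have init: "\<exists>B\<ge>0. \<forall>e \<beta>. P e \<beta> \<longrightarrow> (\<forall>j\<le>n. e j \<le> B)" for n
  proof (induction n)
    case 0
    show ?case by (rule exI[of _ 0]) (auto simp: P_def)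
  next
    case (Suc n)
    then obtain B where B: "B \<ge> 0" "\<And>e \<beta> j. P e \<beta> \<Longrightarrow> j \<le> n \<Longrightarrow> e j \<le> B" by blast
    define B' where "B' = 11/10 * 2 ^ p * B + K * real (Suc n) powr b"
    have "e j \<le> max B B'" if e: "P e \<beta>" and j: "j \<le> Suc n" for e \<beta> j
    proof (cases "j = Suc n")
      case True
      have "norm (e i) \<le> B" if "i \<le> n" for i using e that B(2)[OF e that] by (auto simp: P_def)
      then have "norm ((cesaro ^^ p) e n) \<le> B" by (rule norm_funpow_cesaro_le)
      then have c: "(cesaro ^^ p) e n \<le> B" by simp
      have "e j \<le> 11/10 * 2 ^ p * (cesaro ^^ p) e n + K * real (Suc n) powr \<beta>"
        using e True by (auto simp: P_def)
      also have "\<dots> \<le> B'" unfolding B'_def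
        using c K e by (intro add_mono mult_left_mono powr_mono) (auto simp: P_def)
      finally show ?thesis by simp
    qed (use B(2)[OF e, of j] j in simp)
    then show ?case using B(1) by (intro exI[of _ "max B B'"]) auto
  qed
  \<comment> \<open>For \<open>m \<ge> 21 b\<close> one has
    \<open>(1 + 1 / m) powr \<beta> \<le> exp (1/21) \<le> 105/100\<close>, and 105/100 divided by
    5/2 is the rate 42/100 in \<open>U\<close>.\<close>
  define m0 where "m0 = nat \<lceil>21 * b\<rceil>"
  have m0: "real m0 \<ge> 21 * b" unfolding m0_def by linarith
  define A where "A = (real m0 + 1) powr b"
  have "A \<ge> 0" by (simp add: A_def)
  have shift: "(real m + 1) powr \<beta> \<le> 105/100 * real m powr \<beta> + A" if \<beta>: "3/2 \<le> \<beta>" "\<beta> \<le> b" for m \<beta>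
  proof (cases "m \<le> m0")
    case True
    have "(real m + 1) powr \<beta> \<le> (real m0 + 1) powr \<beta>" using True \<beta> by (intro powr_mono2) auto
    also have "\<dots> \<le> A" unfolding A_def using \<beta> by (intro powr_mono) auto
    finally show ?thesis by (simp add: add_increasing)
  next
    case False
    then have m: "real m \<ge> 21 * b" "real m > 0" using m0 b by linarith+
    have "(real m + 1) powr \<beta> = (real m * (1 + 1 / real m)) powr \<beta>"
      using m by (simp add: distrib_left)
    also have "\<dots> = real m powr \<beta> * (1 + 1 / real m) powr \<beta>"
      by (rule powr_mult)
    finally have 1: "(real m + 1) powr \<beta> = real m powr \<beta> * (1 + 1 / real m) powr \<beta>" .
    have "(1 + 1 / real m) powr \<beta> \<le> exp (1 / real m) powr \<beta>"
      using m \<beta> by (intro powr_mono2) (auto intro: add_nonneg_nonneg)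
    also have "exp (1 / real m) powr \<beta> = exp (\<beta> / real m)" by (simp add: powr_def)
    also have "\<dots> \<le> exp (1 / 21)" using m \<beta> by (simp add: field_simps)
    also have "exp (1 / 21 :: real) \<le> 105/100"
    proof -
      have "1 - 1/21 \<le> exp (- (1/21) :: real)" using exp_ge_add_one_self[of "- (1/21) :: real"] by simp
      then have "20/21 * exp (1/21) \<le> exp (- (1/21)) * exp (1/21 :: real)" by (intro mult_right_mono) auto
      also have "\<dots> = 1" by (simp add: exp_add[symmetric])
      finally show ?thesis by simp
    qed
    finally have "real m powr \<beta> * (1 + 1 / real m) powr \<beta> \<le> real m powr \<beta> * (105/100)"
      by (intro mult_left_mono) auto
    then show ?thesis using \<open>A \<ge> 0\<close> 1 by simp
  qed
  have U: "(cesaro ^^ i) e m \<le> C * ((42/100) ^ i * real m powr \<beta> + real i * A)"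
    if \<beta>: "3/2 \<le> \<beta>" "\<beta> \<le> b" and C: "C \<ge> 0" and e: "\<And>j. j \<le> n \<Longrightarrow> e j \<le> C * real j powr \<beta>" and m: "m \<le> n"
    for i m n C \<beta> and e :: "nat \<Rightarrow> real"
    using m
  proof (induction i arbitrary: m)
    case (Suc i)
    have h1: "cesaro (\<lambda>j. real j powr \<beta>) m \<le> 42/100 * real m powr \<beta> + A"
    proof -
      have "cesaro (\<lambda>j. real j powr \<beta>) m \<le> (real m + 1) powr \<beta> / (\<beta> + 1)" using \<beta> by (intro cesaro_powr_le) auto
      also have "\<dots> \<le> (105/100 * real m powr \<beta> + A) / (5/2)"
        using shift[OF \<beta>, of m] \<beta> \<open>A \<ge> 0\<close> by (intro frac_le) auto
      also have "\<dots> \<le> 42/100 * real m powr \<beta> + A" using \<open>A \<ge> 0\<close> by simp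
      finally show ?thesis .
    qed
    have "(cesaro ^^ Suc i) e m = cesaro ((cesaro ^^ i) e) m" by simp
    also have "\<dots> \<le> cesaro (\<lambda>j. (C * (42/100) ^ i) * real j powr \<beta> + C * (real i * A)) m"
      using Suc by (intro cesaro_mono) (auto simp: algebra_simps)
    also have "\<dots> = (C * (42/100) ^ i) * cesaro (\<lambda>j. real j powr \<beta>) m + C * (real i * A)"
      by (rule cesaro_affine)
    also have "\<dots> \<le> (C * (42/100) ^ i) * (42/100 * real m powr \<beta> + A) + C * (real i * A)"
      using h1 C by (intro add_right_mono mult_left_mono) auto
    also have "\<dots>
       = C * ((42/100) ^ Suc i * real m powr \<beta> + ((42/100) ^ i * A + real i * A))"
      by (simp add: algebra_simps)
    also have "\<dots> \<le> C * ((42/100) ^ Suc i * real m powr \<beta> + (1 * A + real i * A))"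
      using C \<open>A \<ge> 0\<close> by (intro mult_left_mono add_mono mult_right_mono power_le_one) auto
    also have "\<dots> = C * ((42/100) ^ Suc i * real m powr \<beta> + real (Suc i) * A)"
      by (simp add: algebra_simps)
    finally show ?case .
  qed (use e in simp)
  define n0 where "n0 = nat \<lceil>100 * 2 ^ p * p * A\<rceil> + 1"
  have n0: "real n0 \<ge> 100 * 2 ^ p * p * A" "n0 \<ge> 1" unfolding n0_def by linarith+
  obtain B where B: "B \<ge> 0" "\<And>e \<beta> j. P e \<beta> \<Longrightarrow> j \<le> n0 \<Longrightarrow> e j \<le> B" using init[of n0] by blast
  define C where "C = max B (100 * K)"
  have C: "C \<ge> B" "C \<ge> 100 * K" "C \<ge> 0" using B(1) by (auto simp: C_def)
  have main: "e n \<le> C * real n powr \<beta>" if e: "P e \<beta>" for e \<beta> n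
  proof (induction n rule: less_induct)
    case (less n)
    have \<beta>: "3/2 \<le> \<beta>" "\<beta> \<le> b" using e by (auto simp: P_def)
    consider "n = 0" | "n \<noteq> 0" "n \<le> n0" | k where "n = Suc k" "k \<ge> n0" by (cases n) fastforce+
    then show ?case
    proof cases
      case 1
      then show ?thesis using e by (simp add: P_def)
    next
      case 2
      have "e n \<le> C * 1" using B(2)[OF e 2(2)] C by simp
      also have "\<dots> \<le> C * real n powr \<beta>" using 2 \<beta> C by (intro mult_left_mono ge_one_powr_ge_zero) auto
      finally show ?thesis .
    next
      case 3
      have kp: "real k \<le> real k powr \<beta>"
        using powr_mono[of 1 \<beta> "real k"] 3 n0 \<beta> by simp
      have small: "11/10 * 2 ^ p * (p * A) \<le> 4/100 * real k powr \<beta>"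
      proof -
        have "100 * 2 ^ p * p * A \<le> real k powr \<beta>" using n0 3 kp by linarith
        moreover have "0 \<le> 2 ^ p * real p * A" using \<open>A \<ge> 0\<close> by simp
        ultimately show ?thesis by (simp add: algebra_simps)
      qed
      have q: "11/10 * 2 ^ p * (42/100 :: real) ^ p \<le> 94/100"
      proof (cases p)
        case (Suc p')
        have "11/10 * 2 ^ p * (42/100 :: real) ^ p = 11/10 * (84/100) * (84/100) ^ p'"
          by (simp add: Suc power_mult_distrib[symmetric] mult_ac)
        also have "\<dots> \<le> 11/10 * (84/100) * 1" by (intro mult_left_mono power_le_one) auto
        finally show ?thesis by simp
      qed (use p in simp)
      have "e n \<le> 11/10 * 2 ^ p * (cesaro ^^ p) e k + K * real n powr \<beta>"
        using e by (simp add: P_def \<open>n = Suc k\<close>)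
      also have "(cesaro ^^ p) e k \<le> C * ((42/100) ^ p * real k powr \<beta> + real p * A)"
        using less 3 by (intro U[OF \<beta> C(3), of k]) auto
      also have "11/10 * 2 ^ p * (C * ((42/100) ^ p * real k powr \<beta> + real p * A))
        = C * ((11/10 * 2 ^ p * (42/100) ^ p) * real k powr \<beta> + 11/10 * 2 ^ p * (p * A))"
        by (simp add: algebra_simps)
      also have "\<dots> \<le> C * (94/100 * real k powr \<beta> + 4/100 * real k powr \<beta>)"
        using q small C(3) by (intro mult_left_mono add_mono mult_right_mono) auto
      also have "\<dots> \<le> 98/100 * C * real n powr \<beta>"
        using C(3) \<beta> 3 by (simp add: mult_left_mono powr_mono2)
      also have "K * real n powr \<beta> \<le> C / 100 * real n powr \<beta>"
        using C by (intro mult_right_mono) auto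
      finally have "e n \<le> 98/100 * C * real n powr \<beta> + C / 100 * real n powr \<beta>" by simp
      also have "\<dots> = 99/100 * (C * real n powr \<beta>)" by simp
      also have "\<dots> \<le> C * real n powr \<beta>" using C(3) by (simp add: mult_left_le_one_le)
      finally show ?thesis .
    qed
  qed
  show ?thesis
    using main C(3) by (intro exI[of _ C]) (auto simp: P_def)
qed (auto intro!: exI[of _ 0])

text \<open>The 1 stands for the node at the root. For \<open>cmod w > 22 s\<close> adding it costs
  at most the factor \<open>exp (1/22) \<le> 22/21\<close>; smaller \<open>w\<close> go into
  \<open>K\<close>. Together with the bound 21/20 for \<open>cmod z ^ s\<close> this gives
  \<open>22/21 * 21/20 = 11/10\<close>.\<close>

lemma norm_one_plus_power_le:
  assumes "s \<ge> 1"
  shows "\<exists>K\<ge>0. \<forall>w :: complex. cmod (1 + w) ^ s \<le> 22/21 * cmod w ^ s + K"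
proof -
  define R where "R = 22 * real s"
  have R: "R > 0" using assms by (simp add: R_def)
  show ?thesis
  proof (intro exI[of _ "(1 + R) ^ s"] conjI allI)
    show "0 \<le> (1 + R) ^ s" using R by simp
    fix w :: complex
    have le: "cmod (1 + w) \<le> 1 + cmod w" using norm_triangle_ineq[of 1 w] by simp
    show "cmod (1 + w) ^ s \<le> 22/21 * cmod w ^ s + (1 + R) ^ s"
    proof (cases "cmod w \<le> R")
      case True
      then have "cmod (1 + w) ^ s \<le> (1 + R) ^ s" using le by (intro power_mono) auto
      then show ?thesis by (simp add: add_increasing)
    next
      case False
      then have w: "cmod w > R" "cmod w > 0" using R by linarith+
      have "cmod (1 + w) ^ s \<le> (cmod w * (1 + 1 / R)) ^ s"
      proof (rule power_mono)
        have "cmod w / R \<ge> 1" using w R by simp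
        then show "cmod (1 + w) \<le> cmod w * (1 + 1 / R)" using le by (simp add: algebra_simps)
      qed simp
      also have "\<dots> = cmod w ^ s * (1 + 1 / R) ^ s" by (rule power_mult_distrib)
      finally have 1: "cmod (1 + w) ^ s \<le> cmod w ^ s * (1 + 1 / R) ^ s" .
      have "(1 + 1 / R) ^ s \<le> exp (1 / R) ^ s"
        using R by (intro power_mono) (auto intro: add_nonneg_nonneg)
      also have "exp (1 / R) ^ s = exp (1 / 22)"
        using assms by (simp add: exp_of_nat_mult[symmetric] R_def)
      also have "exp (1 / 22 :: real) \<le> 22/21"
      proof -
        have "1 - 1/22 \<le> exp (- (1/22) :: real)" using exp_ge_add_one_self[of "- (1/22) :: real"] by simp
        then have "21/22 * exp (1/22) \<le> exp (- (1/22)) * exp (1/22 :: real)" by (intro mult_right_mono) auto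
        also have "\<dots> = 1" by (simp add: exp_add[symmetric])
        finally show ?thesis by simp
      qed
      finally have "cmod w ^ s * (1 + 1 / R) ^ s \<le> cmod w ^ s * (22/21)" by (intro mult_left_mono) auto
      then have "cmod (1 + w) ^ s \<le> 22/21 * cmod w ^ s" using 1 by simp
      moreover have "0 \<le> (1 + R) ^ s" using R by simp
      ultimately show ?thesis by linarith
    qed
  qed
qed

text \<open>The pure powers keep the coefficient 1, since a large factor would spoil the
  contraction. In the induction the new mixed terms are reduced to the two extreme ones by
  \<open>x^2 y^(s-1) \<le> x y^s + x^s y\<close>, which holds by comparing \<open>x\<close> with
  \<open>y\<close>.\<close>

lemma power_add_le_cross:
  fixes a b :: real
  assumes "a \<ge> 0" "b \<ge> 0" "s \<ge> 2"
  shows "(a + b) ^ s \<le> a ^ s + b ^ s + 4 ^ s * (a ^ (s - 1) * b + a * b ^ (s - 1))"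
  using assms(3)
proof (induction s rule: dec_induct)
  case base
  have "0 \<le> a * b" using assms by simp
  then show ?case by (simp add: power2_eq_square algebra_simps)
next
  case (step s)
  obtain k where "s = 2 + k" using step.hyps le_Suc_ex by blast
  then have k: "s = Suc (Suc k)" by simp
  have mix: "x\<^sup>2 * y ^ (s - 1) \<le> x * y ^ s + x ^ s * y" if "x \<ge> 0" "y \<ge> 0" for x y :: real
  proof (cases "x \<le> y")
    case True
    then have "x * (x * y ^ (s - 1)) \<le> x * (y * y ^ (s - 1))"
      using that by (intro mult_left_mono mult_right_mono) auto
    then show ?thesis using that by (simp add: k power2_eq_square add_increasing2)
  next
    case False
    then have "x\<^sup>2 * y * y ^ k \<le> x\<^sup>2 * y * x ^ k" using that by (intro mult_left_mono power_mono) auto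
    then show ?thesis using that by (simp add: k power2_eq_square mult_ac add_increasing)
  qed
  define X where "X = a ^ s * b"
  define Y where "Y = a * b ^ s"
  have XY: "X \<ge> 0" "Y \<ge> 0" using assms by (auto simp: X_def Y_def)
  have m1: "a\<^sup>2 * b ^ (s - 1) \<le> Y + X" using mix[of a b] assms by (simp add: X_def Y_def)
  have m2: "a ^ (s - 1) * b\<^sup>2 \<le> X + Y" using mix[of b a] assms by (simp add: X_def Y_def mult_ac)
  have "(a + b) ^ Suc s \<le> (a + b) * (a ^ s + b ^ s + 4 ^ s * (a ^ (s - 1) * b + a * b ^ (s - 1)))"
    using step.IH assms by (simp add: mult_left_mono)
  also have "\<dots> = a ^ Suc s + b ^ Suc s + X + Y + 4 ^ s * (X + Y + a\<^sup>2 * b ^ (s - 1) + a ^ (s - 1) * b\<^sup>2)"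
    by (simp add: X_def Y_def k power2_eq_square algebra_simps)
  also have "\<dots> \<le> a ^ Suc s + b ^ Suc s + 4 ^ s * (X + Y) + 4 ^ s * (X + Y + (Y + X) + (X + Y))"
  proof -
    have "X + Y \<le> 4 ^ s * (X + Y)" using XY mult_right_mono[of 1 "4 ^ s" "X + Y"] by simp
    moreover have "4 ^ s * (X + Y + a\<^sup>2 * b ^ (s - 1) + a ^ (s - 1) * b\<^sup>2) \<le> 4 ^ s * (X + Y + (Y + X) + (X + Y))"
      using m1 m2 by (intro mult_left_mono add_mono) auto
    moreover have "X + Y \<le> Q \<Longrightarrow> P \<le> R \<Longrightarrow> u + v + X + Y + P \<le> u + v + Q + R" for P Q R u v :: real
      by linarith
    ultimately show ?thesis by blast
  qed
  also have "\<dots> = a ^ Suc s + b ^ Suc s + 4 ^ Suc s * (X + Y)" by (simp add: algebra_simps)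
  finally show ?case by (simp add: X_def Y_def)
qed

lemma power_sum_le:
  fixes x :: "'i \<Rightarrow> real"
  assumes "finite F" "\<And>i. i \<in> F \<Longrightarrow> x i \<ge> 0" "k \<ge> 1"
  shows "(\<Sum>i\<in>F. x i) ^ k \<le> real (card F) ^ k * (\<Sum>i\<in>F. x i ^ k)"
proof (cases "F = {}")
  case False
  define M where "M = Max (x ` F)"
  have "M \<in> x ` F" unfolding M_def using assms(1) False by (intro Max_in) auto
  then obtain j where j: "j \<in> F" "M = x j" by auto
  have "(\<Sum>i\<in>F. x i) \<le> (\<Sum>i\<in>F. M)" unfolding M_def using assms(1) by (intro sum_mono Max_ge) auto
  then have "(\<Sum>i\<in>F. x i) ^ k \<le> (real (card F) * x j) ^ k"
    using assms j by (intro power_mono sum_nonneg) auto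
  also have "\<dots> \<le> real (card F) ^ k * (\<Sum>i\<in>F. x i ^ k)"
    unfolding power_mult_distrib using assms j by (intro mult_left_mono member_le_sum) auto
  finally show ?thesis .
qed (use assms in \<open>simp add: power_0_left\<close>)

text \<open>Again the pure powers have coefficient 1. Every mixed term is
  \<open>x i ^ (s - 1) * x j\<close> with \<open>i \<noteq> j\<close>. With one summand for each
  subtree, its mean involves only moments of orders \<open>s - 1\<close> and 1, which makes an
  induction on the order possible.\<close>

lemma power_sum_le_cross:
  assumes "finite I" "s \<ge> 2"
  shows "\<exists>C\<ge>0. \<forall>x :: 'i \<Rightarrow> real. (\<forall>i. x i \<ge> 0) \<longrightarrow>
    (\<Sum>i\<in>I. x i) ^ s \<le> (\<Sum>i\<in>I. x i ^ s) + (\<Sum>i\<in>I. \<Sum>j\<in>I - {i}. C * (x i ^ (s - 1) * x j))"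
  using assms(1)
proof (induction I)
  case empty
  then show ?case using assms(2) by (intro exI[of _ 0]) (auto simp: power_0_left)
next
  case (insert a F)
  then obtain C where C: "C \<ge> 0" "\<And>x :: 'i \<Rightarrow> real. (\<forall>i. x i \<ge> 0) \<Longrightarrow>
    (\<Sum>i\<in>F. x i) ^ s \<le> (\<Sum>i\<in>F. x i ^ s) + (\<Sum>i\<in>F. \<Sum>j\<in>F - {i}. C * (x i ^ (s - 1) * x j))" by blast
  define N where "N = real (card F) ^ (s - 1) + 1"
  define D where "D = C + 4 ^ s * N"
  have "N \<ge> 1" by (simp add: N_def)
  then have D: "D \<ge> C" "D \<ge> 4 ^ s" "D \<ge> 4 ^ s * N" "D \<ge> 0" using C(1)
    mult_left_mono[of 1 N "4 ^ s :: real"] unfolding D_def by (simp_all add: add_increasing)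
  show ?case
  proof (intro exI[of _ D] conjI allI impI \<open>D \<ge> 0\<close>)
    fix x :: "'i \<Rightarrow> real" assume x: "\<forall>i. x i \<ge> 0"
    define Y where "Y = (\<Sum>i\<in>F. x i)"
    have Y0: "Y \<ge> 0" unfolding Y_def using x by (intro sum_nonneg) auto
    have Yp: "Y ^ (s - 1) \<le> N * (\<Sum>i\<in>F. x i ^ (s - 1))"
    proof -
      have "Y ^ (s - 1) \<le> real (card F) ^ (s - 1) * (\<Sum>i\<in>F. x i ^ (s - 1))"
        unfolding Y_def using insert.hyps x assms(2) by (intro power_sum_le) auto
      also have "\<dots> \<le> N * (\<Sum>i\<in>F. x i ^ (s - 1))"
        unfolding N_def using x by (intro mult_right_mono sum_nonneg) auto
      finally show ?thesis .
    qed
    have t1: "4 ^ s * (x a ^ (s - 1) * Y) \<le> (\<Sum>j\<in>F. D * (x a ^ (s - 1) * x j))"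
      unfolding Y_def sum_distrib_left using D x by (intro sum_mono mult_right_mono) auto
    have t2: "4 ^ s * (x a * Y ^ (s - 1)) \<le> (\<Sum>i\<in>F. D * (x i ^ (s - 1) * x a))"
    proof -
      have "4 ^ s * (x a * Y ^ (s - 1)) \<le> 4 ^ s * (x a * (N * (\<Sum>i\<in>F. x i ^ (s - 1))))"
        using Yp x by (intro mult_left_mono) auto
      also have "\<dots> = (\<Sum>i\<in>F. (4 ^ s * N) * (x i ^ (s - 1) * x a))"
        by (simp add: sum_distrib_left mult_ac)
      also have "\<dots> \<le> (\<Sum>i\<in>F. D * (x i ^ (s - 1) * x a))"
        using D x by (intro sum_mono mult_right_mono) auto
      finally show ?thesis .
    qed
    have IH: "Y ^ s \<le> (\<Sum>i\<in>F. x i ^ s) + (\<Sum>i\<in>F. \<Sum>j\<in>F - {i}. D * (x i ^ (s - 1) * x j))"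
    proof -
      have "(\<Sum>i\<in>F. \<Sum>j\<in>F - {i}. C * (x i ^ (s - 1) * x j)) \<le> (\<Sum>i\<in>F. \<Sum>j\<in>F - {i}. D * (x i ^ (s - 1) * x j))"
        using D x by (intro sum_mono mult_right_mono) auto
      then show ?thesis using C(2)[OF x] unfolding Y_def by linarith
    qed
    have "(\<Sum>i\<in>insert a F. x i) ^ s = (x a + Y) ^ s" using insert.hyps by (simp add: Y_def)
    also have "\<dots> \<le> x a ^ s + Y ^ s + 4 ^ s * (x a ^ (s - 1) * Y + x a * Y ^ (s - 1))"
      using x Y0 assms(2) by (intro power_add_le_cross) auto
    also have "\<dots> \<le> x a ^ s + (\<Sum>i\<in>F. x i ^ s) + (\<Sum>j\<in>F. D * (x a ^ (s - 1) * x j))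
        + ((\<Sum>i\<in>F. D * (x i ^ (s - 1) * x a)) + (\<Sum>i\<in>F. \<Sum>j\<in>F - {i}. D * (x i ^ (s - 1) * x j)))"
      using IH t1 t2 by (simp add: distrib_left)
    also have "(\<Sum>i\<in>F. D * (x i ^ (s - 1) * x a)) + (\<Sum>i\<in>F. \<Sum>j\<in>F - {i}. D * (x i ^ (s - 1) * x j))
       = (\<Sum>i\<in>F. \<Sum>j\<in>insert a F - {i}. D * (x i ^ (s - 1) * x j))"
    proof -
      have "insert a F - {i} = insert a (F - {i})" if "i \<in> F" for i using insert.hyps that by auto
      then show ?thesis using insert.hyps by (simp add: sum.distrib[symmetric])
    qed
    also have "(\<Sum>j\<in>F. D * (x a ^ (s - 1) * x j)) = (\<Sum>j\<in>insert a F - {a}. D * (x a ^ (s - 1) * x j))"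
      using insert.hyps by (intro sum.cong) auto
    finally show "(\<Sum>i\<in>insert a F. x i) ^ s \<le> (\<Sum>i\<in>insert a F. x i ^ s)
        + (\<Sum>i\<in>insert a F. \<Sum>j\<in>insert a F - {i}. D * (x i ^ (s - 1) * x j))"
      using insert.hyps by simp
  qed
qed

section \<open>Moments of the level polynomial of all orders\<close>

lemma mean_level_poly_bound:
  "\<exists>C\<ge>0. \<forall>z \<zeta> \<alpha>. z = \<zeta> ^ CARD('d::finite) \<longrightarrow> cmod \<zeta> \<le> 2 \<longrightarrow> 3/4 \<le> \<alpha> \<longrightarrow> \<alpha> \<le> 3 \<longrightarrow>
     (\<forall>\<eta>. \<eta> ^ CARD('d) = 1 \<longrightarrow> 2 * Re (\<zeta> * \<eta>) \<le> \<alpha> + 1) \<longrightarrow>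
     (\<forall>n. cmod (mean_level_poly TYPE('d) z n) \<le> C * real n powr \<alpha>)"
proof -
  have "1 \<le> CARD('d)" by (simp add: Suc_leI)
  from mean_recursion_bound[OF this]
  obtain C where C: "C \<ge> 0" "\<forall>(f :: nat \<Rightarrow> complex) \<zeta> \<alpha>. f 0 = 0 \<longrightarrow>
    (\<forall>n. f (Suc n) = 1 + (2 * \<zeta>) ^ CARD('d) * (cesaro ^^ CARD('d)) f n) \<longrightarrow>
    cmod \<zeta> \<le> 2 \<longrightarrow> 3/4 \<le> \<alpha> \<longrightarrow> \<alpha> \<le> 3 \<longrightarrow> (\<forall>\<eta>. \<eta> ^ CARD('d) = 1 \<longrightarrow> 2 * Re (\<zeta> * \<eta>) \<le> \<alpha> + 1) \<longrightarrow>
    (\<forall>n. cmod (f n) \<le> C * real n powr \<alpha>)" by (elim exE conjE)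
  show ?thesis
  proof (intro exI[of _ C] conjI C(1) allI impI)
    fix z \<zeta> :: complex and \<alpha> n
    assume "z = \<zeta> ^ CARD('d)" "cmod \<zeta> \<le> 2" "3/4 \<le> \<alpha>" "\<alpha> \<le> 3"
      "\<forall>\<eta>. \<eta> ^ CARD('d) = 1 \<longrightarrow> 2 * Re (\<zeta> * \<eta>) \<le> \<alpha> + 1"
    then show "cmod (mean_level_poly TYPE('d) z n) \<le> C * real n powr \<alpha>"
      using C(2)[rule_format, of "mean_level_poly TYPE('d) z" \<zeta> \<alpha> n]
      by (simp add: mean_level_poly_Suc power_mult_distrib)
  qed
qed

text \<open>For \<open>s \<ge> 2\<close> the exponent \<open>s \<alpha>\<close> is at least \<open>3/2\<close>, where \<open>2^d C^d\<close> contracts by the factor \<open>(4/5)^d\<close>.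
  This leaves room for the factor \<open>11/10\<close>, which absorbs \<open>cmod z ^ s\<close> and the node at the root.\<close>

definition moment_domain :: "'d :: finite itself \<Rightarrow> nat \<Rightarrow> (complex \<times> real) set" where
  "moment_domain _ s = {(z, \<alpha>). \<exists>\<zeta>. z = \<zeta> ^ CARD('d) \<and> cmod \<zeta> \<le> 2 \<and> 3/4 \<le> \<alpha> \<and> \<alpha> \<le> 3/2 \<and>
     (\<forall>\<eta>. \<eta> ^ CARD('d) = 1 \<longrightarrow> 2 * Re (\<zeta> * \<eta>) \<le> \<alpha> + 1) \<and> cmod z ^ s \<le> 21/20}"

lemma moment_domain_mono:
  assumes "s \<le> s'" "(z, \<alpha>) \<in> moment_domain TYPE('d::finite) s'"
  shows "(z, \<alpha>) \<in> moment_domain TYPE('d) s"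
proof -
  have "cmod z ^ s' \<le> 21/20" using assms(2) by (auto simp: moment_domain_def)
  then have "cmod z ^ s \<le> 21/20"
  proof (cases "cmod z \<le> 1")
    case True
    then have "cmod z ^ s \<le> 1" by (intro power_le_one) auto
    then show ?thesis by simp
  next
    case False
    then have "cmod z ^ s \<le> cmod z ^ s'" using assms(1) by (intro power_increasing) auto
    then show ?thesis using \<open>cmod z ^ s' \<le> 21/20\<close> by simp
  qed
  then show ?thesis using assms(2) by (auto simp: moment_domain_def)
qed

definition level_moment :: "'d :: finite itself \<Rightarrow> complex \<Rightarrow> nat \<Rightarrow> nat \<Rightarrow> real" where
  "level_moment _ z s n = list_mean n (\<lambda>xs :: (real ^ 'd) list. cmod (level_poly z xs) ^ s)"

lemma level_moment_nonneg: "0 \<le> level_moment TYPE('d::finite) z s n"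
  unfolding level_moment_def by (rule list_mean_nonneg) simp

lemma tree_invariant_norm_level_poly: "tree_invariant (\<lambda>xs. cmod (level_poly z xs) ^ s)"
  by (rule tree_invariant_level_poly)

lemma subtree_functional_Cons: "subtree_functional S F (x # xs) = F (filter (\<lambda>y. orthant x y = S) xs)"
  by (simp add: subtree_functional_def)

text \<open>\<open>X S S'\<close> is any majorant for the cross terms between two subtrees: the
  exact inner products for \<open>s = 2\<close>, products of absolute values for larger
  \<open>s\<close>. The number of pairs of cells is absorbed in \<open>K\<close>.\<close>

lemma level_moment_recursion:
  assumes s: "s \<ge> 1"
  shows "\<exists>K\<ge>0. \<forall>z (X :: 'd::finite set \<Rightarrow> 'd set \<Rightarrow> (real ^ 'd) list \<Rightarrow> real) m B. cmod z ^ s \<le> 21/20 \<longrightarrow>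
    (\<forall>S S'. list_measurable (X S S')) \<longrightarrow>
    (\<forall>x xs. cmod (\<Sum>S\<in>UNIV. level_poly z (filter (\<lambda>y. orthant x y = S) xs)) ^ s
       \<le> (\<Sum>S\<in>UNIV. cmod (level_poly z (filter (\<lambda>y. orthant x y = S) xs)) ^ s)
        + (\<Sum>S\<in>UNIV. \<Sum>S'\<in>UNIV - {S}. X S S' (x # xs))) \<longrightarrow>
    (\<forall>S S'. S \<noteq> S' \<longrightarrow> list_mean (Suc m) (X S S') \<le> B) \<longrightarrow> B \<ge> 0 \<longrightarrow>
    level_moment TYPE('d) z s (Suc m) \<le> 11/10 * 2 ^ CARD('d) * (cesaro ^^ CARD('d)) (level_moment TYPE('d) z s) m
      + K * (1 + B)"
proof -
  obtain K0 where K0: "K0 \<ge> 0" "\<And>w :: complex. cmod (1 + w) ^ s \<le> 22/21 * cmod w ^ s + K0"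
    using norm_one_plus_power_le[OF s] by blast
  define c :: real where "c = 11/10 * (2 ^ CARD('d) * 2 ^ CARD('d))"
  show ?thesis
  proof (intro exI[of _ "K0 + c"] conjI allI impI)
    show "0 \<le> K0 + c" using K0(1) by (simp add: c_def)
    fix z and X :: "'d set \<Rightarrow> 'd set \<Rightarrow> (real ^ 'd) list \<Rightarrow> real" and m :: nat and B :: real
    assume z: "cmod z ^ s \<le> 21/20" and X: "\<forall>S S'. list_measurable (X S S')"
      and pt: "\<forall>x xs. cmod (\<Sum>S\<in>UNIV. level_poly z (filter (\<lambda>y. orthant x y = S) xs)) ^ s
         \<le> (\<Sum>S\<in>UNIV. cmod (level_poly z (filter (\<lambda>y. orthant x y = S) xs)) ^ s)
        + (\<Sum>S\<in>UNIV. \<Sum>S'\<in>UNIV - {S}. X S S' (x # xs))"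
      and XB: "\<forall>S S'. S \<noteq> S' \<longrightarrow> list_mean (Suc m) (X S S') \<le> B" and B: "B \<ge> 0"
    let ?P = "\<lambda>xs :: (real ^ 'd) list. cmod (level_poly z xs) ^ s"
    let ?D = "\<lambda>xs. \<Sum>S\<in>UNIV. subtree_functional S ?P xs"
    let ?X = "\<lambda>xs. \<Sum>S\<in>UNIV. \<Sum>S'\<in>UNIV - {S}. X S S' xs"
    have mD: "list_measurable ?D"
      by (intro list_measurable_sum list_measurable_subtree list_measurable_norm_level_poly) auto
    have mX: "list_measurable ?X" using X by (intro list_measurable_sum) auto
    have "level_moment TYPE('d) z s (Suc m) \<le> list_mean (Suc m) (\<lambda>xs. 11/10 * (?D xs + ?X xs) + K0)"
      unfolding level_moment_def
    proof (rule list_mean_mono)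
      show "list_measurable ?P" by (rule list_measurable_norm_level_poly)
      show "list_measurable (\<lambda>xs. 11/10 * (?D xs + ?X xs) + K0)"
        by (intro list_measurable_add list_measurable_mult list_measurable_const mD mX)
      fix xs :: "(real ^ 'd) list" assume "length xs = Suc m"
      then obtain x ys where xs: "xs = x # ys" by (auto simp: length_Suc_conv)
      define w where "w = (\<Sum>S\<in>UNIV. level_poly z (filter (\<lambda>y. orthant x y = S) ys))"
      define R where "R = ?D xs + ?X xs"
      have le: "cmod w ^ s \<le> R"
        using pt unfolding R_def xs subtree_functional_Cons w_def by blast
      have "?P xs = cmod (1 + z * w) ^ s" by (simp add: xs level_poly_Cons w_def)
      also have "\<dots> \<le> 22/21 * cmod (z * w) ^ s + K0" by (rule K0(2))
      also have "cmod (z * w) ^ s = cmod z ^ s * cmod w ^ s" by (simp add: norm_mult power_mult_distrib)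
      also have "cmod z ^ s * cmod w ^ s \<le> 21/20 * R"
        using z le by (intro mult_mono) auto
      finally show "?P xs \<le> 11/10 * (?D xs + ?X xs) + K0" unfolding R_def[symmetric] by simp
    qed
    also have "\<dots> = 11/10 * (list_mean (Suc m) ?D + list_mean (Suc m) ?X) + K0"
      using mD mX by (simp only: list_mean_add list_mean_cmult list_mean_const list_measurable_add
          list_measurable_mult list_measurable_const)
    also have "list_mean (Suc m) ?D = 2 ^ CARD('d) * (cesaro ^^ CARD('d)) (level_moment TYPE('d) z s) m"
    proof -
      have "list_mean (Suc m) ?D = (\<Sum>S\<in>(UNIV :: 'd set set). (cesaro ^^ CARD('d)) (level_moment TYPE('d) z s) m)"
        unfolding level_moment_def
        by (subst list_mean_sum)
          (auto intro!: list_measurable_subtree list_measurable_norm_level_poly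
            simp: list_mean_subtree[OF list_measurable_norm_level_poly tree_invariant_norm_level_poly])
      then show ?thesis by (simp add: card_Pow flip: Pow_UNIV)
    qed
    also have "list_mean (Suc m) ?X \<le> 2 ^ CARD('d) * 2 ^ CARD('d) * B"
    proof -
      have "list_mean (Suc m) ?X = (\<Sum>S\<in>UNIV. \<Sum>S'\<in>UNIV - {S}. list_mean (Suc m) (X S S'))"
        using X by (simp add: list_mean_sum list_measurable_sum)
      also have "\<dots> \<le> (\<Sum>S\<in>(UNIV :: 'd set set). \<Sum>S'\<in>(UNIV :: 'd set set). B)"
        using XB B by (intro sum_mono order_trans[OF sum_mono sum_mono2]) auto
      also have "\<dots> = 2 ^ CARD('d) * 2 ^ CARD('d) * B" by (simp add: card_Pow flip: Pow_UNIV)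
      finally show ?thesis .
    qed
    finally have "level_moment TYPE('d) z s (Suc m)
      \<le> 11/10 * (2 ^ CARD('d) * (cesaro ^^ CARD('d)) (level_moment TYPE('d) z s) m + 2 ^ CARD('d) * 2 ^ CARD('d) * B) + K0"
      by simp
    also have "\<dots> = 11/10 * 2 ^ CARD('d) * (cesaro ^^ CARD('d)) (level_moment TYPE('d) z s) m + (c * B + K0)"
      by (simp add: c_def)
    also have "c * B + K0 \<le> (K0 + c) * (1 + B)"
    proof -
      have "0 \<le> K0 * B" "0 \<le> c" using K0(1) B by (auto simp: c_def)
      then show ?thesis by (simp add: algebra_simps)
    qed
    finally show "level_moment TYPE('d) z s (Suc m) \<le> 11/10 * 2 ^ CARD('d) *
      (cesaro ^^ CARD('d)) (level_moment TYPE('d) z s) m + (K0 + c) * (1 + B)" by simp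
  qed
qed

text \<open>Cross terms with means of order \<open>n powr (s \<alpha>)\<close> are an inhomogeneity
  of exactly the size that \<open>contraction_growth\<close> tolerates, because this exponent lies
  between 3/2 and \<open>3/2 s\<close>.\<close>

lemma level_moment_growth:
  assumes s: "s \<ge> 2" and G: "G \<ge> 0"
    and X: "\<And>z (S :: 'd set) (S' :: 'd set). list_measurable (X z S S' :: (real ^ 'd::finite) list \<Rightarrow> real)"
    and pt: "\<And>z x xs. cmod (\<Sum>S\<in>UNIV. level_poly z (filter (\<lambda>y. orthant (x :: real ^ 'd) y = S) xs)) ^ s
         \<le> (\<Sum>S\<in>UNIV. cmod (level_poly z (filter (\<lambda>y. orthant x y = S) xs)) ^ s)
        + (\<Sum>S\<in>UNIV. \<Sum>S'\<in>UNIV - {S}. X z S S' (x # xs))"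
    and XB: "\<And>z \<alpha> S S' m. (z, \<alpha>) \<in> moment_domain TYPE('d) s \<Longrightarrow> S \<noteq> S' \<Longrightarrow>
        list_mean (Suc m) (X z S S') \<le> G * real (Suc m) powr (real s * \<alpha>)"
  shows "\<exists>C\<ge>0. \<forall>z \<alpha> n. (z, \<alpha>) \<in> moment_domain TYPE('d) s \<longrightarrow>
     level_moment TYPE('d) z s n \<le> C * real n powr (real s * \<alpha>)"
proof -
  have "s \<ge> 1" using s by simp
  from level_moment_recursion[OF this, where 'd = 'd]
  obtain K where K: "K \<ge> 0" "\<And>z (X :: 'd set \<Rightarrow> 'd set \<Rightarrow> (real ^ 'd) list \<Rightarrow> real) m B. cmod z ^ s \<le> 21/20 \<Longrightarrow>
    (\<forall>S S'. list_measurable (X S S')) \<Longrightarrow>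
    (\<forall>x xs. cmod (\<Sum>S\<in>UNIV. level_poly z (filter (\<lambda>y. orthant x y = S) xs)) ^ s
       \<le> (\<Sum>S\<in>UNIV. cmod (level_poly z (filter (\<lambda>y. orthant x y = S) xs)) ^ s)
        + (\<Sum>S\<in>UNIV. \<Sum>S'\<in>UNIV - {S}. X S S' (x # xs))) \<Longrightarrow>
    (\<forall>S S'. S \<noteq> S' \<longrightarrow> list_mean (Suc m) (X S S') \<le> B) \<Longrightarrow> B \<ge> 0 \<Longrightarrow>
    level_moment TYPE('d) z s (Suc m) \<le> 11/10 * 2 ^ CARD('d) * (cesaro ^^ CARD('d)) (level_moment TYPE('d) z s) m
      + K * (1 + B)" by (elim exE conjE) simp
  have "K * (1 + G) \<ge> 0" "1 \<le> CARD('d)" using K(1) G by (auto simp: Suc_leI)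
  from contraction_growth[OF this, of "3/2 * real s"]
  obtain C where C: "C \<ge> 0" "\<forall>e \<beta>. (\<forall>n. 0 \<le> e n) \<longrightarrow> e 0 = 0 \<longrightarrow> 3/2 \<le> \<beta> \<longrightarrow> \<beta> \<le> 3/2 * real s \<longrightarrow>
     (\<forall>n. e (Suc n) \<le> 11/10 * 2 ^ CARD('d) * (cesaro ^^ CARD('d)) e n + (K * (1 + G)) * real (Suc n) powr \<beta>) \<longrightarrow>
     (\<forall>n. e n \<le> C * real n powr \<beta>)" by (elim exE conjE)
  show ?thesis
  proof (intro exI[of _ C] conjI C(1) allI impI)
    fix z \<alpha> n assume dom: "(z, \<alpha>) \<in> moment_domain TYPE('d) s"
    then have \<alpha>: "3/4 \<le> \<alpha>" "\<alpha> \<le> 3/2" and zs: "cmod z ^ s \<le> 21/20" by (auto simp: moment_domain_def)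
    have "2 * (3/4) \<le> real s * \<alpha>" using s \<alpha> by (intro mult_mono) auto
    then have sa: "3/2 \<le> real s * \<alpha>" by simp
    have sb: "real s * \<alpha> \<le> 3/2 * real s" using mult_right_mono[OF \<alpha>(2), of "real s"] by (simp add: mult.commute)
    have e0: "level_moment TYPE('d) z s 0 = 0" using s by (simp add: level_moment_def power_0_left)
    have rec: "level_moment TYPE('d) z s (Suc m) \<le> 11/10 * 2 ^ CARD('d) * (cesaro ^^ CARD('d)) (level_moment TYPE('d) z s) m
      + (K * (1 + G)) * real (Suc m) powr (real s * \<alpha>)" for m
    proof -
      have "level_moment TYPE('d) z s (Suc m) \<le> 11/10 * 2 ^ CARD('d) * (cesaro ^^ CARD('d)) (level_moment TYPE('d) z s) m
        + K * (1 + G * real (Suc m) powr (real s * \<alpha>))"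
        by (rule K(2)[OF zs, of "X z"]) (use X pt XB[OF dom] G in auto)
      also have "K * (1 + G * real (Suc m) powr (real s * \<alpha>)) \<le> K * (1 * real (Suc m) powr (real s * \<alpha>) + G * real (Suc m) powr (real s * \<alpha>))"
        using K(1) sa by (intro mult_left_mono add_right_mono) (auto intro: ge_one_powr_ge_zero)
      finally show ?thesis by (simp add: algebra_simps)
    qed
    show "level_moment TYPE('d) z s n \<le> C * real n powr (real s * \<alpha>)"
      using C(2)[rule_format, of "level_moment TYPE('d) z s" "real s * \<alpha>" n] level_moment_nonneg e0 sa sb rec by blast
  qed
qed

text \<open>Here the cancellation in the mean is transferred to second moments. In the expansion of
  the squared modulus the cross terms are products of real parts, and of imaginary parts, of two
  conditionally independent subtrees; their means are controlled by
  \<open>mean_level_poly_bound\<close>. Bounding \<open>level_poly z\<close> termwise would only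
  give the growth that belongs to \<open>cmod z\<close>.\<close>

lemma second_moment_bound:
  "\<exists>C\<ge>0. \<forall>z \<alpha> n. (z, \<alpha>) \<in> moment_domain TYPE('d::finite) 2 \<longrightarrow>
     level_moment TYPE('d) z 2 n \<le> C * real n powr (2 * \<alpha>)"
proof -
  obtain C where C: "C \<ge> 0" "\<forall>z \<zeta> \<alpha>. z = \<zeta> ^ CARD('d::finite) \<longrightarrow> cmod \<zeta> \<le> 2 \<longrightarrow> 3/4 \<le> \<alpha> \<longrightarrow> \<alpha> \<le> 3 \<longrightarrow>
     (\<forall>\<eta>. \<eta> ^ CARD('d) = 1 \<longrightarrow> 2 * Re (\<zeta> * \<eta>) \<le> \<alpha> + 1) \<longrightarrow>
     (\<forall>n. cmod (mean_level_poly TYPE('d) z n) \<le> C * real n powr \<alpha>)"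
    using mean_level_poly_bound[where 'd = 'd] by (elim exE conjE)
  let ?R = "\<lambda>z (xs :: (real ^ 'd) list). Re (level_poly z xs)"
  let ?I = "\<lambda>z (xs :: (real ^ 'd) list). Im (level_poly z xs)"
  let ?X = "\<lambda>z S S' xs. subtree_functional S (?R z) xs * subtree_functional S' (?R z) xs
     + subtree_functional S (?I z) xs * subtree_functional S' (?I z) xs"
  have mR: "list_measurable (\<lambda>xs. subtree_functional S (?R z) xs * subtree_functional S' (?R z) xs)"
    and mI: "list_measurable (\<lambda>xs. subtree_functional S (?I z) xs * subtree_functional S' (?I z) xs)" for z S S'
    by (intro list_measurable_mult list_measurable_subtree list_measurable_Re_level_poly list_measurable_Im_level_poly)+
  have "\<exists>C\<ge>0. \<forall>z \<alpha> n. (z, \<alpha>) \<in> moment_domain TYPE('d::finite) 2 \<longrightarrow>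
     level_moment TYPE('d) z 2 n \<le> C * real n powr (real 2 * \<alpha>)"
  proof (rule level_moment_growth[where G = "2 * C\<^sup>2" and X = ?X])
    show "list_measurable (?X z S S')" for z S S'
      by (intro list_measurable_add mR mI)
    show "cmod (\<Sum>S\<in>UNIV. level_poly z (filter (\<lambda>y. orthant x y = S) xs)) ^ 2
         \<le> (\<Sum>S\<in>UNIV. cmod (level_poly z (filter (\<lambda>y. orthant x y = S) xs)) ^ 2)
        + (\<Sum>S\<in>UNIV. \<Sum>S'\<in>UNIV - {S}. ?X z S S' (x # xs))" for z and x :: "real ^ 'd" and xs
    proof -
      define p where "p S = level_poly z (filter (\<lambda>y. orthant x y = S) xs)" for S
      have "cmod (\<Sum>S\<in>UNIV. p S) ^ 2 = (\<Sum>S\<in>UNIV. \<Sum>S'\<in>UNIV. Re (p S) * Re (p S') + Im (p S) * Im (p S'))"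
        unfolding cmod_power2 by (simp add: power2_eq_square sum_product sum.distrib)
      also have "\<dots> = (\<Sum>S\<in>UNIV. cmod (p S) ^ 2 + (\<Sum>S'\<in>UNIV - {S}. Re (p S) * Re (p S') + Im (p S) * Im (p S')))"
      proof (rule sum.cong[OF refl])
        fix S
        show "(\<Sum>S'\<in>UNIV. Re (p S) * Re (p S') + Im (p S) * Im (p S'))
          = cmod (p S) ^ 2 + (\<Sum>S'\<in>UNIV - {S}. Re (p S) * Re (p S') + Im (p S) * Im (p S'))"
          unfolding cmod_power2 by (subst sum.remove[of UNIV S]) (auto simp: power2_eq_square)
      qed
      finally show ?thesis unfolding p_def subtree_functional_Cons sum.distrib by simp
    qed
    show "list_mean (Suc m) (?X z S S') \<le> 2 * C\<^sup>2 * real (Suc m) powr (real 2 * \<alpha>)"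
      if dom: "(z, \<alpha>) \<in> moment_domain TYPE('d) 2" and S: "S \<noteq> S'" for z \<alpha> S S' m
    proof -
      have f: "cmod (mean_level_poly TYPE('d) z j) \<le> C * real (Suc m) powr \<alpha>" if "j \<le> m" for j
      proof -
        have "cmod (mean_level_poly TYPE('d) z j) \<le> C * real j powr \<alpha>"
          using C(2) dom by (auto simp: moment_domain_def)
        also have "\<dots> \<le> C * real (Suc m) powr \<alpha>"
          using C(1) dom that by (intro mult_left_mono powr_mono2) (auto simp: moment_domain_def)
        finally show ?thesis .
      qed
      have sq: "a * b \<le> C\<^sup>2 * real (Suc m) powr (real 2 * \<alpha>)"
        if "\<bar>a\<bar> \<le> C * real (Suc m) powr \<alpha>" "\<bar>b\<bar> \<le> C * real (Suc m) powr \<alpha>" for a b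
      proof -
        have "a * b \<le> \<bar>a\<bar> * \<bar>b\<bar>" by (metis abs_ge_self abs_mult)
        also have "\<dots> \<le> (C * real (Suc m) powr \<alpha>) * (C * real (Suc m) powr \<alpha>)"
          using that by (intro mult_mono) auto
        also have "\<dots> = C\<^sup>2 * real (Suc m) powr (real 2 * \<alpha>)"
          by (simp add: power2_eq_square powr_add[symmetric])
        finally show ?thesis .
      qed
      have "list_mean (Suc m) (?X z S S')
        = list_mean (Suc m) (\<lambda>xs. subtree_functional S (?R z) xs * subtree_functional S' (?R z) xs)
        + list_mean (Suc m) (\<lambda>xs. subtree_functional S (?I z) xs * subtree_functional S' (?I z) xs)"
        by (rule list_mean_add[OF mR mI])
      also have "\<dots> \<le> C\<^sup>2 * real (Suc m) powr (real 2 * \<alpha>) + C\<^sup>2 * real (Suc m) powr (real 2 * \<alpha>)"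
      proof (rule add_mono)
        show "list_mean (Suc m) (\<lambda>xs. subtree_functional S (?R z) xs * subtree_functional S' (?R z) xs)
          \<le> C\<^sup>2 * real (Suc m) powr (real 2 * \<alpha>)"
        proof (rule list_mean_subtree_mult_le[OF list_measurable_Re_level_poly tree_invariant_level_poly
              list_measurable_Re_level_poly tree_invariant_level_poly S])
          fix j k assume "j \<le> m" "k \<le> m"
          then show "list_mean j (?R z) * list_mean k (?R z) \<le> C\<^sup>2 * real (Suc m) powr (real 2 * \<alpha>)"
            unfolding list_mean_Re_level_poly by (intro sq order_trans[OF abs_Re_le_cmod f])
        qed
        show "list_mean (Suc m) (\<lambda>xs. subtree_functional S (?I z) xs * subtree_functional S' (?I z) xs)
          \<le> C\<^sup>2 * real (Suc m) powr (real 2 * \<alpha>)"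
        proof (rule list_mean_subtree_mult_le[OF list_measurable_Im_level_poly tree_invariant_level_poly
              list_measurable_Im_level_poly tree_invariant_level_poly S])
          fix j k assume "j \<le> m" "k \<le> m"
          then show "list_mean j (?I z) * list_mean k (?I z) \<le> C\<^sup>2 * real (Suc m) powr (real 2 * \<alpha>)"
            unfolding list_mean_Im_level_poly by (intro sq order_trans[OF abs_Im_le_cmod f])
        qed
      qed
      finally show ?thesis by simp
    qed
  qed auto
  then show ?thesis by simp
qed

lemma first_moment_bound:
  "\<exists>C\<ge>0. \<forall>z \<alpha> n. (z, \<alpha>) \<in> moment_domain TYPE('d::finite) 2 \<longrightarrow>
     level_moment TYPE('d) z 1 n \<le> C * real n powr \<alpha>"
proof -
  obtain C where C: "C \<ge> 0" "\<And>z \<alpha> n. (z, \<alpha>) \<in> moment_domain TYPE('d::finite) 2 \<Longrightarrow>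
     level_moment TYPE('d) z 2 n \<le> C * real n powr (2 * \<alpha>)"
    using second_moment_bound[where 'd = 'd] by (elim exE conjE) simp
  have "level_moment TYPE('d) z 1 n \<le> (C + 1) * real n powr \<alpha>"
    if dom: "(z, \<alpha>) \<in> moment_domain TYPE('d) 2" for z \<alpha> n
  proof (cases "n = 0")
    case False
    \<comment> \<open>The inequality \<open>y \<le> y^2 / a + a\<close>, with \<open>a\<close> of
      the expected size of \<open>y\<close>, takes the place of the Cauchy-Schwarz
      inequality.\<close>
    define a where "a = real n powr \<alpha>"
    have a: "a > 0" using False by (simp add: a_def)
    have "level_moment TYPE('d) z 1 n \<le> list_mean n (\<lambda>xs :: (real ^ 'd) list. (1 / a) * cmod (level_poly z xs) ^ 2 + a)"
      unfolding level_moment_def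
    proof (rule list_mean_mono)
      show "list_measurable (\<lambda>xs :: (real ^ 'd) list. (1 / a) * cmod (level_poly z xs) ^ 2 + a)"
        by (intro list_measurable_add list_measurable_mult list_measurable_const list_measurable_norm_level_poly)
      fix xs :: "(real ^ 'd) list"
      define y where "y = cmod (level_poly z xs)"
      have "0 \<le> (y - a)\<^sup>2" "0 \<le> y * a" using a by (auto simp: y_def)
      then have "y * a \<le> y\<^sup>2 + a * a" by (simp add: power2_eq_square algebra_simps)
      then have "y \<le> (y\<^sup>2 + a * a) / a" using a by (simp add: pos_le_divide_eq)
      also have "\<dots> = (1 / a) * y\<^sup>2 + a" using a by (simp add: add_divide_distrib)
      finally show "cmod (level_poly z xs) ^ 1 \<le> (1 / a) * cmod (level_poly z xs) ^ 2 + a" by (simp add: y_def)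
    qed (rule list_measurable_norm_level_poly)
    also have "\<dots> = (1 / a) * level_moment TYPE('d) z 2 n + a"
      unfolding level_moment_def
      by (simp only: list_mean_add list_mean_cmult list_mean_const list_measurable_mult list_measurable_const list_measurable_norm_level_poly)
    also have "level_moment TYPE('d) z 2 n \<le> C * (a * a)"
      using C(2)[OF dom, of n] by (simp add: a_def powr_add[symmetric])
    then have "(1 / a) * level_moment TYPE('d) z 2 n \<le> (1 / a) * (C * (a * a))" using a by (intro mult_left_mono) auto
    finally show ?thesis using a by (simp add: a_def[symmetric] algebra_simps)
  qed (simp add: level_moment_def)
  then show ?thesis using C(1) by (intro exI[of _ "C + 1"]) auto
qed

text \<open>From order 3 on absolute values suffice: the cross terms \<open>x i ^ s * x j\<close>
  factor into moments of orders \<open>s\<close> and 1, both already known to be of the right size.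
  All cancellation is contained in the case \<open>s = 2\<close>.\<close>

lemma moment_bound:
  assumes "s \<ge> 2"
  shows "\<exists>C\<ge>0. \<forall>z \<alpha> n. (z, \<alpha>) \<in> moment_domain TYPE('d::finite) s \<longrightarrow>
     level_moment TYPE('d) z s n \<le> C * real n powr (real s * \<alpha>)"
  using assms
proof (induction s rule: dec_induct)
  case base
  then show ?case using second_moment_bound[where 'd = 'd] by simp
next
  case (step s)
  obtain C1 where C1: "C1 \<ge> 0" "\<And>z \<alpha> n. (z, \<alpha>) \<in> moment_domain TYPE('d) 2 \<Longrightarrow>
     level_moment TYPE('d) z 1 n \<le> C1 * real n powr \<alpha>"
    using first_moment_bound[where 'd = 'd] by (elim exE conjE) simp
  obtain Cs where Cs: "Cs \<ge> 0" "\<And>z \<alpha> n. (z, \<alpha>) \<in> moment_domain TYPE('d) s \<Longrightarrow>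
     level_moment TYPE('d) z s n \<le> Cs * real n powr (real s * \<alpha>)"
    using step.IH by (elim exE conjE) simp
  have "\<exists>C\<ge>0. \<forall>x :: 'd set \<Rightarrow> real. (\<forall>i. x i \<ge> 0) \<longrightarrow>
    (\<Sum>i\<in>UNIV. x i) ^ Suc s \<le> (\<Sum>i\<in>UNIV. x i ^ Suc s) + (\<Sum>i\<in>UNIV. \<Sum>j\<in>UNIV - {i}. C * (x i ^ s * x j))"
    using power_sum_le_cross[of "UNIV :: 'd set set" "Suc s"] step.hyps by simp
  then obtain C where C: "C \<ge> 0" "\<forall>x :: 'd set \<Rightarrow> real. (\<forall>i. x i \<ge> 0) \<longrightarrow>
    (\<Sum>i\<in>UNIV. x i) ^ Suc s \<le> (\<Sum>i\<in>UNIV. x i ^ Suc s) + (\<Sum>i\<in>UNIV. \<Sum>j\<in>UNIV - {i}. C * (x i ^ s * x j))"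
    by (elim exE conjE)
  let ?P = "\<lambda>z k (xs :: (real ^ 'd) list). cmod (level_poly z xs) ^ k"
  let ?X = "\<lambda>z S S' xs. C * (subtree_functional S (?P z s) xs * subtree_functional S' (?P z 1) xs)"
  show ?case
  proof (rule level_moment_growth[where G = "C * (Cs * C1)" and X = ?X])
    show "list_measurable (?X z S S')" for z S S'
      by (intro list_measurable_mult list_measurable_const list_measurable_subtree list_measurable_norm_level_poly)
    show "cmod (\<Sum>S\<in>UNIV. level_poly z (filter (\<lambda>y. orthant x y = S) xs)) ^ Suc s
         \<le> (\<Sum>S\<in>UNIV. cmod (level_poly z (filter (\<lambda>y. orthant x y = S) xs)) ^ Suc s)
        + (\<Sum>S\<in>UNIV. \<Sum>S'\<in>UNIV - {S}. ?X z S S' (x # xs))" for z and x :: "real ^ 'd" and xs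
    proof -
      have "cmod (\<Sum>S\<in>UNIV. level_poly z (filter (\<lambda>y. orthant x y = S) xs)) ^ Suc s
        \<le> (\<Sum>S\<in>UNIV. cmod (level_poly z (filter (\<lambda>y. orthant x y = S) xs))) ^ Suc s"
        by (intro power_mono norm_sum) auto
      also note C(2)[rule_format]
      finally show ?thesis unfolding subtree_functional_Cons by simp
    qed
    show "list_mean (Suc m) (?X z S S') \<le> C * (Cs * C1) * real (Suc m) powr (real (Suc s) * \<alpha>)"
      if dom: "(z, \<alpha>) \<in> moment_domain TYPE('d) (Suc s)" and S: "S \<noteq> S'" for z \<alpha> S S' m
    proof -
      have d: "(z, \<alpha>) \<in> moment_domain TYPE('d) s" "(z, \<alpha>) \<in> moment_domain TYPE('d) 2"
        using dom step.hyps by (auto intro: moment_domain_mono[rotated])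
      have \<alpha>: "\<alpha> \<ge> 0" using dom by (auto simp: moment_domain_def)
      have "list_mean (Suc m) (\<lambda>xs. subtree_functional S (?P z s) xs * subtree_functional S' (?P z 1) xs)
         \<le> (Cs * real (Suc m) powr (real s * \<alpha>)) * (C1 * real (Suc m) powr \<alpha>)"
      proof (intro list_mean_subtree_mult_le list_measurable_norm_level_poly tree_invariant_norm_level_poly S)
        fix j k assume jk: "j \<le> m" "k \<le> m"
        have "level_moment TYPE('d) z s j \<le> Cs * real (Suc m) powr (real s * \<alpha>)"
          using Cs(1) \<alpha> jk by (intro order_trans[OF Cs(2)[OF d(1)]] mult_left_mono powr_mono2) auto
        moreover have "level_moment TYPE('d) z 1 k \<le> C1 * real (Suc m) powr \<alpha>"
          using C1(1) \<alpha> jk by (intro order_trans[OF C1(2)[OF d(2)]] mult_left_mono powr_mono2) auto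
        ultimately show "list_mean j (?P z s) * list_mean k (?P z 1)
          \<le> (Cs * real (Suc m) powr (real s * \<alpha>)) * (C1 * real (Suc m) powr \<alpha>)"
          using level_moment_nonneg[where 'd = 'd, of z 1 k] Cs(1) unfolding level_moment_def by (intro mult_mono) auto
      qed
      also have "\<dots> = Cs * C1 * real (Suc m) powr (real (Suc s) * \<alpha>)"
        by (simp add: powr_add distrib_right algebra_simps)
      finally show ?thesis unfolding list_mean_cmult
        using C(1) by (simp add: mult_left_mono mult.assoc)
    qed
  qed (use step.hyps C C1 Cs in auto)
qed

section \<open>Circle means, Cauchy's formula and Gaussian integrals\<close>

text \<open>A mean over the circle of radius \<open>r\<close>, unlike the maximum over it, inherits
  moment bounds that hold at each single point, by Jensen's inequality and Fubini's theorem.\<close>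

definition circle_mean :: "(complex \<Rightarrow> complex) \<Rightarrow> real \<Rightarrow> real" where
  "circle_mean f r = integral {0..1} (\<lambda>t. cmod (f (of_real r * cis (2 * pi * t))))"

lemma has_integral_circle:
  assumes "(g has_contour_integral I) (circlepath 0 r)"
  shows "((\<lambda>t. g (of_real r * cis (2 * pi * t)) * (of_real r * cis (2 * pi * t))) has_integral I / (2 * of_real pi * \<i>)) {0..1}"
proof -
  have e: "exp (2 * of_real pi * \<i> * of_real t) = cis (2 * pi * t)" for t :: real
    by (simp add: cis_conv_exp mult_ac)
  have cp: "circlepath 0 r t = of_real r * cis (2 * pi * t)" for t
    by (simp add: circlepath e)
  have vd: "vector_derivative (circlepath 0 r) (at t within {0..1}) = 2 * of_real pi * \<i> * (of_real r * cis (2 * pi * t))"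
    if "0 \<le> t" "t \<le> 1" for t
    using vector_derivative_circlepath01[OF that, of 0 r] unfolding e by (simp add: mult.assoc)
  have "((\<lambda>t. g (circlepath 0 r t) * vector_derivative (circlepath 0 r) (at t within {0..1})) has_integral I) {0..1}"
    using assms by (simp add: has_contour_integral_def)
  then have "((\<lambda>t. g (of_real r * cis (2 * pi * t)) * (2 * of_real pi * \<i> * (of_real r * cis (2 * pi * t)))) has_integral I) {0..1}"
    by (rule has_integral_eq[rotated])
      (auto simp: cp vd)
  from has_integral_mult_right[OF this, of "1 / (2 * of_real pi * \<i>)"] show ?thesis
    by (simp add: field_simps)
qed

text \<open>For \<open>e\<close> on the circle, \<open>1/(e - \<theta>) - 1/e - \<theta>/e^2 =
  \<theta>^2 / (e^2 (e - \<theta>))\<close>, and \<open>cmod (e - \<theta>) \<ge> r/2\<close>.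
  Integrated against \<open>f\<close> in Cauchy's formula this is the Taylor remainder after the
  linear term.\<close>

lemma cauchy_taylor:
  fixes \<theta> :: complex
  assumes f: "f holomorphic_on UNIV" and r: "r > 0" and \<theta>: "cmod \<theta> \<le> r / 2"
    and a: "(f has_field_derivative a) (at 0)"
  shows "cmod (f \<theta> - f 0 - a * \<theta>) \<le> 2 * circle_mean f r * (cmod \<theta>)\<^sup>2 / r\<^sup>2"
    and "cmod a \<le> circle_mean f r / r"
proof -
  define e where "e t = of_real r * cis (2 * pi * t)" for t :: real
  have e0: "e t \<noteq> 0" and en: "cmod (e t) = r" for t using r by (auto simp: e_def norm_mult)
  have val: "((\<lambda>t. f (e t) * e t / (e t - w)) has_integral f w) {0..1}" if "cmod w < r" for w
  proof -
    have "((\<lambda>u. f u / (u - w)) has_contour_integral (2 * of_real pi * \<i> * f w)) (circlepath 0 r)"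
      using that f by (intro Cauchy_integral_circlepath_simple) (auto intro: holomorphic_on_subset)
    from has_integral_circle[OF this] show ?thesis by (simp add: e_def)
  qed
  have der: "((\<lambda>t. f (e t) / e t) has_integral a) {0..1}"
  proof -
    have c: "continuous_on (cball 0 r) f" "f holomorphic_on ball 0 r" "0 \<in> ball (0 :: complex) r"
      using f r by (auto intro: holomorphic_on_subset holomorphic_on_imp_continuous_on)
    note D = Cauchy_derivative_integral_circlepath[OF c]
    have a': "a = 1 / (2 * of_real pi * \<i>) * contour_integral (circlepath 0 r) (\<lambda>u. f u / (u - 0)\<^sup>2)"
      by (rule DERIV_unique[OF a D(2)])
    from has_integral_circle[OF has_contour_integral_integral[OF D(1)]]
    show ?thesis unfolding a' using e0 by (simp add: e_def power2_eq_square)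
  qed
  have cont: "continuous_on {0..1} (\<lambda>t. cmod (f (e t)))"
    unfolding e_def
    by (intro continuous_intros continuous_on_compose2[OF holomorphic_on_imp_continuous_on[OF f]]) auto
  have iJ: "(\<lambda>t. cmod (f (e t))) integrable_on {0..1}"
    using integrable_continuous_interval[OF cont] .
  have J: "circle_mean f r = integral {0..1} (\<lambda>t. cmod (f (e t)))" by (simp add: circle_mean_def e_def)
  show "cmod a \<le> circle_mean f r / r"
  proof -
    have "cmod (integral {0..1} (\<lambda>t. f (e t) / e t)) \<le> integral {0..1} (\<lambda>t. cmod (f (e t)) * (1 / r))"
      using der iJ r by (intro integral_norm_bound_integral integrable_on_mult_left) (auto simp: norm_divide en)
    then show ?thesis using der by (simp add: integral_unique J)
  qed
  have "((\<lambda>t. f (e t) * e t / (e t - \<theta>) - f (e t) * e t / (e t - 0) - f (e t) / e t * \<theta>) has_integral (f \<theta> - f 0 - a * \<theta>)) {0..1}"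
    using \<theta> r by (intro has_integral_diff has_integral_mult_left val der) auto
  moreover have "f (e t) * e t / (e t - \<theta>) - f (e t) * e t / (e t - 0) - f (e t) / e t * \<theta> = f (e t) * (\<theta>\<^sup>2 / (e t * (e t - \<theta>)))" for t
  proof -
    have "e t \<noteq> \<theta>" using en[of t] \<theta> r by auto
    then show ?thesis using e0[of t] by (simp add: field_simps power2_eq_square)
  qed
  ultimately have hi: "((\<lambda>t. f (e t) * (\<theta>\<^sup>2 / (e t * (e t - \<theta>)))) has_integral (f \<theta> - f 0 - a * \<theta>)) {0..1}" by simp
  have "cmod (integral {0..1} (\<lambda>t. f (e t) * (\<theta>\<^sup>2 / (e t * (e t - \<theta>)))))
    \<le> integral {0..1} (\<lambda>t. cmod (f (e t)) * ((cmod \<theta>)\<^sup>2 / (r * (r / 2))))"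
  proof (intro integral_norm_bound_integral integrable_on_mult_left iJ)
    show "(\<lambda>t. f (e t) * (\<theta>\<^sup>2 / (e t * (e t - \<theta>)))) integrable_on {0..1}" using hi by blast
    fix t :: real
    have "r / 2 \<le> cmod (e t - \<theta>)" using norm_triangle_ineq2[of "e t" \<theta>] en[of t] \<theta> by simp
    then have "(cmod \<theta>)\<^sup>2 / (r * cmod (e t - \<theta>)) \<le> (cmod \<theta>)\<^sup>2 / (r * (r / 2))"
      using r by (intro divide_left_mono mult_left_mono mult_pos_pos) auto
    from mult_left_mono[OF this norm_ge_zero[of "f (e t)"]]
    show "cmod (f (e t) * (\<theta>\<^sup>2 / (e t * (e t - \<theta>)))) \<le> cmod (f (e t)) * ((cmod \<theta>)\<^sup>2 / (r * (r / 2)))"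
      by (simp add: norm_mult norm_divide norm_power en)
  qed
  then show "cmod (f \<theta> - f 0 - a * \<theta>) \<le> 2 * circle_mean f r * (cmod \<theta>)\<^sup>2 / r\<^sup>2"
    using hi by (simp add: integral_unique J power2_eq_square mult_ac)
qed

lemma integrable_gauss:
  assumes "b > 0"
  shows "integrable lborel (\<lambda>x :: real. exp (- b * x\<^sup>2))" (is ?A)
    and "(\<integral>x. exp (- b * x\<^sup>2) \<partial>lborel) = sqrt (pi / b)" (is ?B)
proof -
  define \<sigma> where "\<sigma> = 1 / sqrt (2 * b)"
  have \<sigma>: "\<sigma> > 0" "\<sigma>\<^sup>2 = 1 / (2 * b)" using assms by (auto simp: \<sigma>_def power_divide)
  have eq: "exp (- b * x\<^sup>2) = sqrt (pi / b) * normal_density 0 \<sigma> x" for x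
    using assms by (simp add: normal_density_def \<sigma>(2) real_sqrt_divide)
  have "integrable lborel (\<lambda>x. sqrt (pi / b) * normal_density 0 \<sigma> x)"
    using \<sigma>(1) by (intro integrable_mult_right integrable_normal_density)
  then show ?A unfolding eq .
  show ?B unfolding eq using \<sigma>(1) by simp
qed

text \<open>The characteristic function of the standard normal law, rescaled by
  \<open>sqrt (2 b)\<close>.\<close>

lemma gauss_fourier:
  assumes "b > 0"
  shows "(\<integral>x. exp (- b * x\<^sup>2) *\<^sub>R cis (- y * x) \<partial>lborel) = complex_of_real (sqrt (pi / b) * exp (- y\<^sup>2 / (4 * b)))"
proof -
  define c where "c = sqrt (2 * b)"
  have c: "c > 0" "c\<^sup>2 = 2 * b" using assms by (auto simp: c_def)
  have "complex_of_real (exp (- (- y / c)\<^sup>2 / 2)) = (\<integral>x. iexp (- y / c * x) \<partial>std_normal_distribution)"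
    unfolding char_def[symmetric] char_std_normal_distribution by simp
  also have "\<dots> = (\<integral>x. std_normal_density x *\<^sub>R iexp (- y / c * x) \<partial>lborel)"
    by (subst integral_density) (auto simp: normal_density_nonneg)
  also have "\<dots> = c *\<^sub>R (\<integral>x. std_normal_density (0 + c * x) *\<^sub>R iexp (- y / c * (0 + c * x)) \<partial>lborel)"
    using c lborel_integral_real_affine[of c "\<lambda>x. std_normal_density x *\<^sub>R iexp (- y / c * x)" 0] by simp
  also have "(\<lambda>x. std_normal_density (0 + c * x) *\<^sub>R iexp (- y / c * (0 + c * x)))
     = (\<lambda>x. (1 / sqrt (2 * pi)) *\<^sub>R (exp (- b * x\<^sup>2) *\<^sub>R cis (- y * x)))"
    using c by (auto simp: std_normal_density_def fun_eq_iff power_mult_distrib cis_conv_exp)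
  also have "c *\<^sub>R (\<integral>x. (1 / sqrt (2 * pi)) *\<^sub>R (exp (- b * x\<^sup>2) *\<^sub>R cis (- y * x)) \<partial>lborel)
      = (c / sqrt (2 * pi)) *\<^sub>R (\<integral>x. exp (- b * x\<^sup>2) *\<^sub>R cis (- y * x) \<partial>lborel)"
    by (subst integral_scaleR_right) simp
  finally have "complex_of_real (exp (- (- y / c)\<^sup>2 / 2)) = (c / sqrt (2 * pi)) *\<^sub>R (\<integral>x. exp (- b * x\<^sup>2) *\<^sub>R cis (- y * x) \<partial>lborel)"
    .
  moreover have "(- y / c)\<^sup>2 / 2 = y\<^sup>2 / (4 * b)" using c by (simp add: power_divide)
  moreover have "c / sqrt (2 * pi) = inverse (sqrt (pi / b))"
    using assms by (simp add: c_def real_sqrt_divide real_sqrt_mult field_simps)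
  ultimately have "complex_of_real (exp (- (y\<^sup>2 / (4 * b)))) = inverse (sqrt (pi / b)) *\<^sub>R (\<integral>x. exp (- b * x\<^sup>2) *\<^sub>R cis (- y * x) \<partial>lborel)"
    by simp
  then have "sqrt (pi / b) *\<^sub>R complex_of_real (exp (- (y\<^sup>2 / (4 * b)))) = (\<integral>x. exp (- b * x\<^sup>2) *\<^sub>R cis (- y * x) \<partial>lborel)"
    using assms by simp
  then show ?thesis by (simp add: scaleR_conv_of_real)
qed

lemma power_le_exp:
  fixes x :: real
  assumes "x \<ge> 0" "n > 0"
  shows "x ^ n \<le> real n ^ n * exp x"
proof -
  have "x / real n \<le> exp (x / real n)" using exp_ge_add_one_self[of "x / real n"] by linarith
  then have "(x / real n) ^ n \<le> exp (x / real n) ^ n"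
    using assms by (intro power_mono) auto
  also have "\<dots> = exp x" using assms by (simp add: exp_of_nat_mult[symmetric])
  finally show ?thesis using assms by (simp add: power_divide field_simps)
qed

text \<open>With \<open>s = l u^2\<close> the exponent \<open>z\<close> is
  \<open>- s - \<i> l u^3 / 3\<close> plus an error \<open>\<delta>\<close> of size
  \<open>l u^4\<close>. In terms of \<open>s\<close> the cubic term has size
  \<open>s^(3/2) / sqrt l\<close> and the quartic one \<open>s^2 / l\<close>, which gives the two
  orders of approximation; in the second the cubic term is kept explicitly because it is odd in
  \<open>u\<close>. Half of the Gaussian exponent is spent on the powers of
  \<open>s\<close>.\<close>

lemma exp_perturbation_bounds:
  fixes u l :: real
  assumes u: "\<bar>u\<bar> \<le> 1" and l: "l \<ge> 1"
  defines "x \<equiv> sqrt l * \<bar>u\<bar>"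
    and "z \<equiv> of_real (2 * l) * (cis u - 1 - \<i> * of_real u)"
  shows "cmod (exp z - of_real (exp (- l * u\<^sup>2))) \<le> 500 / sqrt l * exp (- (l * u\<^sup>2 / 2))"
    and "cmod (exp z - of_real (exp (- l * u\<^sup>2)) * (1 - \<i> * of_real (l * u ^ 3 / 3))) \<le> 500 / l * exp (- (l * u\<^sup>2 / 2))"
    and "cmod (exp z) \<le> exp (- (l * u\<^sup>2 / 2))"
    and "l * \<bar>u\<bar> ^ 3 * \<bar>u\<bar> * exp (- l * u\<^sup>2) \<le> 500 / l * exp (- (l * u\<^sup>2 / 2))"
proof -
  define s where "s = l * u\<^sup>2"
  have s: "s \<ge> 0" using l by (simp add: s_def)
  define \<delta> where "\<delta> = of_real (2 * l) * (cis u - (1 + \<i> * of_real u - of_real (u\<^sup>2 / 2) - \<i> * of_real (u ^ 3 / 6)))"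
  define w where "w = \<delta> - \<i> * of_real (l * u ^ 3 / 3)"
  have z: "z = of_real (- s) + w"
    by (simp add: z_def w_def \<delta>_def s_def algebra_simps)
  have taylor: "cmod (cis u - (1 + \<i> * of_real u - of_real (u\<^sup>2 / 2) - \<i> * of_real (u ^ 3 / 6))) \<le> \<bar>u\<bar> ^ 4 / 24"
  proof -
    have "(\<Sum>k\<le>3. (\<i> * of_real u) ^ k / fact k) = 1 + \<i> * of_real u - of_real (u\<^sup>2 / 2) - \<i> * of_real (u ^ 3 / 6)"
      by (simp add: atMost_nat_numeral fact_numeral power2_eq_square power3_eq_cube algebra_simps)
    then show ?thesis using iexp_approx1[of u 3] by (simp add: cis_conv_exp fact_numeral)
  qed
  have \<delta>: "cmod \<delta> \<le> l * \<bar>u\<bar> ^ 4 / 12"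
    unfolding \<delta>_def norm_mult using l mult_left_mono[OF taylor, of "2 * l"] by simp
  have u4: "\<bar>u\<bar> ^ 4 = u\<^sup>2 * u\<^sup>2" by (simp flip: power_add)
  have u2: "u\<^sup>2 \<le> 1" using u by (simp add: abs_square_le_1)
  have "\<bar>u\<bar> ^ 4 \<le> u\<^sup>2"
    using mult_right_mono[OF u2 zero_le_power2[of u]] unfolding u4[symmetric] mult_1_left .
  then have "l * \<bar>u\<bar> ^ 4 / 12 \<le> s / 12" using l by (simp add: s_def mult_left_mono)
  then have \<delta>s: "cmod \<delta> \<le> s / 12" using \<delta> by linarith
  have "\<bar>Re w\<bar> \<le> s / 12" using \<delta>s abs_Re_le_cmod[of \<delta>] by (simp add: w_def)
  then have Re_w: "exp \<bar>Re w\<bar> \<le> exp (s / 12)" by simp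
  have u3: "\<bar>u\<bar> ^ 4 \<le> \<bar>u\<bar> ^ 3" using u by (intro power_decreasing) auto
  have w: "cmod w \<le> l * \<bar>u\<bar> ^ 3"
  proof -
    have "cmod w \<le> cmod \<delta> + l * \<bar>u\<bar> ^ 3 / 3"
      unfolding w_def using norm_triangle_ineq4[of \<delta> "\<i> * of_real (l * u ^ 3 / 3)"] l
      by (simp add: norm_mult norm_power abs_mult power_abs)
    also have "cmod \<delta> \<le> l * \<bar>u\<bar> ^ 3 / 12" using \<delta> u3 l by (simp add: order_trans mult_left_mono)
    finally have "cmod w \<le> l * \<bar>u\<bar> ^ 3 / 12 + l * \<bar>u\<bar> ^ 3 / 3" by simp
    moreover have "0 \<le> l * \<bar>u\<bar> ^ 3" using l by simp
    ultimately show ?thesis by linarith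
  qed
  have x: "x \<ge> 0" "x\<^sup>2 = s" using l by (auto simp: x_def s_def power_mult_distrib)
  have lx: "l * \<bar>u\<bar> ^ 3 = x ^ 3 / sqrt l" "l * \<bar>u\<bar> ^ 4 = s\<^sup>2 / l"
    "(l * \<bar>u\<bar> ^ 3)\<^sup>2 = s ^ 3 / l"
  proof -
    have sl: "sqrt l > 0" "sqrt l * sqrt l = l" using l by auto
    have "x ^ 3 = (sqrt l * sqrt l) * sqrt l * \<bar>u\<bar> ^ 3" by (simp add: x_def power3_eq_cube mult_ac)
    then show "l * \<bar>u\<bar> ^ 3 = x ^ 3 / sqrt l" using sl by (simp add: field_simps)
    show "l * \<bar>u\<bar> ^ 4 = s\<^sup>2 / l" using l by (simp add: s_def u4 power2_eq_square)
    have "(\<bar>u\<bar> ^ 3)\<^sup>2 = u\<^sup>2 ^ 3" by (simp add: power_mult[symmetric] power_even_abs)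
    then show "(l * \<bar>u\<bar> ^ 3)\<^sup>2 = s ^ 3 / l"
      using l by (simp add: s_def power_mult_distrib power2_eq_square power3_eq_cube)
  qed
  have x3: "x ^ 3 \<le> s + s\<^sup>2"
  proof (cases "x \<le> 1")
    case True
    then have "x ^ 3 \<le> x ^ 2" using x by (intro power_decreasing) auto
    then show ?thesis using x by (simp add: add_increasing2)
  next
    case False
    then have "x ^ 3 \<le> x ^ 4" by (intro power_increasing) auto
    also have "x ^ 4 = s\<^sup>2" by (simp add: x(2)[symmetric] power_mult[symmetric])
    finally show ?thesis using s by simp
  qed
  \<comment> \<open>\<open>exp (5/12 s)\<close> dominates the powers of \<open>s\<close>; with the
    factor \<open>exp (s/12)\<close> from the real part of \<open>w\<close> it leaves exactly
    \<open>exp (- s/2)\<close> of the Gaussian. The constant 500 is a round upper bound for the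
    coefficients that arise.\<close>
  define e where "e = exp (5/12 * s)"
  have p1: "s \<le> 12/5 * e" and p2: "s\<^sup>2 \<le> 24 * e" and p3: "s ^ 3 \<le> 374 * e"
  proof -
    have e0: "e \<ge> 0" by (simp add: e_def)
    show "s \<le> 12/5 * e" using power_le_exp[of "5/12 * s" 1] s by (simp add: e_def)
    have "25 * s\<^sup>2 \<le> 576 * e" using power_le_exp[of "5/12 * s" 2] s by (simp add: e_def power_mult_distrib power_divide)
    then show "s\<^sup>2 \<le> 24 * e" using e0 by linarith
    have "125 * s ^ 3 \<le> 46656 * e" using power_le_exp[of "5/12 * s" 3] s by (simp add: e_def power_mult_distrib power_divide)
    then show "s ^ 3 \<le> 374 * e" using e0 by linarith
  qed
  have ee: "exp (- s) * exp (s / 12) * e = exp (- (s / 2))" by (simp add: e_def exp_add[symmetric])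
  have e1: "e \<ge> 1" using s by (simp add: e_def)
  have G: "exp z = of_real (exp (- s)) * exp w" unfolding z exp_add by (simp flip: exp_of_real)
  show c: "cmod (exp z) \<le> exp (- (l * u\<^sup>2 / 2))"
  proof -
    have "Re w \<le> s / 12" using \<open>\<bar>Re w\<bar> \<le> s / 12\<close> by linarith
    then have "Re z \<le> - (s / 2)" using s by (simp add: z)
    then show ?thesis by (simp add: norm_exp_eq_Re s_def)
  qed
  show "cmod (exp z - of_real (exp (- l * u\<^sup>2))) \<le> 500 / sqrt l * exp (- (l * u\<^sup>2 / 2))"
  proof -
    have "cmod (exp w - 1) \<le> exp \<bar>Re w\<bar> * cmod w" using Taylor_exp[of w 0] by simp
    also have "\<dots> \<le> exp (s / 12) * (x ^ 3 / sqrt l)" using Re_w w lx(1) by (intro mult_mono) auto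
    also have "\<dots> \<le> exp (s / 12) * (500 * e / sqrt l)"
      using x3 p1 p2 e1 l by (intro mult_left_mono divide_right_mono) auto
    finally have "exp (- s) * cmod (exp w - 1) \<le> exp (- s) * (exp (s / 12) * (500 * e / sqrt l))"
      by (intro mult_left_mono) auto
    also have "\<dots> = 500 / sqrt l * (exp (- s) * exp (s / 12) * e)" by simp
    finally have "exp (- s) * cmod (exp w - 1) \<le> 500 / sqrt l * exp (- (s / 2))" unfolding ee .
    moreover have "exp z - of_real (exp (- l * u\<^sup>2)) = of_real (exp (- s)) * (exp w - 1)"
      by (simp add: G s_def algebra_simps)
    ultimately show ?thesis by (simp add: norm_mult s_def)
  qed
  show "cmod (exp z - of_real (exp (- l * u\<^sup>2)) * (1 - \<i> * of_real (l * u ^ 3 / 3))) \<le> 500 / l * exp (- (l * u\<^sup>2 / 2))"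
  proof -
    have "cmod (exp w - 1 - w) \<le> exp \<bar>Re w\<bar> * (cmod w)\<^sup>2" using Taylor_exp[of w 1] by (simp add: diff_diff_eq power2_eq_square)
    also have "\<dots> \<le> exp (s / 12) * (s ^ 3 / l)"
      unfolding lx(3)[symmetric] using Re_w w by (intro mult_mono power_mono) auto
    finally have 1: "cmod (exp w - 1 - w) \<le> exp (s / 12) * (s ^ 3 / l)" .
    have "cmod \<delta> \<le> 1 * (s\<^sup>2 / l)" 
    proof -
      have "0 \<le> l * \<bar>u\<bar> ^ 4" using l by simp
      then have "cmod \<delta> \<le> l * \<bar>u\<bar> ^ 4" using \<delta> by linarith
      then show ?thesis unfolding lx(2) by simp
    qed
    also have "\<dots> \<le> exp (s / 12) * (s\<^sup>2 / l)" using l s by (intro mult_right_mono) auto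
    finally have 2: "cmod \<delta> \<le> exp (s / 12) * (s\<^sup>2 / l)" .
    have "cmod (exp w - 1 - w + \<delta>) \<le> exp (s / 12) * (s ^ 3 / l) + exp (s / 12) * (s\<^sup>2 / l)"
      using norm_triangle_ineq[of "exp w - 1 - w" \<delta>] 1 2 by linarith
    also have "\<dots> = exp (s / 12) * ((s ^ 3 + s\<^sup>2) / l)" by (simp add: distrib_left add_divide_distrib)
    also have "\<dots> \<le> exp (s / 12) * (500 * e / l)"
      using p2 p3 e1 l by (intro mult_left_mono divide_right_mono) auto
    finally have "exp (- s) * cmod (exp w - 1 - w + \<delta>) \<le> exp (- s) * (exp (s / 12) * (500 * e / l))"
      by (intro mult_left_mono) auto
    also have "\<dots> = 500 / l * (exp (- s) * exp (s / 12) * e)" by simp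
    finally have "exp (- s) * cmod (exp w - 1 - w + \<delta>) \<le> 500 / l * exp (- (s / 2))" unfolding ee .
    moreover have "exp z - of_real (exp (- l * u\<^sup>2)) * (1 - \<i> * of_real (l * u ^ 3 / 3)) = of_real (exp (- s)) * (exp w - 1 - w + \<delta>)"
      by (simp add: G s_def w_def algebra_simps)
    ultimately show ?thesis by (simp add: norm_mult s_def)
  qed
  show "l * \<bar>u\<bar> ^ 3 * \<bar>u\<bar> * exp (- l * u\<^sup>2) \<le> 500 / l * exp (- (l * u\<^sup>2 / 2))"
  proof -
    have "l * \<bar>u\<bar> ^ 3 * \<bar>u\<bar> = s\<^sup>2 / l" unfolding lx(2)[symmetric] by (simp add: numeral_eq_Suc mult_ac)
    also have "\<dots> \<le> 500 * e / l" using p2 e1 l by (intro divide_right_mono) auto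
    also have "\<dots> \<le> exp (s / 12) * (500 * e / l)" using mult_right_mono[of 1 "exp (s / 12)" "500 * e / l"] s l e1 by simp
    finally have "exp (- s) * (l * \<bar>u\<bar> ^ 3 * \<bar>u\<bar>) \<le> exp (- s) * (exp (s / 12) * (500 * e / l))"
      by (intro mult_left_mono) auto
    also have "\<dots> = 500 / l * (exp (- s) * exp (s / 12) * e)" by simp
    finally show ?thesis unfolding ee by (simp add: s_def mult.commute)
  qed
qed

text \<open>Up to the factor \<open>1 / (2 pi)\<close>, the inverse Fourier integral of
  \<open>exp (2 l (e^(i \<theta>/d) - 1))\<close> over
  \<open>\<bar>\<theta>\<bar> \<le> \<rho>\<close>, taken at the signed distance \<open>y\<close>
  from the mean \<open>2 l / d\<close>.\<close>

definition gauss_kernel :: "real \<Rightarrow> real \<Rightarrow> real \<Rightarrow> real \<Rightarrow> complex" where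
  "gauss_kernel \<rho> d l y = (\<integral>\<theta>. indicator {-\<rho>..\<rho>} \<theta> *\<^sub>R
     (exp (of_real (2 * l) * (cis (\<theta> / d) - 1 - \<i> * of_real (\<theta> / d))) * cis (- y * \<theta>)) \<partial>lborel)"

text \<open>Two errors are recorded. The first is uniform in \<open>y\<close>. The second gains a
  factor \<open>sqrt l\<close> near the centre: the cubic correction is odd in
  \<open>\<theta>\<close>, so against \<open>cis (- y * \<theta>)\<close> its contribution to the
  real part carries \<open>sin (y * \<theta>)\<close>, which is at most
  \<open>\<bar>y * \<theta>\<bar>\<close>.\<close>

lemma gauss_kernel_approx:
  fixes \<rho> d :: real
  assumes \<rho>: "0 < \<rho>" "\<rho> \<le> 1" and d: "d \<ge> 1"
  shows "\<exists>C\<ge>0. \<forall>l\<ge>1. \<forall>y.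
    cmod (gauss_kernel \<rho> d l y - of_real (sqrt (pi * d\<^sup>2 / l) * exp (- (y\<^sup>2 * d\<^sup>2 / (4 * l))))) \<le> C / l \<and>
    \<bar>Re (gauss_kernel \<rho> d l y) - sqrt (pi * d\<^sup>2 / l) * exp (- (y\<^sup>2 * d\<^sup>2 / (4 * l)))\<bar> \<le> C * (1 + \<bar>y\<bar>) / (l * sqrt l)"
proof -
  \<comment> \<open>\<open>K / l\<close> bounds \<open>exp (- b \<theta>^2 / 2)\<close> for
    \<open>b = l / d^2\<close> outside the cut, through \<open>x \<le> exp x\<close>; it accounts
    for the part of the Gaussian beyond \<open>\<rho>\<close>.\<close>
  define K where "K = 2 * d\<^sup>2 / \<rho>\<^sup>2"
  define C where "C = (500 + K + 500 * d) * (sqrt (2 * pi) * d)"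
  have K0: "K \<ge> 0" by (simp add: K_def)
  have C0: "C \<ge> 0" using d K0 by (simp add: C_def)
  show ?thesis
  proof (intro exI[of _ C] conjI C0 allI impI)
    fix l y :: real assume l: "l \<ge> 1"
    define E where "E \<theta> = exp (of_real (2 * l) * (cis (\<theta> / d) - 1 - \<i> * of_real (\<theta> / d)))" for \<theta>
    define b where "b = l / d\<^sup>2"
    have b: "b > 0" using l d by (simp add: b_def)
    define F where "F \<theta> = indicator {-\<rho>..\<rho>} \<theta> *\<^sub>R (E \<theta> * cis (- y * \<theta>))" for \<theta>
    define G where "G \<theta> = exp (- b * \<theta>\<^sup>2) *\<^sub>R cis (- y * \<theta>)" for \<theta>
    define B where "B \<theta> = exp (- (b / 2) * \<theta>\<^sup>2)" for \<theta> :: real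
    define g where "g = sqrt (pi * d\<^sup>2 / l) * exp (- (y\<^sup>2 * d\<^sup>2 / (4 * l)))"
    have bu: "l * (\<theta> / d)\<^sup>2 = b * \<theta>\<^sup>2" for \<theta> by (simp add: b_def power_divide)
    have iB: "integrable lborel B" and intB: "(\<integral>\<theta>. B \<theta> \<partial>lborel) = sqrt (2 * pi) * d / sqrt l"
    proof -
      show "integrable lborel B" unfolding B_def using integrable_gauss(1)[of "b / 2"] b by simp
      have "(\<integral>\<theta>. B \<theta> \<partial>lborel) = sqrt (pi / (b / 2))"
        unfolding B_def using integrable_gauss(2)[of "b / 2"] b by simp
      also have "\<dots> = sqrt (2 * pi * d\<^sup>2 / l)" by (simp add: b_def mult_ac)
      finally show "(\<integral>\<theta>. B \<theta> \<partial>lborel) = sqrt (2 * pi) * d / sqrt l"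
        using d by (simp add: real_sqrt_divide real_sqrt_mult)
    qed
    have ud: "\<bar>\<theta> / d\<bar> \<le> 1" if "\<theta> \<in> {-\<rho>..\<rho>}" for \<theta>
      using that \<rho> d by (auto simp: abs_divide divide_le_eq)
    note pert = exp_perturbation_bounds[OF ud l]
    have F_le: "cmod (F \<theta>) \<le> B \<theta>" for \<theta>
      using pert(3)[of \<theta>] unfolding bu by (auto simp: F_def B_def E_def norm_mult indicator_def)
    have mF: "F \<in> borel_measurable lborel"
    proof -
      have "continuous_on UNIV (\<lambda>\<theta>. E \<theta> * cis (- y * \<theta>))"
        unfolding E_def using d by (intro continuous_intros) auto
      then have "(\<lambda>\<theta>. E \<theta> * cis (- y * \<theta>)) \<in> borel_measurable borel"
        by (rule borel_measurable_continuous_onI)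
      then show ?thesis unfolding F_def by measurable
    qed
    have iF: "integrable lborel F"
      by (rule Bochner_Integration.integrable_bound[OF iB mF]) (use F_le in \<open>auto simp: B_def\<close>)
    have iG: "integrable lborel G"
    proof (rule Bochner_Integration.integrable_bound[OF integrable_gauss(1)[OF b]])
      have "continuous_on UNIV G" unfolding G_def by (intro continuous_intros)
      then show "G \<in> borel_measurable lborel" using borel_measurable_continuous_onI by simp
    qed (simp add: G_def)
    have intG: "(\<integral>\<theta>. G \<theta> \<partial>lborel) = of_real g"
    proof -
      have "pi / b = pi * d\<^sup>2 / l" "y\<^sup>2 / (4 * b) = y\<^sup>2 * d\<^sup>2 / (4 * l)" by (simp_all add: b_def)
      then show ?thesis unfolding G_def gauss_fourier[OF b] g_def by simp
    qed
    have intF: "(\<integral>\<theta>. F \<theta> \<partial>lborel) = gauss_kernel \<rho> d l y" by (simp add: F_def gauss_kernel_def E_def)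
    have tail: "exp (- b * \<theta>\<^sup>2) \<le> K / l * B \<theta>" if "\<theta> \<notin> {-\<rho>..\<rho>}" for \<theta>
    proof -
      have "\<rho>\<^sup>2 \<le> \<theta>\<^sup>2" using that \<rho> by (subst abs_le_square_iff[symmetric]) (auto simp: abs_if)
      then have "b * \<rho>\<^sup>2 \<le> b * \<theta>\<^sup>2" using b by (intro mult_left_mono) auto
      then have "b * \<rho>\<^sup>2 / 2 \<le> exp (b * \<theta>\<^sup>2 / 2)" using exp_ge_add_one_self[of "b * \<theta>\<^sup>2 / 2"] by linarith
      then have "exp (- (b * \<theta>\<^sup>2 / 2)) * (b * \<rho>\<^sup>2 / 2) \<le> exp (- (b * \<theta>\<^sup>2 / 2)) * exp (b * \<theta>\<^sup>2 / 2)"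
        by (intro mult_left_mono) auto
      then have "exp (- (b * \<theta>\<^sup>2 / 2)) * (b * \<rho>\<^sup>2 / 2) \<le> 1" by (simp add: exp_add[symmetric])
      then have 1: "exp (- (b * \<theta>\<^sup>2 / 2)) \<le> K / l" using b \<rho> d l by (simp add: K_def b_def field_simps)
      have "exp (- b * \<theta>\<^sup>2) = exp (- (b * \<theta>\<^sup>2 / 2)) * B \<theta>" by (simp add: B_def exp_add[symmetric])
      also have "\<dots> \<le> K / l * B \<theta>" using 1 by (intro mult_right_mono) (auto simp: B_def)
      finally show ?thesis .
    qed
    have sl: "1 / l \<le> 1 / sqrt l" "sqrt l > 0"
    proof -
      have "sqrt l \<ge> 1" using l by simp
      then have "sqrt l * 1 \<le> sqrt l * sqrt l" by (intro mult_left_mono) auto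
      then have "sqrt l \<le> l" using l by simp
      then show "1 / l \<le> 1 / sqrt l" "sqrt l > 0" using l by (auto intro: divide_left_mono)
    qed
    have H1: "cmod (F \<theta> - G \<theta>) \<le> (500 + K) / sqrt l * B \<theta>" for \<theta>
    proof (cases "\<theta> \<in> {-\<rho>..\<rho>}")
      case True
      have "F \<theta> - G \<theta> = (E \<theta> - of_real (exp (- l * (\<theta> / d)\<^sup>2))) * cis (- y * \<theta>)"
        using True by (simp add: F_def G_def bu scaleR_conv_of_real algebra_simps)
      then have "cmod (F \<theta> - G \<theta>) \<le> 500 / sqrt l * B \<theta>"
        using pert(1)[OF True] unfolding bu by (simp add: norm_mult E_def B_def bu)
      also have "\<dots> \<le> (500 + K) / sqrt l * B \<theta>"
        using K0 sl by (intro mult_right_mono divide_right_mono) (auto simp: B_def)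
      finally show ?thesis .
    next
      case False
      have "cmod (F \<theta> - G \<theta>) = exp (- b * \<theta>\<^sup>2)" using False by (simp add: F_def G_def)
      also have "\<dots> \<le> K / l * B \<theta>" by (rule tail[OF False])
      also have "\<dots> \<le> (500 + K) / sqrt l * B \<theta>"
      proof (rule mult_right_mono)
        have "K * (1 / l) \<le> (500 + K) * (1 / sqrt l)" using K0 sl by (intro mult_mono) auto
        then show "K / l \<le> (500 + K) / sqrt l" by simp
      qed (simp add: B_def)
      finally show ?thesis .
    qed
    have H2: "\<bar>Re (F \<theta> - G \<theta>)\<bar> \<le> (500 + K + 500 * d) * (1 + \<bar>y\<bar>) / l * B \<theta>" for \<theta>
    proof (cases "\<theta> \<in> {-\<rho>..\<rho>}")
      case True
      define u where "u = \<theta> / d"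
      define q where "q = of_real (exp (- l * u\<^sup>2)) * (1 - \<i> * of_real (l * u ^ 3 / 3))"
      have "F \<theta> - G \<theta> = (E \<theta> - q) * cis (- y * \<theta>) - of_real (exp (- l * u\<^sup>2) * (l * u ^ 3 / 3)) * (\<i> * cis (- y * \<theta>))"
        using True by (simp add: F_def G_def bu q_def u_def scaleR_conv_of_real algebra_simps)
      moreover have "Re (of_real c * (\<i> * cis (- y * \<theta>))) = c * sin (y * \<theta>)" for c
        by simp
      ultimately have "Re (F \<theta> - G \<theta>) = Re ((E \<theta> - q) * cis (- y * \<theta>)) - exp (- l * u\<^sup>2) * (l * u ^ 3 / 3) * sin (y * \<theta>)"
        by (simp only: minus_complex.sel(1))
      moreover have "\<bar>Re ((E \<theta> - q) * cis (- y * \<theta>))\<bar> \<le> 500 / l * B \<theta>"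
        using abs_Re_le_cmod[of "(E \<theta> - q) * cis (- y * \<theta>)"] pert(2)[OF True]
        by (simp add: norm_mult E_def q_def u_def B_def bu)
      moreover have "\<bar>exp (- l * u\<^sup>2) * (l * u ^ 3 / 3) * sin (y * \<theta>)\<bar> \<le> (500 * d * \<bar>y\<bar>) / l * B \<theta>"
      proof -
        have "\<bar>exp (- l * u\<^sup>2) * (l * u ^ 3 / 3) * sin (y * \<theta>)\<bar> \<le> exp (- l * u\<^sup>2) * (l * \<bar>u\<bar> ^ 3 / 3) * \<bar>y * \<theta>\<bar>"
          using l abs_sin_x_le_abs_x[of "y * \<theta>"] by (simp add: abs_mult power_abs mult_left_mono)
        also have "\<dots> = (d * \<bar>y\<bar> / 3) * (l * \<bar>u\<bar> ^ 3 * \<bar>u\<bar> * exp (- l * u\<^sup>2))"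
          using d by (simp add: u_def abs_mult)
        also have "\<dots> \<le> (d * \<bar>y\<bar>) * (500 / l * exp (- (l * u\<^sup>2 / 2)))"
        proof (rule mult_mono)
          show "l * \<bar>u\<bar> ^ 3 * \<bar>u\<bar> * exp (- l * u\<^sup>2) \<le> 500 / l * exp (- (l * u\<^sup>2 / 2))"
            unfolding u_def by (rule pert(4)[OF True])
        qed (use d l in auto)
        finally show ?thesis by (simp add: u_def B_def bu)
      qed
      ultimately have "\<bar>Re (F \<theta> - G \<theta>)\<bar> \<le> 500 / l * B \<theta> + (500 * d * \<bar>y\<bar>) / l * B \<theta>" by linarith
      also have "\<dots> = (500 + 500 * d * \<bar>y\<bar>) / l * B \<theta>" by (simp add: add_divide_distrib distrib_right)
      also have "\<dots> \<le> (500 + K + 500 * d) * (1 + \<bar>y\<bar>) / l * B \<theta>"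
      proof (intro mult_right_mono divide_right_mono)
        have "0 \<le> K * \<bar>y\<bar>" using K0 by simp
        then show "500 + 500 * d * \<bar>y\<bar> \<le> (500 + K + 500 * d) * (1 + \<bar>y\<bar>)" using K0 d by (simp add: algebra_simps)
      qed (use l in \<open>auto simp: B_def\<close>)
      finally show ?thesis .
    next
      case False
      have "\<bar>Re (F \<theta> - G \<theta>)\<bar> \<le> cmod (F \<theta> - G \<theta>)" by (rule abs_Re_le_cmod)
      also have "\<dots> = exp (- b * \<theta>\<^sup>2)" using False by (simp add: F_def G_def)
      also have "\<dots> \<le> K / l * B \<theta>" by (rule tail[OF False])
      also have "\<dots> \<le> (500 + K + 500 * d) * (1 + \<bar>y\<bar>) / l * B \<theta>"
      proof (intro mult_right_mono divide_right_mono)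
        have "K * 1 \<le> (500 + K + 500 * d) * (1 + \<bar>y\<bar>)" using K0 d by (intro mult_mono) auto
        then show "K \<le> (500 + K + 500 * d) * (1 + \<bar>y\<bar>)" by simp
      qed (use l in \<open>auto simp: B_def\<close>)
      finally show ?thesis .
    qed
    have iH: "integrable lborel (\<lambda>\<theta>. F \<theta> - G \<theta>)" using iF iG by simp
    have eqH: "gauss_kernel \<rho> d l y - of_real g = (\<integral>\<theta>. F \<theta> - G \<theta> \<partial>lborel)"
      using iF iG by (simp add: intF intG)
    have "cmod (\<integral>\<theta>. F \<theta> - G \<theta> \<partial>lborel) \<le> (\<integral>\<theta>. (500 + K) / sqrt l * B \<theta> \<partial>lborel)"
      using iH iB H1 by (intro Bochner_Integration.integral_norm_bound_integral) auto
    also have "\<dots> = (500 + K) * (sqrt (2 * pi) * d) / l" using l by (simp add: intB)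
    also have "\<dots> \<le> C / l" unfolding C_def using d l by (intro divide_right_mono mult_right_mono) auto
    finally show "cmod (gauss_kernel \<rho> d l y - of_real (sqrt (pi * d\<^sup>2 / l) * exp (- (y\<^sup>2 * d\<^sup>2 / (4 * l))))) \<le> C / l"
      unfolding eqH[symmetric] g_def .
    have "\<bar>\<integral>\<theta>. Re (F \<theta> - G \<theta>) \<partial>lborel\<bar> \<le> (\<integral>\<theta>. (500 + K + 500 * d) * (1 + \<bar>y\<bar>) / l * B \<theta> \<partial>lborel)"
      using iH iB H2 Bochner_Integration.integral_norm_bound_integral[of lborel "\<lambda>\<theta>. Re (F \<theta> - G \<theta>)" "\<lambda>\<theta>. (500 + K + 500 * d) * (1 + \<bar>y\<bar>) / l * B \<theta>"]
      by (auto simp del: minus_complex.sel)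
    also have "\<dots> = C * (1 + \<bar>y\<bar>) / (l * sqrt l)" by (simp add: intB C_def mult_ac)
    also have "(\<integral>\<theta>. Re (F \<theta> - G \<theta>) \<partial>lborel) = Re (gauss_kernel \<rho> d l y) - g"
      unfolding integral_Re[OF iH] eqH[symmetric] by simp
    finally show "\<bar>Re (gauss_kernel \<rho> d l y) - sqrt (pi * d\<^sup>2 / l) * exp (- (y\<^sup>2 * d\<^sup>2 / (4 * l)))\<bar> \<le> C * (1 + \<bar>y\<bar>) / (l * sqrt l)"
      unfolding g_def .
  qed
qed

section \<open>From a Gaussian approximation of the profile to its maximum\<close>

lemma exp_minus_le_min:
  assumes "x \<ge> 0"
  shows "exp (- x) \<le> 1 - min x 1 / (2 :: real)"
proof -
  define y where "y = min x 1"
  have y: "0 \<le> y" "y \<le> 1" "y \<le> x" using assms by (auto simp: y_def)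
  have "exp (- x) \<le> exp (- y)" using y by simp
  also have "\<dots> \<le> 1 / (1 + y)"
    using exp_ge_add_one_self[of y] y by (simp add: exp_minus inverse_eq_divide frac_le)
  also have "\<dots> \<le> 1 - y / 2"
  proof -
    have "y * y \<le> 1 * y" using y by (intro mult_right_mono) auto
    then have "1 \<le> (1 - y / 2) * (1 + y)" by (simp add: algebra_simps)
    then show ?thesis using y by (simp add: pos_divide_le_eq)
  qed
  finally show ?thesis by (simp add: y_def)
qed

text \<open>The normal density with mean 0 and variance \<open>2 l / d^2\<close>.\<close>

definition gauss_density :: "real \<Rightarrow> real \<Rightarrow> real \<Rightarrow> real" where
  "gauss_density d l y = d / (2 * sqrt (pi * l)) * exp (- (y\<^sup>2 * d\<^sup>2 / (4 * l)))"

text \<open>After multiplication by \<open>S = l sqrt l\<close> the peak of the Gaussian is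
  \<open>c l\<close>. For a level at distance \<open>y\<close> from the centre let \<open>q\<close>
  be the minimum of \<open>y^2\<close> and \<open>l\<close>. The Gaussian loses at least
  \<open>c/8 q\<close> there, while the errors amount to \<open>C0 + C0 sqrt q + R\<close>; half of
  the loss pays for \<open>C0 sqrt q\<close>, up to a constant. Hence no level exceeds the peak by
  more than \<open>O(1 + R)\<close>, a maximal level has \<open>q = O(1 + R)\<close>, and the level
  \<open>\<lfloor>m\<rfloor>\<close> comes as close to the peak from below.\<close>

lemma width_from_density:
  fixes d C0 :: real
  assumes d: "d \<ge> 1" and C0: "C0 \<ge> 0"
  shows "\<exists>C\<ge>0. \<forall>(p :: nat \<Rightarrow> real) l m R k P. l \<ge> 1 \<longrightarrow> m \<ge> 0 \<longrightarrow> R \<ge> 0 \<longrightarrow>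
     (\<forall>k. \<bar>p k - gauss_density d l (real k - m)\<bar> \<le> min (C0 / l) (C0 * (1 + \<bar>real k - m\<bar>) / (l * sqrt l)) + R / (l * sqrt l)) \<longrightarrow>
     (\<forall>k. p k \<le> P) \<longrightarrow> p k = P \<longrightarrow>
     \<bar>P - d / (2 * sqrt (pi * l))\<bar> \<le> C * (1 + R) / (l * sqrt l) \<and> min ((real k - m)\<^sup>2) l \<le> C * (1 + R)"
proof -
  define c where "c = d / (2 * sqrt pi)"
  have c: "c > 0" using d by (simp add: c_def)
  define A1 where "A1 = C0 + 4 * C0\<^sup>2 / c"
  define A2 where "A2 = c * d\<^sup>2 / 4 + 2 * C0"
  define A where "A = A1 + A2 + 2"
  have A: "A1 \<ge> 0" "A2 \<ge> 0" "A \<ge> 2" using c C0 by (auto simp: A1_def A2_def A_def)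
  define C where "C = (1 + 16 / c) * A"
  have CA: "C \<ge> A" "C \<ge> 16 / c * A" using A c by (auto simp: C_def algebra_simps)
  show ?thesis
  proof (intro exI[of _ C] conjI allI impI)
    show "0 \<le> C" using CA A by linarith
    fix p :: "nat \<Rightarrow> real" and l m R :: real and k :: nat and P :: real
    assume l: "l \<ge> 1" and m: "m \<ge> 0" and R: "R \<ge> 0"
      and ap: "\<forall>k. \<bar>p k - gauss_density d l (real k - m)\<bar> \<le> min (C0 / l) (C0 * (1 + \<bar>real k - m\<bar>) / (l * sqrt l)) + R / (l * sqrt l)"
      and P: "\<forall>k. p k \<le> P" "p k = P"
    define S where "S = l * sqrt l"
    have sl: "sqrt l > 0" using l by simp
    have S: "S > 0" using l by (simp add: S_def)
    define main where "main = d / (2 * sqrt (pi * l))"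
    have main: "main = c / sqrt l" by (simp add: main_def c_def real_sqrt_mult)
    have Smain: "S * main = c * l" using sl by (simp add: S_def main)
    have g: "gauss_density d l y = main * exp (- (y\<^sup>2 * d\<^sup>2 / (4 * l)))" for y
      by (simp add: gauss_density_def main_def)
    define q where "q k = min ((real k - m)\<^sup>2) l" for k
    have q0: "q k \<ge> 0" for k using l by (simp add: q_def)
    have upper: "S * p k \<le> c * l - c / 16 * q k + (A1 + R)" for k
    proof -
      define y where "y = real k - m"
      define x where "x = y\<^sup>2 * d\<^sup>2 / (4 * l)"
      have "1 \<le> d\<^sup>2" using power_mono[of 1 d 2] d by simp
      then have "y\<^sup>2 * 1 \<le> y\<^sup>2 * d\<^sup>2" by (intro mult_left_mono) auto
      then have "y\<^sup>2 / (4 * l) \<le> x" using l by (simp add: x_def divide_right_mono)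
      moreover have "q k / (4 * l) \<le> y\<^sup>2 / (4 * l)" using l by (intro divide_right_mono) (auto simp: q_def y_def)
      moreover have "q k / (4 * l) \<le> 1"
      proof -
        have "q k \<le> l" by (simp add: q_def)
        then show ?thesis using l by (simp add: divide_le_eq)
      qed
      ultimately have mx: "q k / (4 * l) \<le> min x 1" by simp
      have x0: "x \<ge> 0" using l by (simp add: x_def)
      have "S * gauss_density d l y = c * l * exp (- x)" by (simp add: g x_def mult.assoc[symmetric] Smain)
      also have "\<dots> \<le> c * l * (1 - (q k / (4 * l)) / 2)"
      proof (rule mult_left_mono)
        have "1 - min x 1 / 2 \<le> 1 - (q k / (4 * l)) / 2" by (intro diff_left_mono divide_right_mono mx) simp
        then show "exp (- x) \<le> 1 - (q k / (4 * l)) / 2" using exp_minus_le_min[OF x0] by (rule order_trans[rotated])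
      qed (use c l in simp)
      also have "\<dots> = c * l - c / 8 * q k" using l by (simp add: field_simps)
      finally have 1: "S * gauss_density d l y \<le> c * l - c / 8 * q k" .
      have 2: "S * min (C0 / l) (C0 * (1 + \<bar>y\<bar>) / S) \<le> C0 + C0 * sqrt (q k)"
      \<comment> \<open>Up to distance \<open>sqrt l\<close> the second of the two error bounds is
        used, beyond it the first.\<close>
      proof (cases "y\<^sup>2 \<le> l")
        case True
        have "S * min (C0 / l) (C0 * (1 + \<bar>y\<bar>) / S) \<le> S * (C0 * (1 + \<bar>y\<bar>) / S)" using S by (intro mult_left_mono) auto
        also have "\<dots> = C0 * (1 + \<bar>y\<bar>)" using S by simp
        also have "\<dots> = C0 + C0 * sqrt (q k)" using True by (simp add: q_def y_def distrib_left)
        finally show ?thesis .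
      next
        case False
        have "S * min (C0 / l) (C0 * (1 + \<bar>y\<bar>) / S) \<le> S * (C0 / l)" using S by (intro mult_left_mono) auto
        also have "\<dots> = C0 * sqrt (q k)" using False l by (simp add: q_def y_def S_def)
        finally show ?thesis using C0 by simp
      qed
      have 3: "C0 * sqrt (q k) \<le> c / 16 * q k + 4 * C0\<^sup>2 / c"
      proof -
        have "0 \<le> (c * sqrt (q k) - 8 * C0)\<^sup>2" by simp
        also have "\<dots> = c * (c * q k) - 16 * c * (C0 * sqrt (q k)) + 64 * C0\<^sup>2"
          using q0[of k] by (simp add: power2_diff power_mult_distrib) (simp add: power2_eq_square)
        finally have "16 * c * (C0 * sqrt (q k)) \<le> c * (c * q k) + 64 * C0\<^sup>2" by simp
        then show ?thesis using c by (simp add: field_simps power2_eq_square)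
      qed
      have "p k \<le> gauss_density d l y + (min (C0 / l) (C0 * (1 + \<bar>y\<bar>) / S) + R / S)"
        using ap unfolding y_def S_def by (smt (verit))
      then have "S * p k \<le> S * (gauss_density d l y + (min (C0 / l) (C0 * (1 + \<bar>y\<bar>) / S) + R / S))"
        using S by (intro mult_left_mono) auto
      also have "\<dots> = S * gauss_density d l y + S * min (C0 / l) (C0 * (1 + \<bar>y\<bar>) / S) + R"
        using S by (simp add: distrib_left)
      finally show ?thesis using 1 2 3 by (simp add: A1_def)
    qed
    have lower: "S * P \<ge> c * l - (A2 + R)"
    proof -
      define k0 where "k0 = nat \<lfloor>m\<rfloor>"
      define y where "y = real k0 - m"
      have y: "\<bar>y\<bar> \<le> 1" unfolding y_def k0_def using m by linarith
      define x where "x = y\<^sup>2 * d\<^sup>2 / (4 * l)"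
      have "y\<^sup>2 \<le> 1" using y by (simp add: abs_square_le_1)
      then have xl: "x * l \<le> d\<^sup>2 / 4" using l mult_right_mono[of "y\<^sup>2" 1 "d\<^sup>2"] by (simp add: x_def)
      have "c * l - c * d\<^sup>2 / 4 \<le> c * l - c * (x * l)" using c mult_left_mono[OF xl, of c] by simp
      also have "\<dots> = c * l * (1 - x)" by (simp add: algebra_simps)
      also have "\<dots> \<le> c * l * exp (- x)" using c l exp_ge_add_one_self[of "- x"] by (intro mult_left_mono) auto
      also have "\<dots> = S * gauss_density d l y" by (simp add: g x_def mult.assoc[symmetric] Smain)
      finally have 1: "c * l - c * d\<^sup>2 / 4 \<le> S * gauss_density d l y" .
      have "gauss_density d l y - (min (C0 / l) (C0 * (1 + \<bar>y\<bar>) / S) + R / S) \<le> p k0"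
        using ap unfolding y_def S_def by (smt (verit))
      moreover have "min (C0 / l) (C0 * (1 + \<bar>y\<bar>) / S) \<le> C0 * 2 / S"
        using y C0 S by (intro min.coboundedI2 divide_right_mono mult_left_mono) auto
      ultimately have "gauss_density d l y - (C0 * 2 / S + R / S) \<le> P" using P(1)[rule_format, of k0] by linarith
      then have "S * (gauss_density d l y - (C0 * 2 / S + R / S)) \<le> S * P" using S by (intro mult_left_mono) auto
      moreover have "S * (gauss_density d l y - (C0 * 2 / S + R / S)) = S * gauss_density d l y - (C0 * 2 + R)"
        using S by (simp add: right_diff_distrib distrib_left)
      ultimately show ?thesis using 1 unfolding A2_def by linarith
    qed
    have up: "S * P \<le> c * l - c / 16 * q k + (A1 + R)" using upper[of k] P(2) by simp
    have AR: "A1 + R \<le> A * (1 + R)" "A2 + R \<le> A * (1 + R)" "A1 + A2 + 2 * R \<le> A * (1 + R)"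
    proof -
      have "2 * R \<le> A * R" using A R by (intro mult_right_mono) auto
      then show "A1 + R \<le> A * (1 + R)" "A2 + R \<le> A * (1 + R)" "A1 + A2 + 2 * R \<le> A * (1 + R)"
        using A R by (auto simp: A_def distrib_left)
    qed
    show "\<bar>P - d / (2 * sqrt (pi * l))\<bar> \<le> C * (1 + R) / (l * sqrt l)"
    proof -
      have "0 \<le> c / 16 * q k" using c q0 by simp
      then have "\<bar>S * P - c * l\<bar> \<le> A * (1 + R)" using up lower AR by linarith
      also have "\<dots> \<le> C * (1 + R)" using CA R by (intro mult_right_mono) auto
      finally have "\<bar>S * (P - main)\<bar> \<le> C * (1 + R)" by (simp add: right_diff_distrib Smain)
      then have "S * \<bar>P - main\<bar> \<le> C * (1 + R)" using S by (simp add: abs_mult)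
      then show ?thesis using S by (simp add: main_def[symmetric] S_def[symmetric] field_simps)
    qed
    have "c / 16 * q k \<le> A * (1 + R)" using up lower AR(3) by linarith
    then have "q k \<le> 16 / c * A * (1 + R)" using c by (simp add: field_simps)
    also have "\<dots> \<le> C * (1 + R)" using CA R by (intro mult_right_mono) auto
    finally show "min ((real k - m)\<^sup>2) l \<le> C * (1 + R)" by (simp add: q_def)
  qed
qed

section \<open>Fourier inversion for a distribution on the levels\<close>

definition char_poly :: "(nat \<Rightarrow> real) \<Rightarrow> nat \<Rightarrow> complex \<Rightarrow> complex" where
  "char_poly p N \<tau> = (\<Sum>k<N. of_real (p k) * exp (\<i> * of_nat k * \<tau>))"

text \<open>The divisor is the characteristic function, at a complex argument, of a Poisson variable
  with mean \<open>2 l\<close> scaled by \<open>1 / d\<close>. The quotient is 1 at 0 whenever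
  \<open>p\<close> is a probability distribution on the levels below \<open>N\<close>.\<close>

definition normalized_char :: "real \<Rightarrow> real \<Rightarrow> (nat \<Rightarrow> real) \<Rightarrow> nat \<Rightarrow> complex \<Rightarrow> complex" where
  "normalized_char d l p N \<tau> = char_poly p N \<tau> * exp (- of_real (2 * l) * (exp (\<i> * \<tau> / of_real d) - 1))"

definition outer_mass :: "real \<Rightarrow> (nat \<Rightarrow> real) \<Rightarrow> nat \<Rightarrow> real" where
  "outer_mass \<rho> p N = (\<integral>\<theta>. indicator ({-pi..pi} - {-\<rho>..\<rho>}) \<theta> * cmod (char_poly p N (of_real \<theta>)) \<partial>lborel)"

lemma integral_cis_period:
  "(\<integral>\<theta>. indicator {-pi..pi} \<theta> *\<^sub>R cis (of_int j * \<theta>) \<partial>lborel) = (if j = 0 then of_real (2 * pi) else 0)"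
proof (cases "j = 0")
  case True
  then have "(\<integral>\<theta>. indicator {-pi..pi} \<theta> *\<^sub>R cis (of_int j * \<theta>) \<partial>lborel) = (\<integral>\<theta>. indicator {-pi..pi} \<theta> *\<^sub>R (1 :: complex) \<partial>lborel)"
    by simp
  also have "\<dots> = of_real pi - of_real (- pi)"
    by (rule integral_FTC_atLeastAtMost) (auto intro!: derivative_eq_intros continuous_intros simp: has_vector_derivative_def scaleR_conv_of_real fun_eq_iff)
  finally show ?thesis using True by simp
next
  case False
  define F where "F \<theta> = cis (of_int j * \<theta>) / (\<i> * of_int j)" for \<theta> :: real
  have "(\<integral>\<theta>. indicator {-pi..pi} \<theta> *\<^sub>R cis (of_int j * \<theta>) \<partial>lborel) = F pi - F (- pi)"
  proof (rule integral_FTC_atLeastAtMost)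
    fix x :: real
    have "((\<lambda>\<theta>. exp (\<i> * of_int j * of_real \<theta>) / (\<i> * of_int j)) has_vector_derivative
       (\<i> * of_int j * exp (\<i> * of_int j * of_real x)) / (\<i> * of_int j)) (at x within {-pi..pi})"
      by (rule has_vector_derivative_real_field) (auto intro!: derivative_eq_intros)
    then show "(F has_vector_derivative cis (of_int j * x)) (at x within {-pi..pi})"
      using False by (simp add: F_def[abs_def] cis_conv_exp mult.assoc)
  qed (auto intro!: continuous_intros)
  moreover have "cis (of_int j * pi) = cis (of_int j * (- pi))"
  proof -
    have "cis (of_int j * pi) = cis (of_int j * (- pi) + 2 * pi * of_int j)" by (simp add: algebra_simps)
    also have "\<dots> = cis (of_int j * (- pi)) * cis (2 * pi * of_int j)" by (simp only: cis_mult)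
    also have "cis (2 * pi * of_int j) = 1" by (rule cis_multiple_2pi) auto
    finally show ?thesis by simp
  qed
  ultimately show ?thesis using False by (simp add: F_def)
qed

lemma char_poly_real: "char_poly p N (of_real \<theta>) = (\<Sum>k<N. of_real (p k) * cis (real k * \<theta>))"
  by (simp add: char_poly_def cis_conv_exp mult_ac)

lemma continuous_char_poly: "continuous_on UNIV (\<lambda>\<theta> :: real. char_poly p N (of_real \<theta>))"
  unfolding char_poly_def by (intro continuous_intros)

lemma integrable_indicator_continuous:
  fixes f :: "real \<Rightarrow> complex"
  assumes "continuous_on UNIV f"
  shows "integrable lborel (\<lambda>\<theta>. indicator {a..b} \<theta> *\<^sub>R f \<theta>)"
  using borel_integrable_compact[of "{a..b}" f] assms by (simp add: continuous_on_subset)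

lemma fourier_inversion:
  assumes "\<And>k. k \<ge> N \<Longrightarrow> p k = 0"
  shows "(\<integral>\<theta>. indicator {-pi..pi} \<theta> *\<^sub>R (char_poly p N (of_real \<theta>) * cis (- real k * \<theta>)) \<partial>lborel) = of_real (2 * pi * p k)"
proof -
  have cp: "char_poly p N (of_real \<theta>) * cis (- real k * \<theta>) = (\<Sum>j<N. of_real (p j) * cis (of_int (int j - int k) * \<theta>))" for \<theta>
    unfolding char_poly_real sum_distrib_right
    by (intro sum.cong refl) (simp add: cis_mult mult.assoc left_diff_distrib)
  have "(\<integral>\<theta>. indicator {-pi..pi} \<theta> *\<^sub>R (char_poly p N (of_real \<theta>) * cis (- real k * \<theta>)) \<partial>lborel)
     = (\<integral>\<theta>. (\<Sum>j<N. of_real (p j) * (indicator {-pi..pi} \<theta> *\<^sub>R cis (of_int (int j - int k) * \<theta>))) \<partial>lborel)"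
    unfolding cp by (simp add: scaleR_sum_right)
  also have "\<dots> = (\<Sum>j<N. of_real (p j) * (\<integral>\<theta>. indicator {-pi..pi} \<theta> *\<^sub>R cis (of_int (int j - int k) * \<theta>) \<partial>lborel))"
  proof -
    have i: "integrable lborel (\<lambda>\<theta>. of_real (p j) * (indicator {-pi..pi} \<theta> *\<^sub>R cis (of_int (int j - int k) * \<theta>)))" for j
      by (intro integrable_mult_right integrable_indicator_continuous continuous_intros)
    show ?thesis by (simp only: Bochner_Integration.integral_sum[OF i] integral_mult_right_zero)
  qed
  also have "\<dots> = (\<Sum>j<N. if j = k then of_real (p j) * of_real (2 * pi) else 0)"
    unfolding integral_cis_period by (intro sum.cong refl) auto
  also have "\<dots> = of_real (2 * pi * p k)"
    using assms by (auto simp: not_less)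
  finally show ?thesis .
qed

text \<open>Let \<open>M\<close> be the normalised transform and \<open>J\<close> its circle mean.
  Then \<open>M 0 = 1\<close>, and the derivative at 0 is \<open>\<i> X\<close>, where
  \<open>X\<close> is the mean level \<open>m\<close> minus \<open>2 l / d\<close>; Cauchy's
  estimate gives \<open>\<bar>X\<bar> \<le> J / r\<close>. Centring at \<open>m\<close> instead of
  \<open>2 l / d\<close> multiplies \<open>M\<close> by \<open>cis (- X * \<theta>)\<close>, which
  removes the linear term and leaves \<open>1 + O((J + J^2) \<theta>^2)\<close>. Under the Gaussian
  integral \<open>\<theta>^2\<close> is worth \<open>1 / l\<close>, whence the error
  \<open>(J + J^2) / (l sqrt l)\<close>. Arguments beyond \<open>r / 2\<close>, where the Taylor
  estimate stops, are left to \<open>outer_mass\<close>.\<close>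

lemma profile_density_bound:
  fixes r d :: real
  assumes r: "0 < r" "r \<le> 2" and d: "d \<ge> 1"
  shows "\<exists>C\<ge>0. \<forall>p N l k. (\<forall>k. p k \<ge> 0) \<longrightarrow> (\<forall>k\<ge>N. p k = 0) \<longrightarrow> (\<Sum>k<N. p k) = 1 \<longrightarrow> l \<ge> 1 \<longrightarrow>
     \<bar>(\<Sum>k<N. real k * p k) - 2 * l / d\<bar> \<le> circle_mean (normalized_char d l p N) r / r \<and>
     \<bar>p k - gauss_density d l (real k - (\<Sum>k<N. real k * p k))\<bar>
       \<le> min (C / l) (C * (1 + \<bar>real k - (\<Sum>k<N. real k * p k)\<bar>) / (l * sqrt l))
        + (C * (circle_mean (normalized_char d l p N) r + (circle_mean (normalized_char d l p N) r)\<^sup>2)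
            + l * sqrt l * outer_mass (r / 2) p N) / (l * sqrt l)"
proof -
  define \<rho> where "\<rho> = r / 2"
  have \<rho>: "0 < \<rho>" "\<rho> \<le> 1" "\<rho> \<le> pi" using r pi_gt3 by (auto simp: \<rho>_def)
  obtain C where C: "C \<ge> 0" "\<And>l y. l \<ge> 1 \<Longrightarrow> 
    cmod (gauss_kernel \<rho> d l y - of_real (sqrt (pi * d\<^sup>2 / l) * exp (- (y\<^sup>2 * d\<^sup>2 / (4 * l))))) \<le> C / l \<and>
    \<bar>Re (gauss_kernel \<rho> d l y) - sqrt (pi * d\<^sup>2 / l) * exp (- (y\<^sup>2 * d\<^sup>2 / (4 * l)))\<bar> \<le> C * (1 + \<bar>y\<bar>) / (l * sqrt l)"
    using gauss_kernel_approx[OF \<rho>(1,2) d] by blast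
  define C1 where "C1 = 8 / r\<^sup>2 * d\<^sup>2 * (sqrt (4 * pi) * d)"
  have C10: "C1 \<ge> 0" using d by (simp add: C1_def)
  define C2 where "C2 = C + C1"
  have C2: "C2 \<ge> C" "C2 \<ge> C1" "C2 \<ge> 0" using C(1) C10 by (auto simp: C2_def)
  show ?thesis
  proof (intro exI[of _ C2] conjI C2(3) allI impI)
    fix p :: "nat \<Rightarrow> real" and N k :: nat and l :: real
    assume p0: "\<forall>k. p k \<ge> 0" and pN: "\<forall>k\<ge>N. p k = 0" and p1: "(\<Sum>k<N. p k) = 1" and l: "l \<ge> 1"
    define m where "m = (\<Sum>k<N. real k * p k)"
    define X where "X = m - 2 * l / d"
    define M where "M = normalized_char d l p N"
    define J where "J = circle_mean M r"
    have M0: "M 0 = 1" using p1 by (simp add: M_def normalized_char_def char_poly_def flip: of_real_sum)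
    have hol: "M holomorphic_on UNIV"
      unfolding M_def normalized_char_def char_poly_def using d by (intro holomorphic_intros) auto
    have der: "(M has_field_derivative (\<i> * of_real X)) (at 0)"
    proof -
      have "(char_poly p N has_field_derivative (\<Sum>k<N. of_real (p k) * (\<i> * of_nat k))) (at 0)"
        unfolding char_poly_def[abs_def] by (auto intro!: derivative_eq_intros sum.cong)
      moreover have "((\<lambda>\<tau>. exp (- of_real (2 * l) * (exp (\<i> * \<tau> / of_real d) - 1))) has_field_derivative
          (- of_real (2 * l) * (\<i> / of_real d))) (at 0)"
        using d by (auto intro!: derivative_eq_intros)
      ultimately have "(M has_field_derivative (char_poly p N 0 * (- of_real (2 * l) * (\<i> / of_real d))
          + (\<Sum>k<N. of_real (p k) * (\<i> * of_nat k)) * exp (- of_real (2 * l) * (exp (\<i> * 0 / of_real d) - 1)))) (at 0)"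
        unfolding M_def normalized_char_def[abs_def] by (rule DERIV_mult')
      moreover have "char_poly p N 0 = 1" using p1 by (simp add: char_poly_def flip: of_real_sum)
      moreover have "(\<Sum>k<N. of_real (p k) * (\<i> * of_nat k)) = \<i> * of_real m"
        by (simp add: m_def sum_distrib_left mult_ac)
      ultimately show ?thesis by (simp add: X_def algebra_simps)
    qed
    have XJ: "\<bar>X\<bar> \<le> J / r" using cauchy_taylor(2)[OF hol r(1) _ der, of 0] r by (simp add: J_def norm_mult)
    then show "\<bar>(\<Sum>k<N. real k * p k) - 2 * l / d\<bar> \<le> circle_mean (normalized_char d l p N) r / r"
      by (simp add: X_def m_def J_def M_def)
    have J0: "J \<ge> 0" using XJ r by (metis abs_ge_zero order_trans zero_le_divide_iff not_less)
    define b where "b = l / d\<^sup>2"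
    have b: "b > 0" using l d by (simp add: b_def)
    define y where "y = real k - m"
    define E where "E \<theta> = exp (of_real (2 * l) * (cis (\<theta> / d) - 1 - \<i> * of_real (\<theta> / d)))" for \<theta>
    define Fi where "Fi \<theta> = char_poly p N (of_real \<theta>) * cis (- real k * \<theta>)" for \<theta>
    have E_le: "cmod (E \<theta>) \<le> exp (- (b / 2) * \<theta>\<^sup>2)" if "\<theta> \<in> {-\<rho>..\<rho>}" for \<theta>
    proof -
      have "\<bar>\<theta> / d\<bar> \<le> 1" using that \<rho> d by (auto simp: abs_divide divide_le_eq)
      from exp_perturbation_bounds(3)[OF this l] show ?thesis by (simp add: E_def b_def power_divide)
    qed
    \<comment> \<open>The phase \<open>k * \<theta>\<close> is distributed according to
      \<open>k = 2 l / d + X + y\<close>: the drift cancels against the divisor in \<open>M\<close>,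
      the shift \<open>X\<close> goes to \<open>M\<close> and the distance \<open>y\<close> to the
      kernel.\<close>
    have Fi_eq: "Fi \<theta> = (M (of_real \<theta>) * cis (- X * \<theta>)) * (E \<theta> * cis (- y * \<theta>))" for \<theta>
    proof -
      have "exp (\<i> * of_real \<theta> / of_real d) = cis (\<theta> / d)" by (simp add: cis_conv_exp)
      then have "M (of_real \<theta>) * E \<theta> = char_poly p N (of_real \<theta>) * (exp (- of_real (2 * l) * (cis (\<theta> / d) - 1)) * E \<theta>)"
        by (simp add: M_def normalized_char_def)
      also have "exp (- of_real (2 * l) * (cis (\<theta> / d) - 1)) * E \<theta> = exp (\<i> * of_real (- (2 * l * \<theta> / d)))"
        unfolding E_def exp_add[symmetric] by (simp add: algebra_simps)
      also have "\<dots> = cis (- (2 * l * \<theta> / d))" by (simp only: cis_conv_exp)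
      finally have "(M (of_real \<theta>) * cis (- X * \<theta>)) * (E \<theta> * cis (- y * \<theta>))
        = char_poly p N (of_real \<theta>) * (cis (- (2 * l * \<theta> / d)) * cis (- X * \<theta>) * cis (- y * \<theta>))"
        by (simp add: mult_ac)
      also have "cis (- (2 * l * \<theta> / d)) * cis (- X * \<theta>) * cis (- y * \<theta>) = cis (- real k * \<theta>)"
        unfolding cis_mult by (rule arg_cong[of _ _ cis]) (simp add: X_def y_def algebra_simps)
      finally show ?thesis by (simp add: Fi_def)
    qed
    \<comment> \<open>\<open>J\<close> comes from the Taylor remainder of \<open>M\<close>, and
      \<open>J^2\<close> from that of \<open>cis (X * \<theta>)\<close>.\<close>
    have M_le: "cmod (M (of_real \<theta>) * cis (- X * \<theta>) - 1) \<le> 2 / r\<^sup>2 * (J + J\<^sup>2) * \<theta>\<^sup>2" if "\<theta> \<in> {-\<rho>..\<rho>}" for \<theta>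
    proof -
      have "M (of_real \<theta>) * cis (- X * \<theta>) - 1 = (M (of_real \<theta>) - cis (X * \<theta>)) * cis (- X * \<theta>)"
        by (simp add: left_diff_distrib cis_mult)
      then have "cmod (M (of_real \<theta>) * cis (- X * \<theta>) - 1) = cmod (M (of_real \<theta>) - cis (X * \<theta>))" by (simp add: norm_mult)
      also have "\<dots> = cmod ((M (of_real \<theta>) - 1 - \<i> * of_real X * of_real \<theta>) - (cis (X * \<theta>) - (1 + \<i> * of_real (X * \<theta>))))"
        by (simp add: algebra_simps)
      also have "\<dots> \<le> cmod (M (of_real \<theta>) - 1 - \<i> * of_real X * of_real \<theta>) + cmod (cis (X * \<theta>) - (1 + \<i> * of_real (X * \<theta>)))"
        by (rule norm_triangle_ineq4)
      also have "cmod (M (of_real \<theta>) - 1 - \<i> * of_real X * of_real \<theta>) \<le> 2 * J * \<theta>\<^sup>2 / r\<^sup>2"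
      proof -
        have "cmod (of_real \<theta>) \<le> r / 2" using that by (auto simp: \<rho>_def abs_le_iff)
        from cauchy_taylor(1)[OF hol r(1) this der] show ?thesis by (simp add: J_def M0)
      qed
      also have "cmod (cis (X * \<theta>) - (1 + \<i> * of_real (X * \<theta>))) \<le> 2 * J\<^sup>2 * \<theta>\<^sup>2 / r\<^sup>2"
      proof -
        have "cmod (cis (X * \<theta>) - (1 + \<i> * of_real (X * \<theta>))) \<le> \<bar>X * \<theta>\<bar>\<^sup>2 / 2"
          using iexp_approx1[of "X * \<theta>" 1] by (simp add: cis_conv_exp power2_eq_square)
        also have "\<dots> = \<bar>X\<bar>\<^sup>2 * \<theta>\<^sup>2 / 2" by (simp add: power_mult_distrib)
        also have "\<dots> \<le> (J / r)\<^sup>2 * \<theta>\<^sup>2 / 2" using XJ by (intro divide_right_mono mult_right_mono power_mono) auto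
        also have "\<dots> = J\<^sup>2 * \<theta>\<^sup>2 / r\<^sup>2 / 2" by (simp add: power_divide)
        also have "\<dots> \<le> 2 * (J\<^sup>2 * \<theta>\<^sup>2 / r\<^sup>2)"
        proof -
          have *: "x / 2 \<le> 2 * x" if "x \<ge> 0" for x :: real using that by simp
          show ?thesis by (rule *) simp
        qed
        finally show ?thesis by simp
      qed
      finally show ?thesis by (simp add: add_divide_distrib algebra_simps)
    qed
    have contFi: "continuous_on UNIV Fi"
      unfolding Fi_def[abs_def] by (intro continuous_on_mult continuous_char_poly continuous_intros)
    have contE: "continuous_on UNIV (\<lambda>\<theta>. E \<theta> * cis (- y * \<theta>))"
      unfolding E_def using d by (intro continuous_intros) auto
    have sl: "sqrt l > 0" using l by simp
    have inner: "cmod ((\<integral>\<theta>. indicator {-\<rho>..\<rho>} \<theta> *\<^sub>R Fi \<theta> \<partial>lborel) - gauss_kernel \<rho> d l y) \<le> C1 * (J + J\<^sup>2) / (l * sqrt l)"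
    proof -
      have i1: "integrable lborel (\<lambda>\<theta>. indicator {-\<rho>..\<rho>} \<theta> *\<^sub>R Fi \<theta>)"
        and i2: "integrable lborel (\<lambda>\<theta>. indicator {-\<rho>..\<rho>} \<theta> *\<^sub>R (E \<theta> * cis (- y * \<theta>)))"
        by (intro integrable_indicator_continuous contFi contE)+
      define B where "B \<theta> = exp (- (b / 4) * \<theta>\<^sup>2)" for \<theta> :: real
      have iB: "integrable lborel B" and intB: "(\<integral>\<theta>. B \<theta> \<partial>lborel) = sqrt (4 * pi) * d / sqrt l"
      proof -
        show "integrable lborel B" unfolding B_def using integrable_gauss(1)[of "b / 4"] b by simp
        have "(\<integral>\<theta>. B \<theta> \<partial>lborel) = sqrt (pi / (b / 4))"
          unfolding B_def using integrable_gauss(2)[of "b / 4"] b by simp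
        also have "\<dots> = sqrt (4 * pi * d\<^sup>2 / l)" by (simp add: b_def mult_ac)
        finally show "(\<integral>\<theta>. B \<theta> \<partial>lborel) = sqrt (4 * pi) * d / sqrt l"
          using d by (simp add: real_sqrt_divide real_sqrt_mult)
      qed
      have pw: "cmod (indicator {-\<rho>..\<rho>} \<theta> *\<^sub>R Fi \<theta> - indicator {-\<rho>..\<rho>} \<theta> *\<^sub>R (E \<theta> * cis (- y * \<theta>)))
          \<le> 2 / r\<^sup>2 * (J + J\<^sup>2) * (4 / b) * B \<theta>" for \<theta>
      proof (cases "\<theta> \<in> {-\<rho>..\<rho>}")
        case True
        have "Fi \<theta> - E \<theta> * cis (- y * \<theta>) = (M (of_real \<theta>) * cis (- X * \<theta>) - 1) * (E \<theta> * cis (- y * \<theta>))"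
          unfolding Fi_eq by (simp add: left_diff_distrib)
        then have "cmod (Fi \<theta> - E \<theta> * cis (- y * \<theta>)) = cmod (M (of_real \<theta>) * cis (- X * \<theta>) - 1) * cmod (E \<theta>)"
          by (simp add: norm_mult)
        also have "\<dots> \<le> (2 / r\<^sup>2 * (J + J\<^sup>2) * \<theta>\<^sup>2) * exp (- (b / 2) * \<theta>\<^sup>2)"
          using M_le[OF True] E_le[OF True] J0 by (intro mult_mono) auto
        also have "\<dots> = 2 / r\<^sup>2 * (J + J\<^sup>2) * (\<theta>\<^sup>2 * exp (- (b / 2) * \<theta>\<^sup>2))" by simp
        also have "\<dots> \<le> 2 / r\<^sup>2 * (J + J\<^sup>2) * (4 / b * B \<theta>)"
        proof (rule mult_left_mono)
          have "b / 4 * \<theta>\<^sup>2 \<le> exp (b / 4 * \<theta>\<^sup>2)" using exp_ge_add_one_self[of "b / 4 * \<theta>\<^sup>2"] by linarith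
          then have "b / 4 * \<theta>\<^sup>2 * exp (- (b / 2) * \<theta>\<^sup>2) \<le> exp (b / 4 * \<theta>\<^sup>2) * exp (- (b / 2) * \<theta>\<^sup>2)"
            by (intro mult_right_mono) auto
          also have "\<dots> = B \<theta>" unfolding exp_add[symmetric] B_def by (rule arg_cong[of _ _ exp]) (simp add: field_simps)
          finally show "\<theta>\<^sup>2 * exp (- (b / 2) * \<theta>\<^sup>2) \<le> 4 / b * B \<theta>" using b by (simp add: field_simps)
        qed (use J0 in auto)
        also have "\<dots> = 2 / r\<^sup>2 * (J + J\<^sup>2) * (4 / b) * B \<theta>" by (simp only: mult.assoc)
        finally show ?thesis using True by simp
      next
        case False
        then show ?thesis using J0 b by (simp add: B_def)
      qed
      have eq: "(\<integral>\<theta>. indicator {-\<rho>..\<rho>} \<theta> *\<^sub>R Fi \<theta> \<partial>lborel) - gauss_kernel \<rho> d l y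
        = (\<integral>\<theta>. indicator {-\<rho>..\<rho>} \<theta> *\<^sub>R Fi \<theta> - indicator {-\<rho>..\<rho>} \<theta> *\<^sub>R (E \<theta> * cis (- y * \<theta>)) \<partial>lborel)"
        using i1 i2 by (simp add: gauss_kernel_def E_def)
      have "cmod (\<integral>\<theta>. indicator {-\<rho>..\<rho>} \<theta> *\<^sub>R Fi \<theta> - indicator {-\<rho>..\<rho>} \<theta> *\<^sub>R (E \<theta> * cis (- y * \<theta>)) \<partial>lborel)
        \<le> (\<integral>\<theta>. 2 / r\<^sup>2 * (J + J\<^sup>2) * (4 / b) * B \<theta> \<partial>lborel)"
        using i1 i2 iB pw by (intro Bochner_Integration.integral_norm_bound_integral) auto
      also have "\<dots> = C1 * (J + J\<^sup>2) / (l * sqrt l)"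
      proof -
        have *: "2 / R * A * (4 * D / l) * (s * d / q) = 8 / R * D * (s * d) * A / (l * q)" for R A D s q :: real
          by (simp add: mult_ac)
        have b4: "4 / b = 4 * d\<^sup>2 / l" by (simp add: b_def)
        show ?thesis unfolding integral_mult_right_zero intB C1_def b4 by (rule *)
      qed
      finally show ?thesis unfolding eq .
    qed
    define O' where "O' = {-pi..pi} - {-\<rho>..\<rho>}"
    have outer: "cmod (\<integral>\<theta>. indicator O' \<theta> *\<^sub>R Fi \<theta> \<partial>lborel) \<le> outer_mass \<rho> p N"
    proof -
      have "cmod (\<integral>\<theta>. indicator O' \<theta> *\<^sub>R Fi \<theta> \<partial>lborel) \<le> (\<integral>\<theta>. cmod (indicator O' \<theta> *\<^sub>R Fi \<theta>) \<partial>lborel)"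
        by (rule integral_norm_bound)
      also have "\<dots> = outer_mass \<rho> p N"
        unfolding outer_mass_def O'_def by (intro Bochner_Integration.integral_cong) (auto simp: Fi_def norm_mult)
      finally show ?thesis .
    qed
    have split: "of_real (2 * pi * p k) = (\<integral>\<theta>. indicator {-\<rho>..\<rho>} \<theta> *\<^sub>R Fi \<theta> \<partial>lborel) + (\<integral>\<theta>. indicator O' \<theta> *\<^sub>R Fi \<theta> \<partial>lborel)"
    proof -
      have i1: "integrable lborel (\<lambda>\<theta>. indicator {-pi..pi} \<theta> *\<^sub>R Fi \<theta>)" "integrable lborel (\<lambda>\<theta>. indicator {-\<rho>..\<rho>} \<theta> *\<^sub>R Fi \<theta>)"
        by (intro integrable_indicator_continuous contFi)+
      have eq: "indicator O' \<theta> *\<^sub>R Fi \<theta> = indicator {-pi..pi} \<theta> *\<^sub>R Fi \<theta> - indicator {-\<rho>..\<rho>} \<theta> *\<^sub>R Fi \<theta>" for \<theta>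
        using \<rho> by (auto simp: O'_def indicator_def)
      have "of_real (2 * pi * p k) = (\<integral>\<theta>. indicator {-pi..pi} \<theta> *\<^sub>R Fi \<theta> \<partial>lborel)"
        unfolding Fi_def using fourier_inversion[of N p k] pN by simp
      then show ?thesis unfolding eq using i1 by simp
    qed
    define g where "g = sqrt (pi * d\<^sup>2 / l) * exp (- (y\<^sup>2 * d\<^sup>2 / (4 * l)))"
    have gd: "g = 2 * pi * gauss_density d l y"
    proof -
      have "sqrt (pi * d\<^sup>2 / l) = 2 * pi * (d / (2 * sqrt (pi * l)))"
      proof -
        have "2 * pi * (d / (2 * sqrt (pi * l))) = (sqrt pi * sqrt pi) * d / (sqrt pi * sqrt l)"
          by (simp add: real_sqrt_mult)
        also have "\<dots> = sqrt pi * d / sqrt l"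
        proof -
          have *: "a * a * d / (a * q) = a * d / q" if "a \<noteq> 0" for a q :: real using that by simp
          show ?thesis by (rule *) simp
        qed
        also have "\<dots> = sqrt (pi * d\<^sup>2 / l)" using d by (simp add: real_sqrt_divide real_sqrt_mult)
        finally show ?thesis ..
      qed
      then show ?thesis by (simp add: g_def gauss_density_def)
    qed
    have "\<bar>2 * pi * p k - g\<bar> \<le> \<bar>Re (gauss_kernel \<rho> d l y) - g\<bar> + C1 * (J + J\<^sup>2) / (l * sqrt l) + outer_mass \<rho> p N"
    proof -
      define I1 I2 where "I1 = (\<integral>\<theta>. indicator {-\<rho>..\<rho>} \<theta> *\<^sub>R Fi \<theta> \<partial>lborel)" and "I2 = (\<integral>\<theta>. indicator O' \<theta> *\<^sub>R Fi \<theta> \<partial>lborel)"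
      have "2 * pi * p k = Re I1 + Re I2" using arg_cong[OF split, of Re] by (simp add: I1_def I2_def)
      moreover have "\<bar>Re I1 - Re (gauss_kernel \<rho> d l y)\<bar> \<le> C1 * (J + J\<^sup>2) / (l * sqrt l)"
        using inner abs_Re_le_cmod[of "I1 - gauss_kernel \<rho> d l y"] by (simp add: I1_def)
      moreover have "\<bar>Re I2\<bar> \<le> outer_mass \<rho> p N" using outer abs_Re_le_cmod[of I2] by (simp add: I2_def)
      ultimately show ?thesis by linarith
    qed
    also have "\<bar>Re (gauss_kernel \<rho> d l y) - g\<bar> \<le> min (C / l) (C * (1 + \<bar>y\<bar>) / (l * sqrt l))"
      using C(2)[OF l, of y] abs_Re_le_cmod[of "gauss_kernel \<rho> d l y - of_real g"] by (simp add: g_def)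
    also have "\<dots> \<le> min (C2 / l) (C2 * (1 + \<bar>y\<bar>) / (l * sqrt l))"
      using C2 l by (intro min.mono divide_right_mono mult_right_mono) auto
    also have "C1 * (J + J\<^sup>2) / (l * sqrt l) \<le> C2 * (J + J\<^sup>2) / (l * sqrt l)"
      using C2 l J0 by (intro divide_right_mono mult_right_mono) auto
    finally have big: "\<bar>2 * pi * p k - g\<bar> \<le> min (C2 / l) (C2 * (1 + \<bar>y\<bar>) / (l * sqrt l)) + C2 * (J + J\<^sup>2) / (l * sqrt l) + outer_mass \<rho> p N"
      by simp
    have "\<bar>p k - gauss_density d l y\<bar> \<le> (2 * pi) * \<bar>p k - gauss_density d l y\<bar>"
      using pi_gt3 by (simp add: mult_le_cancel_right1)
    also have "\<dots> = \<bar>2 * pi * p k - g\<bar>"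
    proof -
      have "2 * pi * p k - g = 2 * pi * (p k - gauss_density d l y)" by (simp add: gd right_diff_distrib)
      then show ?thesis by (simp add: abs_mult)
    qed
    also note big
    also have "min (C2 / l) (C2 * (1 + \<bar>y\<bar>) / (l * sqrt l)) + C2 * (J + J\<^sup>2) / (l * sqrt l) + outer_mass \<rho> p N
       = min (C2 / l) (C2 * (1 + \<bar>y\<bar>) / (l * sqrt l)) + (C2 * (J + J\<^sup>2) + l * sqrt l * outer_mass \<rho> p N) / (l * sqrt l)"
      using l sl by (simp add: add_divide_distrib)
    finally show "\<bar>p k - gauss_density d l (real k - (\<Sum>k<N. real k * p k))\<bar>
       \<le> min (C2 / l) (C2 * (1 + \<bar>real k - (\<Sum>k<N. real k * p k)\<bar>) / (l * sqrt l))
        + (C2 * (circle_mean (normalized_char d l p N) r + (circle_mean (normalized_char d l p N) r)\<^sup>2)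
            + l * sqrt l * outer_mass (r / 2) p N) / (l * sqrt l)"
      by (simp add: y_def m_def J_def M_def \<rho>_def)
  qed
qed

section \<open>Random profiles: moments of the Fourier data\<close>

text \<open>Of all \<open>d\<close>-th roots of \<open>cis a\<close> with
  \<open>\<bar>a\<bar> \<le> pi\<close>, the principal one has the argument of least absolute value:
  an argument \<open>\<psi>\<close> of any of them satisfies \<open>d \<psi> = a + 2 pi j\<close>,
  hence \<open>\<bar>d \<psi>\<bar> \<ge> \<bar>a\<bar>\<close>. The cosine decreases on
  \<open>[0, pi]\<close>.\<close>

lemma rotation_bound:
  assumes d: "d \<ge> 1" and a: "\<bar>a\<bar> \<le> pi" and \<eta>: "\<eta> ^ d = 1"
  shows "Re (cis (a / real d) * \<eta>) \<le> cos (a / real d)"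
proof -
  define w where "w = cis (a / real d) * \<eta>"
  have n\<eta>: "cmod \<eta> = 1" using d power_eq_1_iff[OF \<eta>] by auto
  then have "cmod w = 1" by (simp add: w_def norm_mult)
  define \<psi> where "\<psi> = Arg w"
  have w: "w = cis \<psi>" using \<open>cmod w = 1\<close> rcis_cmod_Arg[of w] by (simp add: \<psi>_def rcis_def)
  have \<psi>: "\<bar>\<psi>\<bar> \<le> pi" using Arg_bounded[of w] by (auto simp: \<psi>_def)
  have "cis (real d * \<psi>) = w ^ d" unfolding w Complex.DeMoivre ..
  also have "\<dots> = cis a" using \<eta> d by (simp add: w_def power_mult_distrib Complex.DeMoivre)
  finally have "cos (real d * \<psi>) = cos a \<and> sin (real d * \<psi>) = sin a" by (simp add: complex_eq_iff)
  then obtain j :: int where j: "real d * \<psi> = a + 2 * pi * of_int j"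
    using sin_cos_eq_iff[of "real d * \<psi>" a] by auto
  have "\<bar>a\<bar> \<le> \<bar>real d * \<psi>\<bar>"
  proof (cases "j = 0")
    case False
    then have "1 \<le> \<bar>real_of_int j\<bar>" by linarith
    then have "2 * pi \<le> \<bar>2 * pi * of_int j\<bar>" by (simp add: abs_mult)
    then show ?thesis using a j by linarith
  qed (use j in simp)
  then have "\<bar>a\<bar> \<le> real d * \<bar>\<psi>\<bar>" by (simp add: abs_mult)
  then have "\<bar>a / real d\<bar> \<le> \<bar>\<psi>\<bar>" using d by (simp add: divide_le_eq mult.commute)
  then have "cos \<bar>\<psi>\<bar> \<le> cos \<bar>a / real d\<bar>" using \<psi> by (intro cos_monotone_0_pi_le) auto
  then show ?thesis unfolding w_def[symmetric] w cos_abs_real by simp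
qed

lemma exp_split: "exp (\<i> * \<tau> / of_nat d) = of_real (exp (- Im \<tau> / real d)) * cis (Re \<tau> / real d)"
proof -
  have "\<i> * \<tau> / of_nat d = of_real (- Im \<tau> / real d) + \<i> * of_real (Re \<tau> / real d)"
    by (cases "d = 0") (auto simp: complex_eq_iff field_simps)
  then show ?thesis by (simp only: exp_add cis_conv_exp exp_of_real)
qed

text \<open>By \<open>rotation_bound\<close> the condition on all roots of \<open>z\<close> reduces
  to one on the principal root.\<close>

lemma moment_domain_exp:
  assumes \<tau>: "\<bar>Re \<tau>\<bar> \<le> pi" and e: "exp (- Im \<tau> / CARD('d)) \<le> 5/4" and z: "exp (- Im \<tau>) ^ s \<le> 21/20"
    and \<alpha>: "3/4 \<le> \<alpha>" "\<alpha> \<le> 3/2" "2 * Re (exp (\<i> * \<tau> / of_nat CARD('d))) \<le> \<alpha> + 1"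
  shows "(exp (\<i> * \<tau>), \<alpha>) \<in> moment_domain TYPE('d::finite) s"
proof -
  let ?d = "CARD('d)"
  define \<zeta> where "\<zeta> = exp (\<i> * \<tau> / of_nat ?d)"
  have d: "?d \<ge> 1" by (simp add: Suc_leI)
  have "exp (\<i> * \<tau>) = \<zeta> ^ ?d" by (simp add: \<zeta>_def exp_of_nat_mult[symmetric])
  moreover have "cmod \<zeta> \<le> 2" using e unfolding \<zeta>_def exp_split by (simp add: norm_mult)
  moreover have "2 * Re (\<zeta> * \<eta>) \<le> \<alpha> + 1" if "\<eta> ^ ?d = 1" for \<eta>
  proof -
    have "Re (\<zeta> * \<eta>) = exp (- Im \<tau> / ?d) * Re (cis (Re \<tau> / ?d) * \<eta>)"
      unfolding \<zeta>_def exp_split by (simp add: mult.assoc algebra_simps)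
    also have "\<dots> \<le> exp (- Im \<tau> / ?d) * cos (Re \<tau> / ?d)"
      using rotation_bound[OF d \<tau> that] by (intro mult_left_mono) auto
    also have "\<dots> = Re \<zeta>" unfolding \<zeta>_def exp_split by simp
    finally show ?thesis using \<alpha>(3) unfolding \<zeta>_def by linarith
  qed
  moreover have "cmod (exp (\<i> * \<tau>)) ^ s \<le> 21/20" using z by (simp add: norm_exp_eq_Re)
  ultimately show ?thesis using \<alpha> unfolding moment_domain_def by blast
qed

text \<open>The radius makes \<open>cmod z ^ s \<le> exp (1/40) \<le> 40/39\<close>, which is below
  21/20, and keeps the principal root near 1, so that its own exponent
  \<open>2 Re \<zeta> - 1\<close> lies between 3/4 and 3/2. On the circle the moments are thus
  bounded by exactly the power of \<open>n\<close> that \<open>normalized_char\<close> divides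
  out.\<close>

lemma moment_domain_circle:
  assumes s: "s \<ge> 1" and \<tau>: "cmod \<tau> \<le> 1 / (40 * real s)"
  shows "(exp (\<i> * \<tau>), 2 * Re (exp (\<i> * \<tau> / of_nat CARD('d))) - 1) \<in> moment_domain TYPE('d::finite) s"
proof -
  let ?d = "real CARD('d)"
  have d: "?d \<ge> 1" by (simp add: Suc_leI)
  have "1 / (40 * real s) \<le> 1 / 40" using s by (simp add: divide_simps)
  then have t: "cmod \<tau> \<le> 1/40" using \<tau> by linarith
  have im: "\<bar>Im \<tau>\<bar> \<le> 1/40" "\<bar>Re \<tau>\<bar> \<le> 1/40" using t abs_Im_le_cmod[of \<tau>] abs_Re_le_cmod[of \<tau>] by linarith+
  have imd: "\<bar>- Im \<tau> / ?d\<bar> \<le> 1/40" "\<bar>Re \<tau> / ?d\<bar> \<le> 1/40"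
  proof -
    have *: "\<bar>x / ?d\<bar> \<le> 1/40" if x: "\<bar>x\<bar> \<le> 1/40" for x
    proof -
      have "\<bar>x / ?d\<bar> = \<bar>x\<bar> / ?d" by simp
      also have "\<dots> \<le> \<bar>x\<bar> / 1" using d by (intro divide_left_mono) auto
      finally show ?thesis using x by linarith
    qed
    show "\<bar>- Im \<tau> / ?d\<bar> \<le> 1/40" "\<bar>Re \<tau> / ?d\<bar> \<le> 1/40" using im by (intro *; simp)+
  qed
  have exp40: "exp (1/40 :: real) \<le> 40/39"
  proof -
    have "1 - 1/40 \<le> exp (- (1/40) :: real)" using exp_ge_add_one_self[of "- (1/40) :: real"] by simp
    then have "39/40 * exp (1/40) \<le> exp (- (1/40)) * exp (1/40 :: real)" by (intro mult_right_mono) auto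
    also have "\<dots> = 1" by (simp add: exp_add[symmetric])
    finally show ?thesis by simp
  qed
  have e: "39/40 \<le> exp (- Im \<tau> / ?d)" "exp (- Im \<tau> / ?d) \<le> 40/39"
  proof -
    show "39/40 \<le> exp (- Im \<tau> / ?d)" using exp_ge_add_one_self[of "- Im \<tau> / ?d"] imd by linarith
    have "- Im \<tau> / ?d \<le> 1/40" using imd by linarith
    then have "exp (- Im \<tau> / ?d) \<le> exp (1/40)" by (simp only: exp_le_cancel_iff)
    then show "exp (- Im \<tau> / ?d) \<le> 40/39" using exp40 by linarith
  qed
  have c: "19/20 \<le> cos (Re \<tau> / ?d)" "cos (Re \<tau> / ?d) \<le> 1"
  proof -
    define x where "x = Re \<tau> / ?d / 2"
    have "(sin x)\<^sup>2 \<le> (1/80)\<^sup>2"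
    proof (subst abs_le_square_iff[symmetric])
      have "\<bar>sin x\<bar> \<le> \<bar>x\<bar>" by (rule abs_sin_x_le_abs_x)
      also have "\<bar>x\<bar> = \<bar>Re \<tau> / ?d\<bar> / 2" unfolding x_def by (subst abs_divide) simp
      also have "\<dots> \<le> (1/40) / 2" using imd(2) by (rule divide_right_mono) simp
      finally show "\<bar>sin x\<bar> \<le> \<bar>1/80\<bar>" by simp
    qed
    moreover have "cos (Re \<tau> / ?d) = 1 - 2 * (sin x)\<^sup>2" using cos_double_sin[of x] by (simp add: x_def)
    ultimately show "19/20 \<le> cos (Re \<tau> / ?d)" by (simp add: power2_eq_square)
  qed simp
  have re: "Re (exp (\<i> * \<tau> / of_nat CARD('d))) = exp (- Im \<tau> / ?d) * cos (Re \<tau> / ?d)"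
    unfolding exp_split by simp
  have lo: "39/40 * (19/20) \<le> exp (- Im \<tau> / ?d) * cos (Re \<tau> / ?d)" using e c by (intro mult_mono) auto
  have hi: "exp (- Im \<tau> / ?d) * cos (Re \<tau> / ?d) \<le> 40/39 * 1" using e c by (intro mult_mono) auto
  have zs: "exp (- Im \<tau>) ^ s \<le> 21/20"
  proof -
    have "real s * (- Im \<tau>) \<le> real s * (1 / (40 * real s))"
      using \<tau> abs_Im_le_cmod[of \<tau>] by (intro mult_left_mono) auto
    also have "\<dots> = 1/40" using s by simp
    finally have "exp (real s * (- Im \<tau>)) \<le> exp (1/40)" by (simp only: exp_le_cancel_iff)
    then have "exp (real s * (- Im \<tau>)) \<le> 21/20" using exp40 by linarith
    then show ?thesis unfolding exp_of_nat_mult .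
  qed
  show ?thesis
    by (rule moment_domain_exp) (use im e re lo hi zs pi_gt3 in auto)
qed

text \<open>On the real axis \<open>z\<close> has modulus 1, so every order \<open>s\<close> is
  admissible. The exponent is raised to 3/4 where the cosine falls too low; away from
  \<open>\<theta> = 0\<close> it still stays below 1.\<close>

lemma moment_domain_real:
  assumes "\<bar>\<theta>\<bar> \<le> pi"
  shows "(exp (\<i> * of_real \<theta>), max (2 * cos (\<theta> / CARD('d)) - 1) (3/4)) \<in> moment_domain TYPE('d::finite) s"
proof (rule moment_domain_exp)
  show "2 * Re (exp (\<i> * of_real \<theta> / of_nat CARD('d))) \<le> max (2 * cos (\<theta> / CARD('d)) - 1) (3/4) + 1"
    unfolding exp_split by simp
  show "max (2 * cos (\<theta> / CARD('d)) - 1) (3/4) \<le> 3/2"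
    using cos_le_one[of "\<theta> / CARD('d)"] by linarith
qed (use assms in auto)

text \<open>The tangent at \<open>c\<close> lies below the convex power function. Integrated with
  \<open>c\<close> the mean value, this is Jensen's inequality in
  \<open>integral_power_le\<close>.\<close>

lemma power_tangent:
  fixes x c :: real
  assumes "x \<ge> 0" "c \<ge> 0"
  shows "c ^ s + real s * c ^ (s - 1) * (x - c) \<le> x ^ s"
proof (induction s)
  case (Suc s)
  show ?case
  proof (cases s)
    case (Suc k)
    have "x * (c ^ s + real s * c ^ (s - 1) * (x - c)) \<le> x * x ^ s" using Suc.IH assms by (intro mult_left_mono)
    moreover have "x * (c ^ s + real s * c ^ (s - 1) * (x - c)) - (c ^ Suc s + real (Suc s) * c ^ s * (x - c))
      = real s * c ^ k * (x - c)\<^sup>2" by (simp add: Suc power2_eq_square algebra_simps)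
    moreover have "0 \<le> real s * c ^ k * (x - c)\<^sup>2" using assms by simp
    ultimately show ?thesis by simp
  qed simp
qed simp

lemma integral_power_le:
  fixes g :: "real \<Rightarrow> real"
  assumes ab: "a < b" and g: "g \<in> borel_measurable borel" "\<And>t. 0 \<le> g t" "\<And>t. g t \<le> B"
  shows "(\<integral>t. indicator {a..b} t * g t \<partial>lborel) ^ s \<le> (b - a) ^ s * ((\<integral>t. indicator {a..b} t * g t ^ s \<partial>lborel) / (b - a))"
proof -
  define J where "J = (\<integral>t. indicator {a..b} t * g t \<partial>lborel)"
  define c where "c = J / (b - a)"
  have J0: "J \<ge> 0" unfolding J_def using g(2) by (intro Bochner_Integration.integral_nonneg) auto
  have c0: "c \<ge> 0" using J0 ab by (simp add: c_def)
  have B0: "B \<ge> 0" using g(2,3)[of 0] by linarith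
  have i0: "integrable lborel (indicator {a..b} :: real \<Rightarrow> real)"
    using ab by (intro integrable_real_indicator) auto
  have int: "integrable lborel (\<lambda>t. indicator {a..b} t * g t ^ j)" for j
  proof (rule Bochner_Integration.integrable_bound[of _ "\<lambda>t. indicator {a..b} t * B ^ j"])
    show "AE t in lborel. norm (indicator {a..b} t * g t ^ j) \<le> norm (indicator {a..b} t * B ^ j)"
      using g(2,3) B0 by (auto simp: abs_mult power_abs indicator_def intro!: power_mono)
  qed (use g(1) i0 in auto)
  have "(b - a) * c ^ s = (\<integral>t. indicator {a..b} t * (c ^ s + real s * c ^ (s - 1) * (g t - c)) \<partial>lborel)"
  proof -
    have "(\<integral>t. indicator {a..b} t * (c ^ s + real s * c ^ (s - 1) * (g t - c)) \<partial>lborel)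
      = (\<integral>t. (c ^ s - real s * c ^ (s - 1) * c) * indicator {a..b} t + real s * c ^ (s - 1) * (indicator {a..b} t * g t) \<partial>lborel)"
      by (intro Bochner_Integration.integral_cong) (auto simp: algebra_simps)
    also have "\<dots> = (c ^ s - real s * c ^ (s - 1) * c) * (b - a) + real s * c ^ (s - 1) * J"
      using int[of 1] i0 ab by (simp add: J_def)
    also have "J = c * (b - a)" using ab by (simp add: c_def)
    finally show ?thesis by (simp add: algebra_simps)
  qed
  also have "\<dots> \<le> (\<integral>t. indicator {a..b} t * g t ^ s \<partial>lborel)"
  proof (rule Bochner_Integration.integral_mono)
    have "integrable lborel (\<lambda>t. (c ^ s - real s * c ^ (s - 1) * c) * indicator {a..b} t + real s * c ^ (s - 1) * (indicator {a..b} t * g t))"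
      using int[of 1] i0 by simp
    then show "integrable lborel (\<lambda>t. indicator {a..b} t * (c ^ s + real s * c ^ (s - 1) * (g t - c)))"
      by (simp add: algebra_simps)
  qed (use int power_tangent[OF g(2) c0] in \<open>auto simp: indicator_def\<close>)
  finally have "c ^ s \<le> (\<integral>t. indicator {a..b} t * g t ^ s \<partial>lborel) / (b - a)" using ab by (simp add: field_simps)
  then have "(b - a) ^ s * c ^ s \<le> (b - a) ^ s * ((\<integral>t. indicator {a..b} t * g t ^ s \<partial>lborel) / (b - a))"
    using ab by (intro mult_left_mono) auto
  then show ?thesis using ab by (simp add: power_mult_distrib[symmetric] c_def J_def)
qed

text \<open>Jensen's inequality in \<open>t\<close> for each \<open>\<omega>\<close>, then Tonelli's
  theorem. Integrability of the power is a conclusion: its nonnegative integral comes out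
  finite.\<close>

lemma (in prob_space) expectation_integral_power_le:
  fixes g :: "'a \<Rightarrow> real \<Rightarrow> real"
  assumes ab: "a < b" and m: "(\<lambda>(\<omega>, t). g \<omega> t) \<in> borel_measurable (M \<Otimes>\<^sub>M lborel)"
    and g: "\<And>\<omega> t. \<omega> \<in> space M \<Longrightarrow> 0 \<le> g \<omega> t" "\<And>\<omega> t. \<omega> \<in> space M \<Longrightarrow> g \<omega> t \<le> B \<omega>"
    and K: "\<And>t. t \<in> {a..b} \<Longrightarrow> integrable M (\<lambda>\<omega>. g \<omega> t ^ s)" "\<And>t. t \<in> {a..b} \<Longrightarrow> expectation (\<lambda>\<omega>. g \<omega> t ^ s) \<le> K" "K \<ge> 0"
  shows "(\<lambda>\<omega>. \<integral>t. indicator {a..b} t * g \<omega> t \<partial>lborel) \<in> borel_measurable M"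
    and "integrable M (\<lambda>\<omega>. (\<integral>t. indicator {a..b} t * g \<omega> t \<partial>lborel) ^ s)"
    and "expectation (\<lambda>\<omega>. (\<integral>t. indicator {a..b} t * g \<omega> t \<partial>lborel) ^ s) \<le> (b - a) ^ s * K"
proof -
  let ?J = "\<lambda>\<omega>. \<integral>t. indicator {a..b} t * g \<omega> t \<partial>lborel"
  interpret P: pair_sigma_finite M "lborel :: real measure" ..
  have m1: "(\<lambda>(\<omega>, t). indicator {a..b} t * g \<omega> t) \<in> borel_measurable (M \<Otimes>\<^sub>M lborel)"
    using m by measurable
  have i0: "integrable lborel (indicator {a..b} :: real \<Rightarrow> real)"
    using ab by (intro integrable_real_indicator) auto
  show mJ: "?J \<in> borel_measurable M"
    using lborel.borel_measurable_lebesgue_integral[OF m1] by simp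
  have J0: "0 \<le> ?J \<omega>" if "\<omega> \<in> space M" for \<omega> using g(1)[OF that] by (intro Bochner_Integration.integral_nonneg) auto
  have mg: "g \<omega> \<in> borel_measurable borel" if "\<omega> \<in> space M" for \<omega>
    using measurable_Pair2[OF m that] by simp
  have m2: "(\<lambda>(\<omega>, t). ennreal (indicator {a..b} t * g \<omega> t ^ s)) \<in> borel_measurable (M \<Otimes>\<^sub>M lborel)"
    using m by measurable
  have nn: "(\<integral>\<^sup>+\<omega>. ennreal (?J \<omega> ^ s) \<partial>M) \<le> ennreal ((b - a) ^ s * K)"
  proof -
    have "(\<integral>\<^sup>+\<omega>. ennreal (?J \<omega> ^ s) \<partial>M) \<le> (\<integral>\<^sup>+\<omega>. ennreal ((b - a) ^ s / (b - a)) * (\<integral>\<^sup>+t. ennreal (indicator {a..b} t * g \<omega> t ^ s) \<partial>lborel) \<partial>M)"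
    proof (rule nn_integral_mono)
      fix \<omega> assume \<omega>: "\<omega> \<in> space M"
      have B0: "B \<omega> \<ge> 0" using g[OF \<omega>, of 0] by linarith
      have int: "integrable lborel (\<lambda>t. indicator {a..b} t * g \<omega> t ^ s)"
      proof (rule Bochner_Integration.integrable_bound[of _ "\<lambda>t. indicator {a..b} t * B \<omega> ^ s"])
        show "AE t in lborel. norm (indicator {a..b} t * g \<omega> t ^ s) \<le> norm (indicator {a..b} t * B \<omega> ^ s)"
          using g[OF \<omega>] B0 by (auto simp: abs_mult power_abs indicator_def intro!: power_mono)
      qed (use mg[OF \<omega>] i0 in auto)
      have "?J \<omega> ^ s \<le> (b - a) ^ s / (b - a) * (\<integral>t. indicator {a..b} t * g \<omega> t ^ s \<partial>lborel)"
        using integral_power_le[OF ab mg[OF \<omega>] g[OF \<omega>], of s] by simp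
      then have "ennreal (?J \<omega> ^ s) \<le> ennreal ((b - a) ^ s / (b - a)) * ennreal (\<integral>t. indicator {a..b} t * g \<omega> t ^ s \<partial>lborel)"
        using ab by (subst ennreal_mult'[symmetric]) (auto intro!: ennreal_leI)
      also have "ennreal (\<integral>t. indicator {a..b} t * g \<omega> t ^ s \<partial>lborel) = (\<integral>\<^sup>+t. ennreal (indicator {a..b} t * g \<omega> t ^ s) \<partial>lborel)"
        using int g(1)[OF \<omega>] by (intro nn_integral_eq_integral[symmetric]) auto
      finally show "ennreal (?J \<omega> ^ s) \<le> ennreal ((b - a) ^ s / (b - a)) * (\<integral>\<^sup>+t. ennreal (indicator {a..b} t * g \<omega> t ^ s) \<partial>lborel)" .
    qed
    also have "\<dots> = ennreal ((b - a) ^ s / (b - a)) * (\<integral>\<^sup>+\<omega>. \<integral>\<^sup>+t. ennreal (indicator {a..b} t * g \<omega> t ^ s) \<partial>lborel \<partial>M)"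
      using lborel.borel_measurable_nn_integral[OF m2] by (intro nn_integral_cmult) simp
    also have "(\<integral>\<^sup>+\<omega>. \<integral>\<^sup>+t. ennreal (indicator {a..b} t * g \<omega> t ^ s) \<partial>lborel \<partial>M)
       = (\<integral>\<^sup>+t. \<integral>\<^sup>+\<omega>. ennreal (indicator {a..b} t * g \<omega> t ^ s) \<partial>M \<partial>lborel)"
      using P.Fubini'[OF m2] by simp
    also have "\<dots> \<le> (\<integral>\<^sup>+t. ennreal K * indicator {a..b} t \<partial>lborel)"
    proof (rule nn_integral_mono)
      fix t :: real
      show "(\<integral>\<^sup>+\<omega>. ennreal (indicator {a..b} t * g \<omega> t ^ s) \<partial>M) \<le> ennreal K * indicator {a..b} t"
      proof (cases "t \<in> {a..b}")
        case True
        have "(\<integral>\<^sup>+\<omega>. ennreal (g \<omega> t ^ s) \<partial>M) = ennreal (expectation (\<lambda>\<omega>. g \<omega> t ^ s))"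
          using K(1)[OF True] g(1) by (intro nn_integral_eq_integral) auto
        then show ?thesis using True K(2)[OF True] by (simp add: ennreal_leI)
      qed simp
    qed
    also have "\<dots> = ennreal K * ennreal (b - a)" using ab by (simp add: nn_integral_cmult_indicator)
    also have "ennreal ((b - a) ^ s / (b - a)) * (ennreal K * ennreal (b - a)) = ennreal ((b - a) ^ s * K)"
      using ab K(3) by (simp add: ennreal_mult[symmetric])
    finally show ?thesis by (simp add: mult_left_mono)
  qed
  show int: "integrable M (\<lambda>\<omega>. ?J \<omega> ^ s)"
  proof (rule integrableI_nonneg)
    show "(\<integral>\<^sup>+\<omega>. ennreal (?J \<omega> ^ s) \<partial>M) < \<infinity>" using nn by (auto intro: le_less_trans)
  qed (use mJ J0 in auto)
  have "ennreal (expectation (\<lambda>\<omega>. ?J \<omega> ^ s)) \<le> ennreal ((b - a) ^ s * K)"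
    using nn_integral_eq_integral[OF int] J0 nn by simp
  then show "expectation (\<lambda>\<omega>. ?J \<omega> ^ s) \<le> (b - a) ^ s * K"
    using ab K(3) by (subst (asm) ennreal_le_iff) auto
qed

text \<open>The points live on an arbitrary probability space, while the moments were computed for
  the product measure. The law \<open>distr_x\<close> transfers them, by way of
  \<open>expectation_list_mean\<close>.\<close>

locale random_points = prob_space M for M :: "'a measure" +
  fixes x :: "'a \<Rightarrow> nat \<Rightarrow> real ^ 'd"
  assumes x_measurable [measurable]: "x \<in> M \<rightarrow>\<^sub>M PiM UNIV (\<lambda>_. borel)"
    and distr_x: "distr M (PiM UNIV (\<lambda>_. borel)) x = point_seq"
begin

abbreviation "points n \<omega> \<equiv> map (x \<omega>) [0..<n]"

lemma point_dim_ge_1: "(real CARD('d)) \<ge> 1"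
  by (simp add: Suc_leI)

lemma random_list_measurable:
  assumes "list_measurable F"
  shows "(\<lambda>\<omega>. F (points n \<omega>)) \<in> borel_measurable M"
  by (rule measurable_compose[OF x_measurable list_measurableD[OF assms]])

lemma expectation_list_mean:
  assumes "list_measurable F"
  shows "integrable M (\<lambda>\<omega>. F (points n \<omega>))" and "expectation (\<lambda>\<omega>. F (points n \<omega>)) = list_mean n F"
proof -
  show "integrable M (\<lambda>\<omega>. F (points n \<omega>))"
  proof -
    obtain B where B: "\<And>xs. length xs \<le> n \<Longrightarrow> \<bar>F xs\<bar> \<le> B" using list_measurable_bounded[OF assms] by metis
    show ?thesis
      by (rule integrable_const_bound[of _ B]) (use B random_list_measurable[OF assms] in auto)
  qed
  have "expectation (\<lambda>\<omega>. F (points n \<omega>)) = (\<integral>f. F (map f [0..<n]) \<partial>distr M (PiM UNIV (\<lambda>_. borel)) x)"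
    by (rule integral_distr[OF x_measurable list_measurableD[OF assms], symmetric])
  then show "expectation (\<lambda>\<omega>. F (points n \<omega>)) = list_mean n F"
    by (simp add: distr_x list_mean_def)
qed

definition "level_density n \<omega> k = real (nodes_at_level k (quad_tree_of (points n \<omega>))) / real n"

lemma level_density_measurable [measurable]: "(\<lambda>\<omega>. level_density n \<omega> k) \<in> borel_measurable M"
  unfolding level_density_def
  using random_list_measurable[OF list_measurable_nodes_at_level] by measurable

lemma level_density_props:
  assumes "n \<ge> 1"
  shows "level_density n \<omega> k \<ge> 0" "k \<ge> n \<Longrightarrow> level_density n \<omega> k = 0" "(\<Sum>k<n. level_density n \<omega> k) = 1"
proof -
  have "(\<Sum>k<n. nodes_at_level k (quad_tree_of (points n \<omega>))) = n"
    using sum_nodes_at_level[of "points n \<omega>"] by simp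
  then have "(\<Sum>k<n. real (nodes_at_level k (quad_tree_of (points n \<omega>)))) = real n" by (metis of_nat_sum)
  then show "(\<Sum>k<n. level_density n \<omega> k) = 1"
    using assms by (simp add: level_density_def sum_divide_distrib[symmetric])
qed (auto simp: level_density_def nodes_at_level_eq_0)

lemma char_poly_level_density:
  "char_poly (level_density n \<omega>) n \<tau> = level_poly (exp (\<i> * \<tau>)) (points n \<omega>) / of_nat n"
  by (simp add: char_poly_def level_density_def level_poly_def sum_divide_distrib exp_of_nat_mult[symmetric] mult_ac)

text \<open>With \<open>l = ln n\<close> and \<open>\<zeta>\<close> the principal root, the Poisson
  divisor has modulus \<open>n powr (2 Re \<zeta> - 2)\<close>. Together with the division by
  \<open>n\<close> in \<open>level_density\<close> this removes the power
  \<open>n powr (2 Re \<zeta> - 1)\<close>, the one that bounds the moments.\<close>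

lemma norm_normalized_char:
  assumes "n \<ge> 1"
  shows "cmod (normalized_char (real CARD('d)) (ln n) (level_density n \<omega>) n \<tau>)
    = cmod (level_poly (exp (\<i> * \<tau>)) (points n \<omega>)) * real n powr - (2 * Re (exp (\<i> * \<tau> / of_nat CARD('d))) - 1)"
proof -
  define c where "c = Re (exp (\<i> * \<tau> / of_nat CARD('d)))"
  have "exp (- (2 * ln (real n) * (c - 1))) / real n = exp (- (2 * ln (real n) * (c - 1)) - ln (real n))"
    using assms by (simp add: exp_diff)
  also have "\<dots> = real n powr - (2 * c - 1)" using assms by (simp add: powr_def algebra_simps)
  finally have eq: "exp (- (2 * ln (real n) * (c - 1))) / real n = real n powr - (2 * c - 1)" .
  have "cmod (normalized_char (real CARD('d)) (ln n) (level_density n \<omega>) n \<tau>)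
    = cmod (level_poly (exp (\<i> * \<tau>)) (points n \<omega>)) * (exp (- (2 * ln (real n) * (c - 1))) / real n)"
    unfolding normalized_char_def char_poly_level_density
    by (simp add: norm_mult norm_divide norm_exp_eq_Re c_def)
  then show ?thesis unfolding eq by (simp only: c_def)
qed

lemma expectation_level_moment:
  "integrable M (\<lambda>\<omega>. cmod (level_poly z (points n \<omega>)) ^ s)"
  "expectation (\<lambda>\<omega>. cmod (level_poly z (points n \<omega>)) ^ s) = level_moment TYPE('d) z s n"
  unfolding level_moment_def by (intro expectation_list_mean list_measurable_norm_level_poly)+

lemma char_poly_measurable:
  assumes [measurable]: "h \<in> borel_measurable lborel"
  shows "(\<lambda>(\<omega>, t :: real). char_poly (level_density n \<omega>) n (h t)) \<in> borel_measurable (M \<Otimes>\<^sub>M lborel)"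
proof -
  have e [measurable]: "(exp :: complex \<Rightarrow> complex) \<in> borel_measurable borel"
    by (intro borel_measurable_continuous_onI continuous_intros)
  show ?thesis unfolding char_poly_def case_prod_beta by measurable
qed

text \<open>At each point of the circle the exponent from \<open>moment_domain_circle\<close>
  cancels the normalisation, so the \<open>s\<close>-th moment is bounded uniformly in
  \<open>n\<close> and in the point. The radius may shrink with \<open>s\<close>, since only one
  order is treated at a time.\<close>

lemma circle_mean_moment:
  assumes s: "s \<ge> 2"
  shows "\<exists>C\<ge>0. \<forall>n\<ge>3.
    (\<lambda>\<omega>. circle_mean (normalized_char (real CARD('d)) (ln n) (level_density n \<omega>) n) (1 / (40 * real s))) \<in> borel_measurable M \<and>
    integrable M (\<lambda>\<omega>. circle_mean (normalized_char (real CARD('d)) (ln n) (level_density n \<omega>) n) (1 / (40 * real s)) ^ s) \<and>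
    expectation (\<lambda>\<omega>. circle_mean (normalized_char (real CARD('d)) (ln n) (level_density n \<omega>) n) (1 / (40 * real s)) ^ s) \<le> C"
proof -
  obtain C where C: "C \<ge> 0" "\<And>z \<alpha> n. (z, \<alpha>) \<in> moment_domain TYPE('d) s \<Longrightarrow>
     level_moment TYPE('d) z s n \<le> C * real n powr (real s * \<alpha>)"
    using moment_bound[OF s, where 'd = 'd] by (elim exE conjE) simp
  define r where "r = 1 / (40 * real s)"
  have r0: "r > 0" using s by (simp add: r_def)
  define c where "c t = of_real r * cis (2 * pi * t)" for t :: real
  have cm [measurable]: "c \<in> borel_measurable borel"
    unfolding c_def[abs_def] by (intro borel_measurable_continuous_onI continuous_intros)
  have cn: "cmod (c t) = r" for t using r0 by (simp add: c_def norm_mult)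
  show ?thesis
  proof (intro exI[of _ C] conjI[OF C(1)] allI impI)
    fix n :: nat assume n: "n \<ge> 3"
    define g where "g = (\<lambda>\<omega> t. cmod (normalized_char (real CARD('d)) (ln n) (level_density n \<omega>) n (c t)))"
    have cont: "continuous_on S (normalized_char (real CARD('d)) (ln n) (level_density n \<omega>) n)" for \<omega> S
      unfolding normalized_char_def[abs_def] char_poly_def using point_dim_ge_1 by (intro continuous_intros) auto
    have gcont: "continuous_on S (g \<omega>)" for \<omega> S
      unfolding g_def c_def
      by (intro continuous_on_norm continuous_on_compose2[OF cont[of UNIV]] continuous_intros) auto
    have "\<exists>B. \<forall>\<omega> t. g \<omega> t \<le> B \<omega>"
    proof -
      have "\<exists>b. \<forall>t. g \<omega> t \<le> b" for \<omega>
      proof -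
        have "bounded (normalized_char (real CARD('d)) (ln n) (level_density n \<omega>) n ` sphere 0 r)"
          by (intro compact_imp_bounded compact_continuous_image cont compact_sphere)
        then obtain b where "\<forall>z\<in>sphere 0 r. cmod (normalized_char (real CARD('d)) (ln n) (level_density n \<omega>) n z) \<le> b"
          by (auto simp: bounded_iff)
        then show ?thesis using cn by (intro exI[of _ b]) (simp add: g_def)
      qed
      then show ?thesis by metis
    qed
    then obtain B where B: "\<And>\<omega> t. g \<omega> t \<le> B \<omega>" by blast
    have eq: "circle_mean (normalized_char (real CARD('d)) (ln n) (level_density n \<omega>) n) r = (\<integral>t. indicator {0..1} t * g \<omega> t \<partial>lborel)" for \<omega>
      using set_borel_integral_eq_integral(2)[OF borel_integrable_atLeastAtMost'[OF gcont, of 0 1 \<omega>]]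
      by (simp add: circle_mean_def g_def c_def set_lebesgue_integral_def)
    have mom: "integrable M (\<lambda>\<omega>. g \<omega> t ^ s) \<and> expectation (\<lambda>\<omega>. g \<omega> t ^ s) \<le> C" for t
    proof -
      define \<alpha> where "\<alpha> = 2 * Re (exp (\<i> * c t / of_nat CARD('d))) - 1"
      have dom: "(exp (\<i> * c t), \<alpha>) \<in> moment_domain TYPE('d) s"
        unfolding \<alpha>_def using s cn[of t] by (intro moment_domain_circle) (auto simp: r_def)
      have gs: "g \<omega> t ^ s = (real n powr - \<alpha>) ^ s * cmod (level_poly (exp (\<i> * c t)) (points n \<omega>)) ^ s" for \<omega>
        using n unfolding g_def by (subst norm_normalized_char) (auto simp: \<alpha>_def power_mult_distrib)
      have "expectation (\<lambda>\<omega>. g \<omega> t ^ s) = (real n powr - \<alpha>) ^ s * level_moment TYPE('d) (exp (\<i> * c t)) s n"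
        unfolding gs by (simp add: expectation_level_moment)
      also have "\<dots> \<le> (real n powr - \<alpha>) ^ s * (C * real n powr (real s * \<alpha>))"
        by (intro mult_left_mono C(2)[OF dom]) auto
      also have "\<dots> = C"
      proof -
        have "(real n powr - \<alpha>) ^ s = real n powr (real s * - \<alpha>)"
          using n by (simp add: powr_def exp_of_nat_mult[symmetric] mult_ac)
        then have "(real n powr - \<alpha>) ^ s * real n powr (real s * \<alpha>) = 1"
          using n by (simp add: powr_add[symmetric])
        then show ?thesis by (simp add: mult.left_commute)
      qed
      finally show ?thesis unfolding gs using expectation_level_moment(1) by auto
    qed
    have gm: "(\<lambda>(\<omega>, t). g \<omega> t) \<in> borel_measurable (M \<Otimes>\<^sub>M lborel)"
    proof -
      have [measurable]: "(\<lambda>(\<omega>, t). char_poly (level_density n \<omega>) n (c t)) \<in> borel_measurable (M \<Otimes>\<^sub>M lborel)"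
        by (rule char_poly_measurable) simp
      have [measurable]: "(\<lambda>t. exp (- of_real (2 * ln n) * (exp (\<i> * c t / of_real (real CARD('d))) - 1))) \<in> borel_measurable borel"
        unfolding c_def using point_dim_ge_1 by (intro borel_measurable_continuous_onI continuous_intros) auto
      show ?thesis unfolding g_def normalized_char_def by measurable
    qed
    have g0: "0 \<le> g \<omega> t" for \<omega> t by (simp add: g_def)
    note * = expectation_integral_power_le[OF zero_less_one gm g0 B mom[THEN conjunct1] mom[THEN conjunct2] C(1)]
    show "(\<lambda>\<omega>. circle_mean (normalized_char (real CARD('d)) (ln n) (level_density n \<omega>) n) (1 / (40 * real s))) \<in> borel_measurable M \<and>
      integrable M (\<lambda>\<omega>. circle_mean (normalized_char (real CARD('d)) (ln n) (level_density n \<omega>) n) (1 / (40 * real s)) ^ s) \<and>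
      expectation (\<lambda>\<omega>. circle_mean (normalized_char (real CARD('d)) (ln n) (level_density n \<omega>) n) (1 / (40 * real s)) ^ s) \<le> C"
      unfolding r_def[symmetric] eq using * by simp
  qed
qed

lemma outer_mass_moment:
  assumes s: "s \<ge> 2" and \<rho>: "0 < \<rho>" "\<rho> \<le> pi"
  shows "\<exists>C \<kappa>. C \<ge> 0 \<and> \<kappa> > 0 \<and> (\<forall>n\<ge>3.
    (\<lambda>\<omega>. outer_mass \<rho> (level_density n \<omega>) n) \<in> borel_measurable M \<and>
    integrable M (\<lambda>\<omega>. outer_mass \<rho> (level_density n \<omega>) n ^ s) \<and>
    expectation (\<lambda>\<omega>. outer_mass \<rho> (level_density n \<omega>) n ^ s) \<le> C * real n powr - (\<kappa> * real s))"
proof -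
  obtain C where C: "C \<ge> 0" "\<And>z \<alpha> n. (z, \<alpha>) \<in> moment_domain TYPE('d) s \<Longrightarrow>
     level_moment TYPE('d) z s n \<le> C * real n powr (real s * \<alpha>)"
    using moment_bound[OF s, where 'd = 'd] by (elim exE conjE) simp
  \<comment> \<open>On the outer range the gap \<open>1 - \<alpha>\<close> is at least
    \<open>2 - 2 cos (\<rho> / d)\<close>, or 1/4 where the exponent was raised to 3/4.\<close>
  define \<kappa> where "\<kappa> = min (1/4) (2 - 2 * cos (\<rho> / (real CARD('d))))"
  have \<rho>d: "0 < \<rho> / (real CARD('d))" "\<rho> / (real CARD('d)) \<le> pi"
    using \<rho> point_dim_ge_1 by (auto simp: divide_le_eq intro: order_trans[OF \<rho>(2)])
  have "cos (\<rho> / (real CARD('d))) < cos 0" using \<rho>d by (intro cos_monotone_0_pi) auto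
  then have \<kappa>: "\<kappa> > 0" by (simp add: \<kappa>_def)
  define C' where "C' = (2 * pi) ^ s * C"
  have C'0: "C' \<ge> 0" using C(1) by (simp add: C'_def)
  show ?thesis
  proof (rule exI[of _ C'], rule exI[of _ \<kappa>], intro conjI[OF C'0 conjI[OF \<kappa>]] allI impI)
    fix n :: nat assume n: "n \<ge> 3"
    define g where "g \<omega> \<theta> = indicator ({-pi..pi} - {-\<rho>..\<rho>}) \<theta> * cmod (char_poly (level_density n \<omega>) n (of_real \<theta>))" for \<omega> \<theta>
    have eq: "outer_mass \<rho> (level_density n \<omega>) n = (\<integral>\<theta>. indicator {-pi..pi} \<theta> * g \<omega> \<theta> \<partial>lborel)" for \<omega>
      unfolding outer_mass_def g_def by (intro Bochner_Integration.integral_cong) (auto simp: indicator_def)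
    have B: "g \<omega> \<theta> \<le> (\<Sum>k<n. \<bar>level_density n \<omega> k\<bar>)" for \<omega> \<theta>
    proof -
      have "cmod (char_poly (level_density n \<omega>) n (of_real \<theta>)) \<le> (\<Sum>k<n. \<bar>level_density n \<omega> k\<bar>)"
        unfolding char_poly_def by (intro sum_norm_le) (simp add: norm_mult norm_exp_eq_Re)
      moreover have "g \<omega> \<theta> \<le> cmod (char_poly (level_density n \<omega>) n (of_real \<theta>))"
        by (simp add: g_def indicator_def)
      ultimately show ?thesis by linarith
    qed
    have mom: "integrable M (\<lambda>\<omega>. g \<omega> \<theta> ^ s) \<and> expectation (\<lambda>\<omega>. g \<omega> \<theta> ^ s) \<le> C * real n powr - (\<kappa> * real s)" for \<theta>
    proof (cases "\<theta> \<in> {-pi..pi} - {-\<rho>..\<rho>}")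
      case True
      define \<alpha> where "\<alpha> = max (2 * cos (\<theta> / (real CARD('d))) - 1) (3/4)"
      have \<theta>: "\<bar>\<theta>\<bar> \<le> pi" "\<rho> \<le> \<bar>\<theta>\<bar>" using True by auto
      have dom: "(exp (\<i> * of_real \<theta>), \<alpha>) \<in> moment_domain TYPE('d) s"
        unfolding \<alpha>_def by (rule moment_domain_real[OF \<theta>(1)])
      have "\<bar>\<theta> / (real CARD('d))\<bar> \<le> pi" "\<rho> / (real CARD('d)) \<le> \<bar>\<theta> / (real CARD('d))\<bar>"
        using \<theta> point_dim_ge_1 by (auto simp: divide_le_eq divide_right_mono intro: order_trans[OF \<theta>(1)])
      then have "cos \<bar>\<theta> / (real CARD('d))\<bar> \<le> cos (\<rho> / (real CARD('d)))" using \<rho>d by (intro cos_monotone_0_pi_le) auto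
      then have "cos (\<theta> / (real CARD('d))) \<le> cos (\<rho> / (real CARD('d)))" unfolding cos_abs_real .
      then have \<alpha>: "\<alpha> - 1 \<le> - \<kappa>" by (simp add: \<alpha>_def \<kappa>_def)
      have gs: "g \<omega> \<theta> ^ s = (1 / real n ^ s) * cmod (level_poly (exp (\<i> * of_real \<theta>)) (points n \<omega>)) ^ s" for \<omega>
        using True by (simp add: g_def char_poly_level_density norm_divide power_divide)
      have "expectation (\<lambda>\<omega>. g \<omega> \<theta> ^ s) = (1 / real n ^ s) * level_moment TYPE('d) (exp (\<i> * of_real \<theta>)) s n"
        unfolding gs by (simp add: expectation_level_moment)
      also have "\<dots> \<le> (1 / real n ^ s) * (C * real n powr (real s * \<alpha>))"
        by (intro mult_left_mono C(2)[OF dom]) auto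
      also have "\<dots> = C * real n powr (real s * (\<alpha> - 1))"
        using n by (simp add: powr_diff right_diff_distrib powr_realpow)
      also have "\<dots> \<le> C * real n powr - (\<kappa> * real s)"
        using n C(1) mult_left_mono[OF \<alpha>, of "real s"] by (intro mult_left_mono powr_mono) (auto simp: mult.commute)
      finally show ?thesis unfolding gs using expectation_level_moment(1) by auto
    next
      case False
      then have "(\<lambda>\<omega>. g \<omega> \<theta> ^ s) = (\<lambda>_. 0)" using s by (auto simp: g_def power_0_left)
      then show ?thesis using C(1) by simp
    qed
    have gm: "(\<lambda>(\<omega>, t). g \<omega> t) \<in> borel_measurable (M \<Otimes>\<^sub>M lborel)"
    proof -
      have [measurable]: "(\<lambda>(\<omega>, t). char_poly (level_density n \<omega>) n (of_real t)) \<in> borel_measurable (M \<Otimes>\<^sub>M lborel)"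
        by (rule char_poly_measurable) simp
      show ?thesis unfolding g_def by measurable
    qed
    have g0: "0 \<le> g \<omega> t" for \<omega> t by (simp add: g_def)
    have pi: "- pi < pi" and K0: "0 \<le> C * real n powr - (\<kappa> * real s)" using C(1) by auto
    note * = expectation_integral_power_le[OF pi gm g0 B mom[THEN conjunct1] mom[THEN conjunct2] K0]
    show "(\<lambda>\<omega>. outer_mass \<rho> (level_density n \<omega>) n) \<in> borel_measurable M \<and>
      integrable M (\<lambda>\<omega>. outer_mass \<rho> (level_density n \<omega>) n ^ s) \<and>
      expectation (\<lambda>\<omega>. outer_mass \<rho> (level_density n \<omega>) n ^ s) \<le> C' * real n powr - (\<kappa> * real s)"
      unfolding eq using * by (simp add: C'_def mult.assoc)
  qed
qed

end

section \<open>Deviation of the width: pathwise control and moments\<close>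

lemma ln_ge_one: "n \<ge> 3 \<Longrightarrow> 1 \<le> ln (real n)"
  using exp_le by (subst ln_ge_iff) auto

text \<open>The cube of \<open>ln n \<le> n powr (2 \<kappa> / 3) / (2 \<kappa> / 3)\<close>: the
  powers of the logarithm by which \<open>outer_mass\<close> gets multiplied are absorbed by its
  polynomial decay.\<close>

lemma log_power_bound:
  fixes \<kappa> :: real
  assumes "\<kappa> > 0" and n: "n \<ge> (3 :: nat)"
  shows "(ln n * sqrt (ln n)) ^ (2 * s) * real n powr - (\<kappa> * real (2 * s)) \<le> (27 / (8 * \<kappa> ^ 3)) ^ s"
proof -
  define l where "l = ln (real n)"
  have l: "l \<ge> 1" using ln_ge_one[OF n] by (simp add: l_def)
  have "l \<le> real n powr (2 * \<kappa> / 3) / (2 * \<kappa> / 3)" unfolding l_def using assms by (intro ln_powr_bound) auto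
  then have "l ^ 3 \<le> (real n powr (2 * \<kappa> / 3) / (2 * \<kappa> / 3)) ^ 3" using l by (intro power_mono) auto
  also have "\<dots> = real n powr (2 * \<kappa>) * (27 / (8 * \<kappa> ^ 3))"
  proof -
    have "(real n powr (2 * \<kappa> / 3)) ^ 3 = real n powr (2 * \<kappa>)"
      using n by (simp add: powr_def exp_of_nat_mult[symmetric] mult_ac)
    then show ?thesis by (simp add: power_divide power_mult_distrib)
  qed
  finally have "real n powr - (2 * \<kappa>) * l ^ 3 \<le> real n powr - (2 * \<kappa>) * (real n powr (2 * \<kappa>) * (27 / (8 * \<kappa> ^ 3)))"
    by (intro mult_left_mono) auto
  also have "\<dots> = 27 / (8 * \<kappa> ^ 3)" using n by (simp add: mult.assoc[symmetric] powr_add[symmetric])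
  finally have "(real n powr - (2 * \<kappa>) * l ^ 3) ^ s \<le> (27 / (8 * \<kappa> ^ 3)) ^ s" using l by (intro power_mono) auto
  moreover have "(l * sqrt l) ^ (2 * s) = (l ^ 3) ^ s"
  proof -
    have "(l * sqrt l)\<^sup>2 = l ^ 3" using l by (simp add: power_mult_distrib power2_eq_square power3_eq_cube)
    then show ?thesis by (simp add: power_mult)
  qed
  moreover have "real n powr - (\<kappa> * real (2 * s)) = (real n powr - (2 * \<kappa>)) ^ s"
    using n by (simp add: powr_def exp_of_nat_mult[symmetric] mult_ac)
  ultimately show ?thesis unfolding l_def[symmetric] by (simp add: power_mult_distrib mult.commute)
qed

context random_points
begin

lemma level_density_profile: "level_density n \<omega> k = real (profile (x \<omega>) n k) / real n"
  by (simp add: level_density_def profile_def)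

lemma profile_le_width: "profile (x \<omega>) n k \<le> tree_width (x \<omega>) n"
  unfolding tree_width_def by (intro Max_ge finite_range_profile) auto

lemma width_attained: "\<exists>k. profile (x \<omega>) n k = tree_width (x \<omega>) n"
  using Max_in[OF finite_range_profile, of "x \<omega>" n] by (auto simp: tree_width_def)

text \<open>On each path all errors are collected in \<open>Z = 1 + J^2 + S D\<close>, where
  \<open>J\<close> is the circle mean, \<open>D\<close> the outer mass and
  \<open>S = ln n sqrt (ln n)\<close>. As \<open>Z\<close> contains \<open>J^2\<close>, moments of
  order \<open>2 s\<close> are used, which fixes the radius \<open>r\<close>. The distance of a
  maximal level is controlled only up to \<open>ln n\<close>, beyond which the Gaussian comparison
  says nothing more; the claim covers every level that attains the maximum.\<close>

lemma width_control:
  assumes s: "s \<ge> 1"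
  shows "\<exists>C\<ge>1. \<forall>n\<ge>3. \<exists>Z. Z \<in> borel_measurable M \<and> integrable M (\<lambda>\<omega>. Z \<omega> ^ s) \<and> expectation (\<lambda>\<omega>. Z \<omega> ^ s) \<le> C \<and>
    (\<forall>\<omega>. 1 \<le> Z \<omega> \<and>
      \<bar>real (tree_width (x \<omega>) n) / real n - real CARD('d) / (2 * sqrt (pi * ln n))\<bar> \<le> C * Z \<omega> / (ln n * sqrt (ln n)) \<and>
      (\<forall>k. profile (x \<omega>) n k = tree_width (x \<omega>) n \<longrightarrow> min \<bar>real k - 2 * ln n / real CARD('d)\<bar> (ln n) \<le> C * Z \<omega>))"
proof -
  let ?d = "real CARD('d)"
  define r where "r = 1 / (40 * real (2 * s))"
  have r: "0 < r" "r \<le> 2" using s by (auto simp: r_def divide_le_eq)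
  have s2: "2 * s \<ge> 2" using s by simp
  have \<rho>: "0 < r / 2" "r / 2 \<le> pi" using r pi_gt3 by auto
  let ?J = "\<lambda>n \<omega>. circle_mean (normalized_char ?d (ln n) (level_density n \<omega>) n) r"
  let ?D = "\<lambda>n \<omega>. outer_mass (r / 2) (level_density n \<omega>) n"
  obtain CJ where CJ: "CJ \<ge> 0" "\<And>n. n \<ge> 3 \<Longrightarrow> ?J n \<in> borel_measurable M \<and> integrable M (\<lambda>\<omega>. ?J n \<omega> ^ (2 * s)) \<and>
      expectation (\<lambda>\<omega>. ?J n \<omega> ^ (2 * s)) \<le> CJ"
    using circle_mean_moment[OF s2] unfolding r_def[symmetric] by (elim exE conjE) simp
  obtain CD \<kappa> where CD: "CD \<ge> 0" "\<kappa> > 0" "\<And>n. n \<ge> 3 \<Longrightarrow> ?D n \<in> borel_measurable M \<and> integrable M (\<lambda>\<omega>. ?D n \<omega> ^ (2 * s)) \<and>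
      expectation (\<lambda>\<omega>. ?D n \<omega> ^ (2 * s)) \<le> CD * real n powr - (\<kappa> * real (2 * s))"
    using outer_mass_moment[OF s2 \<rho>] by (elim exE conjE) simp
  obtain C1 where C1: "C1 \<ge> 0" "\<forall>p N l k. (\<forall>k. p k \<ge> 0) \<longrightarrow> (\<forall>k\<ge>N. p k = 0) \<longrightarrow> (\<Sum>k<N. p k) = 1 \<longrightarrow> l \<ge> 1 \<longrightarrow>
     \<bar>(\<Sum>k<N. real k * p k) - 2 * l / ?d\<bar> \<le> circle_mean (normalized_char ?d l p N) r / r \<and>
     \<bar>p k - gauss_density ?d l (real k - (\<Sum>k<N. real k * p k))\<bar>
       \<le> min (C1 / l) (C1 * (1 + \<bar>real k - (\<Sum>k<N. real k * p k)\<bar>) / (l * sqrt l))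
        + (C1 * (circle_mean (normalized_char ?d l p N) r + (circle_mean (normalized_char ?d l p N) r)\<^sup>2)
            + l * sqrt l * outer_mass (r / 2) p N) / (l * sqrt l)"
    using profile_density_bound[OF r point_dim_ge_1] by (elim exE conjE)
  obtain C2 where C2: "C2 \<ge> 0" "\<forall>(p :: nat \<Rightarrow> real) l m R k P. l \<ge> 1 \<longrightarrow> m \<ge> 0 \<longrightarrow> R \<ge> 0 \<longrightarrow>
     (\<forall>k. \<bar>p k - gauss_density ?d l (real k - m)\<bar> \<le> min (C1 / l) (C1 * (1 + \<bar>real k - m\<bar>) / (l * sqrt l)) + R / (l * sqrt l)) \<longrightarrow>
     (\<forall>k. p k \<le> P) \<longrightarrow> p k = P \<longrightarrow>
     \<bar>P - ?d / (2 * sqrt (pi * l))\<bar> \<le> C2 * (1 + R) / (l * sqrt l) \<and> min ((real k - m)\<^sup>2) l \<le> C2 * (1 + R)"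
    using width_from_density[OF point_dim_ge_1 C1(1)] by (elim exE conjE)
  define C3 where "C3 = C2 * (1 + 2 * C1)"
  have C3: "C3 \<ge> 0" using C1(1) C2(1) by (simp add: C3_def)
  define Q where "Q = (27 / (8 * \<kappa> ^ 3)) ^ s"
  have Q: "Q \<ge> 0" using CD(2) by (simp add: Q_def)
  define CE where "CE = 3 ^ s * (2 + CJ + CD * Q)"
  have CE: "CE \<ge> 0" using CJ(1) CD(1) Q by (simp add: CE_def)
  define C where "C = C3 + 1 + 1 / r + CE"
  have C: "C \<ge> 1" "C \<ge> C3" "C \<ge> C3 + 1 + 1 / r" "C \<ge> CE" using C3 CE r by (auto simp: C_def)
  show ?thesis
  proof (intro exI[of _ C] conjI[OF C(1)] allI impI)
    fix n :: nat assume n: "n \<ge> 3"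
    define l where "l = ln (real n)"
    have l: "l \<ge> 1" using ln_ge_one[OF n] by (simp add: l_def)
    define S where "S = l * sqrt l"
    have S: "S > 0" using l by (simp add: S_def)
    define Z where "Z \<omega> = 1 + (?J n \<omega>)\<^sup>2 + S * ?D n \<omega>" for \<omega>
    have n1: "n \<ge> 1" using n by simp
    have D0: "?D n \<omega> \<ge> 0" for \<omega> unfolding outer_mass_def by (intro Bochner_Integration.integral_nonneg) auto
    have Z1: "Z \<omega> \<ge> 1" for \<omega> using D0 S by (simp add: Z_def)
    have path: "\<bar>real (tree_width (x \<omega>) n) / real n - ?d / (2 * sqrt (pi * l))\<bar> \<le> C * Z \<omega> / S \<and>
      (\<forall>k. profile (x \<omega>) n k = tree_width (x \<omega>) n \<longrightarrow> min \<bar>real k - 2 * l / ?d\<bar> l \<le> C * Z \<omega>)" for \<omega>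
    proof -
      define p where "p = level_density n \<omega>"
      define m where "m = (\<Sum>k<n. real k * p k)"
      define J where "J = ?J n \<omega>"
      define P where "P = real (tree_width (x \<omega>) n) / real n"
      have pr: "\<forall>k. p k \<ge> 0" "\<forall>k\<ge>n. p k = 0" "(\<Sum>k<n. p k) = 1"
        using level_density_props[OF n1] by (auto simp: p_def)
      have m0: "m \<ge> 0" unfolding m_def using pr by (intro sum_nonneg) auto
      have mJ: "\<bar>m - 2 * l / ?d\<bar> \<le> J / r"
        using C1(2)[rule_format, of p n l] pr l by (simp add: m_def J_def l_def p_def)
      then have J0: "J \<ge> 0" using r by (metis abs_ge_zero order_trans zero_le_divide_iff not_less)
      define R where "R = C1 * (J + J\<^sup>2) + S * ?D n \<omega>"
      have R0: "R \<ge> 0" using C1(1) J0 D0 S by (simp add: R_def)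
      have dens: "\<forall>k. \<bar>p k - gauss_density ?d l (real k - m)\<bar> \<le> min (C1 / l) (C1 * (1 + \<bar>real k - m\<bar>) / (l * sqrt l)) + R / (l * sqrt l)"
        using C1(2)[rule_format, of p n l] pr l by (simp add: m_def J_def R_def S_def l_def p_def)
      have pk: "p k = real (profile (x \<omega>) n k) / real n" for k by (simp add: p_def level_density_profile)
      have pP: "\<forall>k. p k \<le> P" unfolding pk P_def using profile_le_width by (intro allI divide_right_mono) auto
      have "J \<le> 1 + J\<^sup>2"
      proof -
        have "0 \<le> (J - 1)\<^sup>2" by simp
        then have "2 * J \<le> 1 + J\<^sup>2" by (simp add: power2_diff)
        then show ?thesis using J0 by linarith
      qed
      note JJ = this
      have "C1 * (J + J\<^sup>2) \<le> C1 * (1 + 2 * J\<^sup>2)" using JJ C1(1) by (intro mult_left_mono) auto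
      then have h: "C1 * (J + J\<^sup>2) \<le> C1 * (1 + 2 * J\<^sup>2)" "0 \<le> C1 * (S * ?D n \<omega>)" "0 \<le> C1" "0 \<le> J\<^sup>2"
        using C1(1) D0 S by auto
      have RZ: "1 + R \<le> (1 + 2 * C1) * Z \<omega>"
      proof -
        have "1 + (c * (j + q) + t) \<le> (1 + 2 * c) * (1 + q + t)"
          if "c * (j + q) \<le> c * (1 + 2 * q)" "0 \<le> c * t" "0 \<le> c" "0 \<le> q" for c j q t :: real
          using that by (simp add: algebra_simps)
        then show ?thesis unfolding R_def Z_def J_def[symmetric] using h by blast
      qed
      then have C3Z: "C2 * (1 + R) \<le> C3 * Z \<omega>" unfolding C3_def mult.assoc using C2(1) by (rule mult_left_mono)
      have both: "\<bar>P - ?d / (2 * sqrt (pi * l))\<bar> \<le> C2 * (1 + R) / S \<and> min ((real k - m)\<^sup>2) l \<le> C2 * (1 + R)"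
        if "p k = P" for k
        using C2(2)[rule_format, OF l m0 R0, of p P k] dens pP that unfolding S_def by blast
      obtain k0 where "profile (x \<omega>) n k0 = tree_width (x \<omega>) n" using width_attained by blast
      then have "\<bar>P - ?d / (2 * sqrt (pi * l))\<bar> \<le> C2 * (1 + R) / S" using both[of k0] by (simp add: pk P_def)
      also have "\<dots> \<le> C * Z \<omega> / S"
      proof (rule divide_right_mono)
        have "C3 * Z \<omega> \<le> C * Z \<omega>" using C(2) Z1[of \<omega>] by (intro mult_right_mono) auto
        then show "C2 * (1 + R) \<le> C * Z \<omega>" using C3Z by linarith
      qed (use S in simp)
      finally have 1: "\<bar>P - ?d / (2 * sqrt (pi * l))\<bar> \<le> C * Z \<omega> / S" .
      have 2: "min \<bar>real k - 2 * l / ?d\<bar> l \<le> C * Z \<omega>" if "profile (x \<omega>) n k = tree_width (x \<omega>) n" for k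
      proof -
        have "min ((real k - m)\<^sup>2) l \<le> C3 * Z \<omega>" using both[of k] that C3Z by (simp add: pk P_def)
        then consider "(real k - m)\<^sup>2 \<le> C3 * Z \<omega>" | "l \<le> C3 * Z \<omega>" by linarith
        then show ?thesis
        proof cases
          case 1
          have "0 \<le> (\<bar>real k - m\<bar> - 1)\<^sup>2" by simp
          then have "2 * \<bar>real k - m\<bar> \<le> 1 + (real k - m)\<^sup>2" by (simp add: power2_diff)
          moreover have "0 \<le> C3 * Z \<omega>" using C3 Z1[of \<omega>] by simp
          moreover have "2 * a \<le> 1 + q \<Longrightarrow> 0 \<le> w \<Longrightarrow> q \<le> w \<Longrightarrow> 1 \<le> z \<Longrightarrow> a \<le> z + w" for a q w z :: real
            by linarith
          ultimately have a: "\<bar>real k - m\<bar> \<le> Z \<omega> + C3 * Z \<omega>" using 1 Z1[of \<omega>] by blast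
          have "J \<le> Z \<omega>" using JJ D0[of \<omega>] S unfolding Z_def J_def by (smt (verit) mult_nonneg_nonneg)
          then have "J / r \<le> Z \<omega> / r" using r by (intro divide_right_mono) auto
          then have "\<bar>real k - 2 * l / ?d\<bar> \<le> Z \<omega> + C3 * Z \<omega> + Z \<omega> / r" using a mJ by linarith
          also have "\<dots> = (C3 + 1 + 1 / r) * Z \<omega>" by (simp add: algebra_simps)
          also have "\<dots> \<le> C * Z \<omega>" using C(3) Z1[of \<omega>] by (intro mult_right_mono) auto
          finally show ?thesis by linarith
        next
          case 2
          also have "C3 * Z \<omega> \<le> C * Z \<omega>" using C(2) Z1[of \<omega>] by (intro mult_right_mono) auto
          finally show ?thesis by linarith
        qed
      qed
      show ?thesis using 1 2 by (auto simp: P_def)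
    qed
    have [measurable]: "?J n \<in> borel_measurable M" "?D n \<in> borel_measurable M"
      using CJ(2)[OF n] CD(3)[OF n] by auto
    have mZ: "Z \<in> borel_measurable M" unfolding Z_def[abs_def] by measurable
    define F where "F \<omega> = 3 ^ s * (2 + ?J n \<omega> ^ (2 * s) + S ^ (2 * s) * ?D n \<omega> ^ (2 * s))" for \<omega>
    have iF: "integrable M F" unfolding F_def[abs_def] using CJ(2)[OF n] CD(3)[OF n] by auto
    have ZF: "Z \<omega> ^ s \<le> F \<omega>" for \<omega>
    proof -
      define a b where "a = (?J n \<omega>)\<^sup>2" and "b = S * ?D n \<omega>"
      have ab: "a \<ge> 0" "b \<ge> 0" using S D0 by (auto simp: a_def b_def)
      have "Z \<omega> \<le> 3 * max 1 (max a b)" unfolding Z_def a_def b_def by linarith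
      then have "Z \<omega> ^ s \<le> (3 * max 1 (max a b)) ^ s" using Z1[of \<omega>] by (intro power_mono) auto
      also have "\<dots> = 3 ^ s * max 1 (max a b) ^ s" by (rule power_mult_distrib)
      also have "max 1 (max a b) ^ s \<le> 1 + a ^ s + b ^ s"
        using ab by (auto simp: max_def add_increasing add_increasing2)
      also have "b ^ s \<le> 1 + (b ^ s)\<^sup>2"
      proof -
        have "0 \<le> (b ^ s - 1)\<^sup>2" by simp
        then have "2 * b ^ s \<le> 1 + (b ^ s)\<^sup>2" by (simp add: power2_diff)
        then show ?thesis using ab zero_le_power[of b s] by linarith
      qed
      finally show ?thesis by (simp add: F_def a_def b_def power_mult_distrib power_mult[symmetric] mult.commute add.assoc)
    qed
    have iZ: "integrable M (\<lambda>\<omega>. Z \<omega> ^ s)"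
    proof (rule Bochner_Integration.integrable_bound[OF iF])
      show "(\<lambda>\<omega>. Z \<omega> ^ s) \<in> borel_measurable M" using mZ by measurable
      show "AE \<omega> in M. norm (Z \<omega> ^ s) \<le> norm (F \<omega>)"
      proof (intro AE_I2)
        fix \<omega>
        have "0 \<le> Z \<omega> ^ s" using Z1[of \<omega>] by simp
        then show "norm (Z \<omega> ^ s) \<le> norm (F \<omega>)" using ZF[of \<omega>] by simp
      qed
    qed
    have "expectation (\<lambda>\<omega>. Z \<omega> ^ s) \<le> expectation F"
      using ZF by (intro Bochner_Integration.integral_mono iZ iF) auto
    also have "expectation F = 3 ^ s * (2 + expectation (\<lambda>\<omega>. ?J n \<omega> ^ (2 * s)) + S ^ (2 * s) * expectation (\<lambda>\<omega>. ?D n \<omega> ^ (2 * s)))"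
      unfolding F_def using CJ(2)[OF n] CD(3)[OF n] by (simp add: prob_space)
    also have "\<dots> \<le> 3 ^ s * (2 + CJ + CD * Q)"
    proof (intro mult_left_mono add_mono)
      have "S ^ (2 * s) * expectation (\<lambda>\<omega>. ?D n \<omega> ^ (2 * s)) \<le> S ^ (2 * s) * (CD * real n powr - (\<kappa> * real (2 * s)))"
        using CD(3)[OF n] S by (intro mult_left_mono) auto
      also have "\<dots> = CD * (S ^ (2 * s) * real n powr - (\<kappa> * real (2 * s)))" by (simp only: mult.left_commute)
      also have "\<dots> \<le> CD * Q"
        unfolding Q_def S_def l_def using log_power_bound[OF CD(2) n, of s] CD(1) by (intro mult_left_mono) auto
      finally show "S ^ (2 * s) * expectation (\<lambda>\<omega>. ?D n \<omega> ^ (2 * s)) \<le> CD * Q" .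
    qed (use CJ(2)[OF n] in auto)
    also have "\<dots> \<le> C" using C(4) by (simp add: CE_def)
    finally show "\<exists>Z. Z \<in> borel_measurable M \<and> integrable M (\<lambda>\<omega>. Z \<omega> ^ s) \<and> expectation (\<lambda>\<omega>. Z \<omega> ^ s) \<le> C \<and>
      (\<forall>\<omega>. 1 \<le> Z \<omega> \<and>
        \<bar>real (tree_width (x \<omega>) n) / real n - ?d / (2 * sqrt (pi * ln n))\<bar> \<le> C * Z \<omega> / (ln n * sqrt (ln n)) \<and>
        (\<forall>k. profile (x \<omega>) n k = tree_width (x \<omega>) n \<longrightarrow> min \<bar>real k - 2 * ln n / ?d\<bar> (ln n) \<le> C * Z \<omega>))"
      using mZ iZ Z1 path unfolding S_def l_def by blast
  qed
qed

end

text \<open>Filtering an extended list extends the filtered list, so later insertions only add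
  nodes.\<close>

lemma nodes_at_level_append: "nodes_at_level k (quad_tree_of xs) \<le> nodes_at_level k (quad_tree_of (xs @ ys))"
proof (induction k arbitrary: xs ys)
  case 0
  then show ?case by (cases xs) auto
next
  case (Suc k)
  then show ?case by (cases xs) (auto intro!: sum_mono)
qed

lemma tree_width_mono:
  assumes "m \<le> n"
  shows "tree_width x m \<le> tree_width x n"
proof -
  have "profile x m k \<le> profile x n k" for k
  proof -
    have "[0..<n] = [0..<m] @ [m..<n]"
      using upt_add_eq_append[of 0 m "n - m"] assms by simp
    then have "map x [0..<n] = map x [0..<m] @ map x [m..<n]" by simp
    then show ?thesis using nodes_at_level_append by (simp add: profile_def)
  qed
  moreover have "tree_width x m \<in> range (profile x m)"
    unfolding tree_width_def using finite_range_profile by (intro Max_in) auto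
  moreover have "profile x n k \<le> tree_width x n" for k
    unfolding tree_width_def using finite_range_profile by (intro Max_ge) auto
  ultimately show ?thesis by (metis order_trans rangeE)
qed

lemma tree_width_le: "tree_width x n \<le> n"
  using nodes_at_level_le[of _ "map x [0..<n]"] finite_range_profile[of x n]
  by (auto simp: tree_width_def profile_def)

lemma tree_width_pos: "n \<ge> 1 \<Longrightarrow> tree_width x n \<ge> 1"
proof -
  assume "n \<ge> 1"
  then obtain m where m: "n = Suc m" by (cases n) auto
  have "profile x n 0 = 1" by (simp add: profile_def m upt_conv_Cons del: upt_Suc)
  then show ?thesis unfolding tree_width_def using finite_range_profile by (metis Max_ge rangeI)
qed

context random_points
begin

lemma tree_width_measurable [measurable]: "(\<lambda>\<omega>. real (tree_width (x \<omega>) n)) \<in> borel_measurable M"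
proof (subst borel_measurable_iff_ge, intro allI)
  fix a :: real
  have "(\<lambda>\<omega>. real (profile (x \<omega>) n k)) \<in> borel_measurable M" for k
    unfolding profile_def by (rule random_list_measurable[OF list_measurable_nodes_at_level])
  then have "{\<omega> \<in> space M. a \<le> real (profile (x \<omega>) n k)} \<in> sets M" for k by measurable
  then have "(\<Union>k. {\<omega> \<in> space M. a \<le> real (profile (x \<omega>) n k)}) \<in> sets M" by blast
  also have "(\<Union>k. {\<omega> \<in> space M. a \<le> real (profile (x \<omega>) n k)}) = {\<omega> \<in> space M. a \<le> real (tree_width (x \<omega>) n)}"
  proof (intro equalityI subsetI)
    fix \<omega> assume "\<omega> \<in> (\<Union>k. {\<omega> \<in> space M. a \<le> real (profile (x \<omega>) n k)})"
    then obtain k where "\<omega> \<in> space M" "a \<le> real (profile (x \<omega>) n k)" by auto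
    then show "\<omega> \<in> {\<omega> \<in> space M. a \<le> real (tree_width (x \<omega>) n)}"
      using profile_le_width[of \<omega> n k] by (auto intro: order_trans)
  next
    fix \<omega> assume \<omega>: "\<omega> \<in> {\<omega> \<in> space M. a \<le> real (tree_width (x \<omega>) n)}"
    obtain k where "profile (x \<omega>) n k = tree_width (x \<omega>) n" using width_attained by blast
    then show "\<omega> \<in> (\<Union>k. {\<omega> \<in> space M. a \<le> real (profile (x \<omega>) n k)})"
      using \<omega> by (intro UN_I[of k]) auto
  qed
  finally show "{\<omega> \<in> space M. a \<le> real (tree_width (x \<omega>) n)} \<in> sets M" .
qed

lemma integrable_tree_width: "integrable M (\<lambda>\<omega>. real (tree_width (x \<omega>) n))"
  by (rule integrable_const_bound[of _ "real n"]) (use tree_width_le in auto)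

text \<open>For \<open>n \<ge> 3\<close> this is the leading term of the theorem, since
  \<open>L n = ln n\<close> there; \<open>width_error n\<close> is smaller by
  \<open>1 / ln n\<close>, up to a constant.\<close>

definition "width_scale n = real n * (real CARD('d) / (2 * sqrt (pi * ln n)))"

definition "width_error n = real n / (ln n * sqrt (ln n))"

lemma width_scale_pos: "n \<ge> 3 \<Longrightarrow> width_scale n > 0" and width_error_pos: "n \<ge> 3 \<Longrightarrow> width_error n > 0"
  using ln_ge_one[of n] point_dim_ge_1 by (auto simp: width_scale_def width_error_def intro!: mult_pos_pos divide_pos_pos)

lemma width_moment:
  assumes s: "s \<ge> 1"
  shows "\<exists>C\<ge>1. \<forall>n\<ge>3. integrable M (\<lambda>\<omega>. \<bar>real (tree_width (x \<omega>) n) - width_scale n\<bar> ^ s) \<and>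
    expectation (\<lambda>\<omega>. \<bar>real (tree_width (x \<omega>) n) - width_scale n\<bar> ^ s) \<le> C * width_error n ^ s"
proof -
  obtain C where C: "C \<ge> 1" "\<forall>n\<ge>3. \<exists>Z. Z \<in> borel_measurable M \<and> integrable M (\<lambda>\<omega>. Z \<omega> ^ s) \<and> expectation (\<lambda>\<omega>. Z \<omega> ^ s) \<le> C \<and>
    (\<forall>\<omega>. 1 \<le> Z \<omega> \<and>
      \<bar>real (tree_width (x \<omega>) n) / real n - real CARD('d) / (2 * sqrt (pi * ln n))\<bar> \<le> C * Z \<omega> / (ln n * sqrt (ln n)) \<and>
      (\<forall>k. profile (x \<omega>) n k = tree_width (x \<omega>) n \<longrightarrow> min \<bar>real k - 2 * ln n / real CARD('d)\<bar> (ln n) \<le> C * Z \<omega>))"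
    using width_control[OF s] by (elim exE conjE)
  have C': "C ^ s * C \<ge> 1" using C(1) by (simp add: one_le_power mult_ge1_I)
  show ?thesis
  proof (intro exI[of _ "C ^ s * C"] conjI[OF C'] allI impI)
    fix n :: nat assume n: "n \<ge> 3"
    then obtain Z where Z: "Z \<in> borel_measurable M" "integrable M (\<lambda>\<omega>. Z \<omega> ^ s)" "expectation (\<lambda>\<omega>. Z \<omega> ^ s) \<le> C"
      "\<And>\<omega>. 1 \<le> Z \<omega>" "\<And>\<omega>. \<bar>real (tree_width (x \<omega>) n) / real n - real CARD('d) / (2 * sqrt (pi * ln n))\<bar> \<le> C * Z \<omega> / (ln n * sqrt (ln n))"
      using C(2) by blast
    have e0: "width_error n > 0" by (rule width_error_pos[OF n])
    have le: "\<bar>real (tree_width (x \<omega>) n) - width_scale n\<bar> ^ s \<le> (C * width_error n) ^ s * Z \<omega> ^ s" for \<omega>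
    proof -
      have "real (tree_width (x \<omega>) n) - width_scale n = real n * (real (tree_width (x \<omega>) n) / real n - real CARD('d) / (2 * sqrt (pi * ln n)))"
        using n by (simp add: width_scale_def right_diff_distrib)
      then have "\<bar>real (tree_width (x \<omega>) n) - width_scale n\<bar> = real n * \<bar>real (tree_width (x \<omega>) n) / real n - real CARD('d) / (2 * sqrt (pi * ln n))\<bar>"
        by (simp add: abs_mult)
      also have "\<dots> \<le> real n * (C * Z \<omega> / (ln n * sqrt (ln n)))" using Z(5) by (intro mult_left_mono) auto
      also have "\<dots> = C * width_error n * Z \<omega>" by (simp add: width_error_def)
      finally have "\<bar>real (tree_width (x \<omega>) n) - width_scale n\<bar> ^ s \<le> (C * width_error n * Z \<omega>) ^ s" by (intro power_mono) auto
      then show ?thesis by (simp only: power_mult_distrib)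
    qed
    have iB: "integrable M (\<lambda>\<omega>. (C * width_error n) ^ s * Z \<omega> ^ s)" using Z(2) by simp
    have i: "integrable M (\<lambda>\<omega>. \<bar>real (tree_width (x \<omega>) n) - width_scale n\<bar> ^ s)"
    proof (rule Bochner_Integration.integrable_bound[OF iB])
      show "AE \<omega> in M. norm (\<bar>real (tree_width (x \<omega>) n) - width_scale n\<bar> ^ s) \<le> norm ((C * width_error n) ^ s * Z \<omega> ^ s)"
      proof (intro AE_I2)
        fix \<omega>
        have "norm (\<bar>real (tree_width (x \<omega>) n) - width_scale n\<bar> ^ s) = \<bar>real (tree_width (x \<omega>) n) - width_scale n\<bar> ^ s" by simp
        also note le[of \<omega>]
        also have "(C * width_error n) ^ s * Z \<omega> ^ s \<le> norm ((C * width_error n) ^ s * Z \<omega> ^ s)" by simp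
        finally show "norm (\<bar>real (tree_width (x \<omega>) n) - width_scale n\<bar> ^ s) \<le> norm ((C * width_error n) ^ s * Z \<omega> ^ s)" .
      qed
    qed measurable
    have "expectation (\<lambda>\<omega>. \<bar>real (tree_width (x \<omega>) n) - width_scale n\<bar> ^ s) \<le> expectation (\<lambda>\<omega>. (C * width_error n) ^ s * Z \<omega> ^ s)"
      using le by (intro Bochner_Integration.integral_mono i iB)
    also have "\<dots> = (C * width_error n) ^ s * expectation (\<lambda>\<omega>. Z \<omega> ^ s)" by simp
    also have "\<dots> \<le> (C * width_error n) ^ s * C" using Z(3) C(1) e0 by (intro mult_left_mono) auto
    also have "\<dots> = C ^ s * C * width_error n ^ s" by (simp add: power_mult_distrib)
    finally show "integrable M (\<lambda>\<omega>. \<bar>real (tree_width (x \<omega>) n) - width_scale n\<bar> ^ s) \<and>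
      expectation (\<lambda>\<omega>. \<bar>real (tree_width (x \<omega>) n) - width_scale n\<bar> ^ s) \<le> C ^ s * C * width_error n ^ s" using i by simp
  qed
qed

lemma mean_width_bound:
  "\<exists>C\<ge>1. \<forall>n\<ge>3. \<bar>expectation (\<lambda>\<omega>. real (tree_width (x \<omega>) n)) - width_scale n\<bar> \<le> C * width_error n"
proof -
  obtain C where C: "C \<ge> 1" "\<forall>n\<ge>3. integrable M (\<lambda>\<omega>. \<bar>real (tree_width (x \<omega>) n) - width_scale n\<bar> ^ 1) \<and>
    expectation (\<lambda>\<omega>. \<bar>real (tree_width (x \<omega>) n) - width_scale n\<bar> ^ 1) \<le> C * width_error n ^ 1"
    using width_moment[OF order_refl] by (elim exE conjE)
  have "\<bar>expectation (\<lambda>\<omega>. real (tree_width (x \<omega>) n)) - width_scale n\<bar> \<le> C * width_error n" if "n \<ge> 3" for n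
  proof -
    have "expectation (\<lambda>\<omega>. real (tree_width (x \<omega>) n)) - width_scale n = expectation (\<lambda>\<omega>. real (tree_width (x \<omega>) n) - width_scale n)"
      using integrable_tree_width by (simp add: prob_space)
    also have "\<bar>\<dots>\<bar> \<le> expectation (\<lambda>\<omega>. \<bar>real (tree_width (x \<omega>) n) - width_scale n\<bar>)" by (rule integral_abs_bound)
    finally show ?thesis using C(2)[rule_format, OF that] by simp
  qed
  then show ?thesis using C(1) by blast
qed

text \<open>A real exponent is dominated by an integer one: for the deviation \<open>y\<close> in
  units of \<open>width_error n\<close>, \<open>y powr s \<le> 1 + y ^ p\<close> with
  \<open>p \<ge> s\<close>. Replacing \<open>width_scale n\<close> by the mean costs at most
  \<open>C1\<close> units.\<close>

lemma central_moment_bigo: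
  fixes s :: real
  assumes s: "s \<ge> 0"
  shows "(\<lambda>n. expectation (\<lambda>\<omega>. \<bar>real (tree_width (x \<omega>) n) - expectation (\<lambda>\<omega>. real (tree_width (x \<omega>) n))\<bar> powr s))
    \<in> O(\<lambda>n. real n powr s * L n powr (- 3 * s / 2))"
proof -
  define p where "p = nat \<lceil>s\<rceil> + 1"
  have p: "p \<ge> 1" "s \<le> real p" unfolding p_def by linarith+
  obtain C1 where C1: "C1 \<ge> 1" "\<And>n. n \<ge> 3 \<Longrightarrow> \<bar>expectation (\<lambda>\<omega>. real (tree_width (x \<omega>) n)) - width_scale n\<bar> \<le> C1 * width_error n"
    using mean_width_bound by blast
  obtain C2 where C2: "C2 \<ge> 1" "\<And>n. n \<ge> 3 \<Longrightarrow> integrable M (\<lambda>\<omega>. \<bar>real (tree_width (x \<omega>) n) - width_scale n\<bar> ^ p) \<and>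
    expectation (\<lambda>\<omega>. \<bar>real (tree_width (x \<omega>) n) - width_scale n\<bar> ^ p) \<le> C2 * width_error n ^ p"
    using width_moment[OF p(1)] by blast
  define C where "C = 1 + 2 ^ p * (C2 + C1 ^ p)"
  show ?thesis
  proof (rule bigoI[of _ C])
    show "\<forall>\<^sub>F n in sequentially. norm (expectation (\<lambda>\<omega>. \<bar>real (tree_width (x \<omega>) n) - expectation (\<lambda>\<omega>. real (tree_width (x \<omega>) n))\<bar> powr s))
        \<le> C * norm (real n powr s * L n powr (- 3 * s / 2))"
      using eventually_ge_at_top[of 3]
    proof eventually_elim
      case (elim n)
      define e where "e = width_error n"
      have e0: "e > 0" unfolding e_def by (rule width_error_pos[OF elim])
      define m where "m = expectation (\<lambda>\<omega>. real (tree_width (x \<omega>) n))"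
      let ?W = "\<lambda>\<omega>. real (tree_width (x \<omega>) n)"
      have l: "ln (real n) \<ge> 1" "L n = ln (real n)" using ln_ge_one[OF elim] by (auto simp: L_def)
      have es: "e powr s = real n powr s * L n powr (- 3 * s / 2)"
      proof -
        have eq: "ln (real n) * sqrt (ln (real n)) = ln (real n) powr (3 / 2)"
          using l powr_add[of "ln (real n)" 1 "1/2"] by (simp add: powr_half_sqrt)
        have e: "e = real n * ln (real n) powr - (3 / 2)"
          unfolding powr_minus_divide e_def width_error_def eq by simp
        have "- (3 / 2) * s = - 3 * s / 2" by simp
        then show ?thesis unfolding e powr_mult powr_powr l(2) by (simp only:)
      qed
      have pw: "\<bar>?W \<omega> - m\<bar> powr s \<le> e powr s * (1 + 2 ^ p * (\<bar>?W \<omega> - width_scale n\<bar> ^ p / e ^ p + C1 ^ p))" for \<omega>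
      proof -
        define y where "y = \<bar>?W \<omega> - m\<bar> / e"
        have y0: "y \<ge> 0" using e0 by (simp add: y_def)
        have "y powr s \<le> 1 + y ^ p"
        proof (cases "y \<le> 1")
          case True
          then have "y powr s \<le> 1" using y0 s by (simp add: powr_le1)
          then show ?thesis using y0 by (simp add: add_increasing2)
        next
          case False
          then have "y powr s \<le> y powr real p" using p by (intro powr_mono) auto
          also have "\<dots> = y ^ p" using False by (simp add: powr_realpow)
          finally show ?thesis by simp
        qed
        also have "y ^ p \<le> 2 ^ p * (\<bar>?W \<omega> - width_scale n\<bar> ^ p / e ^ p + C1 ^ p)"
        proof -
          define a where "a = \<bar>?W \<omega> - width_scale n\<bar> / e"
          have a0: "a \<ge> 0" using e0 by (simp add: a_def)
          have "\<bar>?W \<omega> - m\<bar> \<le> \<bar>?W \<omega> - width_scale n\<bar> + C1 * e" using C1(2)[OF elim] unfolding m_def e_def by linarith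
          then have "y \<le> (\<bar>?W \<omega> - width_scale n\<bar> + C1 * e) / e" unfolding y_def using e0 by (intro divide_right_mono) auto
          also have "\<dots> = a + C1" using e0 by (simp add: a_def add_divide_distrib)
          also have "\<dots> \<le> 2 * max a C1" by simp
          finally have "y ^ p \<le> (2 * max a C1) ^ p" using y0 by (intro power_mono) auto
          also have "\<dots> = 2 ^ p * max a C1 ^ p" by (rule power_mult_distrib)
          also have "\<dots> \<le> 2 ^ p * (a ^ p + C1 ^ p)" using a0 C1(1) by (intro mult_left_mono) (auto simp: max_def)
          finally show ?thesis by (simp add: a_def power_divide)
        qed
        finally have "y powr s \<le> 1 + 2 ^ p * (\<bar>?W \<omega> - width_scale n\<bar> ^ p / e ^ p + C1 ^ p)" by simp
        then have "e powr s * y powr s \<le> e powr s * (1 + 2 ^ p * (\<bar>?W \<omega> - width_scale n\<bar> ^ p / e ^ p + C1 ^ p))"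
          by (intro mult_left_mono) auto
        moreover have "e powr s * y powr s = \<bar>?W \<omega> - m\<bar> powr s" using e0 by (simp add: powr_mult[symmetric] y_def)
        ultimately show ?thesis by simp
      qed
      have iF: "integrable M (\<lambda>\<omega>. e powr s * (1 + 2 ^ p * (\<bar>?W \<omega> - width_scale n\<bar> ^ p / e ^ p + C1 ^ p)))"
        using C2(2)[OF elim] by auto
      have "expectation (\<lambda>\<omega>. \<bar>?W \<omega> - m\<bar> powr s) \<le> expectation (\<lambda>\<omega>. e powr s * (1 + 2 ^ p * (\<bar>?W \<omega> - width_scale n\<bar> ^ p / e ^ p + C1 ^ p)))"
        by (rule integral_mono_AE'[OF iF]) (use pw in \<open>auto intro: order_trans[OF powr_ge_zero pw]\<close>)
      also have "\<dots> = e powr s * (1 + 2 ^ p * (expectation (\<lambda>\<omega>. \<bar>?W \<omega> - width_scale n\<bar> ^ p) / e ^ p + C1 ^ p))"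
        using C2(2)[OF elim] by (simp add: prob_space)
      also have "\<dots> \<le> e powr s * C"
        unfolding C_def
      proof (intro mult_left_mono add_mono order_refl)
        show "expectation (\<lambda>\<omega>. \<bar>?W \<omega> - width_scale n\<bar> ^ p) / e ^ p \<le> C2"
          using C2(2)[OF elim] e0 by (simp add: e_def divide_le_eq)
      qed auto
      finally have fin: "expectation (\<lambda>\<omega>. \<bar>?W \<omega> - m\<bar> powr s) \<le> e powr s * C" .
      have "0 \<le> expectation (\<lambda>\<omega>. \<bar>?W \<omega> - m\<bar> powr s)" by (intro Bochner_Integration.integral_nonneg) auto
      then show ?case using fin unfolding es[symmetric] m_def by (simp add: mult.commute)
    qed
  qed
qed

end

section \<open>The level of the maximum, and almost sure convergence\<close>

lemma two_powr_root: "(2 powr (1 / real CARD('d::finite))) ^ CARD('d) = (2 :: real)"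
  by (simp add: powr_def exp_of_nat_mult[symmetric])

text \<open>For large \<open>n\<close> the least index \<open>i \<ge> j0\<close> with
  \<open>N i > n\<close> has a predecessor \<open>j \<ge> j0\<close> with
  \<open>N j \<le> n\<close>, which brackets \<open>n\<close> between two consecutive values of
  \<open>N\<close>.\<close>

lemma tendsto_one_sandwich:
  fixes f p q :: "nat \<Rightarrow> real" and N :: "nat \<Rightarrow> nat"
  assumes N: "filterlim N at_top sequentially" and p: "p \<longlonglongrightarrow> a" and q: "q \<longlonglongrightarrow> a"
    and le: "\<And>j n. N j \<le> n \<Longrightarrow> n \<le> N (Suc j) \<Longrightarrow> p j \<le> f n \<and> f n \<le> q j"
  shows "f \<longlonglongrightarrow> a"
proof (rule LIMSEQ_I)
  fix e :: real assume e: "e > 0"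
  have "\<forall>\<^sub>F j in sequentially. a - e < p j \<and> q j < a + e"
    using order_tendstoD(1)[OF p, of "a - e"] order_tendstoD(2)[OF q, of "a + e"] e by (intro eventually_conj) auto
  then obtain j0 where j0: "\<And>j. j \<ge> j0 \<Longrightarrow> a - e < p j \<and> q j < a + e" by (auto simp: eventually_sequentially)
  have "norm (f n - a) < e" if n: "n \<ge> N j0" for n
  proof -
    obtain i where "i \<ge> j0" "N i > n"
      using N[unfolded filterlim_at_top, rule_format, of "Suc n"] by (auto simp: eventually_sequentially Suc_le_eq dest: spec[of _ "max j0 _"])
        (metis max.cobounded1 max.cobounded2)
    then have ex: "\<exists>i. i \<ge> j0 \<and> N i > n" by blast
    define i0 where "i0 = (LEAST i. i \<ge> j0 \<and> N i > n)"
    have i0: "i0 \<ge> j0" "N i0 > n" using LeastI_ex[OF ex] by (auto simp: i0_def)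
    then have "i0 \<noteq> j0" using n by auto
    then obtain j where j: "i0 = Suc j" "j \<ge> j0" using i0(1) by (cases i0) auto
    have "\<not> (j \<ge> j0 \<and> N j > n)" using not_less_Least[of j "\<lambda>i. i \<ge> j0 \<and> N i > n"] j by (simp add: i0_def)
    then have "N j \<le> n" using j by auto
    then show ?thesis using le[of j n] i0(2) j j0[of j] by (auto simp: abs_less_iff)
  qed
  then show "\<exists>no. \<forall>n\<ge>no. norm (f n - a) < e" by blast
qed

context random_points
begin

text \<open>Markov's inequality at \<open>z = 2\<close>, where a node at level \<open>k\<close> has
  weight \<open>2 ^ k\<close>. The exponent 3 is crude: it rests on
  \<open>2 Re (\<zeta> \<eta>) \<le> 4\<close>, which follows from
  \<open>cmod \<zeta> \<le> 2\<close>.\<close>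

lemma exponential_level_bound:
  "\<exists>C\<ge>0. \<forall>n\<ge>1. \<forall>t. prob {\<omega> \<in> space M. 2 powr t \<le> Re (level_poly 2 (points n \<omega>))} \<le> C * real n ^ 3 / 2 powr t"
proof -
  obtain C where C: "C \<ge> 0" "\<forall>z \<zeta> \<alpha>. z = \<zeta> ^ CARD('d) \<longrightarrow> cmod \<zeta> \<le> 2 \<longrightarrow> 3/4 \<le> \<alpha> \<longrightarrow> \<alpha> \<le> 3 \<longrightarrow>
     (\<forall>\<eta>. \<eta> ^ CARD('d) = 1 \<longrightarrow> 2 * Re (\<zeta> * \<eta>) \<le> \<alpha> + 1) \<longrightarrow>
     (\<forall>n. cmod (mean_level_poly TYPE('d) z n) \<le> C * real n powr \<alpha>)"
    using mean_level_poly_bound[where 'd = 'd] by (elim exE conjE)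
  define \<zeta> :: complex where "\<zeta> = of_real (2 powr (1 / real CARD('d)))"
  have \<zeta>2: "2 = \<zeta> ^ CARD('d)" unfolding \<zeta>_def of_real_power[symmetric] two_powr_root by simp
  have n\<zeta>: "cmod \<zeta> \<le> 2"
  proof -
    have "(2 :: real) powr (1 / real CARD('d)) \<le> 2 powr 1" using point_dim_ge_1 by (intro powr_mono) auto
    then show ?thesis by (simp add: \<zeta>_def)
  qed
  have rot: "2 * Re (\<zeta> * \<eta>) \<le> 3 + 1" if "\<eta> ^ CARD('d) = 1" for \<eta>
  proof -
    have "cmod \<eta> = 1" using power_eq_1_iff[OF that] by auto
    then show ?thesis using complex_Re_le_cmod[of "\<zeta> * \<eta>"] n\<zeta> by (simp add: norm_mult)
  qed
  have mean: "cmod (mean_level_poly TYPE('d) 2 n) \<le> C * real n ^ 3" for n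
  proof -
    have "cmod (mean_level_poly TYPE('d) 2 n) \<le> C * real n powr 3"
      using C(2)[rule_format, OF \<zeta>2 n\<zeta> _ _ rot, of n] by simp
    then show ?thesis by (cases "n = 0") (auto simp: powr_numeral)
  qed
  have "prob {\<omega> \<in> space M. 2 powr t \<le> Re (level_poly 2 (points n \<omega>))} \<le> C * real n ^ 3 / 2 powr t" for n and t :: real
  proof -
    note int = expectation_list_mean[OF list_measurable_Re_level_poly, of 2 n]
    have "prob {\<omega> \<in> space M. 2 powr t \<le> Re (level_poly 2 (points n \<omega>))} \<le> expectation (\<lambda>\<omega>. Re (level_poly 2 (points n \<omega>))) / 2 powr t"
      by (rule integral_Markov_inequality_measure[OF int(1), of "space M"]) (auto simp: Re_level_poly intro!: AE_I2 sum_nonneg)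
    also have "expectation (\<lambda>\<omega>. Re (level_poly 2 (points n \<omega>))) \<le> C * real n ^ 3"
      unfolding int(2) list_mean_Re_level_poly using mean[of n] complex_Re_le_cmod order_trans by blast
    finally show ?thesis by (simp add: divide_right_mono)
  qed
  then show ?thesis using C(1) by blast
qed

text \<open>Two regimes. For \<open>T \<le> 9 L n\<close> a deviation by \<open>T\<close> makes both
  terms of the minimum in \<open>width_control\<close> at least \<open>T / 9\<close>, and Markov's
  inequality for \<open>Z ^ s\<close> applies. For larger \<open>T\<close> the maximal level is at
  least \<open>T\<close>, so the level polynomial at 2 is at least \<open>2 powr T\<close>; up to a
  constant this has probability at most \<open>n ^ 3 / 2 powr T \<le> exp (T / 3 - 2 T / 3)\<close>.
  The threshold 27 forces \<open>L n > 3\<close> in the first regime, so that \<open>L n\<close> is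
  the logarithm and \<open>n \<ge> 3\<close>.\<close>

lemma level_tail:
  fixes B :: real and K :: "nat \<Rightarrow> 'a \<Rightarrow> nat"
  assumes K: "\<And>n. n \<ge> 1 \<Longrightarrow> K n \<in> M \<rightarrow>\<^sub>M count_space UNIV"
    and Kw: "\<And>n \<omega>. n \<ge> 1 \<Longrightarrow> \<omega> \<in> space M \<Longrightarrow> profile (x \<omega>) n (K n \<omega>) = tree_width (x \<omega>) n"
    and B: "B > 0"
  shows "\<exists>C. \<forall>n\<ge>1. \<forall>T>27. prob {\<omega> \<in> space M. \<bar>real (K n \<omega>) - 2 / real CARD('d) * L n\<bar> \<ge> T} \<le> C * T powr - B"
proof -
  let ?d = "real CARD('d)"
  define s where "s = nat \<lceil>B\<rceil> + 1"
  have s: "s \<ge> 1" "B \<le> real s" unfolding s_def by linarith+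
  obtain C1 where C1: "C1 \<ge> 1" "\<forall>n\<ge>3. \<exists>Z. Z \<in> borel_measurable M \<and> integrable M (\<lambda>\<omega>. Z \<omega> ^ s) \<and> expectation (\<lambda>\<omega>. Z \<omega> ^ s) \<le> C1 \<and>
    (\<forall>\<omega>. 1 \<le> Z \<omega> \<and>
      \<bar>real (tree_width (x \<omega>) n) / real n - real CARD('d) / (2 * sqrt (pi * ln n))\<bar> \<le> C1 * Z \<omega> / (ln n * sqrt (ln n)) \<and>
      (\<forall>k. profile (x \<omega>) n k = tree_width (x \<omega>) n \<longrightarrow> min \<bar>real k - 2 * ln n / real CARD('d)\<bar> (ln n) \<le> C1 * Z \<omega>))"
    using width_control[OF s(1)] by (elim exE conjE)
  obtain C2 where C2: "C2 \<ge> 0" "\<And>n t. n \<ge> 1 \<Longrightarrow> prob {\<omega> \<in> space M. 2 powr t \<le> Re (level_poly 2 (points n \<omega>))} \<le> C2 * real n ^ 3 / 2 powr t"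
    using exponential_level_bound by blast
  define D1 where "D1 = C1 * (9 * C1) ^ s"
  define D2 where "D2 = C2 * (3 * real s) ^ s"
  have D: "D1 \<ge> 0" "D2 \<ge> 0" using C1(1) C2(1) by (auto simp: D1_def D2_def)
  have pw: "T powr - real s \<le> T powr - B" if "T > 27" for T using that s by (intro powr_mono) auto
  have "prob {\<omega> \<in> space M. \<bar>real (K n \<omega>) - 2 / ?d * L n\<bar> \<ge> T} \<le> (D1 + D2) * T powr - B" if n: "n \<ge> 1" and T: "T > 27" for n T
  proof (cases "T \<le> 9 * L n")
    case True
    then have "L n > 3" using T by linarith
    then have l: "L n = ln (real n)" "ln (real n) > 3" by (auto simp: L_def max_def split: if_splits)
    have n3: "n \<ge> 3"
    proof (rule ccontr)
      assume "\<not> n \<ge> 3"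
      then have "ln (real n) \<le> real n - 1" "real n \<le> 2" using n by (auto intro!: ln_le_minus_one)
      then show False using l(2) by linarith
    qed
    obtain Z where Z: "Z \<in> borel_measurable M" "integrable M (\<lambda>\<omega>. Z \<omega> ^ s)" "expectation (\<lambda>\<omega>. Z \<omega> ^ s) \<le> C1" "\<And>\<omega>. 1 \<le> Z \<omega>"
      "\<And>\<omega> k. profile (x \<omega>) n k = tree_width (x \<omega>) n \<Longrightarrow> min \<bar>real k - 2 * ln n / real CARD('d)\<bar> (ln n) \<le> C1 * Z \<omega>"
      using C1(2) n3 by blast
    define c where "c = T / (9 * C1)"
    have c: "c > 0" using T C1(1) by (simp add: c_def)
    have "{\<omega> \<in> space M. \<bar>real (K n \<omega>) - 2 / ?d * L n\<bar> \<ge> T} \<subseteq> {\<omega> \<in> space M. c ^ s \<le> Z \<omega> ^ s}"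
    proof safe
      fix \<omega> assume \<omega>: "\<omega> \<in> space M" "T \<le> \<bar>real (K n \<omega>) - 2 / ?d * L n\<bar>"
      have "min \<bar>real (K n \<omega>) - 2 * ln n / ?d\<bar> (ln n) \<le> C1 * Z \<omega>" by (intro Z(5) Kw n \<omega>(1))
      moreover have "T / 9 \<le> \<bar>real (K n \<omega>) - 2 * ln n / ?d\<bar>" using \<omega>(2) T by (simp add: l)
      moreover have "T / 9 \<le> ln n" using True l(1) by simp
      ultimately have "T / 9 \<le> C1 * Z \<omega>" by linarith
      then have "c \<le> Z \<omega>" using C1(1) by (simp add: c_def field_simps)
      then show "c ^ s \<le> Z \<omega> ^ s" using c by (intro power_mono) auto
    qed
    then have "prob {\<omega> \<in> space M. \<bar>real (K n \<omega>) - 2 / ?d * L n\<bar> \<ge> T} \<le> prob {\<omega> \<in> space M. c ^ s \<le> Z \<omega> ^ s}"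
      using Z(1) by (intro finite_measure_mono) auto
    also have "\<dots> \<le> expectation (\<lambda>\<omega>. Z \<omega> ^ s) / c ^ s"
      using c Z(4) by (intro integral_Markov_inequality_measure[OF Z(2), of "space M"]) (auto intro!: AE_I2 zero_le_power order_trans[OF zero_le_one])
    also have "\<dots> \<le> C1 / c ^ s" using Z(3) c by (intro divide_right_mono) auto
    also have "\<dots> = D1 * T powr - real s"
    proof -
      have "c ^ s = T ^ s / (9 * C1) ^ s" "T powr - real s = 1 / T ^ s"
        using T by (simp_all only: c_def power_divide powr_minus_divide) (simp add: powr_realpow)
      then show ?thesis by (simp add: D1_def)
    qed
    also have "\<dots> \<le> D1 * T powr - B" using pw[OF T] D by (intro mult_left_mono) auto
    also have "\<dots> \<le> (D1 + D2) * T powr - B" using D by (intro mult_right_mono) auto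
    finally show ?thesis .
  next
    case False
    have L1: "L n \<ge> 1" by (simp add: L_def)
    have "{\<omega> \<in> space M. \<bar>real (K n \<omega>) - 2 / ?d * L n\<bar> \<ge> T} \<subseteq> {\<omega> \<in> space M. 2 powr T \<le> Re (level_poly 2 (points n \<omega>))}"
    proof safe
      fix \<omega> assume \<omega>: "\<omega> \<in> space M" "T \<le> \<bar>real (K n \<omega>) - 2 / ?d * L n\<bar>"
      \<comment> \<open>Below \<open>2 / d * L n\<close> there is only room for a deviation of at
        most \<open>2 L n\<close>, which is less than \<open>T\<close>; hence the deviation is
        upwards.\<close>
      have a: "0 \<le> 2 / ?d * L n" "2 / ?d * L n \<le> 2 * L n"
        using L1 point_dim_ge_1 by (auto intro!: mult_right_mono simp: divide_le_eq)
      then have KT: "T \<le> real (K n \<omega>)" using \<omega>(2) False L1 by linarith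
      define k where "k = K n \<omega>"
      have y1: "nodes_at_level k (quad_tree_of (points n \<omega>)) \<ge> 1"
        using Kw[OF n \<omega>(1)] tree_width_pos[OF n, of "x \<omega>"] by (simp add: k_def profile_def)
      then have kn: "k < n" using nodes_at_level_eq_0[of "points n \<omega>" k] by (cases "k < n") auto
      have "2 powr T \<le> 2 powr real k" using KT by (intro powr_mono) (auto simp: k_def)
      also have "\<dots> = 2 ^ k" by (simp add: powr_realpow)
      also have "\<dots> \<le> Re (2 ^ k) * real (nodes_at_level k (quad_tree_of (points n \<omega>)))"
      proof -
        have "Re (2 ^ k) = 2 ^ k" using Re_complex_of_real[of "2 ^ k"] by simp
        then show ?thesis using y1 by simp
      qed
      also have "\<dots> \<le> Re (level_poly 2 (points n \<omega>))"
      proof -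
        have r2: "0 \<le> Re (2 ^ j)" for j using Re_complex_of_real[of "2 ^ j"] by simp
        show ?thesis unfolding Re_level_poly using kn r2 by (intro member_le_sum) auto
      qed
      finally show "2 powr T \<le> Re (level_poly 2 (points n \<omega>))" .
    qed
    then have "prob {\<omega> \<in> space M. \<bar>real (K n \<omega>) - 2 / ?d * L n\<bar> \<ge> T} \<le> prob {\<omega> \<in> space M. 2 powr T \<le> Re (level_poly 2 (points n \<omega>))}"
      using random_list_measurable[OF list_measurable_Re_level_poly, of 2 n] by (intro finite_measure_mono) auto
    also have "\<dots> \<le> C2 * real n ^ 3 / 2 powr T" by (rule C2(2)[OF n])
    also have "\<dots> \<le> C2 * exp (T / 3) / exp (2 * T / 3)"
    proof (intro frac_le mult_left_mono)
      have "real n \<le> exp (L n)"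
        using n by (simp add: L_def max_def) (metis exp_ge_zero exp_ln exp_le_cancel_iff linorder_not_le not_less_iff_gr_or_eq of_nat_0_less_iff order_less_le order_refl zero_less_one less_eq_Suc_le One_nat_def)
      then have "real n ^ 3 \<le> exp (L n) ^ 3" by (intro power_mono) auto
      also have "\<dots> = exp (3 * L n)" by (simp add: exp_of_nat_mult[symmetric])
      also have "\<dots> \<le> exp (T / 3)" using False by simp
      finally show "real n ^ 3 \<le> exp (T / 3)" .
      have "T * (2/3) \<le> T * ln 2" using T ln2_ge_two_thirds by (intro mult_left_mono) auto
      then show "exp (2 * T / 3) \<le> 2 powr T" by (simp add: powr_def)
    qed (use C2(1) in auto)
    also have "\<dots> = C2 * exp (- (T / 3))"
    proof -
      have "exp (T / 3) / exp (2 * T / 3) = exp (T / 3 - 2 * T / 3)" by (rule exp_diff[symmetric])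
      also have "T / 3 - 2 * T / 3 = - (T / 3)" by simp
      finally show ?thesis by (simp only: times_divide_eq_right[symmetric])
    qed
    also have "\<dots> \<le> C2 * ((3 * real s) ^ s * T powr - real s)"
    proof (rule mult_left_mono)
      have "(T / 3) ^ s \<le> real s ^ s * exp (T / 3)" using power_le_exp[of "T / 3" s] s T by simp
      then have "T ^ s \<le> (3 * real s) ^ s * exp (T / 3)" by (simp add: power_divide power_mult_distrib field_simps)
      then have "T ^ s * exp (- (T / 3)) \<le> (3 * real s) ^ s * exp (T / 3) * exp (- (T / 3))" by (intro mult_right_mono) auto
      then have "T ^ s * exp (- (T / 3)) \<le> (3 * real s) ^ s" by (simp add: mult.assoc exp_add[symmetric])
      then show "exp (- (T / 3)) \<le> (3 * real s) ^ s * T powr - real s"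
        using T by (simp add: powr_minus powr_realpow field_simps)
    qed (use C2(1) in auto)
    also have "\<dots> = D2 * T powr - real s" by (simp add: D2_def)
    also have "\<dots> \<le> D2 * T powr - B" using pw[OF T] D by (intro mult_left_mono) auto
    also have "\<dots> \<le> (D1 + D2) * T powr - B" using D by (intro mult_right_mono) auto
    finally show ?thesis .
  qed
  then show ?thesis by blast
qed

lemma width_ratio: "n \<ge> 3 \<Longrightarrow> width_error n / width_scale n = (2 * sqrt pi / real CARD('d)) / ln n"
  using ln_ge_one[of n] point_dim_ge_1
  by (simp add: width_error_def width_scale_def real_sqrt_mult field_simps)

text \<open>Along \<open>N j\<close> the relative deviation is of order \<open>1 / ln (N j)\<close>,
  at most of order \<open>1 / sqrt j\<close>, so its fourth moments are summable; yet the ratio of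
  consecutive \<open>N j\<close> tends to 1, so monotonicity in between loses nothing in the limit.
  The shift by 4 gives \<open>N j \<ge> 3\<close> for all \<open>j\<close>, since
  \<open>exp 2 \<ge> 3\<close>.\<close>

lemma width_almost_surely: "AE \<omega> in M. (\<lambda>n. real (tree_width (x \<omega>) n) / width_scale n) \<longlonglongrightarrow> 1"
proof -
  define N where "N j = nat \<lceil>exp (sqrt (real j + 4))\<rceil>" for j
  have N_bounds: "exp (sqrt (real j + 4)) \<le> real (N j)" "real (N j) \<le> exp (sqrt (real j + 4)) + 1" for j
  proof -
    have "exp (sqrt (real j + 4)) > 0" by simp
    then show "exp (sqrt (real j + 4)) \<le> real (N j)" "real (N j) \<le> exp (sqrt (real j + 4)) + 1"
      unfolding N_def by linarith+
  qed
  have N3: "N j \<ge> 3" for j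
  proof -
    have "2 \<le> sqrt (real j + 4)" by (rule real_le_rsqrt) simp
    then have "3 \<le> exp (sqrt (real j + 4))" using exp_ge_add_one_self[of "sqrt (real j + 4)"] by linarith
    then show ?thesis using N_bounds(1)[of j] by linarith
  qed
  have lnN: "sqrt (real j + 4) \<le> ln (real (N j))" for j
    using N_bounds(1)[of j] N3[of j] by (subst ln_ge_iff) auto
  have four: "(1 :: nat) \<le> 4" by simp
  obtain C where C: "C \<ge> 1" "\<And>n. n \<ge> 3 \<Longrightarrow> integrable M (\<lambda>\<omega>. \<bar>real (tree_width (x \<omega>) n) - width_scale n\<bar> ^ 4) \<and>
    expectation (\<lambda>\<omega>. \<bar>real (tree_width (x \<omega>) n) - width_scale n\<bar> ^ 4) \<le> C * width_error n ^ 4"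
    using width_moment[OF four] by (elim exE conjE) blast
  define c where "c = 2 * sqrt pi / real CARD('d)"
  have c0: "c \<ge> 0" by (simp add: c_def)
  define V where "V j \<omega> = real (tree_width (x \<omega>) (N j)) / width_scale (N j)" for j \<omega>
  define u where "u j \<omega> = \<bar>V j \<omega> - 1\<bar> ^ 4" for j \<omega>
  have u_eq: "u j \<omega> = \<bar>real (tree_width (x \<omega>) (N j)) - width_scale (N j)\<bar> ^ 4 / width_scale (N j) ^ 4" for j \<omega>
  proof -
    have w: "width_scale (N j) > 0" by (rule width_scale_pos[OF N3])
    then have "V j \<omega> - 1 = (real (tree_width (x \<omega>) (N j)) - width_scale (N j)) / width_scale (N j)"
      by (simp add: V_def diff_divide_distrib)
    then show ?thesis using w by (simp add: u_def abs_divide power_divide)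
  qed
  have u_int: "integrable M (u j)" for j
    unfolding u_eq[abs_def] using C(2)[OF N3] by simp
  have u_exp: "expectation (u j) \<le> C * c ^ 4 * (1 / (real j + 4)\<^sup>2)" for j
  proof -
    have lp: "sqrt (real j + 4) > 0" "ln (real (N j)) > 0" using ln_ge_one[OF N3[of j]] by auto
    have "expectation (u j) = expectation (\<lambda>\<omega>. \<bar>real (tree_width (x \<omega>) (N j)) - width_scale (N j)\<bar> ^ 4) / width_scale (N j) ^ 4"
      unfolding u_eq[abs_def] by simp
    also have "\<dots> \<le> C * width_error (N j) ^ 4 / width_scale (N j) ^ 4"
      using C(2)[OF N3, of j] width_scale_pos[OF N3, of j] by (intro divide_right_mono) auto
    also have "\<dots> = C * (c / ln (N j)) ^ 4"
      by (simp only: times_divide_eq_right[symmetric] power_divide[symmetric] width_ratio[OF N3] c_def)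
    also have "\<dots> \<le> C * (c / sqrt (real j + 4)) ^ 4"
      using C(1) c0 lnN[of j] lp by (intro mult_left_mono power_mono divide_left_mono) auto
    also have "(c / sqrt (real j + 4)) ^ 4 = c ^ 4 / (real j + 4)\<^sup>2"
    proof -
      have "sqrt (real j + 4) ^ 4 = ((sqrt (real j + 4))\<^sup>2)\<^sup>2" by (simp only: power_mult[symmetric]) simp
      then show ?thesis by (simp add: power_divide)
    qed
    finally show ?thesis by simp
  qed
  have "AE \<omega> in M. (\<lambda>j. V j \<omega>) \<longlonglongrightarrow> 1"
  proof -
    have u0: "0 \<le> u j \<omega>" for j \<omega> by (simp add: u_def)
    have "summable (\<lambda>j. 1 / (real j + 4)\<^sup>2)"
    proof (rule summable_comparison_test_ev)
      show "summable (\<lambda>j. 1 / real j ^ 2)" using inverse_power_summable[of 2, where 'a = real] by (simp add: inverse_eq_divide)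
      show "\<forall>\<^sub>F j in sequentially. norm (1 / (real j + 4)\<^sup>2) \<le> 1 / real j ^ 2"
        using eventually_ge_at_top[of 1] by eventually_elim (auto intro!: divide_left_mono power_mono mult_pos_pos)
    qed
    then have summ: "summable (\<lambda>j. C * c ^ 4 * (1 / (real j + 4)\<^sup>2))" by (rule summable_mult)
    \<comment> \<open>The Borel-Cantelli argument in integrated form: the sum of the
      \<open>u j\<close> has finite mean, so it converges almost surely and its terms tend to
      0.\<close>
    have "(\<integral>\<^sup>+\<omega>. (\<Sum>j. ennreal (u j \<omega>)) \<partial>M) = (\<Sum>j. \<integral>\<^sup>+\<omega>. ennreal (u j \<omega>) \<partial>M)"
      using u_int by (intro nn_integral_suminf) auto
    also have "\<dots> = (\<Sum>j. ennreal (expectation (u j)))"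
      using u_int u0 by (intro suminf_cong nn_integral_eq_integral) auto
    also have "\<dots> \<le> (\<Sum>j. ennreal (C * c ^ 4 * (1 / (real j + 4)\<^sup>2)))"
      using u_exp by (intro suminf_le ennreal_leI) auto
    also have "\<dots> = ennreal (\<Sum>j. C * c ^ 4 * (1 / (real j + 4)\<^sup>2))"
      using C(1) c0 by (intro suminf_ennreal2[OF _ summ]) auto
    finally have "(\<integral>\<^sup>+\<omega>. (\<Sum>j. ennreal (u j \<omega>)) \<partial>M) \<noteq> \<infinity>" by (auto simp: top_unique)
    then have "AE \<omega> in M. (\<Sum>j. ennreal (u j \<omega>)) \<noteq> \<infinity>"
      using u_int by (intro nn_integral_PInf_AE) auto
    then show ?thesis
    proof eventually_elim
      case (elim \<omega>)
      then have "summable (\<lambda>j. u j \<omega>)" using u0 by (intro summable_suminf_not_top) auto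
      then have "(\<lambda>j. u j \<omega>) \<longlonglongrightarrow> 0" by (rule summable_LIMSEQ_zero)
      then have "(\<lambda>j. root 4 (u j \<omega>)) \<longlonglongrightarrow> root 4 0" by (rule tendsto_real_root)
      then have "(\<lambda>j. \<bar>V j \<omega> - 1\<bar>) \<longlonglongrightarrow> 0" by (simp add: u_def real_root_power_cancel del: power_even_abs_numeral)
      then show ?case by (rule LIM_zero_cancel[OF tendsto_rabs_zero_cancel])
    qed
  qed
  then show ?thesis
  proof eventually_elim
    case (elim \<omega>)
    have up: "(\<lambda>j. (exp (sqrt (real j + 5)) + 1) / exp (sqrt (real j + 4))) \<longlonglongrightarrow> 1" by real_asymp
    have lo: "(\<lambda>j. exp (sqrt (real j + 5)) / (exp (sqrt (real j + 4)) + 1)) \<longlonglongrightarrow> 1" by real_asymp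
    have ratio: "(\<lambda>j. real (N (Suc j)) / real (N j)) \<longlonglongrightarrow> 1"
    proof (rule tendsto_sandwich[OF _ _ lo up])
      have S: "exp (sqrt (real j + 5)) \<le> real (N (Suc j))" "real (N (Suc j)) \<le> exp (sqrt (real j + 5)) + 1" for j
        using N_bounds[of "Suc j"] by (simp_all add: add.commute)
      have pos: "real (N j) > 0" for j using N3[of j] by linarith
      show "\<forall>\<^sub>F j in sequentially. exp (sqrt (real j + 5)) / (exp (sqrt (real j + 4)) + 1) \<le> real (N (Suc j)) / real (N j)"
        by (intro always_eventually allI frac_le S N_bounds pos) auto
      show "\<forall>\<^sub>F j in sequentially. real (N (Suc j)) / real (N j) \<le> (exp (sqrt (real j + 5)) + 1) / exp (sqrt (real j + 4))"
        by (intro always_eventually allI frac_le S N_bounds) auto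
    qed
    \<comment> \<open>For \<open>n\<close> between \<open>N j\<close> and \<open>N (Suc j)\<close>
      the quotient is a constant times the width times \<open>sqrt (ln n) / n\<close>. In
      \<open>q j\<close> width and logarithm are taken at \<open>N (Suc j)\<close> and the
      denominator at \<open>N j\<close>; in \<open>p j\<close> the roles are exchanged.\<close>
    define q where "q j = V (Suc j) \<omega> * (real (N (Suc j)) / real (N j))" for j
    define p where "p j = V j \<omega> * (1 / (real (N (Suc j)) / real (N j)))" for j
    have q: "q \<longlonglongrightarrow> 1" unfolding q_def[abs_def] using tendsto_mult[OF LIMSEQ_Suc[OF elim] ratio] by simp
    have p: "p \<longlonglongrightarrow> 1" unfolding p_def[abs_def] using tendsto_mult[OF elim tendsto_divide[OF tendsto_const[of 1] ratio]] by simp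
    have "filterlim (\<lambda>j. real (N j)) at_top sequentially"
    proof (rule filterlim_at_top_mono)
      show "filterlim (\<lambda>j. exp (sqrt (real j + 4))) at_top sequentially" by real_asymp
    qed (use N_bounds(1) in auto)
    then have Ninf: "filterlim N at_top sequentially" by (simp add: filterlim_real_sequentially filterlim_sequentially_iff_filterlim_real)
    show ?case
    proof (rule tendsto_one_sandwich[OF Ninf p q])
      fix j n assume jn: "N j \<le> n" "n \<le> N (Suc j)"
      define k where "k = real CARD('d) / (2 * sqrt pi)"
      have k: "k > 0" using point_dim_ge_1 by (simp add: k_def)
      have ws: "w / width_scale m = w * sqrt (ln m) / (k * real m)" if "m \<ge> 3" for w m
        using ln_ge_one[OF that] that by (simp add: width_scale_def k_def real_sqrt_mult mult_ac)
      let ?W = "\<lambda>n. real (tree_width (x \<omega>) n)"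
      have n3: "n \<ge> 3" using jn N3[of j] by linarith
      have W: "?W (N j) \<le> ?W n" "?W n \<le> ?W (N (Suc j))" using tree_width_mono jn by auto
      have l: "0 \<le> ln (real (N j))" "ln (real (N j)) \<le> ln (real n)" "ln (real n) \<le> ln (real (N (Suc j)))"
        using jn N3[of j] by auto
      have pos: "real (N j) > 0" "real n > 0" "real (N (Suc j)) > 0" using n3 N3[of j] N3[of "Suc j"] by auto
      have "?W n * sqrt (ln n) / (k * real n) \<le> ?W (N (Suc j)) * sqrt (ln (N (Suc j))) / (k * real (N j))"
        using W l k pos jn by (intro frac_le mult_mono real_sqrt_le_mono) auto
      also have "\<dots> = q j" using k pos by (simp add: q_def V_def ws[OF N3])
      finally have 1: "?W n / width_scale n \<le> q j" unfolding ws[OF n3] .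
      have "p j = ?W (N j) * sqrt (ln (N j)) / (k * real (N (Suc j)))" using k pos by (simp add: p_def V_def ws[OF N3])
      also have "\<dots> \<le> ?W n * sqrt (ln n) / (k * real n)"
        using W l k pos jn by (intro frac_le mult_mono real_sqrt_le_mono) auto
      finally have 2: "p j \<le> ?W n / width_scale n" unfolding ws[OF n3] .
      show "p j \<le> ?W n / width_scale n \<and> ?W n / width_scale n \<le> q j" using 1 2 by simp
    qed
  qed
qed

end

theorem mainTheorem5:
  fixes M :: "'a measure"
    and X :: "nat \<Rightarrow> 'a \<Rightarrow> real ^ 'd"
    and Y :: "nat \<Rightarrow> nat \<Rightarrow> 'a \<Rightarrow> nat"
    and W :: "nat \<Rightarrow> 'a \<Rightarrow> real"
    and kstar :: "nat \<Rightarrow> 'a \<Rightarrow> nat"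
    and d \<sigma> :: real
  assumes "prob_space M"
    and "prob_space.indep_vars M (\<lambda>_. borel) X UNIV"
    and "\<And>i. distr M borel (X i) = uniform_measure lborel (cbox 0 1)"
    and "\<And>n k \<omega>. Y n k \<omega> = profile (\<lambda>i. X i \<omega>) n k"
    and "\<And>n \<omega>. W n \<omega> = real (tree_width (\<lambda>i. X i \<omega>) n)"
    and "\<And>n. n \<ge> 1 \<Longrightarrow> kstar n \<in> M \<rightarrow>\<^sub>M count_space UNIV"
    and "\<And>n \<omega>. n \<ge> 1 \<Longrightarrow> \<omega> \<in> space M \<Longrightarrow> real (Y n (kstar n \<omega>) \<omega>) = W n \<omega>"
    and "d = real CARD('d)"
    and "\<sigma> > 0" and "\<sigma>\<^sup>2 = 2 / d\<^sup>2"
  shows "(\<exists>\<epsilon> :: nat \<Rightarrow> real. \<epsilon> \<in> O(\<lambda>n. 1 / L n) \<and>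
            (\<forall>n\<ge>1. (\<integral>\<omega>. W n \<omega> \<partial>M) = real n / sqrt (2 * pi * \<sigma>\<^sup>2 * L n) * (1 + \<epsilon> n)))
       \<and> (\<forall>s\<ge>0. (\<lambda>n. \<integral>\<omega>. \<bar>W n \<omega> - (\<integral>\<omega>'. W n \<omega>' \<partial>M)\<bar> powr s \<partial>M)
                  \<in> O(\<lambda>n. real n powr s * L n powr (- 3 * s / 2)))
       \<and> (\<forall>B>0. \<exists>T\<^sub>0>1. \<exists>C. \<forall>n\<ge>1. \<forall>T>T\<^sub>0.
            measure M {\<omega> \<in> space M. \<bar>real (kstar n \<omega>) - 2 / d * L n\<bar> \<ge> T} \<le> C * T powr (- B))
       \<and> (AE \<omega> in M. (\<lambda>n. W n \<omega> / (\<integral>\<omega>'. W n \<omega>' \<partial>M)) \<longlonglongrightarrow> 1)"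
proof -
  note indep = assms(2) and unif = assms(3) and dd = assms(8) and var = assms(9,10)
  interpret prob_space M by (rule assms(1))
  have X [measurable]: "X i \<in> borel_measurable M" for i
    using indep unfolding indep_vars_def by auto
  interpret random_points M "\<lambda>\<omega> i. X i \<omega>"
  proof
    show "(\<lambda>\<omega> i. X i \<omega>) \<in> M \<rightarrow>\<^sub>M PiM UNIV (\<lambda>_. borel)" by (rule measurable_PiM_single') auto
    have "distr M (PiM UNIV (\<lambda>_. borel)) (\<lambda>\<omega>. \<lambda>i\<in>UNIV. X i \<omega>) = PiM UNIV (\<lambda>i. distr M borel (X i))"
      using indep by (subst (asm) indep_vars_iff_distr_eq_PiM) auto
    then show "distr M (PiM UNIV (\<lambda>_. borel)) (\<lambda>\<omega> i. X i \<omega>) = point_seq"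
      by (simp add: unif restrict_UNIV)
  qed
  let ?W = "\<lambda>n \<omega>. real (tree_width (\<lambda>i. X i \<omega>) n)"
  have WX: "W n \<omega> = ?W n \<omega>" for n \<omega> by (rule assms(5))
  have d1: "d \<ge> 1" using point_dim_ge_1 dd by simp
  define m where "m n = expectation (?W n)" for n
  define e where "e n = (2 * sqrt pi / d) / ln (real n)" for n :: nat
  obtain C where C: "C \<ge> 1" "\<And>n. n \<ge> 3 \<Longrightarrow> \<bar>m n - width_scale n\<bar> \<le> C * width_error n"
    using mean_width_bound unfolding m_def by (elim exE conjE) blast
  have ratio: "\<bar>m n / width_scale n - 1\<bar> \<le> C * e n" if n: "n \<ge> 3" for n
  proof -
    have w: "width_scale n > 0" by (rule width_scale_pos[OF n])
    then have "m n / width_scale n - 1 = (m n - width_scale n) / width_scale n" by (simp add: diff_divide_distrib)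
    then have "\<bar>m n / width_scale n - 1\<bar> = \<bar>m n - width_scale n\<bar> / width_scale n" using w by (simp add: abs_divide)
    also have "\<dots> \<le> C * width_error n / width_scale n" using C(2)[OF n] w by (intro divide_right_mono) auto
    also have "\<dots> = C * e n" by (simp only: times_divide_eq_right[symmetric] width_ratio[OF n] e_def dd)
    finally show ?thesis .
  qed
  have "(\<lambda>n. C * e n) \<longlonglongrightarrow> 0" unfolding e_def by real_asymp
  then have "(\<lambda>n. m n / width_scale n - 1) \<longlonglongrightarrow> 0"
    by (rule tendsto_rabs_zero_cancel[OF tendsto_sandwich[OF _ _ tendsto_const], rotated 2])
      (use ratio in \<open>auto simp: eventually_sequentially intro!: exI[of _ 3]\<close>)
  then have mean_lim: "(\<lambda>n. m n / width_scale n) \<longlonglongrightarrow> 1" by (rule LIM_zero_cancel)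
  have L1: "L n \<ge> 1" for n by (simp add: L_def)
  have L3: "L n = ln (real n)" if "n \<ge> 3" for n using ln_ge_one[OF that] by (simp add: L_def)
  define R where "R n = real n / sqrt (2 * pi * \<sigma>\<^sup>2 * L n)" for n
  have R: "R n = width_scale n" if n: "n \<ge> 3" for n
  proof -
    have "2 * pi * \<sigma>\<^sup>2 * L n = (2 / d)\<^sup>2 * (pi * ln n)" using d1 by (simp add: var L3[OF n] power_divide)
    then have "sqrt (2 * pi * \<sigma>\<^sup>2 * L n) = 2 / d * sqrt (pi * ln n)"
      using d1 by (simp only: real_sqrt_mult[of "(2 / d)\<^sup>2"] real_sqrt_abs) simp
    then show ?thesis using d1 by (simp add: R_def width_scale_def dd)
  qed
  have R0: "R n \<noteq> 0" if "n \<ge> 1" for n using that L1[of n] var(1) by (simp add: R_def)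
  \<comment> \<open>Taking \<open>\<epsilon>\<close> as the exact relative error makes the identity
    for the mean hold for every \<open>n \<ge> 1\<close>, where \<open>R n\<close> is nonzero; the
    comparison with \<open>width_scale\<close>, available from \<open>n = 3\<close> on, is enough
    for the order of \<open>\<epsilon>\<close>.\<close>
  define \<epsilon> where "\<epsilon> n = m n / R n - 1" for n
  have mean: "\<epsilon> \<in> O(\<lambda>n. 1 / L n)"
  proof (rule bigoI)
    show "\<forall>\<^sub>F n in sequentially. norm (\<epsilon> n) \<le> C * (2 * sqrt pi / d) * norm (1 / L n)"
      using eventually_ge_at_top[of 3]
    proof eventually_elim
      case (elim n)
      then show ?case using ratio[OF elim] ln_ge_one[OF elim] by (simp add: \<epsilon>_def R L3 e_def)
    qed
  qed
  have mean_eq: "\<forall>n\<ge>1. (\<integral>\<omega>. W n \<omega> \<partial>M) = real n / sqrt (2 * pi * \<sigma>\<^sup>2 * L n) * (1 + \<epsilon> n)"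
  proof (intro allI impI)
    fix n :: nat assume "n \<ge> 1"
    then have "m n = R n * (1 + \<epsilon> n)" using R0[of n] by (simp add: \<epsilon>_def)
    then show "(\<integral>\<omega>. W n \<omega> \<partial>M) = real n / sqrt (2 * pi * \<sigma>\<^sup>2 * L n) * (1 + \<epsilon> n)"
      by (simp add: WX m_def R_def)
  qed
  have moments: "(\<lambda>n. \<integral>\<omega>. \<bar>W n \<omega> - (\<integral>\<omega>'. W n \<omega>' \<partial>M)\<bar> powr s \<partial>M) \<in> O(\<lambda>n. real n powr s * L n powr (- 3 * s / 2))"
    if "s \<ge> 0" for s
    using central_moment_bigo[OF that] by (simp add: WX)
  have tail: "\<exists>T\<^sub>0>1. \<exists>C. \<forall>n\<ge>1. \<forall>T>T\<^sub>0.
      prob {\<omega> \<in> space M. \<bar>real (kstar n \<omega>) - 2 / d * L n\<bar> \<ge> T} \<le> C * T powr (- B)" if "B > 0" for B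
  proof -
    have "profile (\<lambda>i. X i \<omega>) n (kstar n \<omega>) = tree_width (\<lambda>i. X i \<omega>) n" if "n \<ge> 1" "\<omega> \<in> space M" for n \<omega>
      using assms(7)[OF that] by (simp add: assms(4) WX)
    from level_tail[OF assms(6) this \<open>B > 0\<close>] show ?thesis
      unfolding dd by - (rule exI[of _ "27 :: real"], rule conjI, simp_all)
  qed
  have "AE \<omega> in M. (\<lambda>n. W n \<omega> / (\<integral>\<omega>'. W n \<omega>' \<partial>M)) \<longlonglongrightarrow> 1"
    using width_almost_surely
  proof eventually_elim
    case (elim \<omega>)
    have "(\<lambda>n. (?W n \<omega> / width_scale n) / (m n / width_scale n)) \<longlonglongrightarrow> 1"
      using tendsto_divide[OF elim mean_lim] by simp
    then show ?case
    proof (rule Lim_transform_eventually)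
      show "\<forall>\<^sub>F n in sequentially. ?W n \<omega> / width_scale n / (m n / width_scale n) = W n \<omega> / (\<integral>\<omega>'. W n \<omega>' \<partial>M)"
        using eventually_ge_at_top[of 3]
      proof eventually_elim
        case (elim n)
        then show ?case using width_scale_pos[OF elim] by (simp add: WX m_def)
      qed
    qed
  qed
  then show ?thesis using mean mean_eq moments tail by blast
qed

end
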